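(* Let $(c_*,\lambda_* )\in\Lambda$. As $(\mu,\lambda,c)\in\Omega$ tends to $(\mu_s(c_*,\lambda_* ),\lambda_*,c_* )$, so that $\rho:=(v_2-v_1)/(v_3-v_2)\to0$, the Hessian of the action has the asymptotic behavior $$\frac{\nabla^2\Theta}{Y^s}=\frac{2a_s^2}{h_s^2}\,\frac{1+\rho}{\rho^2}\,\mathbf{V}_s\otimes\mathbf{V}_s+\Big(\alpha_s\,\mathbf{V}_s\otimes\mathbf{V}_s+\beta_s\,(\mathbf{V}_s\otimes\mathbf{W}_s+\mathbf{W}_s\otimes\mathbf{V}_s)\Big)\ln\rho$$ $$\qquad+\Big(\frac{a_s^2}{2}\,\mathbf{W}_s\otimes\mathbf{W}_s+\mathbf{T}_s\otimes\mathbf{T}_s+\frac{a_s^2}{4}\,(\mathbf{Z}_s\otimes\mathbf{V}_s+\mathbf{V}_s\otimes\mathbf{Z}_s)\Big)\ln\rho+\mathbf{D}_s+\mathcal{O}(\rho\ln\rho),$$ where $$\alpha_s:=\frac1{Y^s}\Big(b_s\,(Y^s_v+2Y^s_z)+a_s^2\big(\tfrac14Y^s_{vv}+Y^s_{zz}-Y^s_{wz}\big)\Big),\qquad\beta_s:=b_s+\frac{a_s^2}{2}\,\frac{Y^s_v}{Y^s}$$ may be computed explicitly in terms of derivatives of $\mathcal{W}$ and $\kappa$ at $v_s$, and the symmetric matrix $\mathbf{D}_s$ is such that $$\mathbf{S}_s\cdot\mathbf{D}_s\,\mathbf{S}_s=\mathcal{M}'',\qquad \mathbf{S}_s:=\begin{pmatrix}-q_s\\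 B^{-1}U_s\\ -1\end{pmatrix},$$ $\mathcal{M}''$ being the second derivative of the Boussinesq momentum $\mathcal{M}$ with respect to the solitary wave speed $c$ at fixed endstate $U_s$.
   Context: **Potential.** $N\in\{1,2\}$, $b\neq0$ is a real number, $I\subset\mathbb{R}$ is an open interval, $f,\kappa:I\to\mathbb{R}$ are smooth with $\kappa>0$, and if $N=2$, $\tau:I\to\mathbb{R}$ is smooth with $\tau>0$. $B=b$ if $N=1$, $B=\begin{pmatrix}0&b\\ b&0\end{pmatrix}$ if $N=2$. Parameters are $\mu\in\mathbb{R}$, $\lambda\in\mathbb{R}^N$, $c\in\mathbb{R}$. For $N=2$: $g(v;c,\lambda_2):=-\big((c/b)v+\lambda_2\big)/\tau(v)$, $q(v;c,\lambda_2):=v\,g(v;c,\lambda_2)/b$, $\mathcal{W}(v;c,\lambda):=-f(v)+\tfrac12\tau(v)g(v;c,\lambda_2)^2-\lambda_1 v$. For $N=1$: $q(v):=v^2/(2b)$, $\mathcal{W}(v;c,\lambda):=-f(v)-\tfrac{c}{2b}v^2-\lambda v$. **Standing assumption.** $\Lambda\subset\mathbb{R}^{N+1}$ is open, and there are smooth functions $v_0,v_s,v^s:\Lambda\to I$ such that for all $(c,\lambda)\in\Lambda$: $v_s<v_0<v^s$; $\mu_0(c,\lambda):=\mathcal{W}(v_0;c,\lambda)<\mu_s(c,\lambda):=\mathcal{W}(v_s;c,\lambda)=\mathcal{W}(v^s;c,\lambda)$; $\partial_v\mathcal{W}(v_0;c,\lambda)=\partial_v\mathcal{W}(v_s;c,\lambda)=0$;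 $\partial_v^2\mathcal{W}(v_s;c,\lambda)<0<\partial_v^2\mathcal{W}(v_0;c,\lambda)$; $\partial_v\mathcal{W}<0$ on $(v_s,v_0)$ and $\partial_v\mathcal{W}>0$ on $(v_0,v^s]$. Let $\Omega:=\{(\mu,\lambda,c):(c,\lambda)\in\Lambda,\ \mu_0(c,\lambda)<\mu<\mu_s(c,\lambda)\}$, and let $v_1,v_2,v_3:\Omega\to I$ be smooth with $v_1<v_s<v_2<v_0<v_3<v^s$, $\mathcal{W}(v_i(\mu,\lambda,c);c,\lambda)=\mu$ for $i=1,2,3$, and $\partial_v\mathcal{W}(\cdot;c,\lambda)>0$ on $[v_1(\mu,\lambda,c),v_s(c,\lambda))$. **Action.** $\Theta(\mu,\lambda,c)=2\int_{v_2}^{v_3}\sqrt{2\kappa(v)(\mu-\mathcal{W}(v;c,\lambda))}\,dv$ on $\Omega$; $\nabla^2\Theta$ is the $(N+2)\times(N+2)$ Hessian with respect to $(\mu,\lambda,c)$. **Notation.** $\mathbf{X}\otimes\mathbf{Y}:=\mathbf{X}\mathbf{Y}^T$. All quantities with index $s$ are functions of $(c,\lambda)$, with $v_s=v_s(c,\lambda)$. $h_s:=v^s-v_s$, $a_s:=\sqrt{-2/\partial_v^2\mathcal{W}(v_s;c,\lambda)}$, $b_s:=\tfrac13\,\partial_v^3\mathcal{W}(v_s;c,\lambda)/(\partial_v^2\mathcal{W}(v_s;c,\lambda))^2$. $U_s:=v_s$ if $N=1$, $U_s:=(v_s,g(v_s;c,\lambda_2))^T$ if $N=2$; $q_s:=\tfrac12U_s\cdot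 B^{-1}U_s$ (the value of $q$ at $v_s$). For $N=2$ (with $g,g_v,g_{vv},q,q_v,q_{vv}$ and $\tau$ evaluated at $v=v_s$): $\mathbf{V}_s=(1,v_s,g,q)^T$, $\mathbf{W}_s=(0,1,g_v,q_v)^T$, $\mathbf{Z}_s=(0,0,g_{vv},q_{vv})^T$, $\mathbf{T}_s=\tau(v_s)^{-1/2}(0,0,1,v_s/b)^T$. For $N=1$: $\mathbf{V}_s=(1,v_s,q)^T$, $\mathbf{W}_s=(0,1,q_v)^T$, $\mathbf{Z}_s=(0,0,q_{vv})^T$, $\mathbf{T}_s=0$. $$R(v,w,z;c,\lambda):=\int_0^1\!\!\int_0^1 t\,\partial_v^2\mathcal{W}(w+t(z-w)+ts(v-z);c,\lambda)\,ds\,dt,\qquad Y(v,w,z;c,\lambda):=\sqrt{2\kappa(v)/|R(v,w,z;c,\lambda)|}.$$ A superscript $s$ on $Y$ or its partial derivatives (denoted by subscripts $v,w,z$) means evaluation at $v=w=z=v_s(c,\lambda)$. **Boussinesq momentum.** $\mathcal{M}=2\int_{v_s}^{v^s}\sqrt{2\kappa(v)(\mu_s-\mathcal{W}(v;c,\lambda))}\,dv$, a function of $(c,\lambda)\in\Lambda$. Since $\lambda$ is determined by $(c,U_s)$ (one has $\lambda=-\nabla_UH(U_s,0)-cB^{-1}U_s$ with $H(U,0)=f(v)$ if $N=1$ and $H(U,0)=\tfrac12\tau(v)u^2+f(v)$, $U=(v,u)^T$, if $N=2$), $\mathcal{M}$ may be seen as a function of $(c,U_s)$, and $\mathcal{M}''$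 is its second derivative in $c$ at fixed $U_s$; equivalently $\mathcal{M}''(c,\lambda)$ is the second derivative at $\tilde c=c$ of $\tilde c\mapsto\mathcal{M}(\tilde c,\lambda-(\tilde c-c)B^{-1}U_s)$ with $U_s=U_s(c,\lambda)$ held fixed.
   Formalization: The identity S_s·D_s S_s = M'' is replaced by Y^s (S_s·D_s S_s) = M'': since the Hessian is divided by Y^s in the expansion that determines D_s, the printed identity fails unless Y^s = 1 or M'' = 0 (rescaling κ changes M'' but not D_s). *)

theory Defs
  imports "HOL-Analysis.Analysis" "HOL-Library.Landau_Symbols"
begin

text \<open>
  The number \<open>N\<close> is the cardinality of the index type \<open>'n\<close> of the vectors \<open>lam\<close>
  (the letter lambda is reserved syntax). The sort
  \<open>numeral\<close> only serves to name the components \<open>lam $ 1\<close> and \<open>lam $ 2\<close>. It is inhabited by the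
  numeral types \<open>1\<close> and \<open>2\<close>; in the former the indices \<open>1\<close> and \<open>2\<close> coincide, and only
  \<open>lam $ 1\<close> is used.
\<close>

type_synonym 'n rvec = "(real, 'n) vec"


section \<open>Smoothness\<close>

text \<open>For open subsets of finite-dimensional spaces.\<close>

primrec Ck_on :: "nat \<Rightarrow> ('a::real_normed_vector \<Rightarrow> 'b::real_normed_vector) \<Rightarrow> 'a set \<Rightarrow> bool" where
  "Ck_on 0 F S \<longleftrightarrow> continuous_on S F"
| "Ck_on (Suc k) F S \<longleftrightarrow> (\<forall>x\<in>S. F differentiable (at x)) \<and>
     (\<forall>h. Ck_on k (\<lambda>x. frechet_derivative F (at x) h) S)"

definition smooth_on :: "('a::real_normed_vector \<Rightarrow> 'b::real_normed_vector) \<Rightarrow> 'a set \<Rightarrow> bool" where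
  "smooth_on F S \<longleftrightarrow> (\<forall>k. Ck_on k F S)"


section \<open>The potential\<close>

definition gfun :: "real \<Rightarrow> (real \<Rightarrow> real) \<Rightarrow> real \<Rightarrow> real \<Rightarrow> 'n::{finite,numeral} rvec \<Rightarrow> real" where
  "gfun b \<tau> v c lam = - ((c / b) * v + lam $ 2) / \<tau> v"

definition qfun :: "real \<Rightarrow> (real \<Rightarrow> real) \<Rightarrow> real \<Rightarrow> real \<Rightarrow> 'n::{finite,numeral} rvec \<Rightarrow> real" where
  "qfun b \<tau> v c lam = (if CARD('n) = 1 then v\<^sup>2 / (2 * b) else v * gfun b \<tau> v c lam / b)"

definition potential ::
  "real \<Rightarrow> (real \<Rightarrow> real) \<Rightarrow> (real \<Rightarrow> real) \<Rightarrow> real \<Rightarrow> real \<Rightarrow> 'n::{finite,numeral} rvec \<Rightarrow> real" where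
  "potential b f \<tau> v c lam =
     (if CARD('n) = 1 then - f v - c / (2 * b) * v\<^sup>2 - lam $ 1 * v
      else - f v + 1 / 2 * \<tau> v * (gfun b \<tau> v c lam)\<^sup>2 - lam $ 1 * v)"

definition dv :: "nat \<Rightarrow> (real \<Rightarrow> real \<Rightarrow> 'l \<Rightarrow> real) \<Rightarrow> real \<Rightarrow> real \<Rightarrow> 'l \<Rightarrow> real" where
  "dv n F v c lam = (deriv ^^ n) (\<lambda>x. F x c lam) v"

definition Bmat :: "real \<Rightarrow> real ^ 'n ^ 'n::finite" where
  "Bmat b = (if CARD('n) = 1 then (\<chi> i j. b) else (\<chi> i j. if i = j then 0 else b))"

text \<open>The vector \<open>x\<close> if \<open>N = 1\<close>, and \<open>(x, y)\<close> if \<open>N = 2\<close>.\<close>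

definition comps :: "real \<Rightarrow> real \<Rightarrow> 'n::{finite,numeral} rvec" where
  "comps x y = (if CARD('n) = 1 then (\<chi> i. x) else (\<chi> i. if i = 1 then x else y))"

definition Uend :: "real \<Rightarrow> (real \<Rightarrow> real) \<Rightarrow> real \<Rightarrow> real \<Rightarrow> 'n::{finite,numeral} rvec \<Rightarrow> 'n rvec" where
  "Uend b \<tau> v c lam = comps v (gfun b \<tau> v c lam)"

definition qend :: "real \<Rightarrow> (real \<Rightarrow> real) \<Rightarrow> real \<Rightarrow> real \<Rightarrow> 'n::{finite,numeral} rvec \<Rightarrow> real" where
  "qend b \<tau> v c lam = 1 / 2 * (Uend b \<tau> v c lam \<bullet> (matrix_inv (Bmat b) *v Uend b \<tau> v c lam))"


section \<open>Standing assumptions\<close>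

text \<open>\<open>vs\<close> and \<open>vS\<close> stand for $v_s$ and $v^s$: the endstate and the extremal value of the solitary wave.\<close>

definition solitary_branch ::
  "(real \<Rightarrow> real \<Rightarrow> 'l::euclidean_space \<Rightarrow> real) \<Rightarrow> real set \<Rightarrow> (real \<times> 'l) set
    \<Rightarrow> (real \<times> 'l \<Rightarrow> real) \<Rightarrow> (real \<times> 'l \<Rightarrow> real) \<Rightarrow> (real \<times> 'l \<Rightarrow> real) \<Rightarrow> bool" where
  "solitary_branch W I \<Lambda> v0 vs vS \<longleftrightarrow>
     open \<Lambda> \<and> smooth_on v0 \<Lambda> \<and> smooth_on vs \<Lambda> \<and> smooth_on vS \<Lambda> \<and>
     (\<forall>(c, lam)\<in>\<Lambda>.
        v0 (c, lam) \<in> I \<and> vs (c, lam) \<in> I \<and> vS (c, lam) \<in> I \<and>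
        vs (c, lam) < v0 (c, lam) \<and> v0 (c, lam) < vS (c, lam) \<and>
        W (v0 (c, lam)) c lam < W (vs (c, lam)) c lam \<and>
        W (vs (c, lam)) c lam = W (vS (c, lam)) c lam \<and>
        dv 1 W (v0 (c, lam)) c lam = 0 \<and> dv 1 W (vs (c, lam)) c lam = 0 \<and>
        dv 2 W (vs (c, lam)) c lam < 0 \<and> 0 < dv 2 W (v0 (c, lam)) c lam \<and>
        (\<forall>v\<in>{vs (c, lam)<..<v0 (c, lam)}. dv 1 W v c lam < 0) \<and>
        (\<forall>v\<in>{v0 (c, lam)<..vS (c, lam)}. 0 < dv 1 W v c lam))"

definition parameter_domain ::
  "(real \<Rightarrow> real \<Rightarrow> 'l::euclidean_space \<Rightarrow> real) \<Rightarrow> (real \<times> 'l) set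
    \<Rightarrow> (real \<times> 'l \<Rightarrow> real) \<Rightarrow> (real \<times> 'l \<Rightarrow> real) \<Rightarrow> (real \<times> 'l \<times> real) set" where
  "parameter_domain W \<Lambda> v0 vs =
     {(\<mu>, lam, c). (c, lam) \<in> \<Lambda> \<and> W (v0 (c, lam)) c lam < \<mu> \<and> \<mu> < W (vs (c, lam)) c lam}"

definition root_branches ::
  "(real \<Rightarrow> real \<Rightarrow> 'l::euclidean_space \<Rightarrow> real) \<Rightarrow> real set \<Rightarrow> (real \<times> 'l \<times> real) set
    \<Rightarrow> (real \<times> 'l \<Rightarrow> real) \<Rightarrow> (real \<times> 'l \<Rightarrow> real) \<Rightarrow> (real \<times> 'l \<Rightarrow> real)
    \<Rightarrow> (real \<times> 'l \<times> real \<Rightarrow> real) \<Rightarrow> (real \<times> 'l \<times> real \<Rightarrow> real) \<Rightarrow> (real \<times> 'l \<times> real \<Rightarrow> real) \<Rightarrow> bool" where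
  "root_branches W I \<Omega> v0 vs vS v1 v2 v3 \<longleftrightarrow>
     smooth_on v1 \<Omega> \<and> smooth_on v2 \<Omega> \<and> smooth_on v3 \<Omega> \<and>
     (\<forall>(\<mu>, lam, c)\<in>\<Omega>.
        v1 (\<mu>, lam, c) \<in> I \<and> v2 (\<mu>, lam, c) \<in> I \<and> v3 (\<mu>, lam, c) \<in> I \<and>
        v1 (\<mu>, lam, c) < vs (c, lam) \<and> vs (c, lam) < v2 (\<mu>, lam, c) \<and>
        v2 (\<mu>, lam, c) < v0 (c, lam) \<and> v0 (c, lam) < v3 (\<mu>, lam, c) \<and>
        v3 (\<mu>, lam, c) < vS (c, lam) \<and>
        W (v1 (\<mu>, lam, c)) c lam = \<mu> \<and> W (v2 (\<mu>, lam, c)) c lam = \<mu> \<and> W (v3 (\<mu>, lam, c)) c lam = \<mu> \<and>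
        (\<forall>v\<in>{v1 (\<mu>, lam, c)..<vs (c, lam)}. 0 < dv 1 W v c lam))"


section \<open>Action, momentum and Hessian\<close>

fun action ::
  "(real \<Rightarrow> real \<Rightarrow> 'l \<Rightarrow> real) \<Rightarrow> (real \<Rightarrow> real) \<Rightarrow> (real \<times> 'l \<times> real \<Rightarrow> real)
    \<Rightarrow> (real \<times> 'l \<times> real \<Rightarrow> real) \<Rightarrow> real \<times> 'l \<times> real \<Rightarrow> real" where
  "action W \<kappa> v2 v3 (\<mu>, lam, c) =
     2 * integral {v2 (\<mu>, lam, c)..v3 (\<mu>, lam, c)} (\<lambda>v. sqrt (2 * \<kappa> v * (\<mu> - W v c lam)))"

fun momentum ::
  "(real \<Rightarrow> real \<Rightarrow> 'l \<Rightarrow> real) \<Rightarrow> (real \<Rightarrow> real) \<Rightarrow> (real \<times> 'l \<Rightarrow> real)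
    \<Rightarrow> (real \<times> 'l \<Rightarrow> real) \<Rightarrow> real \<times> 'l \<Rightarrow> real" where
  "momentum W \<kappa> vs vS (c, lam) =
     2 * integral {vs (c, lam)..vS (c, lam)}
           (\<lambda>v. sqrt (2 * \<kappa> v * (W (vs (c, lam)) c lam - W v c lam)))"

text \<open>Fixing the endstate \<open>U\<close> makes \<open>lam\<close> an affine function of the speed, of slope
  \<open>- matrix_inv (Bmat b) *v U\<close>.\<close>

definition momentum_speed_deriv2 ::
  "real \<Rightarrow> (real \<times> 'n::finite rvec \<Rightarrow> real) \<Rightarrow> 'n rvec \<Rightarrow> real \<Rightarrow> 'n rvec \<Rightarrow> real" where
  "momentum_speed_deriv2 b M U c lam =
     (deriv ^^ 2) (\<lambda>c'. M (c', lam - (c' - c) *\<^sub>R (matrix_inv (Bmat b) *v U))) c"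

text \<open>\<open>(N+2) \<times> (N+2)\<close> matrices are indexed by the standard basis of
  \<open>real \<times> 'n rvec \<times> real\<close>, the space of the \<open>(\<mu>, lam, c)\<close>.\<close>

definition partial_deriv :: "'p::euclidean_space \<Rightarrow> ('p \<Rightarrow> real) \<Rightarrow> 'p \<Rightarrow> real" where
  "partial_deriv i F p = deriv (\<lambda>t. F (p + t *\<^sub>R i)) 0"

definition hessian :: "('p::euclidean_space \<Rightarrow> real) \<Rightarrow> 'p \<Rightarrow> 'p \<Rightarrow> 'p \<Rightarrow> real" where
  "hessian F p i j = partial_deriv i (partial_deriv j F) p"

definition outer :: "'p::euclidean_space \<Rightarrow> 'p \<Rightarrow> 'p \<Rightarrow> 'p \<Rightarrow> real" where
  "outer X Y i j = (X \<bullet> i) * (Y \<bullet> j)"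

definition symmetric_mat :: "('p::euclidean_space \<Rightarrow> 'p \<Rightarrow> real) \<Rightarrow> bool" where
  "symmetric_mat A \<longleftrightarrow> (\<forall>i\<in>Basis. \<forall>j\<in>Basis. A i j = A j i)"

definition quad_form :: "('p::euclidean_space \<Rightarrow> 'p \<Rightarrow> real) \<Rightarrow> 'p \<Rightarrow> real" where
  "quad_form A X = (\<Sum>i\<in>Basis. \<Sum>j\<in>Basis. (X \<bullet> i) * A i j * (X \<bullet> j))"


section \<open>Coefficients of the expansion\<close>

text \<open>In this section \<open>x\<close> stands for \<open>v\<^sub>s(c, lam)\<close>.\<close>

definition Rfun :: "(real \<Rightarrow> real \<Rightarrow> 'l \<Rightarrow> real) \<Rightarrow> real \<Rightarrow> 'l \<Rightarrow> real \<Rightarrow> real \<Rightarrow> real \<Rightarrow> real" where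
  "Rfun W c lam v w z =
     integral {0..1} (\<lambda>t. integral {0..1} (\<lambda>s.
       t * dv 2 W (w + t * (z - w) + t * s * (v - z)) c lam))"

definition Yfun ::
  "(real \<Rightarrow> real \<Rightarrow> 'l \<Rightarrow> real) \<Rightarrow> (real \<Rightarrow> real) \<Rightarrow> real \<Rightarrow> 'l \<Rightarrow> real \<Rightarrow> real \<Rightarrow> real \<Rightarrow> real" where
  "Yfun W \<kappa> c lam v w z = sqrt (2 * \<kappa> v / \<bar>Rfun W c lam v w z\<bar>)"

definition Ys :: "(real \<Rightarrow> real \<Rightarrow> 'l \<Rightarrow> real) \<Rightarrow> (real \<Rightarrow> real) \<Rightarrow> real \<Rightarrow> real \<Rightarrow> 'l \<Rightarrow> real" where
  "Ys W \<kappa> x c lam = Yfun W \<kappa> c lam x x x"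

definition Ys_v :: "(real \<Rightarrow> real \<Rightarrow> 'l \<Rightarrow> real) \<Rightarrow> (real \<Rightarrow> real) \<Rightarrow> real \<Rightarrow> real \<Rightarrow> 'l \<Rightarrow> real" where
  "Ys_v W \<kappa> x c lam = deriv (\<lambda>v. Yfun W \<kappa> c lam v x x) x"

definition Ys_z :: "(real \<Rightarrow> real \<Rightarrow> 'l \<Rightarrow> real) \<Rightarrow> (real \<Rightarrow> real) \<Rightarrow> real \<Rightarrow> real \<Rightarrow> 'l \<Rightarrow> real" where
  "Ys_z W \<kappa> x c lam = deriv (\<lambda>z. Yfun W \<kappa> c lam x x z) x"

definition Ys_vv :: "(real \<Rightarrow> real \<Rightarrow> 'l \<Rightarrow> real) \<Rightarrow> (real \<Rightarrow> real) \<Rightarrow> real \<Rightarrow> real \<Rightarrow> 'l \<Rightarrow> real" where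
  "Ys_vv W \<kappa> x c lam = (deriv ^^ 2) (\<lambda>v. Yfun W \<kappa> c lam v x x) x"

definition Ys_zz :: "(real \<Rightarrow> real \<Rightarrow> 'l \<Rightarrow> real) \<Rightarrow> (real \<Rightarrow> real) \<Rightarrow> real \<Rightarrow> real \<Rightarrow> 'l \<Rightarrow> real" where
  "Ys_zz W \<kappa> x c lam = (deriv ^^ 2) (\<lambda>z. Yfun W \<kappa> c lam x x z) x"

definition Ys_wz :: "(real \<Rightarrow> real \<Rightarrow> 'l \<Rightarrow> real) \<Rightarrow> (real \<Rightarrow> real) \<Rightarrow> real \<Rightarrow> real \<Rightarrow> 'l \<Rightarrow> real" where
  "Ys_wz W \<kappa> x c lam = deriv (\<lambda>w. deriv (\<lambda>z. Yfun W \<kappa> c lam x w z) x) x"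

definition a_s :: "(real \<Rightarrow> real \<Rightarrow> 'l \<Rightarrow> real) \<Rightarrow> real \<Rightarrow> real \<Rightarrow> 'l \<Rightarrow> real" where
  "a_s W x c lam = sqrt (- 2 / dv 2 W x c lam)"

definition b_s :: "(real \<Rightarrow> real \<Rightarrow> 'l \<Rightarrow> real) \<Rightarrow> real \<Rightarrow> real \<Rightarrow> 'l \<Rightarrow> real" where
  "b_s W x c lam = 1 / 3 * dv 3 W x c lam / (dv 2 W x c lam)\<^sup>2"

definition \<alpha>_s :: "(real \<Rightarrow> real \<Rightarrow> 'l \<Rightarrow> real) \<Rightarrow> (real \<Rightarrow> real) \<Rightarrow> real \<Rightarrow> real \<Rightarrow> 'l \<Rightarrow> real" where
  "\<alpha>_s W \<kappa> x c lam = 1 / Ys W \<kappa> x c lam *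
     (b_s W x c lam * (Ys_v W \<kappa> x c lam + 2 * Ys_z W \<kappa> x c lam)
      + (a_s W x c lam)\<^sup>2 * (1 / 4 * Ys_vv W \<kappa> x c lam + Ys_zz W \<kappa> x c lam - Ys_wz W \<kappa> x c lam))"

definition \<beta>_s :: "(real \<Rightarrow> real \<Rightarrow> 'l \<Rightarrow> real) \<Rightarrow> (real \<Rightarrow> real) \<Rightarrow> real \<Rightarrow> real \<Rightarrow> 'l \<Rightarrow> real" where
  "\<beta>_s W \<kappa> x c lam = b_s W x c lam + (a_s W x c lam)\<^sup>2 / 2 * (Ys_v W \<kappa> x c lam / Ys W \<kappa> x c lam)"

definition Vvec ::
  "real \<Rightarrow> (real \<Rightarrow> real) \<Rightarrow> real \<Rightarrow> real \<Rightarrow> 'n::{finite,numeral} rvec \<Rightarrow> real \<times> 'n rvec \<times> real" where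
  "Vvec b \<tau> x c lam = (1, comps x (gfun b \<tau> x c lam), qfun b \<tau> x c lam)"

definition Wvec ::
  "real \<Rightarrow> (real \<Rightarrow> real) \<Rightarrow> real \<Rightarrow> real \<Rightarrow> 'n::{finite,numeral} rvec \<Rightarrow> real \<times> 'n rvec \<times> real" where
  "Wvec b \<tau> x c lam = (0, comps 1 (dv 1 (gfun b \<tau>) x c lam), dv 1 (qfun b \<tau>) x c lam)"

definition Zvec ::
  "real \<Rightarrow> (real \<Rightarrow> real) \<Rightarrow> real \<Rightarrow> real \<Rightarrow> 'n::{finite,numeral} rvec \<Rightarrow> real \<times> 'n rvec \<times> real" where
  "Zvec b \<tau> x c lam = (0, comps 0 (dv 2 (gfun b \<tau>) x c lam), dv 2 (qfun b \<tau>) x c lam)"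

definition Tvec :: "real \<Rightarrow> (real \<Rightarrow> real) \<Rightarrow> real \<Rightarrow> real \<times> 'n::{finite,numeral} rvec \<times> real" where
  "Tvec b \<tau> x = (if CARD('n) = 1 then 0 else (1 / sqrt (\<tau> x)) *\<^sub>R (0, comps 0 1, x / b))"

definition Svec ::
  "real \<Rightarrow> (real \<Rightarrow> real) \<Rightarrow> real \<Rightarrow> real \<Rightarrow> 'n::{finite,numeral} rvec \<Rightarrow> real \<times> 'n rvec \<times> real" where
  "Svec b \<tau> x c lam =
     (- qend b \<tau> x c lam, matrix_inv (Bmat b) *v Uend b \<tau> x c lam, - 1)"

text \<open>The divergent part of the Hessian of the action divided by \<open>Ys\<close>. The vector \<open>Svec\<close> is
  orthogonal to \<open>Vvec\<close>, \<open>Wvec\<close> and \<open>Tvec\<close>, so that the quadratic form of the Hessian in the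
  direction \<open>Svec\<close> is, in the limit, \<open>Ys\<close> times the one of the remaining constant matrix; this is
  why the second derivative of the momentum equals \<open>Ys * quad_form D Svec\<close>, and not
  \<open>quad_form D Svec\<close>.\<close>

definition singular_part ::
  "real \<Rightarrow> (real \<Rightarrow> real \<Rightarrow> 'n::{finite,numeral} rvec \<Rightarrow> real) \<Rightarrow> (real \<Rightarrow> real) \<Rightarrow> (real \<Rightarrow> real)
    \<Rightarrow> real \<Rightarrow> real \<Rightarrow> real \<Rightarrow> 'n rvec \<Rightarrow> real
    \<Rightarrow> real \<times> 'n rvec \<times> real \<Rightarrow> real \<times> 'n rvec \<times> real \<Rightarrow> real" where
  "singular_part b W \<kappa> \<tau> x h c lam \<rho> i j =
     (let V = Vvec b \<tau> x c lam; Wv = Wvec b \<tau> x c lam; Z = Zvec b \<tau> x c lam; T = Tvec b \<tau> x;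
          a = a_s W x c lam in
        2 * a\<^sup>2 / h\<^sup>2 * ((1 + \<rho>) / \<rho>\<^sup>2) * outer V V i j
        + (\<alpha>_s W \<kappa> x c lam * outer V V i j
           + \<beta>_s W \<kappa> x c lam * (outer V Wv i j + outer Wv V i j)) * ln \<rho>
        + (a\<^sup>2 / 2 * outer Wv Wv i j + outer T T i j
           + a\<^sup>2 / 4 * (outer Z V i j + outer V Z i j)) * ln \<rho>)"

end

theory Submission
  imports Defs
begin

text \<open>
  Near the saddle value put \<open>m = \<mu>\<^sub>s - \<mu>\<close> and straighten the potential by a smooth coordinate \<open>v = X y\<close> with
  \<open>W = \<mu>\<^sub>s - y\<^sup>2\<close>. The action then becomes an integral of \<open>\<phi> y * sqrt (y\<^sup>2 - m)\<close> plus an end piece at the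
  turning point \<open>v\<^sub>3\<close>, which is smooth up to and beyond \<open>m = 0\<close>. Expanding \<open>\<phi>\<close> gives
  \<open>\<Theta> = (Y m / 2 + m\<^sup>2 C) ln m + B\<close> with \<open>Y\<close>, \<open>C\<close> smooth and \<open>B\<close> three times continuously differentiable in a
  two-sided neighbourhood of \<open>m = 0\<close>; at \<open>m = 0\<close> it is the momentum. Differentiating twice yields the singular terms
  \<open>1 / m\<close> and \<open>ln m\<close>; they are rewritten through the expansion of \<open>\<rho>\<close> in \<open>\<epsilon> = sqrt m\<close>. Along a direction
  orthogonal to \<open>V\<^sub>s\<close>, \<open>W\<^sub>s\<close> and \<open>T\<^sub>s\<close> all singular terms vanish, and what remains is the second
  derivative of the momentum.
\<close>

section \<open>Calculus of differentiability classes\<close>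

text \<open>The obstacle is regularity up to the boundary m = 0: \<open>sqrt m\<close> enters the
  turning points, yet the coefficients of the expansion have to be differentiable there as functions
  of (\<mu>, lam, c). No half-integer power of m survives. The factor sqrt (y^2 - m) vanishes at the
  lower limit, odd Taylor terms of \<phi> integrate to smooth functions of m, even terms of degree k
  leave m^(k/2+1) ln m, and the Taylor remainder becomes an Abel integral in u = y^2 whose density
  extends by zero to u < 0. Three derivatives of B are asked for so that its second derivatives are
  Lipschitz and can be compared with their values on m = 0. The error so obtained is O(\<epsilon>),
  which is O(\<rho> ln \<rho>) because |ln \<rho>| is at least 1 for small \<rho>.

  The vectors are forced: V is minus the gradient of m, W and Z are the v-derivatives of V at fixed
  parameters, and T \<otimes> T is the second parameter derivative of the potential. Since \<alpha>
  and \<beta> are stated through derivatives of Y but arise from jets of X, both are computed in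
  derivatives of the potential and of \<kappa> at the endstate and then compared.\<close>

definition dd :: "'a::real_normed_vector \<Rightarrow> ('a \<Rightarrow> 'b::real_normed_vector) \<Rightarrow> 'a \<Rightarrow> 'b" where
  "dd h F = (\<lambda>x. frechet_derivative F (at x) h)"

text \<open>With the direction as first argument, \<open>Ck_on\<close> is a recursion over the
  functions \<open>dd h F\<close>, each of which can be differentiated again.\<close>

lemma Ck_on_Suc_dd:
  "Ck_on (Suc k) F S \<longleftrightarrow> (\<forall>x\<in>S. F differentiable (at x)) \<and> (\<forall>h. Ck_on k (dd h F) S)"
  by (simp add: dd_def)

declare Ck_on.simps(2) [simp del]

lemma dd_eqI: "(F has_derivative F') (at x) \<Longrightarrow> dd h F x = F' h"
  unfolding dd_def by (metis frechet_derivative_at)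

lemma has_derivative_dd: "F differentiable (at x) \<Longrightarrow> (F has_derivative (\<lambda>h. dd h F x)) (at x)"
  unfolding dd_def by (simp add: frechet_derivative_works eta_contract_eq)

lemma linear_dd: "F differentiable (at x) \<Longrightarrow> linear (\<lambda>h. dd h F x)"
  using has_derivative_dd has_derivative_linear by blast

lemma Ck_on_subset: "Ck_on k F S \<Longrightarrow> T \<subseteq> S \<Longrightarrow> Ck_on k F T"
  by (induction k arbitrary: F) (auto simp: Ck_on.simps(2) intro: continuous_on_subset)

lemma Ck_on_Suc_imp: "Ck_on (Suc k) F S \<Longrightarrow> Ck_on k F S"
proof (induction k arbitrary: F)
  case 0
  then show ?case
    by (auto simp: Ck_on.simps(2) intro!: continuous_at_imp_continuous_on differentiable_imp_continuous_within)
next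
  case (Suc k)
  then show ?case
    unfolding Ck_on_Suc_dd by blast
qed

lemma Ck_on_mono: "Ck_on k F S \<Longrightarrow> j \<le> k \<Longrightarrow> Ck_on j F S"
proof (induction k)
  case (Suc k)
  then show ?case using Ck_on_Suc_imp by (cases "j = Suc k") auto
qed simp

lemma Ck_on_continuous_on: "Ck_on k F S \<Longrightarrow> continuous_on S F"
  using Ck_on_mono[of k F S 0] by simp

lemma Ck_on_differentiable: "Ck_on k F S \<Longrightarrow> 0 < k \<Longrightarrow> x \<in> S \<Longrightarrow> F differentiable (at x)"
  by (cases k) (auto simp: Ck_on.simps(2))

text \<open>No differentiability is assumed: \<open>frechet_derivative\<close> is a choice among the
  derivatives at the point, and functions that agree on a neighbourhood have the same derivatives
  there, possibly none.\<close>

lemma dd_cong: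
  assumes "open S" "x \<in> S" "\<And>y. y \<in> S \<Longrightarrow> F y = G y"
  shows "dd h F x = dd h G x"
proof -
  have "(F has_derivative D) (at x) \<longleftrightarrow> (G has_derivative D) (at x)" for D
    using assms has_derivative_transform_within_open by (metis (no_types, lifting))
  then show ?thesis
    by (simp add: dd_def frechet_derivative_def)
qed

lemma differentiable_cong_open:
  assumes "open S" "x \<in> S" "\<And>y. y \<in> S \<Longrightarrow> F y = G y" "G differentiable (at x)"
  shows "F differentiable (at x)"
  using assms unfolding differentiable_def
  by (metis (no_types, lifting) has_derivative_transform_within_open)

lemma Ck_on_cong:
  assumes "open S" "\<And>x. x \<in> S \<Longrightarrow> F x = G x" "Ck_on k G S"
  shows "Ck_on k F S"
  using assms(2,3)
proof (induction k arbitrary: F G)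
  case 0
  then show ?case using continuous_on_cong by auto
next
  case (Suc k)
  have "Ck_on k (dd h F) S" for h
    by (rule Suc.IH[of _ "dd h G"]) (use Suc.prems assms(1) in \<open>auto intro: dd_cong simp: Ck_on_Suc_dd\<close>)
  with Suc.prems show ?case
    unfolding Ck_on_Suc_dd using differentiable_cong_open[OF assms(1)] by blast
qed

text \<open>The form used in most closure proofs below: any explicit derivative formula
  \<open>F'\<close> may replace the chosen \<open>frechet_derivative\<close>, and only its
  components in fixed directions must lie in the lower class.\<close>

lemma Ck_on_SucI:
  assumes "open S" "\<And>x. x \<in> S \<Longrightarrow> (F has_derivative F' x) (at x)" "\<And>h. Ck_on k (\<lambda>x. F' x h) S"
  shows "Ck_on (Suc k) F S"
  unfolding Ck_on_Suc_dd
proof (intro conjI allI ballI)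
  show "F differentiable at x" if "x \<in> S" for x
    using assms(2)[OF that] by (auto simp: differentiable_def)
  show "Ck_on k (dd h F) S" for h
    using assms(3)[of h] by (rule Ck_on_cong[OF assms(1), rotated]) (simp add: dd_eqI assms(2))
qed

lemma Ck_on_has_derivative:
  "Ck_on (Suc k) F S \<Longrightarrow> x \<in> S \<Longrightarrow> (F has_derivative (\<lambda>h. dd h F x)) (at x)"
  by (simp add: Ck_on_Suc_dd has_derivative_dd)

lemma Ck_on_dd: "Ck_on (Suc k) F S \<Longrightarrow> Ck_on k (dd h F) S"
  by (simp add: Ck_on_Suc_dd)

lemma Ck_on_const: "Ck_on k (\<lambda>x. c) S"
proof (induction k arbitrary: c)
  case (Suc k)
  then show ?case
    by (auto simp: Ck_on.simps(2) frechet_derivative_const)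
qed auto

lemma Ck_on_bounded_linear:
  assumes "bounded_linear F" shows "Ck_on k F S"
proof (cases k)
  case 0
  then show ?thesis using linear_continuous_on[OF assms] by simp
next
  case (Suc n)
  have "dd h F = (\<lambda>x. F h)" for h
    by (rule ext) (rule dd_eqI[OF bounded_linear_imp_has_derivative[OF assms]])
  then show ?thesis
    by (simp add: Suc Ck_on_Suc_dd Ck_on_const bounded_linear_imp_differentiable[OF assms])
qed

lemma Ck_on_id: "Ck_on k (\<lambda>x. x) S"
  by (rule Ck_on_bounded_linear) (rule bounded_linear_ident)

lemma Ck_on_fst: "Ck_on k fst S" and Ck_on_snd: "Ck_on k snd S"
  by (rule Ck_on_bounded_linear, rule bounded_linear_fst bounded_linear_snd)+

lemma Ck_on_add:
  assumes "open S" "Ck_on k F S" "Ck_on k G S"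
  shows "Ck_on k (\<lambda>x. F x + G x) S"
  using assms(2,3)
proof (induction k arbitrary: F G)
  case 0
  then show ?case by (auto intro: continuous_intros)
next
  case (Suc k)
  show ?case
    by (rule Ck_on_SucI[OF assms(1), where F' = "\<lambda>x h. dd h F x + dd h G x"])
      (use Suc in \<open>auto intro!: has_derivative_add Ck_on_has_derivative Ck_on_dd\<close>)
qed

lemma Ck_on_linear_comp:
  assumes "open S" "bounded_linear L" "Ck_on k F S"
  shows "Ck_on k (\<lambda>x. L (F x)) S"
  using assms(3)
proof (induction k arbitrary: F)
  case 0
  then show ?case by (auto intro: bounded_linear.continuous_on[OF assms(2)])
next
  case (Suc k)
  show ?case
    by (rule Ck_on_SucI[OF assms(1), where F' = "\<lambda>x h. L (dd h F x)"])
      (use Suc in \<open>auto intro!: bounded_linear.has_derivative[OF assms(2)] Ck_on_has_derivative Ck_on_dd\<close>)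
qed

lemma Ck_on_minus: "open S \<Longrightarrow> Ck_on k F S \<Longrightarrow> Ck_on k (\<lambda>x. - F x) S"
  by (rule Ck_on_linear_comp[OF _ bounded_linear_minus[OF bounded_linear_ident]])

lemma Ck_on_diff:
  "open S \<Longrightarrow> Ck_on k F S \<Longrightarrow> Ck_on k G S \<Longrightarrow> Ck_on k (\<lambda>x. F x - G x) S"
  using Ck_on_add[of S k F "\<lambda>x. - G x"] Ck_on_minus[of S k G] by simp

lemma Ck_on_sum:
  assumes "open S" "\<And>i. i \<in> A \<Longrightarrow> Ck_on k (F i) S"
  shows "Ck_on k (\<lambda>x. \<Sum>i\<in>A. F i x) S"
  using assms(2)
  by (induction A rule: infinite_finite_induct) (auto intro: Ck_on_const Ck_on_add[OF assms(1)])

lemma Ck_on_scaleR: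
  assumes "open S" "Ck_on k F S" "Ck_on k G S"
  shows "Ck_on k (\<lambda>x. F x *\<^sub>R G x) S"
  using assms(2,3)
proof (induction k arbitrary: F G)
  case 0
  then show ?case by (auto intro: continuous_intros)
next
  case (Suc k)
  have Ck: "Ck_on k F S" "Ck_on k G S"
    using Suc.prems Ck_on_Suc_imp by blast+
  show ?case
  proof (rule Ck_on_SucI[OF assms(1), where F' = "\<lambda>x h. F x *\<^sub>R dd h G x + dd h F x *\<^sub>R G x"])
    show "((\<lambda>x. F x *\<^sub>R G x) has_derivative (\<lambda>h. F x *\<^sub>R dd h G x + dd h F x *\<^sub>R G x)) (at x)"
      if "x \<in> S" for x
      by (rule has_derivative_scaleR) (use Suc.prems that in \<open>auto intro!: Ck_on_has_derivative\<close>)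
    show "Ck_on k (\<lambda>x. F x *\<^sub>R dd h G x + dd h F x *\<^sub>R G x) S" for h
      by (intro Ck_on_add assms(1) Suc.IH) (use Suc.prems Ck in \<open>auto intro!: Ck_on_dd\<close>)
  qed
qed

lemma Ck_on_mult:
  fixes F G :: "'a::real_normed_vector \<Rightarrow> real"
  shows "open S \<Longrightarrow> Ck_on k F S \<Longrightarrow> Ck_on k G S \<Longrightarrow> Ck_on k (\<lambda>x. F x * G x) S"
  using Ck_on_scaleR[of S k F G] by simp

lemma Ck_on_power:
  fixes F :: "'a::real_normed_vector \<Rightarrow> real"
  shows "open S \<Longrightarrow> Ck_on k F S \<Longrightarrow> Ck_on k (\<lambda>x. F x ^ n) S"
  by (induction n) (auto intro: Ck_on_const Ck_on_mult)

lemma Ck_on_compose: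
  fixes F :: "'b::euclidean_space \<Rightarrow> 'c::real_normed_vector" and G :: "'a::real_normed_vector \<Rightarrow> 'b"
  assumes "open S" "open T" "Ck_on k F T" "Ck_on k G S" "\<And>x. x \<in> S \<Longrightarrow> G x \<in> T"
  shows "Ck_on k (\<lambda>x. F (G x)) S"
  using assms(3,4)
proof (induction k arbitrary: F)
  case 0
  then show ?case
    using assms(5) by (auto intro: continuous_on_compose2)
next
  case (Suc k)
  have G: "Ck_on k G S" using Suc.prems Ck_on_Suc_imp by blast
  show ?case
  proof (rule Ck_on_SucI[OF assms(1), where F' = "\<lambda>x h. dd (dd h G x) F (G x)"])
    show "((\<lambda>x. F (G x)) has_derivative (\<lambda>h. dd (dd h G x) F (G x))) (at x)" if "x \<in> S" for x
      by (rule has_derivative_compose[where g = F])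
        (use Suc.prems that assms(5) in \<open>auto intro!: Ck_on_has_derivative\<close>)
    fix h
    \<comment> \<open>The direction \<open>dd h G x\<close> moves with \<open>x\<close>, so the
      induction hypothesis does not apply as it stands. Expanding it in the finite basis leaves
      derivatives of \<open>F\<close> in fixed directions; this is why the middle space is
      euclidean.\<close>
    have "Ck_on k (\<lambda>x. \<Sum>b\<in>Basis. (dd h G x \<bullet> b) *\<^sub>R dd b F (G x)) S"
    proof (rule Ck_on_sum[OF assms(1)], rule Ck_on_scaleR[OF assms(1)])
      show "Ck_on k (\<lambda>x. dd h G x \<bullet> b) S" for b
        by (rule Ck_on_linear_comp[OF assms(1) bounded_linear_inner_left Ck_on_dd[OF Suc.prems(2)]])
      show "Ck_on k (\<lambda>x. dd b F (G x)) S" for b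
        by (rule Suc.IH[OF Ck_on_dd[OF Suc.prems(1)] G])
    qed
    moreover have "dd (dd h G x) F (G x) = (\<Sum>b\<in>Basis. (dd h G x \<bullet> b) *\<^sub>R dd b F (G x))" if "x \<in> S" for x
    proof -
      have "linear (\<lambda>h. dd h F (G x))"
        using Suc.prems(1) assms(5)[OF that] by (intro linear_dd) (auto simp: Ck_on_Suc_dd)
      from linear_sum[OF this, of "\<lambda>b. (dd h G x \<bullet> b) *\<^sub>R b" Basis]
      show ?thesis
        unfolding euclidean_representation linear_scale[OF \<open>linear _\<close>] .
    qed
    ultimately show "Ck_on k (\<lambda>x. dd (dd h G x) F (G x)) S"
      by (rule Ck_on_cong[OF assms(1), rotated])
  qed
qed

lemma Ck_on_Pair:
  assumes "open S" "Ck_on k F S" "Ck_on k G S"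
  shows "Ck_on k (\<lambda>x. (F x, G x)) S"
  using assms(2,3)
proof (induction k arbitrary: F G)
  case 0
  then show ?case by (auto intro: continuous_intros)
next
  case (Suc k)
  show ?case
    by (rule Ck_on_SucI[OF assms(1), where F' = "\<lambda>x h. (dd h F x, dd h G x)"])
      (use Suc in \<open>auto intro!: has_derivative_Pair Ck_on_has_derivative Ck_on_dd\<close>)
qed

text \<open>The derivative formula contains the reciprocal itself, but only in the lower class,
  which the induction hypothesis supplies. The square root below follows the same pattern.\<close>

lemma Ck_on_inverse:
  fixes F :: "'a::real_normed_vector \<Rightarrow> real"
  assumes "open S" "Ck_on k F S" "\<And>x. x \<in> S \<Longrightarrow> F x \<noteq> 0"
  shows "Ck_on k (\<lambda>x. inverse (F x)) S"
  using assms(2)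
proof (induction k)
  case 0
  then show ?case using assms(3) by (auto intro: continuous_intros)
next
  case (Suc k)
  show ?case
  proof (rule Ck_on_SucI[OF assms(1), where F' = "\<lambda>x h. - (inverse (F x) * dd h F x * inverse (F x))"])
    show "((\<lambda>x. inverse (F x)) has_derivative (\<lambda>h. - (inverse (F x) * dd h F x * inverse (F x)))) (at x)"
      if "x \<in> S" for x
      by (rule Deriv.has_derivative_inverse) (use Suc.prems that assms(3) in \<open>auto intro!: Ck_on_has_derivative\<close>)
    show "Ck_on k (\<lambda>x. - (inverse (F x) * dd h F x * inverse (F x))) S" for h
      by (intro Ck_on_minus Ck_on_mult assms(1) Suc.IH) (auto intro: Ck_on_dd Suc.prems Ck_on_Suc_imp[OF Suc.prems])
  qed
qed

lemma Ck_on_divide: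
  fixes F G :: "'a::real_normed_vector \<Rightarrow> real"
  shows "open S \<Longrightarrow> Ck_on k F S \<Longrightarrow> Ck_on k G S \<Longrightarrow> (\<And>x. x \<in> S \<Longrightarrow> G x \<noteq> 0) \<Longrightarrow>
    Ck_on k (\<lambda>x. F x / G x) S"
  by (simp add: divide_inverse Ck_on_mult Ck_on_inverse)

lemma Ck_on_sqrt:
  fixes F :: "'a::real_normed_vector \<Rightarrow> real"
  assumes "open S" "Ck_on k F S" "\<And>x. x \<in> S \<Longrightarrow> 0 < F x"
  shows "Ck_on k (\<lambda>x. sqrt (F x)) S"
  using assms(2)
proof (induction k)
  case 0
  then show ?case by (auto intro: continuous_intros)
next
  case (Suc k)
  have nz: "F x \<noteq> 0" if "x \<in> S" for x using assms(3)[OF that] by simp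
  show ?case
  proof (rule Ck_on_SucI[OF assms(1), where F' = "\<lambda>x h. dd h F x * (inverse (sqrt (F x)) / 2)"])
    show "((\<lambda>x. sqrt (F x)) has_derivative (\<lambda>h. dd h F x * (inverse (sqrt (F x)) / 2))) (at x)"
      if "x \<in> S" for x
      by (rule has_derivative_real_sqrt) (use Suc.prems that assms(3) in \<open>auto intro!: Ck_on_has_derivative\<close>)
    show "Ck_on k (\<lambda>x. dd h F x * (inverse (sqrt (F x)) / 2)) S" for h
      by (intro Ck_on_divide Ck_on_inverse Ck_on_mult Ck_on_const assms(1) Suc.IH)
        (auto simp: nz intro!: Ck_on_dd Suc.prems Ck_on_Suc_imp[OF Suc.prems])
  qed
qed

lemma Ck_on_ln:
  fixes F :: "'a::real_normed_vector \<Rightarrow> real"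
  assumes "open S" "Ck_on k F S" "\<And>x. x \<in> S \<Longrightarrow> 0 < F x"
  shows "Ck_on k (\<lambda>x. ln (F x)) S"
proof (cases k)
  case 0
  have "\<And>x. x \<in> S \<Longrightarrow> F x \<noteq> 0" using assms(3) by force
  then show ?thesis using 0 assms(2) by (auto intro: continuous_intros)
next
  case (Suc n)
  have nz: "F x \<noteq> 0" if "x \<in> S" for x using assms(3)[OF that] by simp
  show ?thesis
    unfolding Suc
  proof (rule Ck_on_SucI[OF assms(1), where F' = "\<lambda>x h. dd h F x * inverse (F x)"])
    show "((\<lambda>x. ln (F x)) has_derivative (\<lambda>h. dd h F x * inverse (F x))) (at x)" if "x \<in> S" for x
      by (rule has_derivative_ln) (use assms that Suc in \<open>auto intro!: Ck_on_has_derivative\<close>)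
    show "Ck_on n (\<lambda>x. dd h F x * inverse (F x)) S" for h
      by (intro Ck_on_inverse Ck_on_mult assms(1))
        (auto simp: nz intro!: Ck_on_dd assms(2)[unfolded Suc] Ck_on_Suc_imp[OF assms(2)[unfolded Suc]])
  qed
qed

lemmas Ck_on_intros = Ck_on_const Ck_on_id Ck_on_fst Ck_on_snd Ck_on_add Ck_on_minus Ck_on_diff Ck_on_mult
  Ck_on_power Ck_on_Pair Ck_on_divide Ck_on_sqrt

lemma smooth_onD: "smooth_on F S \<Longrightarrow> Ck_on k F S"
  by (simp add: smooth_on_def)

lemma smooth_onI: "(\<And>k. Ck_on k F S) \<Longrightarrow> smooth_on F S"
  by (simp add: smooth_on_def)

lemma smooth_on_dd: "smooth_on F S \<Longrightarrow> smooth_on (dd h F) S"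
  unfolding smooth_on_def by (blast intro: Ck_on_dd)

lemma smooth_on_subset: "smooth_on F S \<Longrightarrow> T \<subseteq> S \<Longrightarrow> smooth_on F T"
  by (rule smooth_onI) (rule Ck_on_subset[OF smooth_onD])

lemma smooth_on_cong:
  "open S \<Longrightarrow> (\<And>x. x \<in> S \<Longrightarrow> F x = G x) \<Longrightarrow> smooth_on G S \<Longrightarrow> smooth_on F S"
  by (rule smooth_onI, rule Ck_on_cong) (auto dest: smooth_onD)

lemma smooth_on_differentiable: "smooth_on F S \<Longrightarrow> x \<in> S \<Longrightarrow> F differentiable (at x)"
  using Ck_on_differentiable[of 1 F S x] smooth_onD by auto

lemma smooth_on_has_derivative:
  "smooth_on F S \<Longrightarrow> x \<in> S \<Longrightarrow> (F has_derivative (\<lambda>h. dd h F x)) (at x)"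
  by (simp add: has_derivative_dd smooth_on_differentiable)

lemma smooth_on_continuous_on: "smooth_on F S \<Longrightarrow> continuous_on S F"
  by (rule Ck_on_continuous_on[OF smooth_onD])

lemma smooth_on_compose:
  fixes F :: "'b::euclidean_space \<Rightarrow> 'c::real_normed_vector" and G :: "'a::real_normed_vector \<Rightarrow> 'b"
  assumes "open S" "open T" "smooth_on F T" "smooth_on G S" "\<And>x. x \<in> S \<Longrightarrow> G x \<in> T"
  shows "smooth_on (\<lambda>x. F (G x)) S"
  by (rule smooth_onI, rule Ck_on_compose[OF assms(1,2)]) (auto intro: smooth_onD assms)

lemma smooth_on_const: "smooth_on (\<lambda>x. c) S"
  and smooth_on_id: "smooth_on (\<lambda>x. x) S"
  and smooth_on_fst: "smooth_on fst S'"
  and smooth_on_snd: "smooth_on snd S'"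
  by (simp_all add: smooth_on_def Ck_on_intros)

lemma smooth_on_add: "open S \<Longrightarrow> smooth_on F S \<Longrightarrow> smooth_on G S \<Longrightarrow> smooth_on (\<lambda>x. F x + G x) S"
  and smooth_on_diff: "open S \<Longrightarrow> smooth_on F S \<Longrightarrow> smooth_on G S \<Longrightarrow> smooth_on (\<lambda>x. F x - G x) S"
  and smooth_on_minus: "open S \<Longrightarrow> smooth_on F S \<Longrightarrow> smooth_on (\<lambda>x. - F x) S"
  and smooth_on_Pair: "open S \<Longrightarrow> smooth_on F S \<Longrightarrow> smooth_on H S \<Longrightarrow> smooth_on (\<lambda>x. (F x, H x)) S"
  by (simp_all add: smooth_on_def Ck_on_intros)

lemma
  fixes F G :: "'a::real_normed_vector \<Rightarrow> real"
  shows smooth_on_mult: "open S \<Longrightarrow> smooth_on F S \<Longrightarrow> smooth_on G S \<Longrightarrow> smooth_on (\<lambda>x. F x * G x) S"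
    and smooth_on_power: "open S \<Longrightarrow> smooth_on F S \<Longrightarrow> smooth_on (\<lambda>x. F x ^ n) S"
    and smooth_on_divide: "open S \<Longrightarrow> smooth_on F S \<Longrightarrow> smooth_on G S \<Longrightarrow> (\<And>x. x \<in> S \<Longrightarrow> G x \<noteq> 0) \<Longrightarrow>
      smooth_on (\<lambda>x. F x / G x) S"
    and smooth_on_sqrt: "open S \<Longrightarrow> smooth_on F S \<Longrightarrow> (\<And>x. x \<in> S \<Longrightarrow> 0 < F x) \<Longrightarrow>
      smooth_on (\<lambda>x. sqrt (F x)) S"
    and smooth_on_ln: "open S \<Longrightarrow> smooth_on F S \<Longrightarrow> (\<And>x. x \<in> S \<Longrightarrow> 0 < F x) \<Longrightarrow>
      smooth_on (\<lambda>x. ln (F x)) S"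
  by (simp_all add: smooth_on_def Ck_on_intros Ck_on_ln)

section \<open>Directional derivatives and parameter integrals\<close>

lemma dd_line:
  assumes "F differentiable (at x)"
  shows "((\<lambda>t. F (x + t *\<^sub>R h)) has_vector_derivative dd h F x) (at 0)"
proof -
  have "((\<lambda>t. x + t *\<^sub>R h) has_derivative (\<lambda>t. t *\<^sub>R h)) (at 0)"
    by (auto intro!: derivative_eq_intros)
  moreover have "(F has_derivative (\<lambda>h. dd h F x)) (at (x + 0 *\<^sub>R h))"
    using has_derivative_dd[OF assms] by simp
  ultimately have "((\<lambda>t. F (x + t *\<^sub>R h)) has_derivative (\<lambda>t. dd (t *\<^sub>R h) F x)) (at 0)"
    by (rule has_derivative_compose)
  then show ?thesis
    unfolding has_vector_derivative_def linear_scale[OF linear_dd[OF assms]] .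
qed

lemma partial_deriv_eq_dd:
  assumes "F differentiable (at x)"
  shows "partial_deriv h F x = dd h F x"
  unfolding partial_deriv_def using dd_line[OF assms, of h]
  by (intro DERIV_imp_deriv) (simp only: has_real_derivative_iff_has_vector_derivative)

lemma dd_fst_real_derivative:
  fixes F :: "real \<times> 'q::real_normed_vector \<Rightarrow> real"
  assumes "F differentiable (at (v, q))"
  shows "((\<lambda>v. F (v, q)) has_real_derivative dd (1, 0) F (v, q)) (at v)"
proof -
  have "((\<lambda>v. (v, q)) has_derivative (\<lambda>t. (t, 0))) (at v)"
    by (auto intro!: derivative_eq_intros)
  from has_derivative_compose[OF this has_derivative_dd[OF assms]]
  have "((\<lambda>v. F (v, q)) has_derivative (\<lambda>t. dd (t, 0) F (v, q))) (at v)" .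
  moreover have "(\<lambda>t. dd (t, 0) F (v, q)) = (*) (dd (1, 0) F (v, q))"
  proof
    fix t
    show "dd (t, 0) F (v, q) = dd (1, 0) F (v, q) * t"
      using linear_scale[OF linear_dd[OF assms], of t "(1, 0)"] by simp
  qed
  ultimately show ?thesis
    unfolding has_field_derivative_def by (rule has_derivative_eq_rhs)
qed

lemma smooth_on_funpow_dd: "smooth_on F S \<Longrightarrow> smooth_on ((dd h ^^ n) F) S"
  by (induction n) (auto intro: smooth_on_dd)

text \<open>Bridge from the iterated one-variable \<open>deriv\<close> hidden in \<open>dv\<close>
  to iterated directional derivatives of a function of the value and the parameters
  together.\<close>

lemma funpow_deriv_eq_dd:
  fixes F :: "real \<times> 'q::real_normed_vector \<Rightarrow> real"
  assumes "open S" "smooth_on F S" "(v, q) \<in> S"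
  shows "(deriv ^^ n) (\<lambda>v. F (v, q)) v = (dd (1, 0) ^^ n) F (v, q)"
  using assms(3)
proof (induction n arbitrary: v)
  case (Suc n)
  have op: "open ((\<lambda>v. (v, q)) -` S)"
    by (rule open_vimage[OF assms(1)]) (auto intro: continuous_intros)
  have "((\<lambda>v. (dd (1, 0) ^^ n) F (v, q)) has_real_derivative dd (1, 0) ((dd (1, 0) ^^ n) F) (v, q)) (at v)"
    by (rule dd_fst_real_derivative smooth_on_differentiable smooth_on_funpow_dd assms Suc.prems)+
  then have "((deriv ^^ n) (\<lambda>v. F (v, q)) has_real_derivative dd (1, 0) ((dd (1, 0) ^^ n) F) (v, q)) (at v)"
    by (rule has_field_derivative_transform_within_open[OF _ op]) (use Suc in auto)
  then show ?case by (simp add: DERIV_imp_deriv)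
qed simp

text \<open>\<open>Ck_on\<close> yields continuity of the derivative in each fixed direction only;
  linearity reduces the operator norm to the finitely many basis directions.\<close>

lemma dd_euclidean_bound:
  fixes F :: "'a::euclidean_space \<Rightarrow> real"
  assumes "F differentiable (at x)"
  shows "\<bar>dd h F x\<bar> \<le> (\<Sum>b\<in>Basis. \<bar>dd b F x\<bar>) * norm h"
proof -
  have "dd h F x = dd (\<Sum>b\<in>Basis. (h \<bullet> b) *\<^sub>R b) F x" by (simp add: euclidean_representation)
  also have "\<dots> = (\<Sum>b\<in>Basis. (h \<bullet> b) * dd b F x)"
    using linear_sum[OF linear_dd[OF assms], of "\<lambda>b. (h \<bullet> b) *\<^sub>R b" Basis]
      linear_scale[OF linear_dd[OF assms]] by simp
  also have "\<bar>\<dots>\<bar> \<le> (\<Sum>b\<in>Basis. \<bar>dd b F x\<bar> * norm h)"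
    by (rule order_trans[OF sum_abs], rule sum_mono)
      (simp add: abs_mult mult.commute Basis_le_norm mult_right_mono)
  finally show ?thesis by (simp add: sum_distrib_right)
qed

text \<open>The basis derivatives are bounded on a compact ball, and the mean value inequality
  applies on the convex open ball inside. This supplies the linear error terms of all later
  estimates.\<close>

lemma Ck_on_locally_lipschitz:
  fixes F :: "'a::euclidean_space \<Rightarrow> real"
  assumes "open S" "Ck_on 1 F S" "x \<in> S"
  obtains C r where "0 < r" "0 \<le> C" "ball x r \<subseteq> S"
    "\<And>y z. y \<in> ball x r \<Longrightarrow> z \<in> ball x r \<Longrightarrow> \<bar>F y - F z\<bar> \<le> C * norm (y - z)"
proof -
  obtain r where r: "0 < r" "cball x r \<subseteq> S" using assms open_contains_cball by blast
  have D: "continuous_on S (\<lambda>y. \<Sum>b\<in>Basis. \<bar>dd b F y\<bar>)"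
    using assms(2) by (intro continuous_intros) (simp add: Ck_on_Suc_dd)
  have "compact ((\<lambda>y. \<Sum>b\<in>Basis. \<bar>dd b F y\<bar>) ` cball x r)"
    by (intro compact_continuous_image continuous_on_subset[OF D]) (use r in auto)
  then obtain C where C: "\<And>y. y \<in> cball x r \<Longrightarrow> \<bar>\<Sum>b\<in>Basis. \<bar>dd b F y\<bar>\<bar> \<le> C"
    by (meson compact_imp_bounded bounded_real image_eqI)
  show ?thesis
  proof
    show "0 < r" "ball x r \<subseteq> S" using r by auto
    have "\<bar>\<Sum>b\<in>Basis. \<bar>dd b F x\<bar>\<bar> \<le> C" using C[of x] r by simp
    then show "0 \<le> C" by linarith
    fix y z assume yz: "y \<in> ball x r" "z \<in> ball x r"
    have diff: "F differentiable (at u)" if "u \<in> ball x r" for u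
      using that r by (intro Ck_on_differentiable[OF assms(2)]) auto
    have "norm (F y - F z) \<le> C * norm (y - z)"
    proof (rule differentiable_bound[OF convex_ball _ _ yz])
      fix u assume u: "u \<in> ball x r"
      show "(F has_derivative (\<lambda>h. dd h F u)) (at u within ball x r)"
        using has_derivative_at_withinI has_derivative_dd diff u by blast
      show "onorm (\<lambda>h. dd h F u) \<le> C"
      proof (rule onorm_bound)
        show "0 \<le> C" by fact
        fix h
        have "\<bar>dd h F u\<bar> \<le> (\<Sum>b\<in>Basis. \<bar>dd b F u\<bar>) * norm h" using dd_euclidean_bound diff u by blast
        also have "\<dots> \<le> C * norm h" using C[of u] u by (intro mult_right_mono) auto
        finally show "norm (dd h F u) \<le> C * norm h" by simp
      qed
    qed
    then show "\<bar>F y - F z\<bar> \<le> C * norm (y - z)" by simp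
  qed
qed

text \<open>The weight \<open>w\<close> is kept apart because it is merely continuous: the Abel
  integral below uses \<open>sqrt\<close>, which has no derivative at 0. The set \<open>T\<close> is
  left free so that an open set can be taken, on which the closure lemmas apply.\<close>

lemma has_derivative_integral_param:
  fixes H :: "'a::euclidean_space \<times> real \<Rightarrow> real"
  assumes "open S" "continuous_on {0..1} w" "S \<times> {0..1} \<subseteq> T" "Ck_on 1 H T" "x \<in> S"
  shows "((\<lambda>x. integral {0..1} (\<lambda>t. w t * H (x, t))) has_derivative
    (\<lambda>h. integral {0..1} (\<lambda>t. w t * dd (h, 0) H (x, t)))) (at x)"
proof -
  obtain r where r: "0 < r" "ball x r \<subseteq> S" using assms open_contains_ball by blast
  define U where "U = ball x r"
  have U: "open U" "convex U" "x \<in> U" "U \<subseteq> S" using r by (auto simp: U_def)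
  have UT: "U \<times> {0..1} \<subseteq> T" using U assms(3) by auto
  have diff: "H differentiable (at (y, t))" if "y \<in> U" "t \<in> {0..1}" for y t
    using UT that by (intro Ck_on_differentiable[OF assms(4)]) auto
  \<comment> \<open>The Leibniz rule wants the derivative as a continuous map into the bounded
    linear functions; in finite dimension its continuity can be checked on basis vectors.\<close>
  define D where "D y t = Blinfun (\<lambda>h. w t * dd (h, 0) H (y, t))" for y t
  have blin: "bounded_linear (\<lambda>h. w t * dd (h, 0) H (y, t))" if "y \<in> U" "t \<in> {0..1}" for y t
  proof -
    have "bounded_linear (\<lambda>h. dd (h, 0) H (y, t))"
      using bounded_linear_compose[OF has_derivative_bounded_linear[OF has_derivative_dd[OF diff[OF that]]]
          bounded_linear_Pair[OF bounded_linear_ident bounded_linear_zero]] by (simp add: o_def)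
    then show ?thesis by (rule bounded_linear_const_mult)
  qed
  then have D: "blinfun_apply (D y t) h = w t * dd (h, 0) H (y, t)" if "y \<in> U" "t \<in> {0..1}" for y t h
    using that by (simp add: D_def bounded_linear_Blinfun_apply)
  have contw: "continuous_on (U \<times> {0..1}) (\<lambda>(y, t). w t)"
    unfolding split_beta by (rule continuous_on_compose2[OF assms(2)]) (auto intro: continuous_intros)
  have contD: "continuous_on (U \<times> {0..1}) (\<lambda>(y, t). D y t)"
  proof (rule continuous_on_blinfun_componentwise)
    fix b :: 'a assume "b \<in> Basis"
    have "continuous_on (U \<times> {0..1}) (\<lambda>(y, t). w t * dd (b, 0) H (y, t))"
      using continuous_on_mult[OF contw continuous_on_subset[OF _ UT, of "dd (b, 0) H"]] assms(4)
      by (simp add: Ck_on_Suc_dd split_beta)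
    then show "continuous_on (U \<times> {0..1}) (\<lambda>z. blinfun_apply (case z of (y, t) \<Rightarrow> D y t) b)"
      by (rule continuous_on_cong[THEN iffD1, rotated -1]) (auto simp: D)
  qed
  have contH: "continuous_on (U \<times> {0..1}) (\<lambda>(y, t). w t * H (y, t))"
    using continuous_on_mult[OF contw continuous_on_subset[OF Ck_on_continuous_on[OF assms(4)] UT]]
    by (simp add: split_beta)
  have cont1: "continuous_on {0..1} (\<lambda>t. g y t)"
    if "continuous_on (U \<times> {0..1}) (\<lambda>(y, t). g y t)" "y \<in> U" for y and g :: "'a \<Rightarrow> real \<Rightarrow> 'c::real_normed_vector"
  proof -
    have "continuous_on {0..1} (Pair y)" by (intro continuous_intros)
    from continuous_on_compose2[OF that(1) this] that(2) show ?thesis by auto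
  qed
  have "((\<lambda>x. integral (cbox 0 1) (\<lambda>t. w t * H (x, t))) has_derivative integral (cbox 0 1) (D x)) (at x within U)"
  proof (rule leibniz_rule)
    fix y t assume yt: "y \<in> U" "t \<in> cbox (0::real) 1"
    have "((\<lambda>y. (y, t)) has_derivative (\<lambda>h. (h, 0))) (at y)"
      by (auto intro!: derivative_eq_intros)
    from has_derivative_compose[OF this has_derivative_dd[OF diff]] yt
    have "((\<lambda>y. H (y, t)) has_derivative (\<lambda>h. dd (h, 0) H (y, t))) (at y)" by simp
    then have "((\<lambda>y. w t * H (y, t)) has_derivative (\<lambda>h. w t * dd (h, 0) H (y, t))) (at y)"
      by (rule has_derivative_mult_right)
    moreover have "blinfun_apply (D y t) = (\<lambda>h. w t * dd (h, 0) H (y, t))"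
      using D yt by auto
    ultimately show "((\<lambda>y. w t * H (y, t)) has_derivative blinfun_apply (D y t)) (at y within U)"
      by (simp add: has_derivative_at_withinI)
  next
    show "(\<lambda>t. w t * H (y, t)) integrable_on cbox 0 1" if "y \<in> U" for y
      using cont1[OF contH that] by (simp add: integrable_continuous_real)
  qed (use contD U in auto)
  moreover have "blinfun_apply (integral (cbox 0 1) (D x)) h = integral {0..1} (\<lambda>t. w t * dd (h, 0) H (x, t))" for h
  proof -
    have "D x integrable_on cbox 0 1"
      using cont1[OF contD \<open>x \<in> U\<close>] by (simp add: integrable_continuous_real)
    then have "blinfun_apply (integral (cbox 0 1) (D x)) h = integral (cbox 0 1) (\<lambda>t. blinfun_apply (D x t) h)"
      by (rule blinfun_apply_integral)
    also have "\<dots> = integral {0..1} (\<lambda>t. w t * dd (h, 0) H (x, t))"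
      using D[OF \<open>x \<in> U\<close>] by (auto intro!: integral_cong)
    finally show ?thesis .
  qed
  then have "blinfun_apply (integral (cbox 0 1) (D x)) = (\<lambda>h. integral {0..1} (\<lambda>t. w t * dd (h, 0) H (x, t)))"
    by blast
  ultimately show ?thesis
    using at_within_open[OF \<open>x \<in> U\<close> \<open>open U\<close>] by simp
qed

lemma Ck_on_integral_param:
  fixes H :: "'a::euclidean_space \<times> real \<Rightarrow> real"
  assumes "open S" "continuous_on {0..1} w" "S \<times> {0..1} \<subseteq> T" "Ck_on k H T"
  shows "Ck_on k (\<lambda>x. integral {0..1} (\<lambda>t. w t * H (x, t))) S"
  using assms(4)
proof (induction k arbitrary: H)
  case 0
  have "continuous_on (S \<times> {0..1}) (\<lambda>(y, t). w t)"
    unfolding split_beta by (rule continuous_on_compose2[OF assms(2)]) (auto intro: continuous_intros)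
  moreover have "continuous_on (S \<times> {0..1}) H"
    using 0 assms(3) continuous_on_subset by auto
  ultimately have "continuous_on (S \<times> cbox 0 1) (\<lambda>(y, t). w t * H (y, t))"
    using continuous_on_mult by (fastforce simp: split_beta)
  from integral_continuous_on_param[OF this] show ?case by simp
next
  case (Suc k)
  have "Ck_on 1 H T" using Ck_on_mono[OF Suc.prems, of 1] by simp
  from has_derivative_integral_param[OF assms(1-3) this] Suc.IH[OF Ck_on_dd[OF Suc.prems]]
  show ?case by (rule Ck_on_SucI[OF assms(1)])
qed

lemma open_Times_interval: "open \<Theta> \<Longrightarrow> open ({a<..<b::real} \<times> \<Theta>)"
  by (simp add: open_Times)

text \<open>Integrating the derivative of t \<mapsto> \<phi> (t y, q) over the unit interval, the
  chain rule releases the factor y, and the remaining parameter integral is smooth in (y, q)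
  jointly, also at y = 0.\<close>

lemma smooth_on_hadamard:
  fixes \<phi> :: "real \<times> 'q::euclidean_space \<Rightarrow> real"
  assumes "open \<Theta>" "smooth_on \<phi> ({-\<delta><..<\<delta>} \<times> \<Theta>)"
  obtains \<psi> where "smooth_on \<psi> ({-\<delta><..<\<delta>} \<times> \<Theta>)"
    "\<And>y q. y \<in> {-\<delta><..<\<delta>} \<Longrightarrow> q \<in> \<Theta> \<Longrightarrow> \<phi> (y, q) = \<phi> (0, q) + y * \<psi> (y, q)"
proof -
  let ?S = "{-\<delta><..<\<delta>} \<times> \<Theta>"
  define L where "L = (\<lambda>z::(real \<times> 'q) \<times> real. (snd z * fst (fst z), snd (fst z)))"
  define \<psi> where "\<psi> p = integral {0..1} (\<lambda>t. 1 * dd (1, 0) \<phi> (L (p, t)))" for p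
  have op: "open ?S" using assms(1) by (rule open_Times_interval)
  have L: "Ck_on k L UNIV" for k
    unfolding L_def
    by (intro Ck_on_Pair Ck_on_mult Ck_on_linear_comp[OF _ bounded_linear_fst] Ck_on_linear_comp[OF _ bounded_linear_snd]
        Ck_on_id open_UNIV)
  have opL: "open (L -` ?S)"
    by (rule open_vimage[OF op]) (use Ck_on_continuous_on[OF L] in auto)
  have LS: "t * y \<in> {-\<delta><..<\<delta>}" if "y \<in> {-\<delta><..<\<delta>}" "t \<in> {0..1}" for t y
  proof -
    have "\<bar>t * y\<bar> \<le> 1 * \<bar>y\<bar>" unfolding abs_mult using that by (intro mult_right_mono) auto
    then show ?thesis using that by auto
  qed
  then have sub: "?S \<times> {0..1} \<subseteq> L -` ?S" by (auto simp: L_def)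
  show ?thesis
  proof
    show "smooth_on \<psi> ?S"
      unfolding \<psi>_def
    proof (rule smooth_onI, rule Ck_on_integral_param[OF op _ sub])
      show "Ck_on k (\<lambda>z. dd (1, 0) \<phi> (L z)) (L -` ?S)" for k
        by (rule Ck_on_compose[OF opL op smooth_onD[OF smooth_on_dd[OF assms(2)]] Ck_on_subset[OF L]]) auto
    qed auto
    fix y q assume yq: "y \<in> {-\<delta><..<\<delta>}" "q \<in> \<Theta>"
    have "((\<lambda>t. y * dd (1, 0) \<phi> (t * y, q)) has_integral \<phi> (1 * y, q) - \<phi> (0 * y, q)) {0..1}"
    proof (rule fundamental_theorem_of_calculus)
      fix t :: real assume t: "t \<in> {0..1}"
      have "((\<lambda>v. \<phi> (v, q)) has_real_derivative dd (1, 0) \<phi> (t * y, q)) (at (t * y))"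
        using LS[OF yq(1) t] yq(2) by (intro dd_fst_real_derivative smooth_on_differentiable[OF assms(2)]) auto
      then have "((\<lambda>t. \<phi> (t * y, q)) has_real_derivative dd (1, 0) \<phi> (t * y, q) * y) (at t)"
        by (rule DERIV_chain2) (auto intro!: derivative_eq_intros)
      then show "((\<lambda>t. \<phi> (t * y, q)) has_vector_derivative y * dd (1, 0) \<phi> (t * y, q)) (at t within {0..1})"
        by (simp add: has_real_derivative_iff_has_vector_derivative mult.commute has_vector_derivative_at_within)
    qed auto
    from integral_unique[OF this]
    show "\<phi> (y, q) = \<phi> (0, q) + y * \<psi> (y, q)"
      by (simp add: \<psi>_def L_def)
  qed
qed

text \<open>Hadamard division iterated: the next coefficient is the current remainder at y = 0, so
  coefficients and remainder stay smooth in the parameters.\<close>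

lemma smooth_on_taylor:
  fixes \<phi> :: "real \<times> 'q::euclidean_space \<Rightarrow> real"
  assumes "open \<Theta>" "0 < \<delta>" "smooth_on \<phi> ({-\<delta><..<\<delta>} \<times> \<Theta>)"
  shows "\<exists>a \<psi>. (\<forall>i. smooth_on (a i) \<Theta>) \<and> smooth_on \<psi> ({-\<delta><..<\<delta>} \<times> \<Theta>) \<and>
    (\<forall>y\<in>{-\<delta><..<\<delta>}. \<forall>q\<in>\<Theta>. \<phi> (y, q) = (\<Sum>i<n. a i q * y ^ i) + y ^ n * \<psi> (y, q))"
proof (induction n)
  case 0
  show ?case
    by (rule exI[of _ "\<lambda>i q. 0"], rule exI[of _ \<phi>]) (auto simp: assms smooth_on_const)
next
  case (Suc n)
  then obtain a \<psi> where a: "\<And>i. smooth_on (a i) \<Theta>" and \<psi>: "smooth_on \<psi> ({-\<delta><..<\<delta>} \<times> \<Theta>)"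
    and eq: "\<And>y q. y \<in> {-\<delta><..<\<delta>} \<Longrightarrow> q \<in> \<Theta> \<Longrightarrow> \<phi> (y, q) = (\<Sum>i<n. a i q * y ^ i) + y ^ n * \<psi> (y, q)"
    by blast
  obtain g where g: "smooth_on g ({-\<delta><..<\<delta>} \<times> \<Theta>)"
    "\<And>y q. y \<in> {-\<delta><..<\<delta>} \<Longrightarrow> q \<in> \<Theta> \<Longrightarrow> \<psi> (y, q) = \<psi> (0, q) + y * g (y, q)"
    using smooth_on_hadamard[OF assms(1) \<psi>] by blast
  have "smooth_on (\<lambda>q. \<psi> (0, q)) \<Theta>"
    by (rule smooth_on_compose[OF assms(1) open_Times_interval[OF assms(1)] \<psi>])
      (auto intro!: smooth_on_Pair smooth_on_const smooth_on_id simp: assms)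
  with a have "smooth_on ((a(n := \<lambda>q. \<psi> (0, q))) i) \<Theta>" for i by simp
  moreover have "\<phi> (y, q) = (\<Sum>i<Suc n. (a(n := \<lambda>q. \<psi> (0, q))) i q * y ^ i) + y ^ Suc n * g (y, q)"
    if "y \<in> {-\<delta><..<\<delta>}" "q \<in> \<Theta>" for y q
    using eq[OF that] g(2)[OF that] by (simp add: algebra_simps)
  ultimately show ?case using g(1) by blast
qed

text \<open>The function u^(j/2) \<psi> (sqrt u, q), continued to u < 0 by freezing u at 0; for
  positive j this is continuation by zero. The continuation makes classes on open sets around u = 0
  meaningful.\<close>

definition half_power :: "nat \<Rightarrow> (real \<times> 'q \<Rightarrow> real) \<Rightarrow> real \<times> 'q \<Rightarrow> real" where
  "half_power j \<psi> = (\<lambda>(u, q). sqrt (max u 0) ^ j * \<psi> (sqrt (max u 0), q))"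

lemma continuous_on_half_power:
  fixes \<psi> :: "real \<times> 'q::euclidean_space \<Rightarrow> real"
  assumes "0 < \<delta>" "continuous_on ({-\<delta><..<\<delta>} \<times> \<Theta>) \<psi>"
  shows "continuous_on ({..<\<delta>\<^sup>2} \<times> \<Theta>) (half_power j \<psi>)"
  unfolding half_power_def split_beta
proof (intro continuous_intros continuous_on_compose2[OF assms(2)])
  show "(\<lambda>x. (sqrt (max (fst x) 0), snd x)) ` ({..<\<delta>\<^sup>2} \<times> \<Theta>) \<subseteq> {-\<delta><..<\<delta>} \<times> \<Theta>"
  proof (clarsimp, intro conjI)
    fix u :: real assume "u < \<delta>\<^sup>2"
    then show "sqrt (max u 0) < \<delta>" using assms(1) by (intro real_less_lsqrt) auto
    have "0 \<le> sqrt (max u 0)" by simp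
    then show "- \<delta> < sqrt (max u 0)" using assms(1) by linarith
  qed
qed

text \<open>The u-derivative has the same shape with \<open>j - 2\<close> and the new smooth factor
  (j \<psi> + y \<psi>_y) / 2, and parameter derivatives keep \<open>j\<close>. This closure is what
  the induction in \<open>Ck_on_half_power\<close> needs.\<close>

lemma has_derivative_half_power:
  fixes \<psi> :: "real \<times> 'q::euclidean_space \<Rightarrow> real"
  assumes "0 < \<delta>" "open \<Theta>" "smooth_on \<psi> ({-\<delta><..<\<delta>} \<times> \<Theta>)" "x \<in> {..<\<delta>\<^sup>2} \<times> \<Theta>" "3 \<le> j"
  shows "(half_power j \<psi> has_derivative (\<lambda>h. fst h *
      half_power (j - 2) (\<lambda>p. (real j * \<psi> p + fst p * dd (1, 0) \<psi> p) / 2) x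
      + half_power j (dd (0, snd h) \<psi>) x)) (at x)"
proof (cases "fst x > 0")
  case True
  define s where "s = sqrt (fst x)"
  have s: "0 < s" "s < \<delta>" "s\<^sup>2 = fst x" "snd x \<in> \<Theta>"
    using True assms by (auto simp: s_def intro!: real_less_lsqrt)
  have "((\<lambda>z. (sqrt (fst z), snd z)) has_derivative (\<lambda>h. (fst h * (inverse s / 2), snd h))) (at x)"
    unfolding s_def using True by (auto intro!: derivative_eq_intros)
  moreover have "(\<psi> has_derivative (\<lambda>h. dd h \<psi> (s, snd x))) (at (sqrt (fst x), snd x))"
    unfolding s_def[symmetric] using s by (intro smooth_on_has_derivative[OF assms(3)]) auto
  ultimately have "((\<lambda>z. \<psi> (sqrt (fst z), snd z)) has_derivative
      (\<lambda>h. dd (fst h * (inverse s / 2), snd h) \<psi> (s, snd x))) (at x)"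
    by (rule has_derivative_compose)
  moreover have "dd (fst h * (inverse s / 2), snd h) \<psi> (s, snd x) =
      fst h * (inverse s / 2) * dd (1, 0) \<psi> (s, snd x) + dd (0, snd h) \<psi> (s, snd x)" for h
  proof -
    have lin: "linear (\<lambda>h. dd h \<psi> (s, snd x))"
      using s by (intro linear_dd smooth_on_differentiable[OF assms(3)]) auto
    show ?thesis
      using linear_add[OF lin, of "(fst h * (inverse s / 2)) *\<^sub>R (1, 0)" "(0, snd h)"]
        linear_scale[OF lin, of "fst h * (inverse s / 2)" "(1, 0)"] by simp
  qed
  ultimately have \<psi>: "((\<lambda>z. \<psi> (sqrt (fst z), snd z)) has_derivative
      (\<lambda>h. fst h * (inverse s / 2) * dd (1, 0) \<psi> (s, snd x) + dd (0, snd h) \<psi> (s, snd x))) (at x)"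
    by simp
  have pw: "((\<lambda>z. sqrt (fst z) ^ j) has_derivative (\<lambda>h. real j * (fst h * (inverse s / 2)) * s ^ (j - 1))) (at x)"
    unfolding s_def using True by (auto intro!: derivative_eq_intros)
  obtain i where j: "j = Suc (Suc (Suc i))"
    using assms(5) by (metis numeral_3_eq_3 le_Suc_ex add_Suc)
  have sj: "s ^ (j - Suc 0) = s * s ^ (j - 2)" "s ^ j = s * (s * s ^ (j - 2))"
    by (simp_all add: j)
  have "((\<lambda>z. sqrt (fst z) ^ j * \<psi> (sqrt (fst z), snd z)) has_derivative (\<lambda>h. fst h *
      (s ^ (j - 2) * ((real j * \<psi> (s, snd x) + s * dd (1, 0) \<psi> (s, snd x)) / 2))
      + s ^ j * dd (0, snd h) \<psi> (s, snd x))) (at x)"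
    by (rule has_derivative_eq_rhs[OF has_derivative_mult[OF pw \<psi>]])
      (use s in \<open>auto simp: fun_eq_iff sj field_simps simp flip: s_def\<close>)
  moreover have "open {z::real\<times>'q. 0 < fst z}"
    by (intro open_Collect_less continuous_intros)
  ultimately have "(half_power j \<psi> has_derivative (\<lambda>h. fst h *
      (s ^ (j - 2) * ((real j * \<psi> (s, snd x) + s * dd (1, 0) \<psi> (s, snd x)) / 2))
      + s ^ j * dd (0, snd h) \<psi> (s, snd x))) (at x)"
    by (rule has_derivative_transform_within_open) (use True in \<open>auto simp: half_power_def split_beta\<close>)
  then show ?thesis
    using True by (simp add: half_power_def split_beta s_def)
next
  case False
  have x0: "max (fst x) 0 = 0" using False by simp
  have z: "half_power i g x = 0" if "0 < i" for i and g :: "real \<times> 'q \<Rightarrow> real"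
    using that x0 by (simp add: half_power_def split_beta)
  \<comment> \<open>As \<open>j\<close> is at least 3, one factor \<open>max u 0\<close>, bounded by
    the increment, splits off, and the other factor \<open>K\<close> still tends to 0. So the
    difference quotient vanishes at every point with u <= 0.\<close>
  define K where "K z = sqrt (max (fst z) 0) * half_power (j - 3) \<psi> z" for z
  have "isCont (half_power (j - 3) \<psi>) x"
    using continuous_on_half_power[OF assms(1) smooth_on_continuous_on[OF assms(3)], of "j - 3"] assms(2,4)
    by (metis continuous_on_eq_continuous_at open_Times open_lessThan)
  then have "isCont K x" unfolding K_def by (intro continuous_intros)
  then have K: "(\<lambda>h. K (x + h)) \<midarrow>0\<rightarrow> 0" using x0 by (simp add: isCont_iff K_def)
  have F: "half_power j \<psi> z = max (fst z) 0 * K z" for z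
  proof -
    have "sqrt (max (fst z) 0) ^ j = max (fst z) 0 * (sqrt (max (fst z) 0) * sqrt (max (fst z) 0) ^ (j - 3))"
    proof -
      obtain i where j: "j = Suc (Suc (Suc i))"
        using assms(5) by (metis numeral_3_eq_3 le_Suc_ex add_Suc)
      have "sqrt (max (fst z) 0) * (sqrt (max (fst z) 0) * c) = max (fst z) 0 * c" for c
        by (simp flip: mult.assoc)
      then show ?thesis by (simp add: j)
    qed
    then show ?thesis by (simp add: half_power_def split_beta K_def)
  qed
  have "(half_power j \<psi> has_derivative (\<lambda>h. 0)) (at x)"
    unfolding has_derivative_at
  proof
    show "(\<lambda>h. norm (half_power j \<psi> (x + h) - half_power j \<psi> x - 0) / norm h) \<midarrow>0\<rightarrow> 0"
    proof (rule tendsto_0_le[OF K, of _ 1], rule always_eventually, rule allI)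
      fix h :: "real \<times> 'q"
      have "max (fst (x + h)) 0 \<le> norm h"
        using False norm_fst_le[of "fst h" "snd h"] by (auto simp: max_def)
      then have "\<bar>half_power j \<psi> (x + h)\<bar> \<le> norm h * \<bar>K (x + h)\<bar>"
        unfolding F abs_mult by (intro mult_right_mono) auto
      then show "norm (norm (half_power j \<psi> (x + h) - half_power j \<psi> x - 0) / norm h) \<le> norm (K (x + h)) * 1"
        using z[of j] assms(5) by (cases "h = 0") (auto simp: field_simps)
    qed
  qed (rule bounded_linear_zero)
  then show ?thesis using z[of j] z[of "j - 2"] assms(5) by simp
qed

text \<open>Each u-derivative costs two units of \<open>j\<close>; exponent 2k + 1 guarantees that
  even the last of k differentiations starts from exponent at least 3.\<close>

lemma Ck_on_half_power:
  fixes \<psi> :: "real \<times> 'q::euclidean_space \<Rightarrow> real"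
  assumes "0 < \<delta>" "open \<Theta>" "smooth_on \<psi> ({-\<delta><..<\<delta>} \<times> \<Theta>)" "2 * k + 1 \<le> j"
  shows "Ck_on k (half_power j \<psi>) ({..<\<delta>\<^sup>2} \<times> \<Theta>)"
  using assms(3,4)
proof (induction k arbitrary: j \<psi>)
  case 0
  then show ?case using continuous_on_half_power[OF assms(1) smooth_on_continuous_on] by simp
next
  case (Suc k)
  have op: "open ({..<\<delta>\<^sup>2} \<times> \<Theta>)" "open ({-\<delta><..<\<delta>} \<times> \<Theta>)" using assms(2) by (auto intro: open_Times)
  note \<psi> = Suc.prems(1)
  have "smooth_on (\<lambda>p. (real j * \<psi> p + fst p * dd (1, 0) \<psi> p) / 2) ({-\<delta><..<\<delta>} \<times> \<Theta>)"
    by (intro smooth_on_divide smooth_on_add smooth_on_mult smooth_on_const smooth_on_fst smooth_on_dd \<psi> op) auto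
  then have "Ck_on k (half_power (j - 2) (\<lambda>p. (real j * \<psi> p + fst p * dd (1, 0) \<psi> p) / 2)) ({..<\<delta>\<^sup>2} \<times> \<Theta>)"
    by (rule Suc.IH) (use Suc.prems in auto)
  moreover have "Ck_on k (half_power j (dd (0, h) \<psi>)) ({..<\<delta>\<^sup>2} \<times> \<Theta>)" for h
    by (rule Suc.IH[OF smooth_on_dd[OF \<psi>]]) (use Suc.prems in auto)
  ultimately show ?case
    using Suc.prems
    by (intro Ck_on_SucI[OF op(1) has_derivative_half_power[OF assms(1,2) \<psi>]] Ck_on_add[OF op(1)]
        Ck_on_mult[OF op(1)] Ck_on_const) auto
qed

section \<open>Implicit functions and Abel integrals\<close>

text \<open>The inverse function theorem applied to (v, q) \<mapsto> (\<Psi> (v, q), q), whose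
  derivative is triangular and invertible exactly when the v-derivative is nonzero. The parameter is
  unchanged, so the inverse has the form (X, q).\<close>

lemma implicit_function:
  fixes \<Psi> :: "real \<times> 'q::euclidean_space \<Rightarrow> real"
  assumes "open S" "smooth_on \<Psi> S" "x0 \<in> S" "dd (1, 0) \<Psi> x0 \<noteq> 0"
  obtains U V X where "open U" "U \<subseteq> S" "x0 \<in> U" "open V" "(\<Psi> x0, snd x0) \<in> V" "smooth_on X V"
    "\<And>y q. (y, q) \<in> V \<Longrightarrow> (X (y, q), q) \<in> U \<and> \<Psi> (X (y, q), q) = y"
    "\<And>v q. (v, q) \<in> U \<Longrightarrow> (\<Psi> (v, q), q) \<in> V \<and> X (\<Psi> (v, q), q) = v"
proof -
  define D where "D x = Blinfun (\<lambda>h::real\<times>'q. (dd h \<Psi> x, snd h))" for x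
  define E where "E = Blinfun (\<lambda>h::real\<times>'q. ((fst h - dd (0, snd h) \<Psi> x0) / dd (1, 0) \<Psi> x0, snd h))"
  have lin: "linear (\<lambda>h. dd h \<Psi> x)" and bl: "bounded_linear (\<lambda>h. dd h \<Psi> x)" if "x \<in> S" for x
    using that assms(2) has_derivative_bounded_linear smooth_on_has_derivative linear_dd smooth_on_differentiable
    by blast+
  have split: "dd h \<Psi> x = fst h * dd (1, 0) \<Psi> x + dd (0, snd h) \<Psi> x" if "x \<in> S" for x h
    using linear_add[OF lin[OF that], of "fst h *\<^sub>R (1, 0)" "(0, snd h)"]
      linear_scale[OF lin[OF that], of "fst h" "(1, 0)"] by simp
  have D: "blinfun_apply (D x) = (\<lambda>h. (dd h \<Psi> x, snd h))" if "x \<in> S" for x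
    unfolding D_def using bl[OF that] by (intro bounded_linear_Blinfun_apply bounded_linear_Pair bounded_linear_snd)
  have bl0: "bounded_linear (\<lambda>h. dd (0, snd h) \<Psi> x0)"
    using bounded_linear_compose[OF bl[OF assms(3)] bounded_linear_Pair[OF bounded_linear_zero bounded_linear_snd]]
    by (simp add: o_def)
  have E: "blinfun_apply E = (\<lambda>h. ((fst h - dd (0, snd h) \<Psi> x0) / dd (1, 0) \<Psi> x0, snd h))"
    unfolding E_def divide_inverse
    by (intro bounded_linear_Blinfun_apply bounded_linear_Pair bounded_linear_snd bounded_linear_mult_const
        bounded_linear_sub bounded_linear_fst bl0)
  have inv: "E o\<^sub>L D x0 = id_blinfun"
  proof (rule blinfun_eqI)
    fix h
    show "blinfun_apply (E o\<^sub>L D x0) h = blinfun_apply id_blinfun h"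
      using split[OF assms(3), of h] assms(4) by (simp add: E D[OF assms(3)] prod_eq_iff)
  qed
  have der: "((\<lambda>x. (\<Psi> x, snd x)) has_derivative blinfun_apply (D x)) (at x)" if "x \<in> S" for x
    unfolding D[OF that] by (intro has_derivative_Pair smooth_on_has_derivative[OF assms(2) that]
        bounded_linear_imp_has_derivative bounded_linear_snd)
  have contD: "continuous_on S D"
  proof (rule continuous_on_blinfun_componentwise)
    fix b :: "real \<times> 'q"
    have "continuous_on S (\<lambda>x. (dd b \<Psi> x, snd b))"
      by (intro continuous_on_Pair continuous_on_const smooth_on_continuous_on smooth_on_dd assms(2))
    then show "continuous_on S (\<lambda>x. blinfun_apply (D x) b)"
      by (subst continuous_on_cong[OF refl]) (auto simp: D)
  qed
  obtain U V g g' where UV: "open U" "U \<subseteq> S" "x0 \<in> U" "open V" "(\<Psi> x0, snd x0) \<in> V"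
    and hom: "homeomorphism U V (\<lambda>x. (\<Psi> x, snd x)) g"
    and g: "\<And>y. y \<in> V \<Longrightarrow> (g has_derivative (g' y)) (at y)"
      "\<And>y. y \<in> V \<Longrightarrow> g' y = inv (blinfun_apply (D (g y)))"
      "\<And>y. y \<in> V \<Longrightarrow> bij (blinfun_apply (D (g y)))"
    by (rule inverse_function_theorem[OF assms(1) der contD assms(3) inv], assumption, rule that)
  have gU: "g y \<in> U" "g y \<in> S" "(\<Psi> (g y), snd (g y)) = y" if "y \<in> V" for y
  proof -
    show "g y \<in> U" using hom that by (force simp: homeomorphism_def)
    with UV(2) show "g y \<in> S" by blast
    show "(\<Psi> (g y), snd (g y)) = y" using hom that by (simp add: homeomorphism_def)
  qed
  define X where "X y = fst (g y)" for y
  have gX: "g y = (X y, snd y)" if "y \<in> V" for y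
    using gU(3)[OF that] by (cases y; cases "g y") (auto simp: X_def)
  \<comment> \<open>Nonvanishing is assumed at \<open>x0\<close> only; elsewhere it follows from
    bijectivity of the derivative, since otherwise (1, 0) would lie in its kernel.\<close>
  have nz: "dd (1, 0) \<Psi> (g y) \<noteq> 0" if "y \<in> V" for y
  proof
    assume "dd (1, 0) \<Psi> (g y) = 0"
    then have "blinfun_apply (D (g y)) (1, 0) = blinfun_apply (D (g y)) (0, 0)"
      using linear_0[OF lin[OF gU(2)[OF that]]] by (simp add: D[OF gU(2)[OF that]] zero_prod_def)
    then show False using g(3)[OF that] by (simp add: bij_def inj_eq)
  qed
  have X': "(X has_derivative (\<lambda>h. (fst h - dd (0, snd h) \<Psi> (g y)) / dd (1, 0) \<Psi> (g y))) (at y)" if "y \<in> V" for y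
  proof -
    have "g' y h = ((fst h - dd (0, snd h) \<Psi> (g y)) / dd (1, 0) \<Psi> (g y), snd h)" for h
    proof -
      let ?k = "((fst h - dd (0, snd h) \<Psi> (g y)) / dd (1, 0) \<Psi> (g y), snd h)"
      have "blinfun_apply (D (g y)) ?k = h"
        using split[OF gU(2)[OF that], of ?k] nz[OF that] by (simp add: D[OF gU(2)[OF that]])
      then show ?thesis
        using g(2,3)[OF that] by (metis bij_def inv_f_f)
    qed
    then show ?thesis
      unfolding X_def using has_derivative_fst[OF g(1)[OF that]] by simp
  qed
  show ?thesis
  proof
    show "smooth_on X V"
    proof (rule smooth_onI)
      fix k
      \<comment> \<open>Bootstrap: the derivative of \<open>X\<close> is a rational expression in
        derivatives of \<Psi> composed with \<open>g\<close>, so if \<open>g\<close> has class k,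
        then \<open>X\<close> has class k + 1.\<close>
      show "Ck_on k X V"
      proof (induction k)
        case 0
        have "continuous_on V g" using hom by (simp add: homeomorphism_def)
        then show ?case by (simp add: X_def[abs_def] continuous_on_fst)
      next
        case (Suc k)
        have "Ck_on k (\<lambda>y. (X y, snd y)) V" by (intro Ck_on_Pair UV Suc Ck_on_snd)
        then have gk: "Ck_on k g V" by (rule Ck_on_cong[OF UV(4), rotated]) (rule gX)
        have *: "Ck_on k (\<lambda>y. dd h \<Psi> (g y)) V" for h
          by (rule Ck_on_compose[OF UV(4) assms(1) smooth_onD[OF smooth_on_dd[OF assms(2)]] gk gU(2)])
        show ?case
          by (rule Ck_on_SucI[OF UV(4) X']) (auto intro!: Ck_on_divide Ck_on_diff Ck_on_const UV * nz)
      qed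
    qed
    show "(X (y, q), q) \<in> U \<and> \<Psi> (X (y, q), q) = y" if "(y, q) \<in> V" for y q
      using gU[OF that] gX[OF that] by auto
    show "(\<Psi> (v, q), q) \<in> V \<and> X (\<Psi> (v, q), q) = v" if "(v, q) \<in> U" for v q
      using hom that by (force simp: homeomorphism_def X_def)
  qed (use UV in auto)
qed

text \<open>The substitution u = m + (u0 - m) r fixes the limits and turns sqrt (u - m) into sqrt
  (u0 - m) sqrt r. The factor (u0 - m)^(3/2) is smooth because m < u0, and the singular weight sqrt
  r no longer depends on m. The bound \<open>u1\<close> beyond \<open>u0\<close> gives room for
  differentiability at the upper end.\<close>

lemma abel_integral_param:
  fixes K :: "real \<times> 'q::euclidean_space \<Rightarrow> real"
  assumes "open \<Theta>" "u0 < u1" "Ck_on k K ({a<..<u1} \<times> \<Theta>)"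
  obtains J where "Ck_on k J ({a<..<u0} \<times> \<Theta>)"
    "\<And>m q. m \<in> {a<..<u0} \<Longrightarrow> q \<in> \<Theta> \<Longrightarrow> integral {m..u0} (\<lambda>u. K (u, q) * sqrt (u - m)) = J (m, q)"
proof -
  let ?S = "{a<..<u0} \<times> \<Theta>" and ?T = "{a<..<u1} \<times> \<Theta>"
  define L where "L = (\<lambda>z::(real \<times> 'q) \<times> real. (fst (fst z) + (u0 - fst (fst z)) * snd z, snd (fst z)))"
  define J where "J p = (u0 - fst p) * sqrt (u0 - fst p) * integral {0..1} (\<lambda>r. sqrt r * K (L (p, r)))" for p
  have op: "open ?S" "open ?T" using assms(1) by (auto intro: open_Times_interval)
  have L: "Ck_on k L UNIV" for k
    unfolding L_def
    by (intro Ck_on_Pair Ck_on_add Ck_on_diff Ck_on_mult Ck_on_const Ck_on_linear_comp[OF _ bounded_linear_fst]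
        Ck_on_linear_comp[OF _ bounded_linear_snd] Ck_on_id open_UNIV)
  have opL: "open (L -` ?T)"
    by (rule open_vimage[OF op(2)]) (use Ck_on_continuous_on[OF L] in auto)
  have seg: "m + (u0 - m) * r \<in> {m..u0}" if "m \<in> {a<..<u0}" "r \<in> {0..1}" for m r
  proof -
    have "(u0 - m) * r \<le> (u0 - m) * 1" using that by (intro mult_left_mono) auto
    moreover have "0 \<le> (u0 - m) * r" using that by simp
    ultimately show ?thesis by auto
  qed
  have sub: "?S \<times> {0..1} \<subseteq> L -` ?T"
  proof -
    have "m + (u0 - m) * r \<in> {a<..<u1}" if "m \<in> {a<..<u0}" "r \<in> {0..1}" for m r
      using seg[OF that] that assms(2) unfolding atLeastAtMost_iff greaterThanLessThan_iff by linarith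
    then show ?thesis by (auto simp: L_def)
  qed
  show ?thesis
  proof
    show "Ck_on k J ?S"
      unfolding J_def
    proof (rule Ck_on_mult[OF op(1) _ Ck_on_integral_param[OF op(1) _ sub]])
      show "Ck_on k (\<lambda>p. (u0 - fst p) * sqrt (u0 - fst p)) ?S"
        by (intro Ck_on_mult Ck_on_sqrt Ck_on_diff Ck_on_const Ck_on_fst op) auto
      show "continuous_on {0..1} sqrt" by (intro continuous_intros)
      show "Ck_on k (\<lambda>z. K (L z)) (L -` ?T)"
        by (rule Ck_on_compose[OF opL op(2) assms(3) Ck_on_subset[OF L]]) auto
    qed
    fix m q assume mq: "m \<in> {a<..<u0}" "q \<in> \<Theta>"
    define g where "g r = m + (u0 - m) * r" for r
    have "((\<lambda>r. (u0 - m) *\<^sub>R (K (g r, q) * sqrt (g r - m))) has_integral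
      integral {g 0..g 1} (\<lambda>u. K (u, q) * sqrt (u - m))) {0..1}"
    proof (rule has_integral_substitution[where c = m and d = u0])
      have "continuous_on {m..u0} (\<lambda>u. K (u, q))"
        by (rule continuous_on_compose2[OF Ck_on_continuous_on[OF assms(3)]])
          (use mq assms(2) in \<open>auto intro: continuous_intros\<close>)
      then show "continuous_on {m..u0} (\<lambda>u. K (u, q) * sqrt (u - m))" by (intro continuous_intros)
      show "g ` {0..1} \<subseteq> {m..u0}" unfolding g_def using seg[OF mq(1)] by blast
    qed (use mq in \<open>auto simp: g_def intro!: derivative_eq_intros\<close>)
    then have "integral {m..u0} (\<lambda>u. K (u, q) * sqrt (u - m)) =
        integral {0..1} (\<lambda>r. (u0 - m) * (K (g r, q) * sqrt (g r - m)))"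
      by (simp add: g_def has_integral_iff)
    also have "\<dots> = integral {0..1} (\<lambda>r. ((u0 - m) * sqrt (u0 - m)) * (sqrt r * K (L ((m, q), r))))"
      by (intro integral_cong) (simp add: g_def L_def real_sqrt_mult)
    also have "\<dots> = J (m, q)" by (simp add: J_def)
    finally show "integral {m..u0} (\<lambda>u. K (u, q) * sqrt (u - m)) = J (m, q)" .
  qed
qed

text \<open>The coefficient of m^(k/2+1) ln m in the integral of y^k sqrt (y^2 - m) from sqrt m
  upwards. It vanishes for odd k; the quotient (k + 1) / (k + 4) comes from the reduction formula
  below.\<close>

fun log_coeff :: "nat \<Rightarrow> real" where
  "log_coeff 0 = 1 / 4"
| "log_coeff (Suc 0) = 0"
| "log_coeff (Suc (Suc k)) = (real k + 1) / (real k + 4) * log_coeff k"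

lemma less_square_of_sqrt_less: "0 \<le> m \<Longrightarrow> sqrt m < y \<Longrightarrow> m < y\<^sup>2"
  by (metis real_sqrt_ge_zero real_sqrt_pow2 power_strict_mono zero_less_numeral)

text \<open>Elementary antiderivatives settle k = 0 and k = 1, and integration by parts steps from k
  to k + 2. \<open>E\<close> is smooth for negative m too, although the integral is considered for m
  >= 0 only.\<close>

lemma power_sqrt_integral:
  fixes y0 :: real
  assumes "0 < y0"
  shows "\<exists>E. smooth_on E {..<y0\<^sup>2} \<and> (\<forall>m\<in>{0..<y0\<^sup>2}.
    ((\<lambda>y. y ^ k * sqrt (y\<^sup>2 - m)) has_integral log_coeff k * m ^ (k div 2 + 1) * ln m + E m) {sqrt m..y0})"
proof (induction k rule: log_coeff.induct)
  case 1
  define E where "E m = (y0 * sqrt (y0\<^sup>2 - m) - m * ln (y0 + sqrt (y0\<^sup>2 - m))) / 2" for m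
  have "smooth_on E {..<y0\<^sup>2}"
    unfolding E_def
    by (intro smooth_on_divide smooth_on_diff smooth_on_mult smooth_on_ln smooth_on_add smooth_on_sqrt
        smooth_on_const smooth_on_id open_lessThan) (use assms in \<open>auto intro: add_pos_pos\<close>)
  moreover have "((\<lambda>y. y ^ 0 * sqrt (y\<^sup>2 - m)) has_integral log_coeff 0 * m ^ (0 div 2 + 1) * ln m + E m) {sqrt m..y0}"
    if m: "m \<in> {0..<y0\<^sup>2}" for m
  proof -
    \<comment> \<open>Standard antiderivative. Its value -(m ln m) / 4 at y = sqrt m is the only
      source of a logarithm of m, inherited by all even k through the recursion.\<close>
    define F where "F y = (y * sqrt (y\<^sup>2 - m) - m * ln (y + sqrt (y\<^sup>2 - m))) / 2" for y
    have le: "sqrt m \<le> y0" using m assms by (intro real_le_lsqrt) auto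
    have "((\<lambda>y. sqrt (y\<^sup>2 - m)) has_integral F y0 - F (sqrt m)) {sqrt m..y0}"
    proof (rule fundamental_theorem_of_calculus_interior[OF le])
      show "continuous_on {sqrt m..y0} F"
      proof (cases "m = 0")
        case True
        then show ?thesis unfolding F_def by (auto intro!: continuous_intros)
      next
        case False
        have "y + sqrt (y\<^sup>2 - m) \<noteq> 0" if "y \<in> {sqrt m..y0}" for y
        proof -
          have "0 < sqrt m" using False m by simp
          moreover have "m \<le> y\<^sup>2" using that m by (auto simp: sqrt_le_D)
          moreover have "sqrt m \<le> y" "0 \<le> sqrt (y\<^sup>2 - m)" using that calculation by auto
          ultimately show ?thesis by linarith
        qed
        then show ?thesis unfolding F_def by (intro continuous_intros) auto
      qed
      fix y assume y: "y \<in> {sqrt m<..<y0}"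
      have "0 \<le> sqrt m" using m by simp
      then have "0 < y" using y unfolding greaterThanLessThan_iff by linarith
      then have pos: "0 < y" "0 < y\<^sup>2 - m" using y m by (auto simp: less_square_of_sqrt_less)
      define s where "s = sqrt (y\<^sup>2 - m)"
      have s: "0 < s" "s\<^sup>2 = y\<^sup>2 - m" using pos by (auto simp: s_def)
      have "(F has_real_derivative (1 * s + y * ((2 * y) * (inverse s / 2)) -
          m * ((1 + (2 * y) * (inverse s / 2)) * inverse (y + s))) / 2) (at y)"
        unfolding F_def s_def using pos s(1)[unfolded s_def]
        by (auto intro!: derivative_eq_intros simp: add_pos_pos) (simp add: divide_inverse mult_ac)
      moreover have "(1 * s + y * ((2 * y) * (inverse s / 2)) -
          m * ((1 + (2 * y) * (inverse s / 2)) * inverse (y + s))) / 2 = s"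
      proof -
        have "(1 + (2 * y) * (inverse s / 2)) * inverse (y + s) = 1 / s"
          using s(1) pos by (simp add: field_simps)
        then have "(1 * s + y * ((2 * y) * (inverse s / 2)) -
          m * ((1 + (2 * y) * (inverse s / 2)) * inverse (y + s))) / 2 = (s + (y\<^sup>2 - m) / s) / 2"
          using s(1) by (simp add: field_simps power2_eq_square)
        also have "\<dots> = s" unfolding s(2)[symmetric] using s(1) by (simp add: power2_eq_square)
        finally show ?thesis .
      qed
      ultimately show "(F has_vector_derivative sqrt (y\<^sup>2 - m)) (at y)"
        by (simp only: s_def has_real_derivative_iff_has_vector_derivative)
    qed
    moreover have "F (sqrt m) = - (m * ln m / 4)"
      using m by (auto simp: F_def ln_sqrt)
    moreover have "F y0 = E m" by (simp add: F_def E_def)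
    ultimately show ?thesis by (simp add: add.commute)
  qed
  ultimately show ?case by blast
next
  case 2
  define E where "E m = (y0\<^sup>2 - m) * sqrt (y0\<^sup>2 - m) / 3" for m
  have "smooth_on E {..<y0\<^sup>2}"
    unfolding E_def
    by (intro smooth_on_divide smooth_on_diff smooth_on_mult smooth_on_sqrt
        smooth_on_const smooth_on_id open_lessThan) auto
  moreover have "((\<lambda>y. y * sqrt (y\<^sup>2 - m)) has_integral E m) {sqrt m..y0}"
    if m: "m \<in> {0..<y0\<^sup>2}" for m
  proof -
    define F where "F y = (y\<^sup>2 - m) * sqrt (y\<^sup>2 - m) / 3" for y
    have le: "sqrt m \<le> y0" using m assms by (intro real_le_lsqrt) auto
    have "((\<lambda>y. y * sqrt (y\<^sup>2 - m)) has_integral F y0 - F (sqrt m)) {sqrt m..y0}"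
    proof (rule fundamental_theorem_of_calculus_interior[OF le])
      show "continuous_on {sqrt m..y0} F" unfolding F_def by (intro continuous_intros) auto
      fix y assume y: "y \<in> {sqrt m<..<y0}"
      then have pos: "0 < y\<^sup>2 - m" using m by (auto simp: less_square_of_sqrt_less)
      have "(F has_real_derivative y * sqrt (y\<^sup>2 - m)) (at y)"
        unfolding F_def using pos
        by (auto intro!: derivative_eq_intros simp: field_simps power2_eq_square)
      then show "(F has_vector_derivative y * sqrt (y\<^sup>2 - m)) (at y)"
        by (simp add: has_real_derivative_iff_has_vector_derivative)
    qed
    then show ?thesis using m by (simp add: F_def E_def)
  qed
  ultimately show ?case by auto
next
  case (3 k)
  then obtain E0 where E0: "smooth_on E0 {..<y0\<^sup>2}" "\<And>m. m \<in> {0..<y0\<^sup>2} \<Longrightarrow>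
    ((\<lambda>y. y ^ k * sqrt (y\<^sup>2 - m)) has_integral log_coeff k * m ^ (k div 2 + 1) * ln m + E0 m) {sqrt m..y0}"
    by blast
  define E where "E m = (y0 ^ Suc k * ((y0\<^sup>2 - m) * sqrt (y0\<^sup>2 - m)) + (real k + 1) * (m * E0 m)) / (real k + 4)" for m
  have "smooth_on E {..<y0\<^sup>2}"
    unfolding E_def
    by (intro smooth_on_divide smooth_on_diff smooth_on_mult smooth_on_sqrt smooth_on_add
        smooth_on_const smooth_on_id open_lessThan E0) auto
  moreover have "((\<lambda>y. y ^ Suc (Suc k) * sqrt (y\<^sup>2 - m)) has_integral
      log_coeff (Suc (Suc k)) * m ^ (Suc (Suc k) div 2 + 1) * ln m + E m) {sqrt m..y0}"
    if m: "m \<in> {0..<y0\<^sup>2}" for m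
  proof -
    \<comment> \<open>The derivative of y^(k+1) (y^2 - m)^(3/2) is (k + 4) y^(k+2) sqrt (y^2 - m) -
      (k + 1) m y^k sqrt (y^2 - m), and the boundary term at sqrt m vanishes.\<close>
    define F where "F y = y ^ Suc k * ((y\<^sup>2 - m) * sqrt (y\<^sup>2 - m))" for y
    have le: "sqrt m \<le> y0" using m assms by (intro real_le_lsqrt) auto
    have "((\<lambda>y. (real k + 4) * (y ^ Suc (Suc k) * sqrt (y\<^sup>2 - m)) - (real k + 1) * m * (y ^ k * sqrt (y\<^sup>2 - m)))
        has_integral F y0 - F (sqrt m)) {sqrt m..y0}"
    proof (rule fundamental_theorem_of_calculus_interior[OF le])
      show "continuous_on {sqrt m..y0} F" unfolding F_def by (intro continuous_intros)
      fix y assume y: "y \<in> {sqrt m<..<y0}"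
      then have pos: "0 < y\<^sup>2 - m" using m by (auto simp: less_square_of_sqrt_less)
      define s where "s = sqrt (y\<^sup>2 - m)"
      have s: "0 < s" "s\<^sup>2 = y\<^sup>2 - m" using pos by (auto simp: s_def)
      have d: "(F has_real_derivative (real k + 1) * y ^ k * ((y\<^sup>2 - m) * s) +
          y ^ Suc k * (2 * y * s + (y\<^sup>2 - m) * ((2 * y) * (inverse s / 2)))) (at y)"
      proof -
        have ds: "((\<lambda>y. sqrt (y\<^sup>2 - m)) has_real_derivative (2 * y) * (inverse s / 2)) (at y)"
          unfolding s_def using pos by (auto intro!: derivative_eq_intros)
        have dq: "((\<lambda>y. y\<^sup>2 - m) has_real_derivative 2 * y) (at y)"
          by (auto intro!: derivative_eq_intros)
        have dp: "((\<lambda>y. y ^ Suc k) has_real_derivative (real k + 1) * y ^ k) (at y)"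
          using DERIV_pow[of "Suc k" y] by (simp add: add.commute)
        show ?thesis
          unfolding F_def by (rule DERIV_cong[OF DERIV_mult[OF dp DERIV_mult[OF dq ds]]]) (simp add: s_def algebra_simps)
      qed
      have e: "(y\<^sup>2 - m) * ((2 * y) * (inverse s / 2)) = y * s"
        unfolding s(2)[symmetric] using s(1) by (simp add: power2_eq_square)
      have "(F has_real_derivative (real k + 4) * (y ^ Suc (Suc k) * s) - (real k + 1) * m * (y ^ k * s)) (at y)"
        by (rule DERIV_cong[OF d[unfolded e]]) (simp add: algebra_simps power2_eq_square)
      then show "(F has_vector_derivative (real k + 4) * (y ^ Suc (Suc k) * sqrt (y\<^sup>2 - m))
          - (real k + 1) * m * (y ^ k * sqrt (y\<^sup>2 - m))) (at y)"
        by (simp add: s_def has_real_derivative_iff_has_vector_derivative)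
    qed
    from has_integral_add[OF this has_integral_mult_right[OF E0(2)[OF m], of "(real k + 1) * m"]]
    have "((\<lambda>y. (real k + 4) * (y ^ Suc (Suc k) * sqrt (y\<^sup>2 - m))) has_integral F y0 - F (sqrt m) +
      (real k + 1) * m * (log_coeff k * m ^ (k div 2 + 1) * ln m + E0 m)) {sqrt m..y0}"
      by simp
    from has_integral_mult_right[OF this, of "1 / (real k + 4)"]
    have "((\<lambda>y. y ^ Suc (Suc k) * sqrt (y\<^sup>2 - m)) has_integral 1 / (real k + 4) * (F y0 - F (sqrt m) +
      (real k + 1) * m * (log_coeff k * m ^ (k div 2 + 1) * ln m + E0 m))) {sqrt m..y0}"
      by simp
    moreover have "F (sqrt m) = 0" using m by (simp add: F_def)
    moreover have "1 / (real k + 4) * (F y0 - 0 + (real k + 1) * m * (log_coeff k * m ^ (k div 2 + 1) * ln m + E0 m)) =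
        log_coeff (Suc (Suc k)) * m ^ (Suc (Suc k) div 2 + 1) * ln m + E m"
      by (simp add: E_def F_def divide_inverse algebra_simps)
    ultimately show ?thesis by simp
  qed
  ultimately show ?case by blast
qed

text \<open>Taylor expansion in y to order 8. In u = y^2 the remainder y^8 \<psi> dy is half of
  u^(7/2) \<psi> du, and 7 = 2 * 3 + 1 is the exponent at which \<open>Ck_on_half_power\<close>
  yields class 3. The value \<open>C (0, q)\<close> is recorded since it enters the coefficient of V
  \<otimes> V.\<close>

lemma log_sqrt_integral:
  fixes \<phi> :: "real \<times> 'q::euclidean_space \<Rightarrow> real"
  assumes \<Theta>: "open \<Theta>" and y0: "0 < y0" "y0 < \<delta>" and \<phi>: "smooth_on \<phi> ({-\<delta><..<\<delta>} \<times> \<Theta>)"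
  obtains C B where "smooth_on C (UNIV \<times> \<Theta>)" "Ck_on 3 B ({-y0\<^sup>2<..<y0\<^sup>2} \<times> \<Theta>)"
    "\<And>m q. m \<in> {0..<y0\<^sup>2} \<Longrightarrow> q \<in> \<Theta> \<Longrightarrow> ((\<lambda>y. \<phi> (y, q) * sqrt (y\<^sup>2 - m)) has_integral
      (\<phi> (0, q) / 4 * m + m\<^sup>2 * C (m, q)) * ln m + B (m, q)) {sqrt m..y0}"
    "\<And>q. q \<in> \<Theta> \<Longrightarrow> C (0, q) = dd (1, 0) (dd (1, 0) \<phi>) (0, q) / 32"
proof -
  have \<delta>: "0 < \<delta>" using y0 by simp
  obtain a \<psi> where A: "(\<forall>i. smooth_on (a i) \<Theta>) \<and> smooth_on \<psi> ({-\<delta><..<\<delta>} \<times> \<Theta>) \<and>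
    (\<forall>y\<in>{-\<delta><..<\<delta>}. \<forall>q\<in>\<Theta>. \<phi> (y, q) = (\<Sum>i<8. a i q * y ^ i) + y ^ 8 * \<psi> (y, q))"
    using smooth_on_taylor[OF \<Theta> \<delta> \<phi>, of 8] by (elim exE) (rule that)
  then have a: "\<And>i. smooth_on (a i) \<Theta>" and \<psi>: "smooth_on \<psi> ({-\<delta><..<\<delta>} \<times> \<Theta>)"
    and eq: "\<And>y q. y \<in> {-\<delta><..<\<delta>} \<Longrightarrow> q \<in> \<Theta> \<Longrightarrow> \<phi> (y, q) = (\<Sum>i<8. a i q * y ^ i) + y ^ 8 * \<psi> (y, q)"
    by simp_all
  have op: "open ({-y0\<^sup>2<..<y0\<^sup>2} \<times> \<Theta>)" "open ((UNIV::real set) \<times> \<Theta>)"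
    using \<Theta> by (auto intro: open_Times_interval open_Times)
  obtain E where E': "\<forall>i. smooth_on (E i) {..<y0\<^sup>2} \<and> (\<forall>m\<in>{0..<y0\<^sup>2}. ((\<lambda>y. y ^ i * sqrt (y\<^sup>2 - m)) has_integral
        log_coeff i * m ^ (i div 2 + 1) * ln m + E i m) {sqrt m..y0})"
    using choice[of "\<lambda>i E. smooth_on E {..<y0\<^sup>2} \<and> (\<forall>m\<in>{0..<y0\<^sup>2}. ((\<lambda>y. y ^ i * sqrt (y\<^sup>2 - m)) has_integral
        log_coeff i * m ^ (i div 2 + 1) * ln m + E m) {sqrt m..y0})"] power_sqrt_integral[OF y0(1)]
    by blast
  then have E: "\<And>i. smooth_on (E i) {..<y0\<^sup>2}" and Eint: "\<And>i m. m \<in> {0..<y0\<^sup>2} \<Longrightarrow>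
    ((\<lambda>y. y ^ i * sqrt (y\<^sup>2 - m)) has_integral log_coeff i * m ^ (i div 2 + 1) * ln m + E i m) {sqrt m..y0}"
    by simp_all
  have K: "Ck_on 3 (half_power 7 \<psi>) ({-y0\<^sup>2<..<\<delta>\<^sup>2} \<times> \<Theta>)"
    by (rule Ck_on_subset[OF Ck_on_half_power[OF \<delta> \<Theta> \<psi>]]) auto
  have lt: "y0\<^sup>2 < \<delta>\<^sup>2" using y0 by (intro power_strict_mono) auto
  obtain J where J: "Ck_on 3 J ({-y0\<^sup>2<..<y0\<^sup>2} \<times> \<Theta>)"
    and Jint: "\<And>m q. m \<in> {-y0\<^sup>2<..<y0\<^sup>2} \<Longrightarrow> q \<in> \<Theta> \<Longrightarrow>
      integral {m..y0\<^sup>2} (\<lambda>u. half_power 7 \<psi> (u, q) * sqrt (u - m)) = J (m, q)"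
    by (rule abel_integral_param[OF \<Theta> lt K], rule that)
  \<comment> \<open>The weights are \<open>log_coeff\<close> at 2, 4 and 6, with m^2 factored out.
    The Taylor term of degree 0 gives the separate term \<phi> (0, q) m / 4, and odd degrees give no
    logarithm.\<close>
  define C where "C = (\<lambda>p. a 2 (snd p) / 16 + fst p * a 4 (snd p) / 32 + 5 / 256 * (fst p)\<^sup>2 * a 6 (snd p))"
  define B where "B = (\<lambda>p. (\<Sum>i<8. a i (snd p) * E i (fst p)) + J p / 2)"
  show ?thesis
  proof
    show "smooth_on C (UNIV \<times> \<Theta>)"
      unfolding C_def
      by (intro smooth_on_add smooth_on_mult smooth_on_divide smooth_on_power smooth_on_const smooth_on_fst op(2)
          smooth_on_compose[OF op(2) \<Theta> a smooth_on_snd]) auto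
    show "Ck_on 3 B ({-y0\<^sup>2<..<y0\<^sup>2} \<times> \<Theta>)"
      unfolding B_def
      by (intro Ck_on_add Ck_on_sum Ck_on_mult Ck_on_divide Ck_on_const J op(1)
          Ck_on_compose[OF op(1) \<Theta> smooth_onD[OF a] Ck_on_snd]
          Ck_on_compose[OF op(1) open_lessThan smooth_onD[OF E] Ck_on_fst]) auto
  next
    fix m q assume m: "m \<in> {0..<y0\<^sup>2}" and q: "q \<in> \<Theta>"
    have le: "sqrt m \<le> y0" using m y0 by (intro real_le_lsqrt) auto
    \<comment> \<open>Substitution u = y^2; the factor 2 y combines with the y^7 of
      \<open>half_power 7\<close> to twice the Taylor remainder.\<close>
    have "((\<lambda>y. (2 * y) *\<^sub>R (half_power 7 \<psi> (y\<^sup>2, q) * sqrt (y\<^sup>2 - m))) has_integral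
        integral {(sqrt m)\<^sup>2..y0\<^sup>2} (\<lambda>u. half_power 7 \<psi> (u, q) * sqrt (u - m))) {sqrt m..y0}"
    proof (rule has_integral_substitution[where c = m and d = "y0\<^sup>2"])
      show "continuous_on {m..y0\<^sup>2} (\<lambda>u. half_power 7 \<psi> (u, q) * sqrt (u - m))"
        using lt m q y0
        by (intro continuous_intros continuous_on_compose2[OF Ck_on_continuous_on[OF K], of _ "\<lambda>u. (u, q)"])
          (auto intro: less_le_trans[of _ 0])
      show "(\<lambda>y. y\<^sup>2) ` {sqrt m..y0} \<subseteq> {m..y0\<^sup>2}"
      proof (clarsimp, intro conjI)
        fix y assume y: "sqrt m \<le> y" "y \<le> y0"
        then show "m \<le> y\<^sup>2" by (simp add: sqrt_le_D)
        have "0 \<le> sqrt m" using m by simp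
        then show "y\<^sup>2 \<le> y0\<^sup>2" using y by (intro power_mono) linarith+
      qed
      show "(sqrt m)\<^sup>2 \<le> y0\<^sup>2" using m by simp
    qed (use le in \<open>auto intro!: derivative_eq_intros\<close>)
    then have "((\<lambda>y. (2 * y) *\<^sub>R (half_power 7 \<psi> (y\<^sup>2, q) * sqrt (y\<^sup>2 - m))) has_integral J (m, q)) {sqrt m..y0}"
      using m q y0 Jint[of m q] by (auto intro: less_le_trans[of _ 0])
    from has_integral_mult_right[OF this, of "1 / 2"]
    have "((\<lambda>y. y ^ 8 * \<psi> (y, q) * sqrt (y\<^sup>2 - m)) has_integral J (m, q) / 2) {sqrt m..y0}"
    proof (rule has_integral_eq_rhs[OF has_integral_eq, rotated])
      fix y assume y: "y \<in> {sqrt m..y0}"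
      have "0 \<le> sqrt m" using m by simp
      then have "0 \<le> y" using y unfolding atLeastAtMost_iff by linarith
      then have "half_power 7 \<psi> (y\<^sup>2, q) = y ^ 7 * \<psi> (y, q)"
        by (simp add: half_power_def max_absorb1)
      moreover have "y ^ 8 = y * y ^ 7" by (simp flip: power_Suc)
      ultimately show "1 / 2 * ((2 * y) *\<^sub>R (half_power 7 \<psi> (y\<^sup>2, q) * sqrt (y\<^sup>2 - m))) =
          y ^ 8 * \<psi> (y, q) * sqrt (y\<^sup>2 - m)"
        by simp
    qed simp
    moreover have "((\<lambda>y. \<Sum>i<8. a i q * (y ^ i * sqrt (y\<^sup>2 - m))) has_integral
        (\<Sum>i<8. a i q * (log_coeff i * m ^ (i div 2 + 1) * ln m + E i m))) {sqrt m..y0}"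
      by (intro has_integral_sum has_integral_mult_right Eint[OF m]) auto
    ultimately have "((\<lambda>y. (\<Sum>i<8. a i q * (y ^ i * sqrt (y\<^sup>2 - m))) + y ^ 8 * \<psi> (y, q) * sqrt (y\<^sup>2 - m)) has_integral
        (\<Sum>i<8. a i q * (log_coeff i * m ^ (i div 2 + 1) * ln m + E i m)) + J (m, q) / 2) {sqrt m..y0}"
      by (rule has_integral_add[rotated])
    then have "((\<lambda>y. \<phi> (y, q) * sqrt (y\<^sup>2 - m)) has_integral
        (\<Sum>i<8. a i q * (log_coeff i * m ^ (i div 2 + 1) * ln m + E i m)) + J (m, q) / 2) {sqrt m..y0}"
    proof (rule has_integral_eq[rotated])
      fix y assume y: "y \<in> {sqrt m..y0}"
      have "0 \<le> sqrt m" using m by simp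
      then have "0 \<le> y" using y unfolding atLeastAtMost_iff by linarith
      then have "y \<in> {-\<delta><..<\<delta>}" using y y0 by auto
      from eq[OF this q] show "(\<Sum>i<8. a i q * (y ^ i * sqrt (y\<^sup>2 - m))) + y ^ 8 * \<psi> (y, q) * sqrt (y\<^sup>2 - m) =
          \<phi> (y, q) * sqrt (y\<^sup>2 - m)"
        by (simp add: sum_distrib_right distrib_right mult.assoc)
    qed
    moreover have "\<phi> (0, q) = a 0 q" using eq[of 0 q] q \<delta> by (simp add: eval_nat_numeral)
    moreover have "(\<Sum>i<8. a i q * (log_coeff i * m ^ (i div 2 + 1) * ln m + E i m)) + J (m, q) / 2 =
        (a 0 q / 4 * m + m\<^sup>2 * C (m, q)) * ln m + B (m, q)"
    proof -
      have lc: "log_coeff 2 = 1 / 16" "log_coeff 3 = 0" "log_coeff 4 = 1 / 32" "log_coeff 5 = 0" "log_coeff 6 = 5 / 256"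
        "log_coeff 7 = 0"
        by (simp_all add: eval_nat_numeral)
      have set: "{..<8::nat} = {0, 1, 2, 3, 4, 5, 6, 7}" by auto
      show ?thesis
        by (simp add: B_def C_def lc set distrib_left sum.distrib) (simp add: power_numeral_reduce field_simps)
    qed
    ultimately show "((\<lambda>y. \<phi> (y, q) * sqrt (y\<^sup>2 - m)) has_integral
        (\<phi> (0, q) / 4 * m + m\<^sup>2 * C (m, q)) * ln m + B (m, q)) {sqrt m..y0}"
      by simp
  next
    fix q assume q: "q \<in> \<Theta>"
    have op': "open ({-\<delta><..<\<delta>} \<times> \<Theta>)" by (rule open_Times_interval[OF \<Theta>])
    have der: "((\<lambda>y. F (y, q)) has_real_derivative dd (1, 0) F (y, q)) (at y)"
      if "smooth_on F ({-\<delta><..<\<delta>} \<times> \<Theta>)" "y \<in> {-\<delta><..<\<delta>}" for F y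
      using that q by (intro dd_fst_real_derivative smooth_on_differentiable[OF that(1)]) auto
    \<comment> \<open>The Taylor identity is differentiated twice, first on a whole neighbourhood
      and then at 0, which leaves 2 \<open>a 2 q\<close>. Division by 32 then reproduces the weight
      1 / 16 of \<open>a 2\<close> in \<open>C\<close>.\<close>
    let ?f1 = "\<lambda>y. (\<Sum>i<8. a i q * (real i * y ^ (i - 1))) + (8 * (y ^ 7 * \<psi> (y, q)) + y ^ 8 * dd (1, 0) \<psi> (y, q))"
    have f1: "dd (1, 0) \<phi> (y, q) = ?f1 y" if y: "y \<in> {-\<delta><..<\<delta>}" for y
    proof -
      have "((\<lambda>y. (\<Sum>i<8. a i q * y ^ i) + y ^ 8 * \<psi> (y, q)) has_real_derivative ?f1 y) (at y)"
        by (rule derivative_eq_intros der[OF \<psi> y] refl)+ (simp add: mult_ac)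
      then have "((\<lambda>y. \<phi> (y, q)) has_real_derivative ?f1 y) (at y)"
        by (rule has_field_derivative_transform_within_open[of _ _ _ "{-\<delta><..<\<delta>}"]) (use y eq q in auto)
      with der[OF \<phi> y] show ?thesis by (rule DERIV_unique)
    qed
    have "(?f1 has_real_derivative (\<Sum>i<8. a i q * (real i * (real (i - 1) * 0 ^ (i - 1 - 1)))) + 0) (at 0)"
    proof (rule DERIV_add)
      show "((\<lambda>y. \<Sum>i<8. a i q * (real i * y ^ (i - 1))) has_real_derivative
          (\<Sum>i<8. a i q * (real i * (real (i - 1) * 0 ^ (i - 1 - 1))))) (at 0)"
        by (rule derivative_eq_intros refl)+ (simp add: mult_ac)
      have z: "((\<lambda>y. y ^ n * F (y, q)) has_real_derivative 0) (at 0)"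
        if "smooth_on F ({-\<delta><..<\<delta>} \<times> \<Theta>)" "2 \<le> n" for F n
        by (rule DERIV_cong[OF DERIV_mult[OF DERIV_pow der[OF that(1)]]]) (use \<delta> that(2) in \<open>auto simp: power_0_left\<close>)
      show "((\<lambda>y. 8 * (y ^ 7 * \<psi> (y, q)) + y ^ 8 * dd (1, 0) \<psi> (y, q)) has_real_derivative 0) (at 0)"
        by (rule DERIV_cong[OF DERIV_add[OF DERIV_cmult[OF z[OF \<psi>]] z[OF smooth_on_dd[OF \<psi>]]]]) auto
    qed
    then have "((\<lambda>y. dd (1, 0) \<phi> (y, q)) has_real_derivative (\<Sum>i<8. a i q * (real i * (real (i - 1) * 0 ^ (i - 1 - 1)))) + 0) (at 0)"
      by (rule has_field_derivative_transform_within_open[of _ _ _ "{-\<delta><..<\<delta>}"]) (use f1 \<delta> in auto)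
    with der[OF smooth_on_dd[OF \<phi>]] \<delta>
    have "dd (1, 0) (dd (1, 0) \<phi>) (0, q) = (\<Sum>i<8. a i q * (real i * (real (i - 1) * 0 ^ (i - 1 - 1)))) + 0"
      by (intro DERIV_unique) auto
    also have "\<dots> = 2 * a 2 q" by (simp add: eval_nat_numeral)
    finally show "C (0, q) = dd (1, 0) (dd (1, 0) \<phi>) (0, q) / 32" by (simp add: C_def)
  qed
qed

section \<open>Product neighbourhoods of points with first coordinate 0\<close>

lemma eventually_nhds_prod_box:
  fixes q :: "'q::metric_space"
  assumes "eventually P (nhds (0::real, q))"
  obtains \<eta> \<Theta> where "0 < \<eta>" "open \<Theta>" "q \<in> \<Theta>" "\<And>y p. y \<in> {-\<eta><..<\<eta>} \<Longrightarrow> p \<in> \<Theta> \<Longrightarrow> P (y, p)"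
proof -
  obtain S where S: "open S" "(0, q) \<in> S" "\<And>x. x \<in> S \<Longrightarrow> P x"
    using assms by (auto simp: eventually_nhds)
  obtain A \<Theta> where A: "open A" "open \<Theta>" "(0, q) \<in> A \<times> \<Theta>" "A \<times> \<Theta> \<subseteq> S"
    using S(1,2) by (auto simp: open_prod_def)
  obtain \<eta> where "0 < \<eta>" "ball 0 \<eta> \<subseteq> A" using A open_contains_ball by blast
  moreover have "P (y, p)" if "y \<in> {-\<eta><..<\<eta>}" "p \<in> \<Theta>" for y p
  proof -
    have "y \<in> ball 0 \<eta>" using that by (auto simp: dist_real_def)
    with that A(4) \<open>ball 0 \<eta> \<subseteq> A\<close> show ?thesis by (intro S(3)) blast
  qed
  ultimately show ?thesis using that[of \<eta> \<Theta>] A by blast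
qed

lemma eventually_nhds_gt:
  fixes F :: "'a::topological_space \<Rightarrow> real"
  assumes "open S" "continuous_on S F" "x \<in> S" "c < F x"
  shows "eventually (\<lambda>y. y \<in> S \<and> c < F y) (nhds x)"
proof -
  have "open (F -` {c<..} \<inter> S)" using assms(1,2) continuous_on_open_vimage open_greaterThan by blast
  then show ?thesis using assms eventually_nhds_in_open[of "F -` {c<..} \<inter> S" x]
    by (auto elim: eventually_mono)
qed

lemma eventually_nhds_compose:
  assumes "open S" "continuous_on S G" "x \<in> S" "eventually P (nhds (G x))"
  shows "eventually (\<lambda>y. y \<in> S \<and> P (G y)) (nhds x)"
proof -
  obtain T where T: "open T" "G x \<in> T" "\<And>z. z \<in> T \<Longrightarrow> P z" using assms(4) by (auto simp: eventually_nhds)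
  have "open (G -` T \<inter> S)" using assms(1,2) T(1) continuous_on_open_vimage by blast
  then show ?thesis using assms T eventually_nhds_in_open[of "G -` T \<inter> S" x]
    by (auto elim: eventually_mono)
qed

section \<open>Straightening coordinates\<close>

lemma dd_fst_line:
  fixes F :: "real \<times> 'q::euclidean_space \<Rightarrow> real"
  assumes "smooth_on F S" "(y, q) \<in> S"
  shows "((\<lambda>y. F (y, q)) has_real_derivative dd (1, 0) F (y, q)) (at y)"
  by (intro dd_fst_real_derivative smooth_on_differentiable[OF assms])

text \<open>One-variable Morse lemma with parameters. Taylor expansion at the critical point gives W
  (vs + x) = W (vs) + x^2 \<psi> (x, q) with \<psi> (0, q) half the second derivative, hence
  negative. So y = x sqrt (- \<psi>) is a coordinate, inverted by the implicit function
  theorem.\<close>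

lemma left_coordinate:
  fixes W :: "real \<times> 'q::euclidean_space \<Rightarrow> real"
  assumes I: "open I" and \<Lambda>: "open \<Lambda>" and W: "smooth_on W (I \<times> \<Lambda>)"
    and vs: "smooth_on vs \<Lambda>" "\<And>q. q \<in> \<Lambda> \<Longrightarrow> vs q \<in> I"
    and W1: "\<And>q. q \<in> \<Lambda> \<Longrightarrow> dd (1, 0) W (vs q, q) = 0"
    and W2: "\<And>q. q \<in> \<Lambda> \<Longrightarrow> dd (1, 0) (dd (1, 0) W) (vs q, q) < 0" and q0: "q0 \<in> \<Lambda>"
  obtains X \<eta> \<Theta> where "0 < \<eta>" "open \<Theta>" "q0 \<in> \<Theta>" "\<Theta> \<subseteq> \<Lambda>" "smooth_on X ({-\<eta><..<\<eta>} \<times> \<Theta>)"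
    "\<And>y q. y \<in> {-\<eta><..<\<eta>} \<Longrightarrow> q \<in> \<Theta> \<Longrightarrow> X (y, q) \<in> I"
    "\<And>y q. y \<in> {-\<eta><..<\<eta>} \<Longrightarrow> q \<in> \<Theta> \<Longrightarrow> W (X (y, q), q) = W (vs q, q) - y\<^sup>2"
    "\<And>y q. y \<in> {-\<eta><..<\<eta>} \<Longrightarrow> q \<in> \<Theta> \<Longrightarrow> 0 < dd (1, 0) X (y, q)"
    "\<And>q. q \<in> \<Theta> \<Longrightarrow> X (0, q) = vs q"
proof -
  have op\<Lambda>: "open ((UNIV::real set) \<times> \<Lambda>)" "open (I \<times> \<Lambda>)" using \<Lambda> I by (auto intro: open_Times)
  have svs: "smooth_on (\<lambda>p. vs (snd p)) ((UNIV::real set) \<times> \<Lambda>)"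
    by (rule smooth_on_compose[OF op\<Lambda>(1) \<Lambda> vs(1) smooth_on_snd]) auto
  have sG: "smooth_on (\<lambda>p. vs (snd p) + fst p) ((UNIV::real set) \<times> \<Lambda>)"
    by (intro smooth_on_add op\<Lambda> svs smooth_on_fst)
  have "eventually (\<lambda>v. v \<in> I) (nhds (vs (snd (0::real, q0)) + fst (0::real, q0)))"
    using I vs(2)[OF q0] by (simp add: eventually_nhds_in_open)
  from eventually_nhds_compose[OF op\<Lambda>(1) smooth_on_continuous_on[OF sG] _ this]
  have ev1: "eventually (\<lambda>p. p \<in> UNIV \<times> \<Lambda> \<and> vs (snd p) + fst p \<in> I) (nhds (0, q0))" using q0 by simp
  obtain \<delta>1 \<Theta>1 where b1: "0 < \<delta>1" "open \<Theta>1" "q0 \<in> \<Theta>1"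
    and b1': "\<And>y q. y \<in> {-\<delta>1<..<\<delta>1} \<Longrightarrow> q \<in> \<Theta>1 \<Longrightarrow>
      (y, q) \<in> UNIV \<times> \<Lambda> \<and> vs (snd (y, q)) + fst (y, q) \<in> I"
    by (rule eventually_nhds_prod_box[OF ev1], rule that)
  define S1 where "S1 = {-\<delta>1<..<\<delta>1} \<times> \<Theta>1"
  have S1: "open S1" "S1 \<subseteq> UNIV \<times> \<Lambda>" using b1 b1' by (auto simp: S1_def intro: open_Times_interval)
  have S1I: "(vs q + x, q) \<in> I \<times> \<Lambda>" if "(x, q) \<in> S1" for x q using b1'[of x q] that by (auto simp: S1_def)
  define Wt where "Wt p = W (vs (snd p) + fst p, snd p)" for p
  have Wt: "smooth_on Wt S1"
    unfolding Wt_def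
    by (rule smooth_on_compose[OF S1(1) op\<Lambda>(2) W smooth_on_Pair[OF S1(1) smooth_on_subset[OF sG S1(2)] smooth_on_snd]])
      (use S1I in force)
  obtain a \<psi> where A: "(\<forall>i. smooth_on (a i) \<Theta>1) \<and> smooth_on \<psi> ({-\<delta>1<..<\<delta>1} \<times> \<Theta>1) \<and>
    (\<forall>y\<in>{-\<delta>1<..<\<delta>1}. \<forall>q\<in>\<Theta>1. Wt (y, q) = (\<Sum>i<2. a i q * y ^ i) + y ^ 2 * \<psi> (y, q))"
    using smooth_on_taylor[OF b1(2,1) Wt[unfolded S1_def], of 2] by (elim exE) (rule that)
  then have \<psi>: "smooth_on \<psi> S1"
    and eq: "\<And>y q. y \<in> {-\<delta>1<..<\<delta>1} \<Longrightarrow> q \<in> \<Theta>1 \<Longrightarrow> Wt (y, q) = a 0 q + a 1 q * y + y ^ 2 * \<psi> (y, q)"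
    by (simp_all add: S1_def eval_nat_numeral)
  have a0: "a 0 q = W (vs q, q)" if "q \<in> \<Theta>1" for q
    using eq[of 0 q] that b1 by (simp add: Wt_def)
  have Wx: "dd (1, 0) W (vs q + x, q) = a 1 q + (2 * (x * \<psi> (x, q)) + x\<^sup>2 * dd (1, 0) \<psi> (x, q))"
    if "x \<in> {-\<delta>1<..<\<delta>1}" "q \<in> \<Theta>1" for x q
  proof -
    have xq: "(x, q) \<in> S1" using that by (simp add: S1_def)
    have "((\<lambda>x. W (vs q + x, q)) has_real_derivative dd (1, 0) W (vs q + x, q) * 1) (at x)"
      by (rule DERIV_chain2[where g = "\<lambda>x. vs q + x", OF dd_fst_line[OF W S1I[OF xq]]]) (auto intro!: derivative_eq_intros)
    moreover have "((\<lambda>x. W (vs q + x, q)) has_real_derivative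
        a 1 q + (2 * (x * \<psi> (x, q)) + x\<^sup>2 * dd (1, 0) \<psi> (x, q))) (at x)"
    proof (rule has_field_derivative_transform_within_open[where S = "{-\<delta>1<..<\<delta>1}"])
      show "((\<lambda>x. a 0 q + a 1 q * x + x ^ 2 * \<psi> (x, q)) has_real_derivative
        a 1 q + (2 * (x * \<psi> (x, q)) + x\<^sup>2 * dd (1, 0) \<psi> (x, q))) (at x)"
        by (rule derivative_eq_intros dd_fst_line[OF \<psi> xq] refl)+ (simp add: mult_ac)
    qed (use that eq in \<open>auto simp: Wt_def\<close>)
    ultimately show ?thesis using DERIV_unique by fastforce
  qed
  have a1: "a 1 q = 0" if "q \<in> \<Theta>1" for q
    using Wx[of 0 q] W1[of q] b1'[of 0 q] that b1 by simp
  have \<psi>0: "\<psi> (0, q) < 0" if "q \<in> \<Theta>1" for q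
  proof -
    have q: "q \<in> \<Lambda>" "(0, q) \<in> S1" using b1'[of 0 q] that b1 by (auto simp: S1_def)
    have "((\<lambda>x. dd (1, 0) W (vs q + x, q)) has_real_derivative dd (1, 0) (dd (1, 0) W) (vs q + 0, q) * 1) (at 0)"
      by (rule DERIV_chain2[where g = "\<lambda>x. vs q + x", OF dd_fst_line[OF smooth_on_dd[OF W] S1I[OF q(2)]]]) (auto intro!: derivative_eq_intros)
    moreover have "((\<lambda>x. dd (1, 0) W (vs q + x, q)) has_real_derivative 0 + (2 * \<psi> (0, q) + 0)) (at 0)"
    proof (rule has_field_derivative_transform_within_open[where S = "{-\<delta>1<..<\<delta>1}"])
      show "((\<lambda>x. a 1 q + (2 * (x * \<psi> (x, q)) + x\<^sup>2 * dd (1, 0) \<psi> (x, q))) has_real_derivative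
        0 + (2 * \<psi> (0, q) + 0)) (at 0)"
        by (rule derivative_eq_intros dd_fst_line[OF \<psi> q(2)] dd_fst_line[OF smooth_on_dd[OF \<psi>] q(2)] refl)+ simp
    qed (use that b1 Wx in \<open>auto\<close>)
    ultimately have "dd (1, 0) (dd (1, 0) W) (vs q + 0, q) * 1 = 0 + (2 * \<psi> (0, q) + 0)"
      by (rule DERIV_unique)
    then show ?thesis using W2[OF q(1)] by simp
  qed
  have q0S: "(0, q0) \<in> S1" using b1 by (simp add: S1_def)
  have ev2: "eventually (\<lambda>p. p \<in> S1 \<and> 0 < - \<psi> p) (nhds (0, q0))"
    by (rule eventually_nhds_gt[OF S1(1) continuous_on_minus[OF smooth_on_continuous_on[OF \<psi>]] q0S])
      (use \<psi>0[OF b1(3)] in simp)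
  obtain \<delta>2 \<Theta>2 where b2: "0 < \<delta>2" "open \<Theta>2" "q0 \<in> \<Theta>2"
    and b2': "\<And>y q. y \<in> {-\<delta>2<..<\<delta>2} \<Longrightarrow> q \<in> \<Theta>2 \<Longrightarrow> (y, q) \<in> S1 \<and> 0 < - \<psi> (y, q)"
    by (rule eventually_nhds_prod_box[OF ev2], rule that)
  define S2 where "S2 = {-\<delta>2<..<\<delta>2} \<times> \<Theta>2"
  have S2: "open S2" "S2 \<subseteq> S1" "\<And>p. p \<in> S2 \<Longrightarrow> 0 < - \<psi> p"
    using b2 b2' by (auto simp: S2_def intro: open_Times_interval)
  \<comment> \<open>Here x = \<open>fst p\<close> is the displacement from the endstate. The
    v-derivative of \<Psi> at x = 0 is sqrt (- \<psi>), which is positive; this also gives the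
    inverse its sign.\<close>
  define \<Psi> where "\<Psi> p = fst p * sqrt (- \<psi> p)" for p
  have sq: "smooth_on (\<lambda>p. sqrt (- \<psi> p)) S2"
    by (rule smooth_on_sqrt[OF S2(1) smooth_on_minus[OF S2(1) smooth_on_subset[OF \<psi> S2(2)]] S2(3)])
  have \<Psi>: "smooth_on \<Psi> S2"
    unfolding \<Psi>_def by (rule smooth_on_mult[OF S2(1) smooth_on_fst sq])
  have q02: "(0, q0) \<in> S2" using b2 by (simp add: S2_def)
  have \<Psi>': "dd (1, 0) \<Psi> (0, q0) = sqrt (- \<psi> (0, q0))"
  proof -
    have "((\<lambda>x. x * sqrt (- \<psi> (x, q0))) has_real_derivative sqrt (- \<psi> (0, q0))) (at 0)"
      by (rule DERIV_cong[OF DERIV_mult[OF DERIV_ident dd_fst_line[OF sq q02]]]) simp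
    moreover have "((\<lambda>x. x * sqrt (- \<psi> (x, q0))) has_real_derivative dd (1, 0) \<Psi> (0, q0)) (at 0)"
      using dd_fst_line[OF \<Psi> q02] by (simp add: \<Psi>_def)
    ultimately show ?thesis by (rule DERIV_unique[symmetric])
  qed
  then have nz: "dd (1, 0) \<Psi> (0, q0) \<noteq> 0" using S2(3)[OF q02] by simp
  obtain U V Xh where UV: "open U" "U \<subseteq> S2" "(0, q0) \<in> U" "open V" "(\<Psi> (0, q0), snd (0::real, q0)) \<in> V" "smooth_on Xh V"
    and Xh: "\<And>y q. (y, q) \<in> V \<Longrightarrow> (Xh (y, q), q) \<in> U \<and> \<Psi> (Xh (y, q), q) = y"
    and Xh': "\<And>v q. (v, q) \<in> U \<Longrightarrow> (\<Psi> (v, q), q) \<in> V \<and> Xh (\<Psi> (v, q), q) = v"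
    by (rule implicit_function[OF S2(1) \<Psi> q02 nz], rule that)
  have q0V: "(0, q0) \<in> V" using UV(5) by (simp add: \<Psi>_def)
  have X0: "Xh (0, q) = 0" if "(0, q) \<in> U" for q using Xh'[OF that] by (simp add: \<Psi>_def)
  have "0 < dd (1, 0) Xh (0, q0)"
  proof -
    have "((\<lambda>y. \<Psi> (Xh (y, q0), q0)) has_real_derivative dd (1, 0) \<Psi> (Xh (0, q0), q0) * dd (1, 0) Xh (0, q0)) (at 0)"
      by (rule DERIV_chain2[where g = "\<lambda>y. Xh (y, q0)", OF dd_fst_line[OF \<Psi>] dd_fst_line[OF UV(6) q0V]]) (use X0[OF UV(3)] q02 in simp)
    then have "((\<lambda>y. y) has_real_derivative dd (1, 0) \<Psi> (Xh (0, q0), q0) * dd (1, 0) Xh (0, q0)) (at 0)"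
    proof (rule has_field_derivative_transform_within_open)
      show "open ((\<lambda>y. (y, q0)) -` V)" by (rule open_vimage[OF UV(4)]) (auto intro: continuous_intros)
    qed (use q0V Xh in auto)
    then have "dd (1, 0) \<Psi> (Xh (0, q0), q0) * dd (1, 0) Xh (0, q0) = 1" using DERIV_ident DERIV_unique by blast
    then show ?thesis using \<Psi>' X0[OF UV(3)] S2(3)[OF q02] by (metis real_sqrt_gt_zero zero_less_mult_pos zero_less_one)
  qed
  then have "eventually (\<lambda>p. p \<in> V \<and> 0 < dd (1, 0) Xh p) (nhds (0, q0))"
    by (rule eventually_nhds_gt[OF UV(4) smooth_on_continuous_on[OF smooth_on_dd[OF UV(6)]] q0V])
  \<comment> \<open>Membership of (0, q) in \<open>U\<close> is requested in addition: it is what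
    allows the local inverse to be evaluated as 0 at y = 0, giving \<open>X (0, q) = vs q\<close>
    for all nearby q.\<close>
  moreover have "eventually (\<lambda>p. p \<in> UNIV \<and> (\<lambda>p. p \<in> U) (0, snd p)) (nhds (0::real, q0))"
    by (rule eventually_nhds_compose[where G = "\<lambda>p. (0, snd p)" and P = "\<lambda>p. p \<in> U", OF open_UNIV])
      (use UV in \<open>auto intro!: continuous_intros eventually_nhds_in_open\<close>)
  ultimately have ev3: "eventually (\<lambda>p. (p \<in> V \<and> 0 < dd (1, 0) Xh p) \<and> (p \<in> UNIV \<and> (\<lambda>p. p \<in> U) (0, snd p))) (nhds (0, q0))"
    by (rule eventually_conj)
  obtain \<eta> \<Theta> where b3: "0 < \<eta>" "open \<Theta>" "q0 \<in> \<Theta>"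
    and b3': "\<And>y q. y \<in> {-\<eta><..<\<eta>} \<Longrightarrow> q \<in> \<Theta> \<Longrightarrow> ((y, q) \<in> V \<and> 0 < dd (1, 0) Xh (y, q)) \<and> ((y, q) \<in> UNIV \<and> (\<lambda>p. p \<in> U) (0, snd (y, q)))"
    by (rule eventually_nhds_prod_box[OF ev3], rule that)
  have \<Theta>2: "q \<in> \<Theta>2" "q \<in> \<Theta>1" "q \<in> \<Lambda>" "(0, q) \<in> U" if "q \<in> \<Theta>" for q
    using b3'[of 0 q] that b3(1) UV(2) S2(2) S1(2) by (auto simp: S2_def S1_def)
  have XS: "(Xh (y, q), q) \<in> S2" "\<Psi> (Xh (y, q), q) = y" "(y, q) \<in> V" if "y \<in> {-\<eta><..<\<eta>}" "q \<in> \<Theta>" for y q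
    using Xh[of y q] b3'[OF that] UV(2) by auto
  let ?S = "{-\<eta><..<\<eta>} \<times> \<Theta>"
  have opS: "open ?S" using b3 by (auto intro: open_Times_interval)
  define X where "X p = vs (snd p) + Xh p" for p
  have X: "smooth_on X ?S"
    unfolding X_def
    by (rule smooth_on_add[OF opS smooth_on_subset[OF svs] smooth_on_subset[OF UV(6)]]) (use \<Theta>2 XS in auto)
  show ?thesis
  proof (rule that[of \<eta> \<Theta> X])
    show "\<Theta> \<subseteq> \<Lambda>" using \<Theta>2 by blast
    fix y q assume yq: "y \<in> {-\<eta><..<\<eta>}" "q \<in> \<Theta>"
    have S1: "(Xh (y, q), q) \<in> S1" using XS(1)[OF yq] S2(2) by blast
    then show "X (y, q) \<in> I" using S1I by (auto simp: X_def)
    have "y\<^sup>2 = (Xh (y, q))\<^sup>2 * (- \<psi> (Xh (y, q), q))"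
    proof -
      have "y\<^sup>2 = (Xh (y, q) * sqrt (- \<psi> (Xh (y, q), q)))\<^sup>2"
        using XS(2)[OF yq] by (simp add: \<Psi>_def)
      then show ?thesis using S2(3)[OF XS(1)[OF yq]] by (simp add: power_mult_distrib)
    qed
    moreover have "W (X (y, q), q) = W (vs q, q) + (Xh (y, q))\<^sup>2 * \<psi> (Xh (y, q), q)"
      using eq[of "Xh (y, q)" q] S1 a0[of q] a1[of q] by (simp add: S1_def Wt_def X_def)
    ultimately show "W (X (y, q), q) = W (vs q, q) - y\<^sup>2" by simp
    have "((\<lambda>y. vs q + Xh (y, q)) has_real_derivative 0 + dd (1, 0) Xh (y, q)) (at y)"
      by (rule DERIV_add[OF DERIV_const dd_fst_line[OF UV(6) XS(3)[OF yq]]])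
    moreover have "((\<lambda>y. vs q + Xh (y, q)) has_real_derivative dd (1, 0) X (y, q)) (at y)"
      using dd_fst_line[OF X, of y q] yq by (simp add: X_def)
    ultimately have "dd (1, 0) X (y, q) = 0 + dd (1, 0) Xh (y, q)" by (rule DERIV_unique[symmetric])
    then show "0 < dd (1, 0) X (y, q)" using b3'[OF yq] by simp
  next
    show "X (0, q) = vs q" if "q \<in> \<Theta>" for q using X0 \<Theta>2(4)[OF that] by (simp add: X_def)
  qed (use b3 X in auto)
qed

text \<open>At the far end of the wave the potential has nonzero slope, so its difference from the
  value at \<open>vS\<close> is itself a coordinate and no square root occurs.\<close>

lemma right_coordinate:
  fixes W :: "real \<times> 'q::euclidean_space \<Rightarrow> real"
  assumes I: "open I" and \<Lambda>: "open \<Lambda>" and W: "smooth_on W (I \<times> \<Lambda>)"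
    and vS: "smooth_on vS \<Lambda>" "\<And>q. q \<in> \<Lambda> \<Longrightarrow> vS q \<in> I"
    and W1: "0 < dd (1, 0) W (vS q0, q0)" and q0: "q0 \<in> \<Lambda>"
  obtains X \<eta> \<Theta> where "0 < \<eta>" "open \<Theta>" "q0 \<in> \<Theta>" "\<Theta> \<subseteq> \<Lambda>" "smooth_on X ({-\<eta><..<\<eta>} \<times> \<Theta>)"
    "\<And>z q. z \<in> {-\<eta><..<\<eta>} \<Longrightarrow> q \<in> \<Theta> \<Longrightarrow> X (z, q) \<in> I"
    "\<And>z q. z \<in> {-\<eta><..<\<eta>} \<Longrightarrow> q \<in> \<Theta> \<Longrightarrow> W (X (z, q), q) = W (vS q, q) + z"
    "\<And>z q. z \<in> {-\<eta><..<\<eta>} \<Longrightarrow> q \<in> \<Theta> \<Longrightarrow> 0 < dd (1, 0) X (z, q)"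
    "\<And>q. q \<in> \<Theta> \<Longrightarrow> X (0, q) = vS q"
proof -
  have op\<Lambda>: "open ((UNIV::real set) \<times> \<Lambda>)" "open (I \<times> \<Lambda>)" using \<Lambda> I by (auto intro: open_Times)
  define \<Psi> where "\<Psi> p = W p - W (vS (snd p), snd p)" for p
  have sG: "smooth_on (\<lambda>p. (vS (snd p), snd p)) ((UNIV::real set) \<times> \<Lambda>)" 
    by (rule smooth_on_Pair[OF op\<Lambda>(1) smooth_on_compose[OF op\<Lambda>(1) \<Lambda> vS(1) smooth_on_snd] smooth_on_snd]) auto
  have sWS: "smooth_on (\<lambda>p. W (vS (snd p), snd p)) (I \<times> \<Lambda>)"
    by (rule smooth_on_compose[OF op\<Lambda>(2) op\<Lambda>(2) W smooth_on_subset[OF sG]]) (use vS(2) in auto)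
  have \<Psi>: "smooth_on \<Psi> (I \<times> \<Lambda>)"
    unfolding \<Psi>_def by (rule smooth_on_diff[OF op\<Lambda>(2) W sWS])
  have q0S: "(vS q0, q0) \<in> I \<times> \<Lambda>" using vS(2) q0 by simp
  have \<Psi>': "dd (1, 0) \<Psi> (v, q) = dd (1, 0) W (v, q)" if "(v, q) \<in> I \<times> \<Lambda>" for v q
  proof -
    have "((\<lambda>v. W (v, q) - W (vS q, q)) has_real_derivative dd (1, 0) W (v, q) - 0) (at v)"
      by (rule DERIV_diff[OF dd_fst_line[OF W that] DERIV_const])
    moreover have "((\<lambda>v. W (v, q) - W (vS q, q)) has_real_derivative dd (1, 0) \<Psi> (v, q)) (at v)"
      using dd_fst_line[OF \<Psi> that] by (simp add: \<Psi>_def)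
    ultimately have "dd (1, 0) W (v, q) - 0 = dd (1, 0) \<Psi> (v, q)" by (rule DERIV_unique)
    then show ?thesis by simp
  qed
  have nz: "dd (1, 0) \<Psi> (vS q0, q0) \<noteq> 0" using \<Psi>'[OF q0S] W1 by simp
  obtain U V X where UV: "open U" "U \<subseteq> I \<times> \<Lambda>" "(vS q0, q0) \<in> U" "open V" "(\<Psi> (vS q0, q0), snd (vS q0, q0)) \<in> V" "smooth_on X V"
    and X: "\<And>y q. (y, q) \<in> V \<Longrightarrow> (X (y, q), q) \<in> U \<and> \<Psi> (X (y, q), q) = y"
    and X': "\<And>v q. (v, q) \<in> U \<Longrightarrow> (\<Psi> (v, q), q) \<in> V \<and> X (\<Psi> (v, q), q) = v"
    by (rule implicit_function[OF op\<Lambda>(2) \<Psi> q0S nz], rule that)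
  have q0V: "(0, q0) \<in> V" using UV(5) by (simp add: \<Psi>_def)
  have X0: "X (0, q) = vS q" if "(vS q, q) \<in> U" for q using X'[OF that] by (simp add: \<Psi>_def)
  have "0 < dd (1, 0) X (0, q0)"
  proof -
    have "((\<lambda>y. \<Psi> (X (y, q0), q0)) has_real_derivative dd (1, 0) \<Psi> (X (0, q0), q0) * dd (1, 0) X (0, q0)) (at 0)"
      by (rule DERIV_chain2[where g = "\<lambda>y. X (y, q0)", OF dd_fst_line[OF \<Psi>] dd_fst_line[OF UV(6) q0V]]) (use X0[OF UV(3)] q0S in simp)
    then have "((\<lambda>y. y) has_real_derivative dd (1, 0) \<Psi> (X (0, q0), q0) * dd (1, 0) X (0, q0)) (at 0)"
    proof (rule has_field_derivative_transform_within_open)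
      show "open ((\<lambda>y. (y, q0)) -` V)" by (rule open_vimage[OF UV(4)]) (auto intro: continuous_intros)
    qed (use q0V X in auto)
    then have "dd (1, 0) \<Psi> (X (0, q0), q0) * dd (1, 0) X (0, q0) = 1" using DERIV_ident DERIV_unique by blast
    then show ?thesis using \<Psi>'[OF q0S] X0[OF UV(3)] W1 by (metis zero_less_mult_pos zero_less_one)
  qed
  then have "eventually (\<lambda>p. p \<in> V \<and> 0 < dd (1, 0) X p) (nhds (0, q0))"
    by (rule eventually_nhds_gt[OF UV(4) smooth_on_continuous_on[OF smooth_on_dd[OF UV(6)]] q0V])
  moreover have "eventually (\<lambda>p. p \<in> UNIV \<times> \<Lambda> \<and> (\<lambda>p. p \<in> U) (vS (snd p), snd p)) (nhds (0::real, q0))"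
    by (rule eventually_nhds_compose[where P = "\<lambda>p. p \<in> U", OF op\<Lambda>(1) smooth_on_continuous_on[OF sG]])
      (use UV q0 in \<open>auto intro!: eventually_nhds_in_open\<close>)
  ultimately have ev3: "eventually (\<lambda>p. (p \<in> V \<and> 0 < dd (1, 0) X p) \<and> (p \<in> UNIV \<times> \<Lambda> \<and> (\<lambda>p. p \<in> U) (vS (snd p), snd p))) (nhds (0, q0))"
    by (rule eventually_conj)
  obtain \<eta> \<Theta> where b3: "0 < \<eta>" "open \<Theta>" "q0 \<in> \<Theta>"
    and b3': "\<And>y q. y \<in> {-\<eta><..<\<eta>} \<Longrightarrow> q \<in> \<Theta> \<Longrightarrow> ((y, q) \<in> V \<and> 0 < dd (1, 0) X (y, q)) \<and>
      ((y, q) \<in> UNIV \<times> \<Lambda> \<and> (\<lambda>p. p \<in> U) (vS (snd (y, q)), snd (y, q)))"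
    by (rule eventually_nhds_prod_box[OF ev3], rule that)
  show ?thesis
  proof (rule that[of \<eta> \<Theta> X])
    show "smooth_on X ({-\<eta><..<\<eta>} \<times> \<Theta>)" by (rule smooth_on_subset[OF UV(6)]) (use b3' in auto)
    show "\<Theta> \<subseteq> \<Lambda>" using b3'[of 0] b3(1) by auto
    show "X (0, q) = vS q" if "q \<in> \<Theta>" for q using X0 b3'[of 0 q] that b3(1) by simp
    fix y q assume yq: "y \<in> {-\<eta><..<\<eta>}" "q \<in> \<Theta>"
    show "X (y, q) \<in> I" "W (X (y, q), q) = W (vS q, q) + y" "0 < dd (1, 0) X (y, q)"
      using b3'[OF yq] X[of y q] UV(2) by (auto simp: \<Psi>_def)
  qed (use b3 in auto)
qed

section \<open>Expansion of the action at the saddle\<close>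

text \<open>Near the saddle value the action splits into the two end pieces, where the coordinates
  \<open>y\<close> and \<open>u\<close> with \<open>W = \<mu>\<^sub>s - y\<^sup>2\<close> and \<open>W = \<mu>\<^sub>s - u\<close> straighten the potential, and a regular
  middle piece; only the piece at the saddle produces a logarithm. The case \<open>m = 0\<close> is the
  momentum.\<close>

lemma action_expansion:
  fixes W :: "real \<times> 'q::euclidean_space \<Rightarrow> real"
  assumes I: "open I" "is_interval I" and \<Lambda>: "open \<Lambda>" and W: "smooth_on W (I \<times> \<Lambda>)"
    and \<kappa>: "smooth_on \<kappa> I" "\<And>v. v \<in> I \<Longrightarrow> 0 < \<kappa> v"
    and vs: "smooth_on vs \<Lambda>" "\<And>q. q \<in> \<Lambda> \<Longrightarrow> vs q \<in> I"
    and v0: "smooth_on v0 \<Lambda>" and vS: "smooth_on vS \<Lambda>" "\<And>q. q \<in> \<Lambda> \<Longrightarrow> vS q \<in> I"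
    and W1: "\<And>q. q \<in> \<Lambda> \<Longrightarrow> dd (1, 0) W (vs q, q) = 0"
    and W2: "\<And>q. q \<in> \<Lambda> \<Longrightarrow> dd (1, 0) (dd (1, 0) W) (vs q, q) < 0"
    and ord: "\<And>q. q \<in> \<Lambda> \<Longrightarrow> vs q < v0 q" "\<And>q. q \<in> \<Lambda> \<Longrightarrow> v0 q < vS q"
    and eqW: "\<And>q. q \<in> \<Lambda> \<Longrightarrow> W (vS q, q) = W (vs q, q)"
    and neg: "\<And>q v. q \<in> \<Lambda> \<Longrightarrow> v \<in> {vs q<..<v0 q} \<Longrightarrow> dd (1, 0) W (v, q) < 0"
    and pos: "\<And>q v. q \<in> \<Lambda> \<Longrightarrow> v \<in> {v0 q<..vS q} \<Longrightarrow> 0 < dd (1, 0) W (v, q)" and q0: "q0 \<in> \<Lambda>"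
  obtains X X3 \<eta> \<Theta> C B where "0 < \<eta>" "open \<Theta>" "q0 \<in> \<Theta>" "\<Theta> \<subseteq> \<Lambda>"
    "smooth_on X ({-\<eta><..<\<eta>} \<times> \<Theta>)" "smooth_on X3 ({-\<eta>\<^sup>2<..<\<eta>\<^sup>2} \<times> \<Theta>)"
    "\<And>y q. y \<in> {-\<eta><..<\<eta>} \<Longrightarrow> q \<in> \<Theta> \<Longrightarrow> X (y, q) \<in> I \<and> X (y, q) < v0 q \<and>
      W (X (y, q), q) = W (vs q, q) - y\<^sup>2 \<and> 0 < dd (1, 0) X (y, q)"
    "\<And>q. q \<in> \<Theta> \<Longrightarrow> X (0, q) = vs q \<and> X3 (0, q) = vS q"
    "\<And>m q. m \<in> {-\<eta>\<^sup>2<..<\<eta>\<^sup>2} \<Longrightarrow> q \<in> \<Theta> \<Longrightarrow> X3 (m, q) \<in> I \<and> v0 q < X3 (m, q) \<and>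
      W (X3 (m, q), q) = W (vs q, q) - m \<and> dd (1, 0) X3 (m, q) < 0"
    "smooth_on C (UNIV \<times> \<Theta>)" "Ck_on 3 B ({-\<eta>\<^sup>2<..<\<eta>\<^sup>2} \<times> \<Theta>)"
    "\<And>m q. m \<in> {0..<\<eta>\<^sup>2} \<Longrightarrow> q \<in> \<Theta> \<Longrightarrow>
      2 * integral {X (sqrt m, q)..X3 (m, q)} (\<lambda>v. sqrt (2 * \<kappa> v * (W (vs q, q) - m - W (v, q)))) =
      (sqrt (2 * \<kappa> (vs q)) * dd (1, 0) X (0, q) / 2 * m + m\<^sup>2 * C (m, q)) * ln m + B (m, q)"
    "\<And>q. q \<in> \<Theta> \<Longrightarrow>
      C (0, q) = dd (1, 0) (dd (1, 0) (\<lambda>p. sqrt (2 * \<kappa> (X p)) * dd (1, 0) X p)) (0, q) / 16"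
proof -
  have segm: "{a..b} \<subseteq> I" if "a \<in> I" "b \<in> I" for a b
    using mem_is_interval_1_I[OF I(2) that] by auto
  obtain X \<eta>1 \<Theta>1 where b1: "0 < \<eta>1" "open \<Theta>1" "q0 \<in> \<Theta>1" "\<Theta>1 \<subseteq> \<Lambda>" "smooth_on X ({-\<eta>1<..<\<eta>1} \<times> \<Theta>1)"
    and XI: "\<And>y q. y \<in> {-\<eta>1<..<\<eta>1} \<Longrightarrow> q \<in> \<Theta>1 \<Longrightarrow> X (y, q) \<in> I"
    and XW: "\<And>y q. y \<in> {-\<eta>1<..<\<eta>1} \<Longrightarrow> q \<in> \<Theta>1 \<Longrightarrow> W (X (y, q), q) = W (vs q, q) - y\<^sup>2"
    and X': "\<And>y q. y \<in> {-\<eta>1<..<\<eta>1} \<Longrightarrow> q \<in> \<Theta>1 \<Longrightarrow> 0 < dd (1, 0) X (y, q)"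
    and X0: "\<And>q. q \<in> \<Theta>1 \<Longrightarrow> X (0, q) = vs q"
    by (rule left_coordinate[OF I(1) \<Lambda> W vs W1 W2 q0], assumption, assumption, assumption, rule that)
  have W1S: "0 < dd (1, 0) W (vS q0, q0)" using pos[OF q0] ord[OF q0] by simp
  obtain Z \<eta>2 \<Theta>2 where b2: "0 < \<eta>2" "open \<Theta>2" "q0 \<in> \<Theta>2" "\<Theta>2 \<subseteq> \<Lambda>" "smooth_on Z ({-\<eta>2<..<\<eta>2} \<times> \<Theta>2)"
    and ZI: "\<And>z q. z \<in> {-\<eta>2<..<\<eta>2} \<Longrightarrow> q \<in> \<Theta>2 \<Longrightarrow> Z (z, q) \<in> I"
    and ZW: "\<And>z q. z \<in> {-\<eta>2<..<\<eta>2} \<Longrightarrow> q \<in> \<Theta>2 \<Longrightarrow> W (Z (z, q), q) = W (vS q, q) + z"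
    and Z': "\<And>z q. z \<in> {-\<eta>2<..<\<eta>2} \<Longrightarrow> q \<in> \<Theta>2 \<Longrightarrow> 0 < dd (1, 0) Z (z, q)"
    and Z0: "\<And>q. q \<in> \<Theta>2 \<Longrightarrow> Z (0, q) = vS q"
    by (rule right_coordinate[OF I(1) \<Lambda> W vS W1S q0], assumption, rule that)
  define S1 where "S1 = {-\<eta>1<..<\<eta>1} \<times> \<Theta>1"
  define S2 where "S2 = {-\<eta>2<..<\<eta>2} \<times> \<Theta>2"
  have S: "open S1" "open S2" using b1 b2 by (auto simp: S1_def S2_def intro: open_Times_interval)
  note sX = b1(5)[folded S1_def] and sZ = b2(5)[folded S2_def]
  have v0S: "smooth_on (\<lambda>p. v0 (snd p)) S1" "smooth_on (\<lambda>p. v0 (snd p)) S2"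
    by (rule smooth_on_compose[OF _ \<Lambda> v0 smooth_on_snd]; use S b1 b2 in \<open>auto simp: S1_def S2_def\<close>)+
  have "eventually (\<lambda>p. p \<in> S1 \<and> 0 < v0 (snd p) - X p) (nhds (0, q0))"
    by (rule eventually_nhds_gt[OF S(1) continuous_on_diff[OF smooth_on_continuous_on[OF v0S(1)] smooth_on_continuous_on[OF sX]]])
      (use b1 ord(1)[OF q0] X0[OF b1(3)] in \<open>auto simp: S1_def\<close>)
  moreover have "eventually (\<lambda>p. p \<in> S2 \<and> 0 < Z p - v0 (snd p)) (nhds (0, q0))"
    by (rule eventually_nhds_gt[OF S(2) continuous_on_diff[OF smooth_on_continuous_on[OF sZ] smooth_on_continuous_on[OF v0S(2)]]])
      (use b2 ord(2)[OF q0] Z0[OF b2(3)] in \<open>auto simp: S2_def\<close>)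
  ultimately have ev: "eventually (\<lambda>p. (p \<in> S1 \<and> 0 < v0 (snd p) - X p) \<and> (p \<in> S2 \<and> 0 < Z p - v0 (snd p))) (nhds (0, q0))"
    by (rule eventually_conj)
  obtain \<delta> \<Theta> where b3: "0 < \<delta>" "open \<Theta>" "q0 \<in> \<Theta>"
    and b3': "\<And>y q. y \<in> {-\<delta><..<\<delta>} \<Longrightarrow> q \<in> \<Theta> \<Longrightarrow> ((y, q) \<in> S1 \<and> 0 < v0 (snd (y, q)) - X (y, q)) \<and>
      ((y, q) \<in> S2 \<and> 0 < Z (y, q) - v0 (snd (y, q)))"
    by (rule eventually_nhds_prod_box[OF ev], rule that)
  \<comment> \<open>Halving \<open>min \<delta> 1\<close> ensures both \<eta> < \<delta> for the
    coordinate y and \<open>\<eta>\<^sup>2 < \<delta>\<close> for the level m = y^2, so that one box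
    serves both ends.\<close>
  define \<eta> where "\<eta> = min \<delta> 1 / 2"
  have \<eta>: "0 < \<eta>" "\<eta> < \<delta>" "\<eta>\<^sup>2 < \<delta>"
  proof -
    show "0 < \<eta>" "\<eta> < \<delta>" using b3(1) by (auto simp: \<eta>_def min_def)
    have "\<eta>\<^sup>2 \<le> \<eta> * 1" unfolding power2_eq_square by (rule mult_left_mono) (use b3(1) in \<open>auto simp: \<eta>_def\<close>)
    then show "\<eta>\<^sup>2 < \<delta>" using \<open>\<eta> < \<delta>\<close> by simp
  qed
  have \<Theta>: "\<Theta> \<subseteq> \<Lambda>" "\<Theta> \<subseteq> \<Theta>1" "\<Theta> \<subseteq> \<Theta>2" using b3'[of 0] b3(1) b1(4) by (auto simp: S1_def S2_def)
  have sub1: "{-\<delta><..<\<delta>} \<times> \<Theta> \<subseteq> S1" and sub2: "{-\<delta><..<\<delta>} \<times> \<Theta> \<subseteq> S2" using b3' by auto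
  have sXd: "smooth_on X ({-\<delta><..<\<delta>} \<times> \<Theta>)" and sZd: "smooth_on Z ({-\<delta><..<\<delta>} \<times> \<Theta>)"
    using smooth_on_subset sX sZ sub1 sub2 by blast+
  have X: "X (y, q) \<in> I" "X (y, q) < v0 q" "W (X (y, q), q) = W (vs q, q) - y\<^sup>2" "0 < dd (1, 0) X (y, q)"
    if "y \<in> {-\<delta><..<\<delta>}" "q \<in> \<Theta>" for y q
    using b3'[OF that] XI[of y q] XW[of y q] X'[of y q] by (auto simp: S1_def)
  \<comment> \<open>The coordinate z of the right end increases with the potential; the level
    \<mu>_s - m is reached at z = - m.\<close>
  define X3 where "X3 p = Z (- fst p, snd p)" for p
  have Z: "Z (z, q) \<in> I" "v0 q < Z (z, q)" "W (Z (z, q), q) = W (vs q, q) + z" "0 < dd (1, 0) Z (z, q)"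
    if "z \<in> {-\<delta><..<\<delta>}" "q \<in> \<Theta>" for z q
    using b3'[OF that] ZI[of z q] ZW[of z q] Z'[of z q] eqW[of q] that \<Theta> by (auto simp: S2_def)
  have mono: "F (a, q) < F (b, q)" if "smooth_on F ({-\<delta><..<\<delta>} \<times> \<Theta>)"
    "\<And>y. y \<in> {-\<delta><..<\<delta>} \<Longrightarrow> 0 < dd (1, 0) F (y, q)" "q \<in> \<Theta>" "a < b" "a \<in> {-\<delta><..<\<delta>}" "b \<in> {-\<delta><..<\<delta>}"
    for F :: "real \<times> 'q \<Rightarrow> real" and a b q
  proof (rule DERIV_pos_imp_increasing[OF that(4)])
    fix y assume "a \<le> y" "y \<le> b"
    then have "y \<in> {-\<delta><..<\<delta>}" using that(5,6) by auto
    then show "\<exists>d. ((\<lambda>y. F (y, q)) has_real_derivative d) (at y) \<and> 0 < d"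
      using dd_fst_line[OF that(1), of y q] that(2)[of y] that(3) by blast
  qed
  have Xmono: "X (a, q) < X (b, q)" if "q \<in> \<Theta>" "a < b" "a \<in> {-\<delta><..<\<delta>}" "b \<in> {-\<delta><..<\<delta>}" for a b q
    by (rule mono[OF sXd]) (use that X in auto)
  have Zmono: "Z (a, q) < Z (b, q)" if "q \<in> \<Theta>" "a < b" "a \<in> {-\<delta><..<\<delta>}" "b \<in> {-\<delta><..<\<delta>}" for a b q
    by (rule mono[OF sZd]) (use that Z in auto)
  let ?D = "{-\<eta>\<^sup>2<..<\<eta>\<^sup>2} \<times> \<Theta>"
  have opD: "open ?D" "open ((UNIV::real set) \<times> \<Theta>)" using b3(2) by (auto intro: open_Times_interval open_Times)
  define K where "K v = sqrt (2 * \<kappa> v)" for v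
  have sK: "smooth_on K I"
    unfolding K_def by (intro smooth_on_sqrt smooth_on_mult smooth_on_const I \<kappa>) (use \<kappa>(2) in auto)
  have opd: "open ({-\<delta><..<\<delta>} \<times> \<Theta>)" using b3(2) by (rule open_Times_interval)

  \<comment> \<open>Under v = X (y, q) the radicand becomes 2 \<kappa> (v) (y^2 - m), so \<phi>
    collects everything that does not depend on m.\<close>
  define \<phi> where "\<phi> p = K (X p) * dd (1, 0) X p" for p
  have s\<phi>: "smooth_on \<phi> ({-\<delta><..<\<delta>} \<times> \<Theta>)"
    unfolding \<phi>_def by (rule smooth_on_mult[OF opd smooth_on_compose[OF opd I(1) sK sXd] smooth_on_dd[OF sXd]])
      (use X in auto)
  obtain C B1 where C: "smooth_on C (UNIV \<times> \<Theta>)" and B1: "Ck_on 3 B1 ?D"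
    and left: "\<And>m q. m \<in> {0..<\<eta>\<^sup>2} \<Longrightarrow> q \<in> \<Theta> \<Longrightarrow> ((\<lambda>y. \<phi> (y, q) * sqrt (y\<^sup>2 - m)) has_integral
      (\<phi> (0, q) / 4 * m + m\<^sup>2 * C (m, q)) * ln m + B1 (m, q)) {sqrt m..\<eta>}"
    and C0: "\<And>q. q \<in> \<Theta> \<Longrightarrow> C (0, q) = dd (1, 0) (dd (1, 0) \<phi>) (0, q) / 32"
    by (rule log_sqrt_integral[OF b3(2) \<eta>(1,2) s\<phi>], rule that)

  define k3 where "k3 p = K (X3 p) * dd (1, 0) Z (- fst p, snd p)" for p
  have refl: "smooth_on (\<lambda>p::real\<times>'q. (- fst p, snd p)) S" for S :: "(real\<times>'q) set"
    by (rule smooth_onI, rule Ck_on_bounded_linear) (intro bounded_linear_Pair bounded_linear_minus bounded_linear_fst bounded_linear_snd)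
  have sX3: "smooth_on X3 ({-\<delta><..<\<delta>} \<times> \<Theta>)"
    unfolding X3_def by (rule smooth_on_compose[OF opd opd sZd refl]) auto
  have "smooth_on k3 ({-\<delta><..<\<delta>} \<times> \<Theta>)"
    unfolding k3_def
    by (rule smooth_on_mult[OF opd smooth_on_compose[OF opd I(1) sK sX3] smooth_on_compose[OF opd opd smooth_on_dd[OF sZd] refl]])
      (use Z in \<open>auto simp: X3_def\<close>)
  then have k3: "Ck_on 3 k3 ({-\<eta>\<^sup>2<..<\<delta>} \<times> \<Theta>)"
    by (rule smooth_onD[OF smooth_on_subset]) (use \<eta> in auto)
  obtain B2 where B2: "Ck_on 3 B2 ?D" and right: "\<And>m q. m \<in> {-\<eta>\<^sup>2<..<\<eta>\<^sup>2} \<Longrightarrow> q \<in> \<Theta> \<Longrightarrow>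
      integral {m..\<eta>\<^sup>2} (\<lambda>u. k3 (u, q) * sqrt (u - m)) = B2 (m, q)"
    by (rule abel_integral_param[OF b3(2) \<eta>(3) k3], rule that)

  \<comment> \<open>The interval is cut at the two points on the level \<mu>_s - \<eta>^2. They
    depend on q alone, so m enters only the outer limits and the radicand.\<close>
  define l where "l q = X (\<eta>, q)" for q
  define r where "r q = Z (- \<eta>\<^sup>2, q)" for q
  have \<eta>in: "\<eta> \<in> {-\<delta><..<\<delta>}" "0 \<in> {-\<delta><..<\<delta>}" "- \<eta>\<^sup>2 \<in> {-\<delta><..<\<delta>}" using \<eta> by (auto intro: less_le_trans[of _ 0])
  have lr: "vs q < l q" "l q < v0 q" "v0 q < r q" "r q < vS q" "l q \<in> I" "r q \<in> I" if "q \<in> \<Theta>" for q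
  proof -
    have "X (0, q) < l q" using Xmono[OF that \<eta>(1) \<eta>in(2,1)] by (simp add: l_def)
    then show "vs q < l q" using X0 that \<Theta> by auto
    have "r q < Z (0, q)" unfolding r_def by (rule Zmono[OF that _ \<eta>in(3,2)]) (use \<eta>(1) in simp)
    then show "r q < vS q" using Z0 that \<Theta> by auto
  qed (use X[OF \<eta>in(1) that] Z[OF \<eta>in(3) that] in \<open>simp_all add: l_def r_def\<close>)
  have slr: "smooth_on l \<Theta>" "smooth_on r \<Theta>"
    unfolding l_def r_def
    by (rule smooth_on_compose[OF b3(2) opd sXd smooth_on_Pair[OF b3(2) smooth_on_const smooth_on_id]]
        smooth_on_compose[OF b3(2) opd sZd smooth_on_Pair[OF b3(2) smooth_on_const smooth_on_id]]; use \<eta>in in force)+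
  \<comment> \<open>The potential falls from \<open>l\<close> to the minimum and rises from there to
    \<open>r\<close>, so it stays at or below the cut level. For m < \<eta>^2 the radicand of the
    middle piece is therefore strictly positive.\<close>
  have Wmid: "W (v, q) \<le> W (vs q, q) - \<eta>\<^sup>2" if "v \<in> {l q..r q}" "q \<in> \<Theta>" for v q
  proof -
    have q: "q \<in> \<Lambda>" using that \<Theta> by auto
    have inI: "v \<in> I" if "vs q \<le> v" "v \<le> vS q" for v
      using segm[OF vs(2)[OF q] vS(2)[OF q]] that by auto
    have der: "((\<lambda>v. W (v, q)) has_real_derivative dd (1, 0) W (v, q)) (at v)" if "v \<in> I" for v
      using dd_fst_line[OF W] that q by auto
    have cont: "continuous_on {a..b} (\<lambda>v. W (v, q))" if "vs q \<le> a" "b \<le> vS q" for a b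
    proof (rule continuous_at_imp_continuous_on, rule ballI)
      fix x assume "x \<in> {a..b}"
      then have "x \<in> I" using that by (intro inI) auto
      then show "isCont (\<lambda>v. W (v, q)) x" by (rule DERIV_isCont[OF der])
    qed
    show ?thesis
    proof (cases "v \<le> v0 q")
      case True
      have "W (v, q) \<le> W (l q, q)"
      proof (cases "l q = v")
        case False
        then have "l q < v" using that by auto
        then have "W (v, q) < W (l q, q)"
        proof (rule DERIV_neg_imp_decreasing_open)
          fix x assume "l q < x" "x < v"
          then have "x \<in> {vs q<..<v0 q}" using lr[OF that(2)] True by auto
          then show "\<exists>d. ((\<lambda>v. W (v, q)) has_real_derivative d) (at x) \<and> d < 0"
            using neg[OF q] der inI[of x] ord[OF q] by (intro exI[of _ "dd (1, 0) W (x, q)"]) auto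
        qed (use cont lr[OF that(2)] True ord[OF q] in auto)
        then show ?thesis by simp
      qed simp
      then show ?thesis using X(3)[OF \<eta>in(1) that(2)] by (simp add: l_def)
    next
      case False
      have "W (v, q) \<le> W (r q, q)"
      proof (cases "r q = v")
        case False
        then have "v < r q" using that by auto
        then have "W (v, q) < W (r q, q)"
        proof (rule DERIV_pos_imp_increasing_open)
          fix x assume "v < x" "x < r q"
          then have "x \<in> {v0 q<..vS q}" using lr[OF that(2)] \<open>\<not> v \<le> v0 q\<close> by auto
          then show "\<exists>d. ((\<lambda>v. W (v, q)) has_real_derivative d) (at x) \<and> 0 < d"
            using pos[OF q] der inI[of x] ord[OF q] by (intro exI[of _ "dd (1, 0) W (x, q)"]) auto
        qed (use cont lr[OF that(2)] \<open>\<not> v \<le> v0 q\<close> ord[OF q] in auto)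
        then show ?thesis by simp
      qed simp
      then show ?thesis using Z(3)[OF \<eta>in(3) that(2)] by (simp add: r_def)
    qed
  qed
  have mid: "\<exists>B3. Ck_on 3 B3 ?D \<and> (\<forall>(m, q)\<in>?D. integral {l q..r q} (\<lambda>v. sqrt (2 * \<kappa> v * (W (vs q, q) - m - W (v, q)))) = B3 (m, q))"
  proof -
    define O1 where "O1 = ((UNIV::real set) \<times> \<Theta>) \<times> (UNIV::real set)"
    define G where "G x = l (snd (fst x)) + (r (snd (fst x)) - l (snd (fst x))) * snd x" for x :: "(real \<times> 'q) \<times> real"
    have opO1: "open O1" using b3(2) by (auto simp: O1_def intro!: open_Times)
    have sq1: "smooth_on (\<lambda>x::(real \<times> 'q) \<times> real. snd (fst x)) S" "smooth_on (\<lambda>x::(real \<times> 'q) \<times> real. fst (fst x)) S" for S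
      by (rule smooth_onI, rule Ck_on_bounded_linear, intro bounded_linear_compose[OF bounded_linear_snd bounded_linear_fst, unfolded o_def]
        bounded_linear_compose[OF bounded_linear_fst bounded_linear_fst, unfolded o_def])+
    have slr1: "smooth_on (\<lambda>x. l (snd (fst x))) O1" "smooth_on (\<lambda>x. r (snd (fst x))) O1"
      by (rule smooth_on_compose[OF opO1 b3(2) _ sq1(1)]; use slr in \<open>auto simp: O1_def\<close>)+
    have sG: "smooth_on G O1"
      unfolding G_def by (rule smooth_on_add[OF opO1 slr1(1) smooth_on_mult[OF opO1 smooth_on_diff[OF opO1 slr1(2,1)] smooth_on_snd]])
    define O2 where "O2 = G -` I \<inter> O1"
    have opO2: "open O2" unfolding O2_def
      using continuous_on_open_vimage[OF opO1, of G] smooth_on_continuous_on[OF sG] I(1) by blast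
    define P where "P x = W (vs (snd (fst x)), snd (fst x)) - fst (fst x) - W (G x, snd (fst x))" for x
    have opIL: "open (I \<times> \<Lambda>)" using I \<Lambda> by (rule_tac open_Times)
    have svs1: "smooth_on (\<lambda>x. vs (snd (fst x))) O2"
      by (rule smooth_on_compose[OF opO2 \<Lambda> vs(1) sq1(1)]) (use \<Theta> in \<open>auto simp: O1_def O2_def\<close>)
    have sP: "smooth_on P O2"
      unfolding P_def
    proof (rule smooth_on_diff[OF opO2 smooth_on_diff[OF opO2 _ sq1(2)]])
      show "smooth_on (\<lambda>x. W (vs (snd (fst x)), snd (fst x))) O2"
        by (rule smooth_on_compose[OF opO2 opIL W smooth_on_Pair[OF opO2 svs1 sq1(1)]])
          (use \<Theta> vs(2) in \<open>auto simp: O1_def O2_def\<close>)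
      show "smooth_on (\<lambda>x. W (G x, snd (fst x))) O2"
        by (rule smooth_on_compose[OF opO2 opIL W smooth_on_Pair[OF opO2 smooth_on_subset[OF sG] sq1(1)]])
          (use \<Theta> in \<open>auto simp: O1_def O2_def\<close>)
    qed
    \<comment> \<open>Open set on which the radicand is positive and its root smooth; by
      \<open>Wmid\<close> it contains the parameter box times the closed unit interval.\<close>
    define T where "T = P -` {0<..} \<inter> O2"
    have opT: "open T" unfolding T_def
      using continuous_on_open_vimage[OF opO2, of P] smooth_on_continuous_on[OF sP] open_greaterThan by blast
    have "T \<subseteq> O1" "T \<subseteq> O2" by (auto simp: T_def O2_def)
    have sH: "smooth_on (\<lambda>x. sqrt (2 * \<kappa> (G x) * P x)) T"
    proof (rule smooth_on_sqrt[OF opT])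
      show "smooth_on (\<lambda>x. 2 * \<kappa> (G x) * P x) T"
        by (rule smooth_on_mult[OF opT smooth_on_mult[OF opT smooth_on_const
              smooth_on_compose[OF opT I(1) \<kappa>(1) smooth_on_subset[OF sG \<open>T \<subseteq> O1\<close>]]] smooth_on_subset[OF sP \<open>T \<subseteq> O2\<close>]])
          (auto simp: T_def O2_def)
      show "0 < 2 * \<kappa> (G x) * P x" if "x \<in> T" for x
        using that \<kappa>(2)[of "G x"] by (auto simp: T_def O2_def)
    qed
    have seg: "l q + (r q - l q) * t \<in> {l q..r q}" if "q \<in> \<Theta>" "t \<in> {0..1}" for q t
    proof -
      have "(r q - l q) * t \<le> (r q - l q) * 1" using that lr[OF that(1)] by (intro mult_left_mono) auto
      moreover have "0 \<le> (r q - l q) * t" using that lr[OF that(1)] by simp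
      ultimately show ?thesis by simp
    qed
    have segI: "{l q..r q} \<subseteq> I" if "q \<in> \<Theta>" for q
      using segm lr[OF that] by blast
    have sub: "?D \<times> {0..1} \<subseteq> T"
    proof clarify
      fix m q t assume *: "m \<in> {-\<eta>\<^sup>2<..<\<eta>\<^sup>2}" "q \<in> \<Theta>" "t \<in> {0..1::real}"
      show "((m, q), t) \<in> T"
        using Wmid[OF seg[OF *(2,3)] *(2)] segI[OF *(2)] seg[OF *(2,3)] *
        by (auto simp: T_def O2_def O1_def P_def G_def)
    qed
    define B3 where "B3 p = (r (snd p) - l (snd p)) * integral {0..1} (\<lambda>t. 1 * sqrt (2 * \<kappa> (G (p, t)) * P (p, t)))" for p
    have slr2: "smooth_on (\<lambda>p. l (snd p)) ?D" "smooth_on (\<lambda>p. r (snd p)) ?D"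
      by (rule smooth_on_compose[OF opD(1) b3(2) _ smooth_on_snd]; use slr in auto)+
    have "Ck_on 3 B3 ?D"
      unfolding B3_def
      by (rule Ck_on_mult[OF opD(1) smooth_onD[OF smooth_on_diff[OF opD(1) slr2(2,1)]]
            Ck_on_integral_param[OF opD(1) continuous_on_const sub smooth_onD[OF sH]]])
    moreover have "integral {l q..r q} (\<lambda>v. sqrt (2 * \<kappa> v * (W (vs q, q) - m - W (v, q)))) = B3 (m, q)"
      if *: "m \<in> {-\<eta>\<^sup>2<..<\<eta>\<^sup>2}" "q \<in> \<Theta>" for m q
    proof -
      define g where "g t = l q + (r q - l q) * t" for t
      have "((\<lambda>t. (r q - l q) *\<^sub>R sqrt (2 * \<kappa> (g t) * (W (vs q, q) - m - W (g t, q)))) has_integral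
        integral {g 0..g 1} (\<lambda>v. sqrt (2 * \<kappa> v * (W (vs q, q) - m - W (v, q))))) {0..1}"
      proof (rule has_integral_substitution[where c = "l q" and d = "r q"])
        show "continuous_on {l q..r q} (\<lambda>v. sqrt (2 * \<kappa> v * (W (vs q, q) - m - W (v, q))))"
          by (intro continuous_intros continuous_on_subset[OF smooth_on_continuous_on[OF \<kappa>(1)] segI]
              continuous_on_compose2[OF smooth_on_continuous_on[OF W], of _ "\<lambda>v. (v, q)"])
            (use *(2) \<Theta> segI[OF *(2)] in auto)
        show "g ` {0..1} \<subseteq> {l q..r q}" unfolding g_def using seg[OF *(2)] by blast
      qed (use lr[OF *(2)] in \<open>auto simp: g_def intro!: derivative_eq_intros\<close>)
      then show ?thesis
        by (simp add: g_def has_integral_iff B3_def G_def P_def)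
    qed
    ultimately show ?thesis by blast
  qed
  then obtain B3 where B3: "Ck_on 3 B3 ?D"
    and middle: "\<And>m q. m \<in> {-\<eta>\<^sup>2<..<\<eta>\<^sup>2} \<Longrightarrow> q \<in> \<Theta> \<Longrightarrow>
      integral {l q..r q} (\<lambda>v. sqrt (2 * \<kappa> v * (W (vs q, q) - m - W (v, q)))) = B3 (m, q)"
    by blast
  define B where "B p = 2 * (B1 p + B3 p + B2 p)" for p
  show ?thesis
  proof (rule that[of \<eta> \<Theta> X X3 "\<lambda>p. 2 * C p" B])
    show "smooth_on X ({-\<eta><..<\<eta>} \<times> \<Theta>)" by (rule smooth_on_subset[OF sXd]) (use \<eta> in auto)
    show "smooth_on X3 ?D" by (rule smooth_on_subset[OF sX3]) (use \<eta> in auto)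
    show "smooth_on (\<lambda>p. 2 * C p) (UNIV \<times> \<Theta>)" by (intro smooth_on_mult smooth_on_const C opD)
    show "Ck_on 3 B ?D" unfolding B_def by (intro Ck_on_mult Ck_on_add Ck_on_const B1 B2 B3 opD)
    show "X (0, q) = vs q \<and> X3 (0, q) = vS q" if "q \<in> \<Theta>" for q
      using X0 Z0 that \<Theta> by (auto simp: X3_def)
    show "2 * C (0, q) = dd (1, 0) (dd (1, 0) (\<lambda>p. sqrt (2 * \<kappa> (X p)) * dd (1, 0) X p)) (0, q) / 16" if "q \<in> \<Theta>" for q
      using C0[OF that] by (simp add: \<phi>_def[abs_def] K_def)
    show "X (y, q) \<in> I \<and> X (y, q) < v0 q \<and> W (X (y, q), q) = W (vs q, q) - y\<^sup>2 \<and> 0 < dd (1, 0) X (y, q)"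
      if "y \<in> {-\<eta><..<\<eta>}" "q \<in> \<Theta>" for y q
      using X[of y q] that \<eta> by auto
    fix m q assume q: "q \<in> \<Theta>"
    show "X3 (m, q) \<in> I \<and> v0 q < X3 (m, q) \<and> W (X3 (m, q), q) = W (vs q, q) - m \<and> dd (1, 0) X3 (m, q) < 0"
      if "m \<in> {-\<eta>\<^sup>2<..<\<eta>\<^sup>2}"
    proof -
      have m: "- m \<in> {-\<delta><..<\<delta>}" "m \<in> {-\<delta><..<\<delta>}" using that \<eta> by auto
      have "((\<lambda>m. Z (- m, q)) has_real_derivative dd (1, 0) Z (- m, q) * - 1) (at m)"
        by (rule DERIV_chain2[where g = uminus, OF dd_fst_line[OF sZd]]) (use m q in \<open>auto intro!: derivative_eq_intros\<close>)
      moreover have "((\<lambda>m. Z (- m, q)) has_real_derivative dd (1, 0) X3 (m, q)) (at m)"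
        using dd_fst_line[OF sX3, of m q] m q by (simp add: X3_def)
      ultimately have "dd (1, 0) Z (- m, q) * - 1 = dd (1, 0) X3 (m, q)" by (rule DERIV_unique)
      then show ?thesis using Z[OF m(1) q] by (simp add: X3_def)
    qed
    assume m: "m \<in> {0..<\<eta>\<^sup>2}"
    define F where "F v = sqrt (2 * \<kappa> v * (W (vs q, q) - m - W (v, q)))" for v
    have sm: "sqrt m \<in> {-\<delta><..<\<delta>}" "sqrt m \<le> \<eta>" "0 \<le> sqrt m"
    proof -
      show "0 \<le> sqrt m" using m by simp
      show "sqrt m \<le> \<eta>" using m \<eta> by (intro real_le_lsqrt) auto
      then show "sqrt m \<in> {-\<delta><..<\<delta>}" using \<open>0 \<le> sqrt m\<close> \<eta> unfolding greaterThanLessThan_iff by linarith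
    qed
    have mm: "- m \<in> {-\<delta><..<\<delta>}" "- \<eta>\<^sup>2 \<le> - m" using m \<eta> by auto
    have q\<Lambda>: "q \<in> \<Lambda>" using q \<Theta> by auto
    have contF: "continuous_on I F"
      unfolding F_def
      by (intro continuous_intros smooth_on_continuous_on[OF \<kappa>(1)]
          continuous_on_compose2[OF smooth_on_continuous_on[OF W], of _ "\<lambda>v. (v, q)"]) (use q\<Lambda> in auto)
    have Fint: "F integrable_on {a..b}" if "a \<in> I" "b \<in> I" for a b
    proof -
      have "{a..b} \<subseteq> I" using segm that by blast
      then show ?thesis by (intro integrable_continuous_real continuous_on_subset[OF contF])
    qed
    let ?L = "X (sqrt m, q)" and ?R = "Z (- m, q)"
    have ends: "?L \<in> I" "?R \<in> I" "?L \<le> l q" "r q \<le> ?R"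
      using X[OF sm(1) q] Z[OF mm(1) q] Xmono[OF q, of "sqrt m" \<eta>] Zmono[OF q, of "- \<eta>\<^sup>2" "- m"] sm mm \<eta>in
      by (auto simp: l_def r_def le_less)
    note segI = segm
    have "((\<lambda>y. dd (1, 0) X (y, q) *\<^sub>R F (X (y, q))) has_integral integral {?L..X (\<eta>, q)} F) {sqrt m..\<eta>}"
    proof (rule has_integral_substitution[where c = ?L and d = "l q"])
      show "(\<lambda>y. X (y, q)) ` {sqrt m..\<eta>} \<subseteq> {?L..l q}"
      proof (rule image_subsetI)
        fix y assume y: "y \<in> {sqrt m..\<eta>}"
        then have "y \<in> {-\<delta><..<\<delta>}" using sm \<eta> unfolding greaterThanLessThan_iff atLeastAtMost_iff by linarith
        then show "X (y, q) \<in> {?L..l q}"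
          using Xmono[OF q, of "sqrt m" y] Xmono[OF q, of y \<eta>] y sm \<eta>in by (force simp: l_def le_less)
      qed
      show "continuous_on {?L..l q} F" by (rule continuous_on_subset[OF contF segI]) (use ends lr[OF q] in auto)
      show "((\<lambda>y. X (y, q)) has_real_derivative dd (1, 0) X (y, q)) (at y within {sqrt m..\<eta>})" if "y \<in> {sqrt m..\<eta>}" for y
      proof -
        have "y \<in> {-\<delta><..<\<delta>}" using that sm \<eta> unfolding greaterThanLessThan_iff atLeastAtMost_iff by linarith
        then show ?thesis using dd_fst_line[OF sXd, of y q] q has_field_derivative_at_within by blast
      qed
    qed (use sm ends in \<open>auto simp: l_def\<close>)
    then have "((\<lambda>y. \<phi> (y, q) * sqrt (y\<^sup>2 - m)) has_integral integral {?L..l q} F) {sqrt m..\<eta>}"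
      unfolding l_def[symmetric]
    proof (rule has_integral_eq[rotated])
      fix y assume "y \<in> {sqrt m..\<eta>}"
      then have "y \<in> {-\<delta><..<\<delta>}" using sm \<eta> unfolding greaterThanLessThan_iff atLeastAtMost_iff by linarith
      from X(3)[OF this q] have "W (vs q, q) - m - W (X (y, q), q) = y\<^sup>2 - m" by simp
      then show "dd (1, 0) X (y, q) *\<^sub>R F (X (y, q)) = \<phi> (y, q) * sqrt (y\<^sup>2 - m)"
        by (simp add: F_def \<phi>_def K_def real_sqrt_mult)
    qed
    from has_integral_unique[OF this left[OF m q]]
    have L: "integral {?L..l q} F = (\<phi> (0, q) / 4 * m + m\<^sup>2 * C (m, q)) * ln m + B1 (m, q)" .
    have "((\<lambda>z. dd (1, 0) Z (z, q) *\<^sub>R F (Z (z, q))) has_integral integral {Z (- \<eta>\<^sup>2, q)..?R} F) {- \<eta>\<^sup>2..- m}"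
    proof (rule has_integral_substitution[where c = "r q" and d = ?R])
      show "(\<lambda>y. Z (y, q)) ` {- \<eta>\<^sup>2..- m} \<subseteq> {r q..?R}"
      proof (rule image_subsetI)
        fix y assume y: "y \<in> {- \<eta>\<^sup>2..- m}"
        then have "y \<in> {-\<delta><..<\<delta>}" using mm \<eta> unfolding greaterThanLessThan_iff atLeastAtMost_iff by linarith
        then show "Z (y, q) \<in> {r q..?R}"
          using Zmono[OF q, of "- \<eta>\<^sup>2" y] Zmono[OF q, of y "- m"] y mm \<eta>in by (force simp: r_def le_less)
      qed
      show "continuous_on {r q..?R} F" by (rule continuous_on_subset[OF contF segI]) (use ends lr[OF q] in auto)
      show "((\<lambda>y. Z (y, q)) has_real_derivative dd (1, 0) Z (y, q)) (at y within {- \<eta>\<^sup>2..- m})" if "y \<in> {- \<eta>\<^sup>2..- m}" for y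
      proof -
        have "y \<in> {-\<delta><..<\<delta>}" using that mm \<eta> unfolding greaterThanLessThan_iff atLeastAtMost_iff by linarith
        then show ?thesis using dd_fst_line[OF sZd, of y q] q has_field_derivative_at_within by blast
      qed
    qed (use mm ends in \<open>auto simp: r_def\<close>)
    \<comment> \<open>Reflection u = - z turns m into the lower limit, the form in which
      \<open>abel_integral_param\<close> applies.\<close>
    then have "((\<lambda>u. dd (1, 0) Z (- u, q) *\<^sub>R F (Z (- u, q))) has_integral integral {r q..?R} F) {m..\<eta>\<^sup>2}"
      by (subst has_integral_reflect_real[symmetric]) (simp add: r_def)
    then have "((\<lambda>u. k3 (u, q) * sqrt (u - m)) has_integral integral {r q..?R} F) {m..\<eta>\<^sup>2}"
    proof (rule has_integral_eq[rotated])
      fix u assume "u \<in> {m..\<eta>\<^sup>2}"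
      then have "- u \<in> {-\<delta><..<\<delta>}" using m \<eta> by auto
      from Z(3)[OF this q] have "W (vs q, q) - m - W (Z (- u, q), q) = u - m" by simp
      then show "dd (1, 0) Z (- u, q) *\<^sub>R F (Z (- u, q)) = k3 (u, q) * sqrt (u - m)"
        by (simp add: F_def k3_def X3_def K_def real_sqrt_mult)
    qed
    then have R: "integral {r q..?R} F = B2 (m, q)"
      using right[of m q] m q \<eta> by (auto simp: has_integral_iff intro: less_le_trans[of _ 0])
    have M: "integral {l q..r q} F = B3 (m, q)"
      using middle[of m q] m q \<eta> by (auto simp: F_def[abs_def] intro: less_le_trans[of _ 0])
    have "integral {?L..?R} F = integral {?L..l q} F + integral {l q..r q} F + integral {r q..?R} F"
      using Henstock_Kurzweil_Integration.integral_combine[of ?L "l q" ?R F]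
        Henstock_Kurzweil_Integration.integral_combine[of "l q" "r q" ?R F] ends lr[OF q] Fint by auto
    moreover have "\<phi> (0, q) = sqrt (2 * \<kappa> (vs q)) * dd (1, 0) X (0, q)"
      using X0[of q] q \<Theta> by (auto simp: \<phi>_def K_def)
    ultimately show "2 * integral {X (sqrt m, q)..X3 (m, q)} (\<lambda>v. sqrt (2 * \<kappa> v * (W (vs q, q) - m - W (v, q)))) =
        (sqrt (2 * \<kappa> (vs q)) * dd (1, 0) X (0, q) / 2 * m + m\<^sup>2 * (2 * C (m, q))) * ln m + B (m, q)"
      unfolding F_def[abs_def, symmetric] X3_def fst_conv snd_conv by (simp add: L M R B_def algebra_simps)
  qed (use \<eta> b3 \<Theta> in auto)
qed

section \<open>Second-order calculus: symmetry of second derivatives, and the Hessian of Q m ln m +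
  B\<close>

lemma dd_line_at:
  fixes F :: "'a::real_normed_vector \<Rightarrow> real"
  assumes "F differentiable (at (x + t *\<^sub>R h))"
  shows "((\<lambda>t. F (x + t *\<^sub>R h)) has_real_derivative dd h F (x + t *\<^sub>R h)) (at t)"
proof -
  have "((\<lambda>s. s - t) has_real_derivative 1) (at t)" by (auto intro!: derivative_eq_intros)
  moreover have "((\<lambda>s. F ((x + t *\<^sub>R h) + s *\<^sub>R h)) has_real_derivative dd h F (x + t *\<^sub>R h)) (at (t - t))"
    using dd_line[OF assms, of h] by (simp add: has_real_derivative_iff_has_vector_derivative)
  ultimately have "((\<lambda>s. F ((x + t *\<^sub>R h) + (s - t) *\<^sub>R h)) has_real_derivative dd h F (x + t *\<^sub>R h) * 1) (at t)"
    by (rule DERIV_chain2[rotated])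
  moreover have "(x + t *\<^sub>R h) + (s - t) *\<^sub>R h = x + s *\<^sub>R h" for s by (simp add: algebra_simps)
  ultimately show ?thesis by simp
qed

text \<open>Two mean value steps: along \<open>i\<close> for the increment of \<open>F\<close> in
  direction \<open>j\<close>, then along \<open>j\<close> for the resulting difference of first
  derivatives.\<close>

lemma second_difference_mvt:
  fixes F :: "'a::real_normed_vector \<Rightarrow> real"
  assumes S: "\<And>a b. 0 \<le> a \<Longrightarrow> a \<le> s \<Longrightarrow> 0 \<le> b \<Longrightarrow> b \<le> s \<Longrightarrow> x + a *\<^sub>R i + b *\<^sub>R j \<in> S"
    and F: "Ck_on 2 F S" and s: "0 < s"
  obtains a b where "0 \<le> a" "a \<le> s" "0 \<le> b" "b \<le> s"
    "F (x + s *\<^sub>R i + s *\<^sub>R j) - F (x + s *\<^sub>R i) - F (x + s *\<^sub>R j) + F x = s * s * dd j (dd i F) (x + a *\<^sub>R i + b *\<^sub>R j)"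
proof -
  have d: "F differentiable (at y)" "dd i F differentiable (at y)" if "y \<in> S" for y
    using F that Ck_on_differentiable[OF F _ that] Ck_on_differentiable[of 1 "dd i F" S y]
    by (auto simp: numeral_2_eq_2 Ck_on_Suc_dd)
  define u where "u a = F (x + s *\<^sub>R j + a *\<^sub>R i) - F (x + a *\<^sub>R i)" for a
  have u': "(u has_real_derivative dd i F (x + s *\<^sub>R j + a *\<^sub>R i) - dd i F (x + a *\<^sub>R i)) (at a)"
    if "0 \<le> a" "a \<le> s" for a
    unfolding u_def using S[of a s] S[of a 0] that s
    by (intro DERIV_diff dd_line_at d) (simp_all add: add_ac)
  obtain a where a: "0 < a" "a < s" "u s - u 0 = (s - 0) * (dd i F (x + s *\<^sub>R j + a *\<^sub>R i) - dd i F (x + a *\<^sub>R i))"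
    using MVT2[OF s u'] by blast
  have w': "((\<lambda>b. dd i F (x + a *\<^sub>R i + b *\<^sub>R j)) has_real_derivative dd j (dd i F) (x + a *\<^sub>R i + b *\<^sub>R j)) (at b)"
    if "0 \<le> b" "b \<le> s" for b
    using S[of a b] a that s by (intro dd_line_at d) auto
  obtain b where b: "0 < b" "b < s"
    "dd i F (x + a *\<^sub>R i + s *\<^sub>R j) - dd i F (x + a *\<^sub>R i + 0 *\<^sub>R j) = (s - 0) * dd j (dd i F) (x + a *\<^sub>R i + b *\<^sub>R j)"
    using MVT2[OF s w'] by blast
  show ?thesis
    by (rule that[of a b]) (use a b in \<open>simp_all add: u_def add_ac\<close>)
qed

text \<open>The second difference over a small parallelogram is symmetric in the two directions, so
  the two mixed derivatives coincide at a pair of points close to x. If they differed at x,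
  continuity would separate them.\<close>

lemma dd_commute:
  fixes F :: "'a::real_normed_vector \<Rightarrow> real"
  assumes "open S" "Ck_on 2 F S" "x \<in> S"
  shows "dd i (dd j F) x = dd j (dd i F) x"
proof (rule ccontr)
  assume ne: "dd i (dd j F) x \<noteq> dd j (dd i F) x"
  define d where "d = \<bar>dd i (dd j F) x - dd j (dd i F) x\<bar> / 2"
  have d: "0 < d" using ne by (simp add: d_def)
  have cont: "isCont (dd k (dd l F)) x" for k l
  proof -
    have "Ck_on 0 (dd k (dd l F)) S" using assms(2) by (simp add: numeral_2_eq_2 Ck_on_Suc_dd)
    then show ?thesis using assms(1,3) by (simp add: continuous_on_eq_continuous_at)
  qed
  obtain r1 where r1: "0 < r1" "\<And>y. dist y x < r1 \<Longrightarrow> dist (dd i (dd j F) y) (dd i (dd j F) x) < d"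
    using cont d unfolding continuous_at_eps_delta dist_real_def[symmetric] by (metis dist_commute)
  obtain r2 where r2: "0 < r2" "\<And>y. dist y x < r2 \<Longrightarrow> dist (dd j (dd i F) y) (dd j (dd i F) x) < d"
    using cont d unfolding continuous_at_eps_delta dist_real_def[symmetric] by (metis dist_commute)
  obtain r3 where r3: "0 < r3" "ball x r3 \<subseteq> S" using assms open_contains_ball by blast
  define r where "r = min r1 (min r2 r3)"
  have r: "0 < r" "r \<le> r1" "r \<le> r2" "r \<le> r3" using r1 r2 r3 by (auto simp: r_def)
  \<comment> \<open>Chosen so that the parallelogram spanned by s i and s j lies within distance r
    of x; the added 1 also covers zero directions.\<close>
  define s where "s = r / (norm i + norm j + 1)"
  have n: "0 < norm i + norm j + 1" by (smt (verit) norm_ge_zero)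
  have s: "0 < s" using r n by (simp add: s_def)
  have near: "dist (x + a *\<^sub>R i + b *\<^sub>R j) x < r" if "0 \<le> a" "a \<le> s" "0 \<le> b" "b \<le> s" for a b
  proof -
    have "norm (a *\<^sub>R i + b *\<^sub>R j) \<le> norm (a *\<^sub>R i) + norm (b *\<^sub>R j)" by (rule norm_triangle_ineq)
    also have "\<dots> \<le> s * norm i + s * norm j" using that by (intro add_mono) (auto intro: mult_right_mono)
    also have "\<dots> < s * (norm i + norm j + 1)" using s by (simp add: algebra_simps)
    also have "\<dots> = r" using n by (simp add: s_def)
    finally show ?thesis by (simp add: dist_norm add.assoc)
  qed
  have inS: "x + a *\<^sub>R i + b *\<^sub>R j \<in> S" if "0 \<le> a" "a \<le> s" "0 \<le> b" "b \<le> s" for a b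
    using near[OF that] r(4) r3(2) by (auto simp: dist_commute subset_iff)
  have inS': "x + a *\<^sub>R j + b *\<^sub>R i \<in> S" if "0 \<le> a" "a \<le> s" "0 \<le> b" "b \<le> s" for a b
    using inS[OF that(3,4,1,2)] by (simp add: add_ac)
  obtain a b where 1: "0 \<le> a" "a \<le> s" "0 \<le> b" "b \<le> s"
    "F (x + s *\<^sub>R i + s *\<^sub>R j) - F (x + s *\<^sub>R i) - F (x + s *\<^sub>R j) + F x = s * s * dd j (dd i F) (x + a *\<^sub>R i + b *\<^sub>R j)"
    by (rule second_difference_mvt[OF inS assms(2) s], assumption, assumption, assumption, assumption, rule that)
  obtain a' b' where 2: "0 \<le> a'" "a' \<le> s" "0 \<le> b'" "b' \<le> s"
    "F (x + s *\<^sub>R j + s *\<^sub>R i) - F (x + s *\<^sub>R j) - F (x + s *\<^sub>R i) + F x = s * s * dd i (dd j F) (x + a' *\<^sub>R j + b' *\<^sub>R i)"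
    by (rule second_difference_mvt[OF inS' assms(2) s], assumption, assumption, assumption, assumption, rule that)
  have "s * s * dd j (dd i F) (x + a *\<^sub>R i + b *\<^sub>R j) = s * s * dd i (dd j F) (x + a' *\<^sub>R j + b' *\<^sub>R i)"
    unfolding 1(5)[symmetric] 2(5)[symmetric] by (simp add: add_ac)
  then have eq: "dd j (dd i F) (x + a *\<^sub>R i + b *\<^sub>R j) = dd i (dd j F) (x + b' *\<^sub>R i + a' *\<^sub>R j)"
    using s by (simp add: add_ac)
  have "dist (dd i (dd j F) (x + b' *\<^sub>R i + a' *\<^sub>R j)) (dd i (dd j F) x) < d"
    using near[OF 2(3,4,1,2)] r by (intro r1) simp
  moreover have "dist (dd j (dd i F) (x + a *\<^sub>R i + b *\<^sub>R j)) (dd j (dd i F) x) < d"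
    using near[OF 1(1-4)] r by (intro r2) simp
  ultimately show False unfolding eq using ne unfolding d_def dist_real_def by argo
qed

lemma dd_add: "F differentiable (at x) \<Longrightarrow> G differentiable (at x) \<Longrightarrow>
    dd h (\<lambda>x. F x + G x) x = dd h F x + dd h G x"
  by (rule dd_eqI, rule has_derivative_add) (rule has_derivative_dd, assumption)+

lemma dd_diff: "F differentiable (at x) \<Longrightarrow> G differentiable (at x) \<Longrightarrow>
    dd h (\<lambda>x. F x - G x) x = dd h F x - dd h G x"
  by (rule dd_eqI, rule has_derivative_diff) (rule has_derivative_dd, assumption)+

lemma dd_const: "dd h (\<lambda>x. c) x = 0"
  by (rule dd_eqI, rule has_derivative_const)

lemma dd_mult:
  fixes F G :: "'a::real_normed_vector \<Rightarrow> real"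
  assumes "F differentiable (at x)" "G differentiable (at x)"
  shows "dd h (\<lambda>x. F x * G x) x = F x * dd h G x + dd h F x * G x"
  by (rule dd_eqI, rule has_derivative_mult) (rule has_derivative_dd, fact assms)+

lemma has_derivative_compose_dd:
  fixes F :: "'b::real_normed_vector \<Rightarrow> 'c::real_normed_vector"
  assumes "F differentiable (at (G x))" "(G has_derivative G') (at x)"
  shows "((\<lambda>x. F (G x)) has_derivative (\<lambda>h. dd (G' h) F (G x))) (at x)"
  by (rule has_derivative_compose[OF assms(2) has_derivative_dd[OF assms(1)]])

lemma dd_ln:
  fixes F :: "'a::real_normed_vector \<Rightarrow> real"
  assumes "F differentiable (at x)" "0 < F x"
  shows "dd h (\<lambda>x. ln (F x)) x = dd h F x / F x"
  using dd_eqI[OF has_derivative_ln[OF assms(2) has_derivative_dd[OF assms(1)]], of h]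
  by (simp add: divide_inverse)

lemma hessian_eq_dd:
  fixes F :: "'a::euclidean_space \<Rightarrow> real"
  assumes "open S" "Ck_on 2 F S" "x \<in> S"
  shows "hessian F x i j = dd i (dd j F) x"
proof -
  have d: "F differentiable (at y)" if "y \<in> S" for y using Ck_on_differentiable[OF assms(2) _ that] by simp
  have "Ck_on 1 (dd j F) S" using assms(2) by (simp add: numeral_2_eq_2 Ck_on_Suc_dd)
  then have d': "dd j F differentiable (at x)" using Ck_on_differentiable assms(3) by fastforce
  have eq: "partial_deriv j F y = dd j F y" if "y \<in> S" for y by (rule partial_deriv_eq_dd[OF d[OF that]])
  show ?thesis
    unfolding hessian_def
    using partial_deriv_eq_dd[OF differentiable_cong_open[OF assms(1,3) eq d'], where h = i] dd_cong[OF assms(1,3) eq, where h = i]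
    by simp
qed

lemma hessian_cong_open:
  assumes "open S" "x \<in> S" "\<And>y. y \<in> S \<Longrightarrow> F y = G y"
  shows "hessian F x i j = hessian G x i j"
proof -
  have op: "open ((\<lambda>t. y + t *\<^sub>R h) -` S)" for y h
    by (rule open_vimage[OF assms(1)]) (intro continuous_intros)
  have eq: "partial_deriv h F' y = partial_deriv h G' y"
    if "y \<in> S" "\<And>z. z \<in> S \<Longrightarrow> F' z = G' z" for y h F' and G' :: "'a \<Rightarrow> real"
  proof -
    have "eventually (\<lambda>t. t \<in> (\<lambda>t. y + t *\<^sub>R h) -` S) (nhds 0)"
      by (rule eventually_nhds_in_open[OF op]) (use that(1) in simp)
    then have "eventually (\<lambda>t. F' (y + t *\<^sub>R h) = G' (y + t *\<^sub>R h)) (nhds 0)"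
      by (rule eventually_mono) (simp add: that(2))
    then show ?thesis unfolding partial_deriv_def by (rule deriv_cong_ev) simp
  qed
  show ?thesis unfolding hessian_def
    by (rule eq[OF assms(2)], rule eq) (use assms(3) in auto)
qed

text \<open>All singular behaviour is displayed: factors \<open>ln (m x)\<close> and 1 /
  \<open>m x\<close>. The logarithm-free middle line comes from the 1 in the derivative 1 + ln m of
  m ln m.\<close>

lemma dd_dd_log_expansion:
  fixes Q m B :: "'a::euclidean_space \<Rightarrow> real"
  assumes S: "open S" and Q: "Ck_on 2 Q S" and m: "Ck_on 2 m S" and B: "Ck_on 2 B S"
    and pos: "\<And>y. y \<in> S \<Longrightarrow> 0 < m y" and x: "x \<in> S"
  shows "dd i (dd j (\<lambda>p. Q p * (m p * ln (m p)) + B p)) x =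
      (dd i (dd j Q) x * m x + dd j Q x * dd i m x + dd i Q x * dd j m x + Q x * dd i (dd j m) x) * ln (m x)
      + (dd j Q x * dd i m x + dd i Q x * dd j m x + Q x * dd i (dd j m) x)
      + Q x * dd i m x * dd j m x / m x + dd i (dd j B) x"
proof -
  have d: "F differentiable (at y)" if "Ck_on 2 F S" "y \<in> S" for F :: "'a \<Rightarrow> real" and y
    using Ck_on_differentiable[OF that(1) _ that(2)] by simp
  have d1: "dd h F differentiable (at y)" if "Ck_on 2 F S" "y \<in> S" for F :: "'a \<Rightarrow> real" and y h
  proof -
    have "Ck_on 1 (dd h F) S" using that(1) by (simp add: numeral_2_eq_2 Ck_on_Suc_dd)
    then show ?thesis using Ck_on_differentiable that(2) by fastforce
  qed
  have L: "Ck_on 2 (\<lambda>p. ln (m p)) S" by (rule Ck_on_ln[OF S m pos])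
  have Lx: "dd h (\<lambda>p. ln (m p)) y = dd h m y / m y" if "y \<in> S" for h y
    by (rule dd_ln[OF d[OF m that] pos[OF that]])
  have mL: "Ck_on 2 (\<lambda>p. m p * ln (m p)) S" by (rule Ck_on_mult[OF S m L])
  have QmL: "Ck_on 2 (\<lambda>p. Q p * (m p * ln (m p))) S" by (rule Ck_on_mult[OF S Q mL])
  let ?G = "\<lambda>y. Q y * (dd j m y * ln (m y) + dd j m y) + dd j Q y * (m y * ln (m y)) + dd j B y"
  have G: "dd j (\<lambda>p. Q p * (m p * ln (m p)) + B p) y = ?G y" if y: "y \<in> S" for y
    using pos[OF y]
    by (simp add: dd_add[OF d[OF QmL y] d[OF B y]] dd_mult[OF d[OF Q y] d[OF mL y]] dd_mult[OF d[OF m y] d[OF L y]] Lx[OF y])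
  have "dd i (dd j (\<lambda>p. Q p * (m p * ln (m p)) + B p)) x = dd i ?G x"
    by (rule dd_cong[OF S x G])
  also have "\<dots> = Q x * (dd j m x * (dd i m x / m x) + dd i (dd j m) x * ln (m x) + dd i (dd j m) x)
      + dd i Q x * (dd j m x * ln (m x) + dd j m x)
      + (dd j Q x * (m x * (dd i m x / m x) + dd i m x * ln (m x)) + dd i (dd j Q) x * (m x * ln (m x))) + dd i (dd j B) x"
    by (simp add: dd_add dd_mult d[OF Q x] d[OF m x] d[OF L x] d1[OF Q x] d1[OF m x] d1[OF B x] Lx[OF x])
  also have "\<dots> = (dd i (dd j Q) x * m x + dd j Q x * dd i m x + dd i Q x * dd j m x + Q x * dd i (dd j m) x) * ln (m x)
      + (dd j Q x * dd i m x + dd i Q x * dd j m x + Q x * dd i (dd j m) x)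
      + Q x * dd i m x * dd j m x / m x + dd i (dd j B) x"
    using pos[OF x] by (simp add: field_simps)
  finally show ?thesis .
qed

section \<open>The Hessian of the action\<close>

lemma DERIV_eq_on_open:
  fixes F G :: "real \<Rightarrow> real"
  assumes "open S" "y \<in> S" "\<And>z. z \<in> S \<Longrightarrow> F z = G z"
    and "(F has_real_derivative F') (at y)" "(G has_real_derivative G') (at y)"
  shows "F' = G'"
  using has_field_derivative_transform_within_open[OF assms(4,1,2,3)] assms(5) DERIV_unique by blast

text \<open>The second, third and fourth derivatives of f0 (g0 y) = c - y^2, taken at y = 0 where
  \<open>f1\<close> vanishes. The earlier identities are proved on the whole interval because each
  is differentiated again.\<close>

lemma sqrt_coordinate_jets:
  fixes f0 f1 f2 f3 f4 g0 g1 g2 g3 g4 :: "real \<Rightarrow> real"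
  assumes f: "\<And>v. v \<in> I \<Longrightarrow> (f0 has_real_derivative f1 v) (at v)" "\<And>v. v \<in> I \<Longrightarrow> (f1 has_real_derivative f2 v) (at v)"
      "\<And>v. v \<in> I \<Longrightarrow> (f2 has_real_derivative f3 v) (at v)" "\<And>v. v \<in> I \<Longrightarrow> (f3 has_real_derivative f4 v) (at v)"
    and g: "\<And>y. y \<in> {-\<delta><..<\<delta>} \<Longrightarrow> (g0 has_real_derivative g1 y) (at y)" "\<And>y. y \<in> {-\<delta><..<\<delta>} \<Longrightarrow> (g1 has_real_derivative g2 y) (at y)"
      "\<And>y. y \<in> {-\<delta><..<\<delta>} \<Longrightarrow> (g2 has_real_derivative g3 y) (at y)" "\<And>y. y \<in> {-\<delta><..<\<delta>} \<Longrightarrow> (g3 has_real_derivative g4 y) (at y)"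
    and gI: "\<And>y. y \<in> {-\<delta><..<\<delta>} \<Longrightarrow> g0 y \<in> I" and eq: "\<And>y. y \<in> {-\<delta><..<\<delta>} \<Longrightarrow> f0 (g0 y) = c - y\<^sup>2"
    and \<delta>: "0 < \<delta>" and crit: "f1 (g0 0) = 0"
  shows "f2 (g0 0) * (g1 0)\<^sup>2 = - 2"
    and "f3 (g0 0) * g1 0 ^ 3 + 3 * f2 (g0 0) * g1 0 * g2 0 = 0"
    and "f4 (g0 0) * g1 0 ^ 4 + 6 * f3 (g0 0) * (g1 0)\<^sup>2 * g2 0 + 3 * f2 (g0 0) * (g2 0)\<^sup>2 + 4 * f2 (g0 0) * g1 0 * g3 0 = 0"
proof -
  let ?S = "{-\<delta><..<\<delta>}"
  have fg: "((\<lambda>y. F (g0 y)) has_real_derivative F' (g0 y) * g1 y) (at y)"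
    if "y \<in> ?S" "\<And>v. v \<in> I \<Longrightarrow> (F has_real_derivative F' v) (at v)" for F F' y
    by (rule DERIV_chain2[OF that(2)[OF gI[OF that(1)]] g(1)[OF that(1)]])
  have A: "f1 (g0 y) * g1 y = - 2 * y" if y: "y \<in> ?S" for y
  proof (rule DERIV_eq_on_open[OF _ y eq fg[OF y f(1)]])
    show "((\<lambda>y. c - y\<^sup>2) has_real_derivative - 2 * y) (at y)" by (auto intro!: derivative_eq_intros)
  qed auto
  have B: "f2 (g0 y) * g1 y * g1 y + g2 y * f1 (g0 y) = - 2" if y: "y \<in> ?S" for y
  proof (rule DERIV_eq_on_open[OF _ y A DERIV_mult[OF fg[OF y f(2)] g(2)[OF y]]])
    show "((\<lambda>y. - 2 * y) has_real_derivative - 2) (at y)" by (auto intro!: derivative_eq_intros)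
  qed auto
  have C: "f3 (g0 y) * g1 y * (g1 y * g1 y) + (g2 y * g1 y + g2 y * g1 y) * f2 (g0 y) + (g3 y * f1 (g0 y) + f2 (g0 y) * g1 y * g2 y) = 0"
    if y: "y \<in> ?S" for y
    by (rule DERIV_eq_on_open[OF _ y _ DERIV_add[OF DERIV_mult[OF fg[OF y f(3)] DERIV_mult[OF g(2)[OF y] g(2)[OF y]]]
          DERIV_mult[OF g(3)[OF y] fg[OF y f(2)]]] DERIV_const[of "- 2"]]) (use B in \<open>auto simp: mult_ac\<close>)
  have D: "(f4 (g0 y) * g1 y * (g1 y * (g1 y * g1 y)) + (g2 y * (g1 y * g1 y) + (g2 y * g1 y + g2 y * g1 y) * g1 y) * f3 (g0 y))
      + 3 * (f3 (g0 y) * g1 y * (g1 y * g2 y) + (g2 y * g2 y + g3 y * g1 y) * f2 (g0 y))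
      + (g4 y * f1 (g0 y) + f2 (g0 y) * g1 y * g3 y) = 0" if y: "y \<in> ?S" for y
    by (rule DERIV_eq_on_open[OF _ y _ DERIV_add[OF DERIV_add[OF DERIV_mult[OF fg[OF y f(4)] DERIV_mult[OF g(2)[OF y] DERIV_mult[OF g(2)[OF y] g(2)[OF y]]]]
          DERIV_cmult[of _ _ _ _ 3, OF DERIV_mult[OF fg[OF y f(3)] DERIV_mult[OF g(2)[OF y] g(3)[OF y]]]]]
          DERIV_mult[OF g(4)[OF y] fg[OF y f(2)]]] DERIV_const[of 0]])
      (use C in \<open>auto simp: algebra_simps\<close>)
  have z: "0 \<in> ?S" using \<delta> by simp
  show "f2 (g0 0) * (g1 0)\<^sup>2 = - 2" using B[OF z] crit by (simp add: power2_eq_square algebra_simps)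
  show "f3 (g0 0) * g1 0 ^ 3 + 3 * f2 (g0 0) * g1 0 * g2 0 = 0"
    using C[OF z] crit by (simp add: power3_eq_cube algebra_simps)
  show "f4 (g0 0) * g1 0 ^ 4 + 6 * f3 (g0 0) * (g1 0)\<^sup>2 * g2 0 + 3 * f2 (g0 0) * (g2 0)\<^sup>2 + 4 * f2 (g0 0) * g1 0 * g3 0 = 0"
    using D[OF z] crit by (simp add: power4_eq_xxxx power2_eq_square algebra_simps)
qed

text \<open>The parameter q stands for (c, lam). The asymptotic analysis does not depend on how the
  potential involves q; that structure enters only when the vectors are identified.\<close>

locale soliton =
  fixes W :: "real \<times> 'q::euclidean_space \<Rightarrow> real" and \<kappa> :: "real \<Rightarrow> real" and I :: "real set"
    and \<Lambda> :: "'q set" and v0 vs vS :: "'q \<Rightarrow> real"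
  assumes I: "open I" "is_interval I" and \<Lambda>: "open \<Lambda>" and W: "smooth_on W (I \<times> \<Lambda>)"
    and \<kappa>: "smooth_on \<kappa> I" "\<And>v. v \<in> I \<Longrightarrow> 0 < \<kappa> v"
    and vs: "smooth_on vs \<Lambda>" "\<And>q. q \<in> \<Lambda> \<Longrightarrow> vs q \<in> I"
    and v0: "smooth_on v0 \<Lambda>" and vS: "smooth_on vS \<Lambda>" "\<And>q. q \<in> \<Lambda> \<Longrightarrow> vS q \<in> I"
    and W1: "\<And>q. q \<in> \<Lambda> \<Longrightarrow> dd (1, 0) W (vs q, q) = 0"
    and W2: "\<And>q. q \<in> \<Lambda> \<Longrightarrow> dd (1, 0) (dd (1, 0) W) (vs q, q) < 0"
    and ord: "\<And>q. q \<in> \<Lambda> \<Longrightarrow> vs q < v0 q" "\<And>q. q \<in> \<Lambda> \<Longrightarrow> v0 q < vS q"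
    and eqW: "\<And>q. q \<in> \<Lambda> \<Longrightarrow> W (vS q, q) = W (vs q, q)"
    and neg: "\<And>q v. q \<in> \<Lambda> \<Longrightarrow> v \<in> {vs q<..<v0 q} \<Longrightarrow> dd (1, 0) W (v, q) < 0"
    and pos: "\<And>q v. q \<in> \<Lambda> \<Longrightarrow> v \<in> {v0 q<..vS q} \<Longrightarrow> 0 < dd (1, 0) W (v, q)"
begin

definition mus :: "'q \<Rightarrow> real" where "mus q = W (vs q, q)"
definition W2s :: "'q \<Rightarrow> real" where "W2s q = dd (1, 0) (dd (1, 0) W) (vs q, q)"
definition W3s :: "'q \<Rightarrow> real" where "W3s q = dd (1, 0) (dd (1, 0) (dd (1, 0) W)) (vs q, q)"
definition W4s :: "'q \<Rightarrow> real" where "W4s q = dd (1, 0) (dd (1, 0) (dd (1, 0) (dd (1, 0) W))) (vs q, q)"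
definition as :: "'q \<Rightarrow> real" where "as q = sqrt (- 2 / W2s q)"
text \<open>Closed form with a double role: it is \<phi> at y = 0, because \<open>as q\<close> is
  the y-derivative of the straightening coordinate, and it is \<open>Ys\<close>, because
  \<open>Rfun\<close> on the diagonal is half the second derivative of the potential.\<close>

definition Y :: "'q \<Rightarrow> real" where "Y q = sqrt (2 * \<kappa> (vs q)) * as q"

lemma open_IL: "open (I \<times> \<Lambda>)" using I \<Lambda> by (rule_tac open_Times)

lemma smooth_on_graph: "smooth_on (\<lambda>q. (vs q, q)) \<Lambda>"
  by (rule smooth_on_Pair[OF \<Lambda> vs(1) smooth_on_id])

lemma smooth_on_vs: "smooth_on F (I \<times> \<Lambda>) \<Longrightarrow> smooth_on (\<lambda>q. F (vs q, q)) \<Lambda>"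
  by (rule smooth_on_compose[OF \<Lambda> open_IL _ smooth_on_graph]) (auto simp: vs)

lemma dd_split:
  assumes "smooth_on F (I \<times> \<Lambda>)" "(v, q) \<in> I \<times> \<Lambda>"
  shows "dd (a, k) F (v, q) = a * dd (1, 0) F (v, q) + dd (0, k) F (v, q)"
proof -
  note lin = linear_dd[OF smooth_on_differentiable[OF assms]]
  show ?thesis
    using linear_add[OF lin, of "a *\<^sub>R (1, 0)" "(0, k)"] linear_scale[OF lin, of a "(1, 0)"] by simp
qed

lemma dd_vs_comp:
  assumes "smooth_on F (I \<times> \<Lambda>)" "q \<in> \<Lambda>"
  shows "dd k (\<lambda>q. F (vs q, q)) q = dd k vs q * dd (1, 0) F (vs q, q) + dd (0, k) F (vs q, q)"
proof -
  have q: "(vs q, q) \<in> I \<times> \<Lambda>" using assms vs by simp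
  have "((\<lambda>q. (vs q, q)) has_derivative (\<lambda>h. (dd h vs q, h))) (at q)"
    by (rule has_derivative_Pair[OF smooth_on_has_derivative[OF vs(1) assms(2)] has_derivative_ident])
  from dd_eqI[OF has_derivative_compose_dd[OF smooth_on_differentiable[OF assms(1) q] this]]
  show ?thesis by (simp add: dd_split[OF assms(1) q, of "dd k vs q" k])
qed

lemma dd_commute_W:
  fixes F :: "real \<times> 'q \<Rightarrow> real"
  assumes "smooth_on F (I \<times> \<Lambda>)" "v \<in> I" "q \<in> \<Lambda>"
  shows "dd h (dd k F) (v, q) = dd k (dd h F) (v, q)"
  by (rule dd_commute[OF open_IL smooth_onD[OF assms(1)]]) (use assms in simp)

text \<open>Envelope identity: the motion of the endstate contributes nothing at first order, since
  the potential is critical there.\<close>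

lemma dd_mus: "q \<in> \<Lambda> \<Longrightarrow> dd k mus q = dd (0, k) W (vs q, q)"
  using dd_vs_comp[OF W, of q k] W1 by (simp add: mus_def[abs_def])

text \<open>Parameter derivative of the critical-point equation for \<open>vs\<close>.\<close>

lemma dd_vs: "q \<in> \<Lambda> \<Longrightarrow> dd k vs q * W2s q = - dd (1, 0) (dd (0, k) W) (vs q, q)"
proof -
  assume q: "q \<in> \<Lambda>"
  have "dd k (\<lambda>q. dd (1, 0) W (vs q, q)) q = dd k (\<lambda>q. 0) q"
    by (rule dd_cong[OF \<Lambda> q W1])
  then show ?thesis
    using dd_vs_comp[OF smooth_on_dd[OF W] q, of k] dd_commute_W[OF W vs(2)[OF q] q, of "(0, k)" "(1, 0)"]
    by (simp add: dd_const W2s_def)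
qed

lemma dd_dd_mus:
  "q \<in> \<Lambda> \<Longrightarrow> dd k (dd l mus) q = dd k vs q * dd (1, 0) (dd (0, l) W) (vs q, q) + dd (0, k) (dd (0, l) W) (vs q, q)"
proof -
  assume q: "q \<in> \<Lambda>"
  have "dd k (dd l mus) q = dd k (\<lambda>q. dd (0, l) W (vs q, q)) q"
    by (rule dd_cong[OF \<Lambda> q dd_mus])
  then show ?thesis by (simp add: dd_vs_comp[OF smooth_on_dd[OF W] q])
qed

lemma W2s_neg: "q \<in> \<Lambda> \<Longrightarrow> W2s q < 0" using W2 by (simp add: W2s_def)

lemma smooth_W2s: "smooth_on W2s \<Lambda>"
  unfolding W2s_def by (rule smooth_on_vs[OF smooth_on_dd[OF smooth_on_dd[OF W]]])

lemma smooth_mus: "smooth_on mus \<Lambda>"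
  unfolding mus_def by (rule smooth_on_vs[OF W])

lemma smooth_\<kappa>s: "smooth_on (\<lambda>q. \<kappa> (vs q)) \<Lambda>"
  by (rule smooth_on_compose[OF \<Lambda> I(1) \<kappa>(1) vs(1) vs(2)])

lemma smooth_as: "smooth_on as \<Lambda>"
  unfolding as_def
  by (rule smooth_on_sqrt[OF \<Lambda> smooth_on_divide[OF \<Lambda> smooth_on_const smooth_W2s]])
    (use W2s_neg in \<open>auto simp: divide_neg_neg less_imp_neq\<close>)

lemma as_pos: "q \<in> \<Lambda> \<Longrightarrow> 0 < as q"
  using W2s_neg by (simp add: as_def divide_neg_neg)

lemma as_sq: "q \<in> \<Lambda> \<Longrightarrow> (as q)\<^sup>2 = - 2 / W2s q"
  using W2s_neg[of q] by (simp add: as_def divide_nonpos_neg)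

lemma smooth_Y: "smooth_on Y \<Lambda>"
  unfolding Y_def
  by (rule smooth_on_mult[OF \<Lambda> smooth_on_sqrt[OF \<Lambda> smooth_on_mult[OF \<Lambda> smooth_on_const smooth_\<kappa>s]] smooth_as])
    (use \<kappa>(2) vs(2) in simp)

lemma Y_pos: "q \<in> \<Lambda> \<Longrightarrow> 0 < Y q"
  using as_pos \<kappa>(2) vs(2) by (simp add: Y_def)

lemma Y_sq: "q \<in> \<Lambda> \<Longrightarrow> (Y q)\<^sup>2 * W2s q = - 4 * \<kappa> (vs q)"
  using \<kappa>(2)[OF vs(2)] W2s_neg[of q] by (simp add: Y_def power_mult_distrib as_sq less_imp_le)

text \<open>Differentiates the polynomial relation Y^2 W'' = - 4 \<kappa> at the endstate, which
  avoids derivatives of square roots.\<close>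

lemma dd_Y:
  assumes q: "q \<in> \<Lambda>"
  shows "2 * Y q * dd k Y q * W2s q + (Y q)\<^sup>2 * (dd k vs q * W3s q + dd (1, 0) (dd (1, 0) (dd (0, k) W)) (vs q, q)) =
    - 4 * (deriv \<kappa> (vs q) * dd k vs q)"
proof -
  note sm = smooth_on_differentiable[OF _ q]
  have "((\<lambda>q. \<kappa> (vs q)) has_derivative (\<lambda>h. deriv \<kappa> (vs q) * dd h vs q)) (at q)"
  proof -
    have "\<kappa> differentiable (at (vs q))" using smooth_on_differentiable[OF \<kappa>(1) vs(2)[OF q]] .
    then have "(\<kappa> has_real_derivative deriv \<kappa> (vs q)) (at (vs q))"
      by (simp add: DERIV_deriv_iff_real_differentiable)
    from has_derivative_compose[OF smooth_on_has_derivative[OF vs(1) q] this[unfolded has_field_derivative_def]]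
    show ?thesis .
  qed
  then have k1: "dd k (\<lambda>q. - 4 * \<kappa> (vs q)) q = - 4 * (deriv \<kappa> (vs q) * dd k vs q)"
    by (intro dd_eqI[OF has_derivative_mult_right])
  have W2: "dd k W2s q = dd k vs q * W3s q + dd (1, 0) (dd (1, 0) (dd (0, k) W)) (vs q, q)"
  proof -
    have c: "dd (0, k) (dd (1, 0) W) y = dd (1, 0) (dd (0, k) W) y" if "y \<in> I \<times> \<Lambda>" for y
      using dd_commute_W[OF W, of "fst y" "snd y"] that by auto
    have "dd (0, k) (dd (1, 0) (dd (1, 0) W)) (vs q, q) = dd (1, 0) (dd (0, k) (dd (1, 0) W)) (vs q, q)"
      by (rule dd_commute_W[OF smooth_on_dd[OF W] vs(2)[OF q] q])
    also have "\<dots> = dd (1, 0) (dd (1, 0) (dd (0, k) W)) (vs q, q)"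
      by (rule dd_cong[OF open_IL _ c]) (use q vs in auto)
    finally show ?thesis
      using dd_vs_comp[OF smooth_on_dd[OF smooth_on_dd[OF W]] q] by (simp add: W2s_def[abs_def] W3s_def)
  qed
  have e1: "dd k (\<lambda>q. Y q * Y q * W2s q) q = dd k (\<lambda>q. - 4 * \<kappa> (vs q)) q"
    by (rule dd_cong[OF \<Lambda> q]) (use Y_sq in \<open>simp add: power2_eq_square\<close>)
  have e2: "dd k (\<lambda>q. Y q * Y q * W2s q) q = Y q * Y q * dd k W2s q + (Y q * dd k Y q + dd k Y q * Y q) * W2s q"
    by (simp add: dd_mult sm[OF smooth_Y] sm[OF smooth_W2s] sm[OF smooth_on_mult[OF \<Lambda> smooth_Y smooth_Y]])
  show ?thesis using e1[unfolded e2 k1 W2] by (simp add: power2_eq_square algebra_simps)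
qed

text \<open>The jet identities at the saddle; positivity of the y-derivative selects the root
  \<open>as q\<close>. The last equation is the second y-derivative of the density \<phi>, which
  determines \<open>C (0, q)\<close>.\<close>

lemma straight_coordinate_jets:
  assumes \<eta>: "0 < \<eta>" and \<Theta>: "open \<Theta>" "\<Theta> \<subseteq> \<Lambda>" and X: "smooth_on X ({-\<eta><..<\<eta>} \<times> \<Theta>)"
    and XI: "\<And>y q. y \<in> {-\<eta><..<\<eta>} \<Longrightarrow> q \<in> \<Theta> \<Longrightarrow> X (y, q) \<in> I"
    and XW: "\<And>y q. y \<in> {-\<eta><..<\<eta>} \<Longrightarrow> q \<in> \<Theta> \<Longrightarrow> W (X (y, q), q) = mus q - y\<^sup>2"
    and X0: "\<And>q. q \<in> \<Theta> \<Longrightarrow> X (0, q) = vs q" and X1: "\<And>q. q \<in> \<Theta> \<Longrightarrow> 0 < dd (1, 0) X (0, q)"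
    and q: "q \<in> \<Theta>"
  shows "dd (1, 0) X (0, q) = as q"
    and "W3s q * as q ^ 3 + 3 * W2s q * as q * dd (1, 0) (dd (1, 0) X) (0, q) = 0"
    and "W4s q * as q ^ 4 + 6 * W3s q * (as q)\<^sup>2 * dd (1, 0) (dd (1, 0) X) (0, q)
      + 3 * W2s q * (dd (1, 0) (dd (1, 0) X) (0, q))\<^sup>2
      + 4 * W2s q * as q * dd (1, 0) (dd (1, 0) (dd (1, 0) X)) (0, q) = 0"
    and "dd (1, 0) (dd (1, 0) (\<lambda>p. sqrt (2 * \<kappa> (X p)) * dd (1, 0) X p)) (0, q) =
      deriv (deriv (\<lambda>v. sqrt (2 * \<kappa> v))) (vs q) * as q ^ 3
      + 3 * deriv (\<lambda>v. sqrt (2 * \<kappa> v)) (vs q) * as q * dd (1, 0) (dd (1, 0) X) (0, q)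
      + sqrt (2 * \<kappa> (vs q)) * dd (1, 0) (dd (1, 0) (dd (1, 0) X)) (0, q)"
proof -
  have q\<Lambda>: "q \<in> \<Lambda>" using q \<Theta> by auto
  have dW: "((\<lambda>v. F (v, q)) has_real_derivative dd (1, 0) F (v, q)) (at v)"
    if "smooth_on F (I \<times> \<Lambda>)" "v \<in> I" for F v
    using dd_fst_line[OF that(1)] that(2) q\<Lambda> by simp
  have dX: "((\<lambda>y. F (y, q)) has_real_derivative dd (1, 0) F (y, q)) (at y)"
    if "smooth_on F ({-\<eta><..<\<eta>} \<times> \<Theta>)" "y \<in> {-\<eta><..<\<eta>}" for F y
    using dd_fst_line[OF that(1)] that(2) q by simp
  note sX = X smooth_on_dd[OF X] smooth_on_dd[OF smooth_on_dd[OF X]] smooth_on_dd[OF smooth_on_dd[OF smooth_on_dd[OF X]]]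
  note sW = W smooth_on_dd[OF W] smooth_on_dd[OF smooth_on_dd[OF W]] smooth_on_dd[OF smooth_on_dd[OF smooth_on_dd[OF W]]]
  have crit: "dd (1, 0) W (X (0, q), q) = 0" using W1[OF q\<Lambda>] X0[OF q] by simp
  note J = sqrt_coordinate_jets[OF dW[OF sW(1)] dW[OF sW(2)] dW[OF sW(3)] dW[OF sW(4)]
      dX[OF sX(1)] dX[OF sX(2)] dX[OF sX(3)] dX[OF sX(4)] XI[OF _ q] XW[OF _ q] \<eta> crit]
  have "W2s q * (dd (1, 0) X (0, q))\<^sup>2 = - 2" using J(1) by (simp add: W2s_def X0[OF q])
  then have "(dd (1, 0) X (0, q))\<^sup>2 = - 2 / W2s q" using W2s_neg[OF q\<Lambda>] by (simp add: field_simps)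
  then have "(dd (1, 0) X (0, q))\<^sup>2 = (as q)\<^sup>2" by (simp add: as_sq[OF q\<Lambda>])
  then show a: "dd (1, 0) X (0, q) = as q"
    using X1[OF q] as_pos[OF q\<Lambda>] by (simp add: power2_eq_iff_nonneg less_imp_le)
  show "W3s q * as q ^ 3 + 3 * W2s q * as q * dd (1, 0) (dd (1, 0) X) (0, q) = 0"
    using J(2) by (simp add: W2s_def W3s_def X0[OF q] a)
  show "W4s q * as q ^ 4 + 6 * W3s q * (as q)\<^sup>2 * dd (1, 0) (dd (1, 0) X) (0, q)
      + 3 * W2s q * (dd (1, 0) (dd (1, 0) X) (0, q))\<^sup>2
      + 4 * W2s q * as q * dd (1, 0) (dd (1, 0) (dd (1, 0) X)) (0, q) = 0"
    using J(3) by (simp add: W2s_def W3s_def W4s_def X0[OF q] a)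
  define K where "K v = sqrt (2 * \<kappa> v)" for v
  have sK: "smooth_on K I"
    unfolding K_def by (intro smooth_on_sqrt smooth_on_mult smooth_on_const I \<kappa>) (use \<kappa>(2) in auto)
  have dK0: "(F has_real_derivative dd 1 F v) (at v)" if "smooth_on F I" "v \<in> I" for F v
    using dd_line_at[of F 0 v 1] smooth_on_differentiable[OF that] by simp
  have dKeq: "deriv F v = dd 1 F v" if "smooth_on F I" "v \<in> I" for F v
    by (rule DERIV_imp_deriv[OF dK0[OF that]])
  have dKd: "(deriv F has_real_derivative dd 1 (dd 1 F) v) (at v)" if "smooth_on F I" "v \<in> I" for F v
    by (rule has_field_derivative_transform_within_open[OF dK0[OF smooth_on_dd[OF that(1)] that(2)] I(1) that(2)])
      (simp add: dKeq[OF that(1)])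
  have dK1: "(K has_real_derivative deriv K v) (at v)" "(deriv K has_real_derivative deriv (deriv K) v) (at v)" if "v \<in> I" for v
    using dK0[OF sK that] dKd[OF sK that] dKeq[OF sK that] DERIV_imp_deriv by metis+
  let ?\<phi> = "\<lambda>p. K (X p) * dd (1, 0) X p"
  have op: "open ({-\<eta><..<\<eta>} \<times> \<Theta>)" using \<Theta> by (simp add: open_Times_interval)
  have s\<phi>: "smooth_on ?\<phi> ({-\<eta><..<\<eta>} \<times> \<Theta>)"
    by (rule smooth_on_mult[OF op smooth_on_compose[OF op I(1) sK X] sX(2)]) (use XI in auto)
  have KX: "((\<lambda>y. G (X (y, q))) has_real_derivative G' (X (y, q)) * dd (1, 0) X (y, q)) (at y)"
    if "y \<in> {-\<eta><..<\<eta>}" "\<And>v. v \<in> I \<Longrightarrow> (G has_real_derivative G' v) (at v)" for G G' y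
    by (rule DERIV_chain2[OF that(2)[OF XI[OF that(1) q]] dX[OF X that(1)]])
  have \<phi>1: "dd (1, 0) ?\<phi> (y, q) = deriv K (X (y, q)) * dd (1, 0) X (y, q) * dd (1, 0) X (y, q) + dd (1, 0) (dd (1, 0) X) (y, q) * K (X (y, q))"
    if y: "y \<in> {-\<eta><..<\<eta>}" for y
    by (rule DERIV_unique[OF dX[OF s\<phi> y] DERIV_mult[OF KX[OF y dK1(1)] dX[OF sX(2) y]]])
  have z: "0 \<in> {-\<eta><..<\<eta>}" using \<eta> by simp
  have "dd (1, 0) (dd (1, 0) ?\<phi>) (0, q) = (deriv (deriv K) (X (0, q)) * dd (1, 0) X (0, q) * (dd (1, 0) X (0, q) * dd (1, 0) X (0, q))
      + (dd (1, 0) (dd (1, 0) X) (0, q) * dd (1, 0) X (0, q) + dd (1, 0) (dd (1, 0) X) (0, q) * dd (1, 0) X (0, q)) * deriv K (X (0, q)))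
    + (dd (1, 0) (dd (1, 0) (dd (1, 0) X)) (0, q) * K (X (0, q)) + deriv K (X (0, q)) * dd (1, 0) X (0, q) * dd (1, 0) (dd (1, 0) X) (0, q))"
    by (rule DERIV_eq_on_open[OF _ z _ dX[OF smooth_on_dd[OF s\<phi>] z] DERIV_add[OF DERIV_mult[OF KX[OF z dK1(2)] DERIV_mult[OF dX[OF sX(2) z] dX[OF sX(2) z]]]
          DERIV_mult[OF dX[OF sX(3) z] KX[OF z dK1(1)]]]]) (use \<phi>1 in \<open>auto simp: mult_ac\<close>)
  then have "dd (1, 0) (dd (1, 0) ?\<phi>) (0, q) = deriv (deriv K) (vs q) * as q ^ 3
      + 3 * deriv K (vs q) * as q * dd (1, 0) (dd (1, 0) X) (0, q) + K (vs q) * dd (1, 0) (dd (1, 0) (dd (1, 0) X)) (0, q)"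
    unfolding X0[OF q] a by (simp add: power3_eq_cube algebra_simps)
  then show "dd (1, 0) (dd (1, 0) (\<lambda>p. sqrt (2 * \<kappa> (X p)) * dd (1, 0) X p)) (0, q) =
      deriv (deriv (\<lambda>v. sqrt (2 * \<kappa> v))) (vs q) * as q ^ 3
      + 3 * deriv (\<lambda>v. sqrt (2 * \<kappa> v)) (vs q) * as q * dd (1, 0) (dd (1, 0) X) (0, q)
      + sqrt (2 * \<kappa> (vs q)) * dd (1, 0) (dd (1, 0) (dd (1, 0) X)) (0, q)"
    unfolding K_def[abs_def] .
qed

end

text \<open>Here \<open>\<rho> = \<epsilon> r(\<epsilon>)\<close> with \<open>r\<close> smooth, \<open>r(0) = 2a/h\<close> and \<open>r'(0) = r(0)\<^sup>2/2\<close>; the last equation,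
  due to the oddness of the numerator of \<open>\<rho>\<close>, is what turns \<open>1/(2\<epsilon>\<^sup>2)\<close> into \<open>(1 + \<rho>)/\<rho>\<^sup>2\<close> without a term of order \<open>1/\<epsilon>\<close>.\<close>

lemma gap_ratio_expansion:
  fixes X Z :: "real \<times> 'q::euclidean_space \<Rightarrow> real"
  assumes \<eta>: "0 < \<eta>" and \<Theta>: "open \<Theta>" "q0 \<in> \<Theta>"
    and X: "smooth_on X ({-\<eta><..<\<eta>} \<times> \<Theta>)" and Z: "smooth_on Z ({-\<eta>\<^sup>2<..<\<eta>\<^sup>2} \<times> \<Theta>)"
    and XZ: "\<And>y m q. y \<in> {-\<eta><..<\<eta>} \<Longrightarrow> m \<in> {-\<eta>\<^sup>2<..<\<eta>\<^sup>2} \<Longrightarrow> q \<in> \<Theta> \<Longrightarrow> X (y, q) < Z (m, q)"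
    and X1: "\<And>q. q \<in> \<Theta> \<Longrightarrow> 0 < dd (1, 0) X (0, q)"
  obtains d \<delta> M \<Theta>' where "0 < \<delta>" "\<delta> \<le> \<eta>" "\<delta> \<le> 1" "open \<Theta>'" "q0 \<in> \<Theta>'" "\<Theta>' \<subseteq> \<Theta>"
    "\<And>\<epsilon> q \<rho> a h. \<epsilon> \<in> {0<..<\<delta>} \<Longrightarrow> q \<in> \<Theta>' \<Longrightarrow> \<rho> = (X (\<epsilon>, q) - X (- \<epsilon>, q)) / (Z (\<epsilon>\<^sup>2, q) - X (\<epsilon>, q)) \<Longrightarrow>
      a = dd (1, 0) X (0, q) \<Longrightarrow> h = Z (0, q) - X (0, q) \<Longrightarrow>
      0 < \<rho> \<and> \<rho> \<le> M * \<epsilon> \<and> \<epsilon> \<le> M * \<bar>\<rho> * ln \<rho>\<bar> \<and>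
      \<bar>1 / (2 * \<epsilon>\<^sup>2) - 2 * a\<^sup>2 / h\<^sup>2 * ((1 + \<rho>) / \<rho>\<^sup>2) - d q\<bar> \<le> M * \<epsilon> \<and>
      \<bar>ln \<epsilon> - ln \<rho> - ln (h / (2 * a))\<bar> \<le> M * \<epsilon>"
proof -
  let ?S = "{-\<eta><..<\<eta>} \<times> \<Theta>"
  have op: "open ?S" "open ({-\<eta>\<^sup>2<..<\<eta>\<^sup>2} \<times> \<Theta>)" using \<Theta> by (auto intro: open_Times_interval)
  have z: "0 \<in> {-\<eta><..<\<eta>}" using \<eta> by simp
  have sq: "y\<^sup>2 \<in> {-\<eta>\<^sup>2<..<\<eta>\<^sup>2}" if "y \<in> {-\<eta><..<\<eta>}" for y
  proof -
    have "y\<^sup>2 < \<eta>\<^sup>2" using that \<eta> by (intro power2_strict_mono) auto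
    then show ?thesis using \<eta> by (auto intro: less_le_trans[of _ 0])
  qed
  have refl: "smooth_on (\<lambda>p::real\<times>'q. (- fst p, snd p)) S" for S :: "(real\<times>'q) set"
    by (rule smooth_onI, rule Ck_on_bounded_linear) (intro bounded_linear_Pair bounded_linear_minus bounded_linear_fst bounded_linear_snd)
  have sXr: "smooth_on (\<lambda>p. X (- fst p, snd p)) ?S"
    by (rule smooth_on_compose[OF op(1) op(1) X refl]) auto
  define num where "num p = X p - X (- fst p, snd p)" for p
  have num: "smooth_on num ?S" unfolding num_def by (rule smooth_on_diff[OF op(1) X sXr])
  have sZ2: "smooth_on (\<lambda>p. Z ((fst p)\<^sup>2, snd p)) ?S"
    by (rule smooth_on_compose[OF op(1) op(2) Z smooth_on_Pair[OF op(1) smooth_on_power[OF op(1) smooth_on_fst] smooth_on_snd]])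
      (use sq in auto)
  define den where "den p = Z ((fst p)\<^sup>2, snd p) - X p" for p
  have den: "smooth_on den ?S" unfolding den_def by (rule smooth_on_diff[OF op(1) sZ2 X])
  have den_pos: "0 < den p" if "p \<in> ?S" for p
    using XZ[of "fst p" "(fst p)\<^sup>2" "snd p"] sq that by (auto simp: den_def)
  obtain n where n: "smooth_on n ?S" and n': "\<And>y q. y \<in> {-\<eta><..<\<eta>} \<Longrightarrow> q \<in> \<Theta> \<Longrightarrow> num (y, q) = num (0, q) + y * n (y, q)"
    by (rule smooth_on_hadamard[OF \<Theta>(1) num], rule that)
  have nn: "num (y, q) = y * n (y, q)" if "y \<in> {-\<eta><..<\<eta>}" "q \<in> \<Theta>" for y q
    using n'[OF that] by (simp add: num_def)
  have dl: "((\<lambda>y. F (y, q)) has_real_derivative dd (1, 0) F (y, q)) (at y)"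
    if "smooth_on F ?S" "y \<in> {-\<eta><..<\<eta>}" "q \<in> \<Theta>" for F :: "real \<times> 'q \<Rightarrow> real" and y q
    using dd_fst_line[OF that(1)] that by simp
  have n0: "n (0, q) = 2 * dd (1, 0) X (0, q)" if q: "q \<in> \<Theta>" for q
  proof -
    have u: "(uminus has_real_derivative - 1) (at (0::real))" by (auto intro!: derivative_eq_intros)
    have "((\<lambda>y. X (- y, q)) has_real_derivative dd (1, 0) X (0, q) * - 1) (at 0)"
      by (rule DERIV_chain2[where g = uminus, OF _ u]) (use dl[OF X z q] in simp)
    from DERIV_diff[OF dl[OF X z q] this]
    have "((\<lambda>y. num (y, q)) has_real_derivative 2 * dd (1, 0) X (0, q)) (at 0)" by (simp add: num_def)
    moreover have "((\<lambda>y. y * n (y, q)) has_real_derivative 1 * n (0, q) + dd (1, 0) n (0, q) * 0) (at 0)"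
      by (rule DERIV_mult[OF DERIV_ident dl[OF n z q]])
    ultimately have "2 * dd (1, 0) X (0, q) = 1 * n (0, q) + dd (1, 0) n (0, q) * 0"
      by (intro DERIV_eq_on_open[OF _ z nn[OF _ q]]) auto
    then show ?thesis by simp
  qed
  \<comment> \<open>The numerator X (y) - X (- y) is odd, so its quotient by y is even and has zero
    derivative at 0.\<close>
  have n1: "dd (1, 0) n (0, q) = 0" if q: "q \<in> \<Theta>" for q
  proof -
    have even: "n (- y, q) = n (y, q)" if "y \<in> {-\<eta><..<\<eta>}" for y
    proof (cases "y = 0")
      case False
      have "X (y, q) - X (- y, q) = y * n (y, q)" "X (- y, q) - X (y, q) = - (y * n (- y, q))"
        using nn[OF that q] nn[of "- y" q] that q by (simp_all add: num_def)
      then have "y * n (- y, q) = y * n (y, q)" by linarith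
      then show ?thesis using False by simp
    qed simp
    have u: "(uminus has_real_derivative - 1) (at (0::real))" by (auto intro!: derivative_eq_intros)
    have "((\<lambda>y. n (- y, q)) has_real_derivative dd (1, 0) n (0, q) * - 1) (at 0)"
      by (rule DERIV_chain2[where g = uminus, OF _ u]) (use dl[OF n z q] in simp)
    from DERIV_eq_on_open[OF _ z even this dl[OF n z q]] show ?thesis by simp
  qed
  \<comment> \<open>The right turning point depends on y only through y^2 and does not contribute at
    first order.\<close>
  have d0: "((\<lambda>y. den (y, q)) has_real_derivative - dd (1, 0) X (0, q)) (at 0)" if q: "q \<in> \<Theta>" for q
  proof -
    have u: "((\<lambda>y. y\<^sup>2) has_real_derivative 0) (at (0::real))" by (auto intro!: derivative_eq_intros)
    have "((\<lambda>y. Z (y\<^sup>2, q)) has_real_derivative dd (1, 0) Z (0, q) * 0) (at 0)"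
      by (rule DERIV_chain2[where g = "\<lambda>y. y\<^sup>2", OF _ u]) (use dd_fst_line[OF Z, of 0 q] q \<eta> in auto)
    from DERIV_diff[OF this dl[OF X z q]] show ?thesis by (simp add: den_def)
  qed
  define r where "r p = n p / den p" for p
  have r: "smooth_on r ?S" unfolding r_def by (rule smooth_on_divide[OF op(1) n den]) (use den_pos in fastforce)
  define r0 where "r0 q = r (0, q)" for q
  have r0: "r0 q = 2 * dd (1, 0) X (0, q) / (Z (0, q) - X (0, q))" if "q \<in> \<Theta>" for q
    using n0[OF that] by (simp add: r0_def r_def den_def)
  have r0_pos: "0 < r0 q" if "q \<in> \<Theta>" for q
    using r0[OF that] X1[OF that] XZ[OF z _ that, of 0] \<eta> by simp
  have sr0: "smooth_on (\<lambda>p. r0 (snd p)) ?S"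
    unfolding r0_def by (rule smooth_on_compose[OF op(1) op(1) r smooth_on_Pair[OF op(1) smooth_on_const smooth_on_snd]]) (use z in auto)
  \<comment> \<open>With n' = 0 and den' = - X_y the quotient rule gives n X_y / den^2 at 0; since n
    = 2 X_y there, this is half the square of r.\<close>
  have r1: "dd (1, 0) r (0, q) = (r0 q)\<^sup>2 / 2" if q: "q \<in> \<Theta>" for q
  proof -
    have dp: "0 < den (0, q)" using den_pos z q by auto
    have "((\<lambda>y. n (y, q) / den (y, q)) has_real_derivative
        (dd (1, 0) n (0, q) * den (0, q) - n (0, q) * - dd (1, 0) X (0, q)) / (den (0, q) * den (0, q))) (at 0)"
      by (rule DERIV_divide[OF dl[OF n z q] d0[OF q]]) (use dp in simp)
    then have "((\<lambda>y. r (y, q)) has_real_derivative (r0 q)\<^sup>2 / 2) (at 0)"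
      unfolding r_def r0_def
      by (rule DERIV_cong) (use dp in \<open>simp add: n1[OF q] n0[OF q] power2_eq_square field_simps\<close>)
    then show ?thesis using dl[OF r z q] DERIV_unique by blast
  qed
  \<comment> \<open>Numerator of 1 / (2 \<epsilon>^2) - (r0^2 / 2) (1 + \<rho>) / \<rho>^2 over the
    denominator 2 \<epsilon>^2 r^2. It vanishes at 0, and so does its derivative 2 r0 r' - r0^3 by
    \<open>r1\<close>; hence the difference stays smooth.\<close>
  define g where "g p = (r p)\<^sup>2 - (r0 (snd p))\<^sup>2 * (1 + fst p * r p)" for p
  have g: "smooth_on g ?S"
    unfolding g_def
    by (intro smooth_on_diff smooth_on_power smooth_on_mult smooth_on_add smooth_on_const smooth_on_fst op sr0 r)
  obtain c w where A: "(\<forall>i. smooth_on (c i) \<Theta>) \<and> smooth_on w ?S \<and>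
    (\<forall>y\<in>{-\<eta><..<\<eta>}. \<forall>q\<in>\<Theta>. g (y, q) = (\<Sum>i<2. c i q * y ^ i) + y ^ 2 * w (y, q))"
    using smooth_on_taylor[OF \<Theta>(1) \<eta> g, of 2] by (elim exE) (rule that)
  then have w: "smooth_on w ?S"
    and gw': "\<And>y q. y \<in> {-\<eta><..<\<eta>} \<Longrightarrow> q \<in> \<Theta> \<Longrightarrow> g (y, q) = c 0 q + c 1 q * y + y ^ 2 * w (y, q)"
    by (simp_all add: eval_nat_numeral)
  have c0: "c 0 q = 0" if "q \<in> \<Theta>" for q using gw'[OF z that] by (simp add: g_def r0_def)
  have c1: "c 1 q = 0" if q: "q \<in> \<Theta>" for q
  proof -
    have sq: "((\<lambda>y. (r (y, q))\<^sup>2) has_real_derivative 2 * r (0, q) * dd (1, 0) r (0, q)) (at 0)"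
      by (rule DERIV_cong[OF DERIV_power[OF dl[OF r z q], of 2]]) simp
    have 1: "((\<lambda>y. g (y, q)) has_real_derivative 0) (at 0)"
      unfolding g_def fst_conv snd_conv
      by (rule DERIV_cong[OF DERIV_diff[OF sq DERIV_cmult[OF DERIV_add[OF DERIV_const DERIV_mult[OF DERIV_ident dl[OF r z q]]]]]])
        (simp add: r1[OF q] r0_def power2_eq_square)
    have 2: "((\<lambda>y. c 0 q + c 1 q * y + y ^ 2 * w (y, q)) has_real_derivative c 1 q) (at 0)"
      by (rule DERIV_cong[OF DERIV_add[OF DERIV_add[OF DERIV_const DERIV_cmult_Id]
            DERIV_mult[OF DERIV_power[OF DERIV_ident, of 2] dl[OF w z q]]]]) simp
    show ?thesis using DERIV_eq_on_open[OF _ z gw'[OF _ q] 1 2] by simp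
  qed
  have gw: "g (y, q) = y\<^sup>2 * w (y, q)" if "y \<in> {-\<eta><..<\<eta>}" "q \<in> \<Theta>" for y q
    using gw'[OF that] c0[OF that(2)] c1[OF that(2)] by simp
  define R where "R = r0 q0"
  have R: "0 < R" using r0_pos[OF \<Theta>(2)] by (simp add: R_def)
  have q0S: "(0, q0) \<in> ?S" using z \<Theta> by simp
  have "eventually (\<lambda>p. p \<in> ?S \<and> R / 2 < r p) (nhds (0, q0))"
    by (rule eventually_nhds_gt[OF op(1) smooth_on_continuous_on[OF r] q0S]) (use R in \<open>simp add: R_def r0_def\<close>)
  moreover have "eventually (\<lambda>p. p \<in> ?S \<and> - (2 * R) < - r p) (nhds (0, q0))"
    by (rule eventually_nhds_gt[OF op(1) continuous_on_minus[OF smooth_on_continuous_on[OF r]] q0S]) (use R in \<open>simp add: R_def r0_def\<close>)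
  ultimately have ev: "eventually (\<lambda>p. (p \<in> ?S \<and> R / 2 < r p) \<and> (p \<in> ?S \<and> - (2 * R) < - r p)) (nhds (0, q0))"
    by (rule eventually_conj)
  obtain \<delta>1 \<Theta>1 where b1: "0 < \<delta>1" "open \<Theta>1" "q0 \<in> \<Theta>1"
    and b1': "\<And>y q. y \<in> {-\<delta>1<..<\<delta>1} \<Longrightarrow> q \<in> \<Theta>1 \<Longrightarrow> ((y, q) \<in> ?S \<and> R / 2 < r (y, q)) \<and> ((y, q) \<in> ?S \<and> - (2 * R) < - r (y, q))"
    by (rule eventually_nhds_prod_box[OF ev], rule that)
  let ?S1 = "{-\<delta>1<..<\<delta>1} \<times> \<Theta>1"
  have S1: "open ?S1" "?S1 \<subseteq> ?S" "(0, q0) \<in> ?S1" using b1 b1' by (auto intro: open_Times_interval)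
  have rS1: "0 < r p" if "p \<in> ?S1" for p using b1'[of "fst p" "snd p"] that R by auto
  define T where "T p = w p / (2 * (r p)\<^sup>2)" for p
  have T: "smooth_on T ?S1"
    unfolding T_def
  proof (rule smooth_on_divide[OF S1(1) smooth_on_subset[OF w S1(2)]])
    show "smooth_on (\<lambda>p. 2 * (r p)\<^sup>2) ?S1"
      by (intro smooth_on_mult smooth_on_const smooth_on_power smooth_on_subset[OF r S1(2)] S1)
    show "2 * (r p)\<^sup>2 \<noteq> 0" if "p \<in> ?S1" for p using rS1[OF that] by simp
  qed
  have lr: "smooth_on (\<lambda>p. ln (r p)) ?S1"
    by (rule smooth_on_ln[OF S1(1) smooth_on_subset[OF r S1(2)] rS1])
  obtain C1 s1 where L1: "0 < s1" "0 \<le> C1" "ball (0, q0) s1 \<subseteq> ?S1"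
    and L1': "\<And>x y. x \<in> ball (0, q0) s1 \<Longrightarrow> y \<in> ball (0, q0) s1 \<Longrightarrow> \<bar>T x - T y\<bar> \<le> C1 * norm (x - y)"
    by (rule Ck_on_locally_lipschitz[OF S1(1) smooth_onD[OF T] S1(3)], rule that)
  obtain C2 s2 where L2: "0 < s2" "0 \<le> C2" "ball (0, q0) s2 \<subseteq> ?S1"
    and L2': "\<And>x y. x \<in> ball (0, q0) s2 \<Longrightarrow> y \<in> ball (0, q0) s2 \<Longrightarrow> \<bar>ln (r x) - ln (r y)\<bar> \<le> C2 * norm (x - y)"
    by (rule Ck_on_locally_lipschitz[OF S1(1) smooth_onD[OF lr] S1(3)], rule that)
  have "eventually (\<lambda>p. p \<in> ball (0, q0) s1) (nhds (0::real, q0))" "eventually (\<lambda>p. p \<in> ball (0, q0) s2) (nhds (0::real, q0))"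
    by (rule eventually_nhds_in_open[OF open_ball]; use L1 L2 in simp)+
  then have ev2: "eventually (\<lambda>p. p \<in> ball (0, q0) s1 \<and> p \<in> ball (0, q0) s2) (nhds (0::real, q0))"
    by (rule eventually_conj)
  obtain \<delta>2 \<Theta>2 where b2: "0 < (\<delta>2::real)" "open \<Theta>2" "q0 \<in> \<Theta>2"
    and b2': "\<And>y q. y \<in> {-\<delta>2<..<\<delta>2} \<Longrightarrow> q \<in> \<Theta>2 \<Longrightarrow> (y, q) \<in> ball (0, q0) s1 \<and> (y, q) \<in> ball (0, q0) s2"
    by (rule eventually_nhds_prod_box[OF ev2], rule that)
  \<comment> \<open>The last entry forces \<rho> <= exp (- 1), as r < 2 R on the box. Then |ln
    \<rho>| is at least 1, and a bound by \<epsilon> becomes one by |\<rho> ln \<rho>|.\<close>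
  define \<delta> where "\<delta> = Min {\<delta>2, \<eta>, 1, exp (- 1) / (2 * R)}"
  have \<delta>: "0 < \<delta>" "\<delta> \<le> \<delta>2" "\<delta> \<le> \<eta>" "\<delta> \<le> 1" "\<delta> \<le> exp (- 1) / (2 * R)"
    using b2 \<eta> R by (auto simp: \<delta>_def)
  define M where "M = Max {2 * R, 2 / R, C1, C2}"
  have M: "2 * R \<le> M" "2 / R \<le> M" "C1 \<le> M" "C2 \<le> M" by (simp_all add: M_def)
  have in1: "(y, q) \<in> ?S1" if "y \<in> {-\<delta><..<\<delta>}" "q \<in> \<Theta>2" for y q
    using b2'[of y q] L1(3) that \<delta> by (auto simp: subset_iff)
  show ?thesis
  proof (rule that[of \<delta> \<Theta>2 M "\<lambda>q. T (0, q)"])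
    show "0 < \<delta>" "\<delta> \<le> \<eta>" "\<delta> \<le> 1" "open \<Theta>2" "q0 \<in> \<Theta>2" by fact+
    show "\<Theta>2 \<subseteq> \<Theta>"
    proof
      fix q assume "q \<in> \<Theta>2"
      then have "(0, q) \<in> ?S1" using \<delta>(1) by (intro in1) auto
      then show "q \<in> \<Theta>" using S1(2) by blast
    qed
    fix \<epsilon> q \<rho> a h
    assume \<epsilon>: "\<epsilon> \<in> {0<..<\<delta>}" and q: "q \<in> \<Theta>2" and \<rho>: "\<rho> = (X (\<epsilon>, q) - X (- \<epsilon>, q)) / (Z (\<epsilon>\<^sup>2, q) - X (\<epsilon>, q))"
      and a: "a = dd (1, 0) X (0, q)" and h: "h = Z (0, q) - X (0, q)"
    have \<epsilon>in: "\<epsilon> \<in> {-\<delta><..<\<delta>}" "0 \<in> {-\<delta><..<\<delta>}" using \<epsilon> by auto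
    have q\<Theta>: "q \<in> \<Theta>" using in1[OF \<epsilon>in(2) q] S1(2) by blast
    have \<epsilon>\<eta>: "\<epsilon> \<in> {-\<eta><..<\<eta>}" using \<epsilon> \<delta> by auto
    have \<rho>r: "\<rho> = \<epsilon> * r (\<epsilon>, q)"
      using nn[OF \<epsilon>\<eta> q\<Theta>] by (simp add: \<rho> r_def num_def den_def)
    have rb: "R / 2 < r (\<epsilon>, q)" "r (\<epsilon>, q) < 2 * R" "0 < r (\<epsilon>, q)"
      using b1'[of \<epsilon> q] in1[OF \<epsilon>in(1) q] rS1[OF in1[OF \<epsilon>in(1) q]] by auto
    have ah: "2 * a\<^sup>2 / h\<^sup>2 = (r0 q)\<^sup>2 / 2" "h / (2 * a) = 1 / r0 q"
      by (simp_all add: r0[OF q\<Theta>] a h power2_eq_square)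
    have pos: "0 < \<rho>" using \<epsilon> rb by (simp add: \<rho>r)
    have dist: "norm ((\<epsilon>, q) - (0, q)) = \<epsilon>" using \<epsilon> by simp
    have balls: "(\<epsilon>, q) \<in> ball (0, q0) s1" "(0::real, q) \<in> ball (0, q0) s1" "(\<epsilon>, q) \<in> ball (0, q0) s2" "(0::real, q) \<in> ball (0, q0) s2"
      using b2'[of \<epsilon> q] b2'[of 0 q] \<epsilon> \<delta> q by auto
    have up: "\<rho> \<le> 2 * R * \<epsilon>" using \<epsilon> rb unfolding \<rho>r by (simp add: mult.commute mult_right_mono)
    also have "\<dots> \<le> M * \<epsilon>" using M \<epsilon> by (intro mult_right_mono) auto
    finally have 1: "\<rho> \<le> M * \<epsilon>" .
    have 2: "\<epsilon> \<le> M * \<bar>\<rho> * ln \<rho>\<bar>"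
    proof -
      have "\<rho> \<le> 2 * R * (exp (- 1) / (2 * R))"
        using up \<epsilon> \<delta>(5) R by (smt (verit) greaterThanLessThan_iff mult_left_mono)
      then have "\<rho> \<le> exp (- 1)" using R by simp
      then have "ln \<rho> \<le> - 1" using pos by (metis ln_exp ln_le_cancel_iff exp_gt_zero)
      then have "\<rho> * 1 \<le> \<rho> * \<bar>ln \<rho>\<bar>" using pos by (intro mult_left_mono) auto
      then have "\<rho> \<le> \<bar>\<rho> * ln \<rho>\<bar>" using pos by (simp add: abs_mult)
      moreover have "\<epsilon> * (R / 2) \<le> \<rho>" using \<epsilon> rb unfolding \<rho>r by (intro mult_left_mono) auto
      ultimately have "\<epsilon> \<le> 2 / R * \<bar>\<rho> * ln \<rho>\<bar>" using R by (simp add: field_simps)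
      also have "\<dots> \<le> M * \<bar>\<rho> * ln \<rho>\<bar>" using M by (intro mult_right_mono) auto
      finally show ?thesis .
    qed
    have 3: "\<bar>1 / (2 * \<epsilon>\<^sup>2) - 2 * a\<^sup>2 / h\<^sup>2 * ((1 + \<rho>) / \<rho>\<^sup>2) - T (0, q)\<bar> \<le> M * \<epsilon>"
    proof -
      have "1 / (2 * \<epsilon>\<^sup>2) - (r0 q)\<^sup>2 / 2 * ((1 + \<rho>) / \<rho>\<^sup>2) = g (\<epsilon>, q) / (2 * \<epsilon>\<^sup>2 * (r (\<epsilon>, q))\<^sup>2)"
        using \<epsilon> rb by (simp add: \<rho>r g_def field_simps power2_eq_square)
      also have "\<dots> = T (\<epsilon>, q)" using \<epsilon> rb by (simp add: gw[OF \<epsilon>\<eta> q\<Theta>] T_def)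
      finally have "\<bar>1 / (2 * \<epsilon>\<^sup>2) - 2 * a\<^sup>2 / h\<^sup>2 * ((1 + \<rho>) / \<rho>\<^sup>2) - T (0, q)\<bar> = \<bar>T (\<epsilon>, q) - T (0, q)\<bar>"
        by (simp add: ah)
      also have "\<dots> \<le> C1 * \<epsilon>" using L1'[OF balls(1,2)] dist by simp
      also have "\<dots> \<le> M * \<epsilon>" using M \<epsilon> by (intro mult_right_mono) auto
      finally show ?thesis .
    qed
    have 4: "\<bar>ln \<epsilon> - ln \<rho> - ln (h / (2 * a))\<bar> \<le> M * \<epsilon>"
    proof -
      have "ln \<rho> = ln \<epsilon> + ln (r (\<epsilon>, q))" using \<epsilon> rb by (simp add: \<rho>r ln_mult)
      moreover have "ln (h / (2 * a)) = - ln (r (0, q))"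
        using r0_pos[OF q\<Theta>] by (simp add: ah ln_div r0_def)
      ultimately have "\<bar>ln \<epsilon> - ln \<rho> - ln (h / (2 * a))\<bar> = \<bar>ln (r (\<epsilon>, q)) - ln (r (0, q))\<bar>" by simp
      also have "\<dots> \<le> C2 * \<epsilon>" using L2'[OF balls(3,4)] dist by simp
      also have "\<dots> \<le> M * \<epsilon>" using M \<epsilon> by (intro mult_right_mono) auto
      finally show ?thesis .
    qed
    show "0 < \<rho> \<and> \<rho> \<le> M * \<epsilon> \<and> \<epsilon> \<le> M * \<bar>\<rho> * ln \<rho>\<bar> \<and>
      \<bar>1 / (2 * \<epsilon>\<^sup>2) - 2 * a\<^sup>2 / h\<^sup>2 * ((1 + \<rho>) / \<rho>\<^sup>2) - T (0, q)\<bar> \<le> M * \<epsilon> \<and>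
      \<bar>ln \<epsilon> - ln \<rho> - ln (h / (2 * a))\<bar> \<le> M * \<epsilon>"
      using pos 1 2 3 4 by blast
  qed
qed

section \<open>Monotonicity of the potential on either side of its minimum, and auxiliary
  estimates\<close>

context soliton
begin

lemma segment_subset: "a \<in> I \<Longrightarrow> b \<in> I \<Longrightarrow> {a..b} \<subseteq> I"
proof
  fix v assume "a \<in> I" "b \<in> I" "v \<in> {a..b}"
  then show "v \<in> I" using mem_is_interval_1_I[OF I(2), of a b v] by simp
qed

lemma between_mem: "q \<in> \<Lambda> \<Longrightarrow> vs q \<le> v \<Longrightarrow> v \<le> vS q \<Longrightarrow> v \<in> I"
proof -
  assume *: "q \<in> \<Lambda>" "vs q \<le> v" "v \<le> vS q"
  then have "v \<in> {vs q..vS q}" by simp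
  then show "v \<in> I" using segment_subset[OF vs(2)[OF *(1)] vS(2)[OF *(1)]] by blast
qed

lemma W_line: "v \<in> I \<Longrightarrow> q \<in> \<Lambda> \<Longrightarrow> ((\<lambda>v. W (v, q)) has_real_derivative dd (1, 0) W (v, q)) (at v)"
  using dd_fst_line[OF W] by simp

lemma W_continuous_on: "S \<subseteq> I \<Longrightarrow> q \<in> \<Lambda> \<Longrightarrow> continuous_on S (\<lambda>v. W (v, q))"
proof (rule continuous_at_imp_continuous_on, rule ballI)
  fix v assume "S \<subseteq> I" "q \<in> \<Lambda>" "v \<in> S"
  then show "isCont (\<lambda>v. W (v, q)) v" by (intro DERIV_isCont[OF W_line]) auto
qed

lemma W_decreasing:
  assumes q: "q \<in> \<Lambda>" and ab: "vs q \<le> a" "a < b" "b \<le> v0 q"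
  shows "W (b, q) < W (a, q)"
proof (rule DERIV_neg_imp_decreasing_open[OF ab(2)])
  fix x assume x: "a < x" "x < b"
  have "x \<in> I" using between_mem[OF q, of x] x ab ord[OF q] by simp
  moreover have "x \<in> {vs q<..<v0 q}" using x ab by simp
  ultimately show "\<exists>d. ((\<lambda>v. W (v, q)) has_real_derivative d) (at x) \<and> d < 0"
    using W_line[OF _ q] neg[OF q] by blast
next
  have "{a..b} \<subseteq> I" using between_mem[OF q] ab ord[OF q] by auto
  then show "continuous_on {a..b} (\<lambda>v. W (v, q))" by (rule W_continuous_on[OF _ q])
qed

lemma W_increasing:
  assumes q: "q \<in> \<Lambda>" and ab: "v0 q \<le> a" "a < b" "b \<le> vS q"
  shows "W (a, q) < W (b, q)"
proof (rule DERIV_pos_imp_increasing_open[OF ab(2)])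
  fix x assume x: "a < x" "x < b"
  have "x \<in> I" using between_mem[OF q, of x] x ab ord[OF q] by simp
  moreover have "x \<in> {v0 q<..vS q}" using x ab by simp
  ultimately show "\<exists>d. ((\<lambda>v. W (v, q)) has_real_derivative d) (at x) \<and> 0 < d"
    using W_line[OF _ q] pos[OF q] by blast
next
  have "{a..b} \<subseteq> I" using between_mem[OF q] ab ord[OF q] by auto
  then show "continuous_on {a..b} (\<lambda>v. W (v, q))" by (rule W_continuous_on[OF _ q])
qed

end

lemma dd_comp_snd:
  assumes "F differentiable (at (snd p))"
  shows "dd h (\<lambda>p. F (snd p)) p = dd (snd h) F (snd p)"
  by (rule dd_eqI[OF has_derivative_compose_dd[OF assms has_derivative_snd[OF has_derivative_ident]]])

text \<open>Relates the iterated \<open>deriv\<close> in the momentum to second directional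
  derivatives; \<open>g\<close> need agree with \<open>F\<close> only while the line stays in
  \<open>S\<close>.\<close>

lemma deriv_deriv_line:
  fixes F :: "'a::real_normed_vector \<Rightarrow> real"
  assumes "open S" "Ck_on 2 F S" "x \<in> S" and g: "\<And>t. x + t *\<^sub>R h \<in> S \<Longrightarrow> g t = F (x + t *\<^sub>R h)"
  shows "(deriv ^^ 2) g 0 = dd h (dd h F) x"
proof -
  define T where "T = (\<lambda>t. x + t *\<^sub>R h) -` S"
  have T: "open T" unfolding T_def by (rule open_vimage[OF assms(1)]) (intro continuous_intros)
  have T0: "0 \<in> T" using assms(3) by (simp add: T_def)
  have d: "F differentiable (at (x + t *\<^sub>R h))" "dd h F differentiable (at (x + t *\<^sub>R h))" if "t \<in> T" for t
    using Ck_on_differentiable[OF assms(2), of "x + t *\<^sub>R h"] assms(2) that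
      Ck_on_differentiable[of 1 "dd h F" S "x + t *\<^sub>R h"] by (auto simp: T_def numeral_2_eq_2 Ck_on_Suc_dd)
  have g1: "deriv g t = dd h F (x + t *\<^sub>R h)" if "t \<in> T" for t
    by (rule DERIV_imp_deriv, rule has_field_derivative_transform_within_open[OF dd_line_at[OF d(1)[OF that]] T that])
      (simp add: T_def g)
  have "((\<lambda>t. dd h F (x + t *\<^sub>R h)) has_real_derivative dd h (dd h F) (x + 0 *\<^sub>R h)) (at 0)"
    by (rule dd_line_at[OF d(2)[OF T0]])
  then have "(deriv g has_real_derivative dd h (dd h F) (x + 0 *\<^sub>R h)) (at 0)"
    by (rule has_field_derivative_transform_within_open[OF _ T T0]) (simp add: g1)
  then show ?thesis by (simp add: numeral_2_eq_2 DERIV_imp_deriv)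
qed

text \<open>Absorbs the logarithm where a coefficient of ln \<epsilon> varies by
  O(\<epsilon>^2).\<close>

lemma eps_abs_ln_le: "0 < \<epsilon> \<Longrightarrow> \<epsilon> \<le> 1 \<Longrightarrow> \<epsilon> * \<bar>ln \<epsilon>\<bar> \<le> (1::real)"
proof -
  assume e: "0 < \<epsilon>" "\<epsilon> \<le> 1"
  have "ln (1 / \<epsilon>) \<le> 1 / \<epsilon> - 1" using e by (intro ln_le_minus_one) simp
  then have "\<bar>ln \<epsilon>\<bar> \<le> 1 / \<epsilon>" using e by (simp add: ln_div)
  then have "\<epsilon> * \<bar>ln \<epsilon>\<bar> \<le> \<epsilon> * (1 / \<epsilon>)" using e by (intro mult_left_mono) auto
  then show ?thesis using e by simp
qed

section \<open>The Hessian of the action near the saddle level\<close>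

context soliton
begin

definition mm :: "real \<times> 'q \<Rightarrow> real" where "mm p = mus (snd p) - fst p"
text \<open>\<open>Vv\<close>, \<open>Wv\<close>, \<open>Zv\<close> are the components along i of
  V_s, W_s, Z_s, and \<open>TT\<close> is the entry of T_s \<otimes> T_s, all read off from
  derivatives of the potential at the endstate. For the Boussinesq potential the agreement is shown
  by \<open>dd_Wt\<close>, \<open>dd_fst_dd_Wt\<close> and \<open>dd_dd_Wt\<close>.\<close>

definition Vv :: "'q \<Rightarrow> real \<times> 'q \<Rightarrow> real" where "Vv q i = fst i - dd (0, snd i) W (vs q, q)"
definition Wv :: "'q \<Rightarrow> real \<times> 'q \<Rightarrow> real" where "Wv q i = - dd (1, 0) (dd (0, snd i) W) (vs q, q)"
definition Zv :: "'q \<Rightarrow> real \<times> 'q \<Rightarrow> real" where "Zv q i = - dd (1, 0) (dd (1, 0) (dd (0, snd i) W)) (vs q, q)"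
definition TT :: "'q \<Rightarrow> real \<times> 'q \<Rightarrow> real \<times> 'q \<Rightarrow> real" where "TT q i j = dd (0, snd i) (dd (0, snd j) W) (vs q, q)"
text \<open>Second y-derivative of the straightening coordinate at 0, obtained by solving the
  third-order jet identity; \<open>x3\<close> is the third derivative, from the fourth-order
  one.\<close>

definition x2 :: "'q \<Rightarrow> real" where "x2 q = - W3s q * (as q)\<^sup>2 / (3 * W2s q)"
definition x3 :: "'q \<Rightarrow> real" where
  "x3 q = - (W4s q * as q ^ 4 + 6 * W3s q * (as q)\<^sup>2 * x2 q + 3 * W2s q * (x2 q)\<^sup>2) / (4 * W2s q * as q)"
text \<open>Second y-derivative at 0 of the density sqrt (2 \<kappa> (X)) X_y.\<close>

definition \<phi>2 :: "'q \<Rightarrow> real" where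
  "\<phi>2 q = deriv (deriv (\<lambda>v. sqrt (2 * \<kappa> v))) (vs q) * as q ^ 3
    + 3 * deriv (\<lambda>v. sqrt (2 * \<kappa> v)) (vs q) * as q * x2 q + sqrt (2 * \<kappa> (vs q)) * x3 q"
text \<open>\<open>alpha\<close> and \<open>beta\<close> are the forms in which the two coefficients
  come out of the analysis; \<open>coefficients\<close> shows that they equal
  \<open>\<alpha>_s\<close> and \<open>\<beta>_s\<close>.\<close>

definition alpha :: "'q \<Rightarrow> real" where "alpha q = \<phi>2 q / (4 * Y q)"
definition beta :: "'q \<Rightarrow> real" where
  "beta q = W3s q / (2 * (W2s q)\<^sup>2) - deriv \<kappa> (vs q) / (2 * \<kappa> (vs q) * W2s q)"
definition Lc :: "'q \<Rightarrow> real \<times> 'q \<Rightarrow> real \<times> 'q \<Rightarrow> real" where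
  "Lc q i j = alpha q * (Vv q i * Vv q j) + beta q * (Vv q i * Wv q j + Wv q i * Vv q j)
    + (as q)\<^sup>2 / 2 * (Wv q i * Wv q j) + TT q i j + (as q)\<^sup>2 / 4 * (Zv q i * Vv q j + Vv q i * Zv q j)"
definition sing :: "'q \<Rightarrow> real \<Rightarrow> real \<times> 'q \<Rightarrow> real \<times> 'q \<Rightarrow> real" where
  "sing q \<rho> i j = 2 * (as q)\<^sup>2 / (vS q - vs q)\<^sup>2 * ((1 + \<rho>) / \<rho>\<^sup>2) * (Vv q i * Vv q j) + Lc q i j * ln \<rho>"
definition act :: "(real \<times> 'q \<Rightarrow> real) \<Rightarrow> (real \<times> 'q \<Rightarrow> real) \<Rightarrow> real \<times> 'q \<Rightarrow> real" where
  "act v2 v3 p = 2 * integral {v2 p..v3 p} (\<lambda>v. sqrt (2 * \<kappa> v * (fst p - W (v, snd p))))"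
definition mom :: "'q \<Rightarrow> real" where
  "mom q = 2 * integral {vs q..vS q} (\<lambda>v. sqrt (2 * \<kappa> v * (mus q - W (v, q))))"

lemma open_UL: "open ((UNIV::real set) \<times> \<Lambda>)" using \<Lambda> by (simp add: open_Times)

lemma smooth_on_snd_comp: "smooth_on F \<Lambda> \<Longrightarrow> smooth_on (\<lambda>p::real\<times>'q. F (snd p)) (UNIV \<times> \<Lambda>)"
  by (rule smooth_on_compose[OF open_UL \<Lambda> _ smooth_on_snd]) auto

lemma smooth_mm: "smooth_on mm (UNIV \<times> \<Lambda>)"
  unfolding mm_def by (rule smooth_on_diff[OF open_UL smooth_on_snd_comp[OF smooth_mus] smooth_on_fst])

lemma dd_mm:
  assumes "snd p \<in> \<Lambda>"
  shows "dd h mm p = - Vv (snd p) h"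
proof -
  have d: "mus differentiable (at (snd p))" by (rule smooth_on_differentiable[OF smooth_mus assms])
  have 1: "(\<lambda>p. mus (snd p)) differentiable (at p)"
    using has_derivative_compose_dd[OF d has_derivative_snd[OF has_derivative_ident]] by (auto simp: differentiable_def)
  have "dd h mm p = dd h (\<lambda>p. mus (snd p)) p - dd h fst p"
    unfolding mm_def by (rule dd_diff[OF 1 bounded_linear_imp_differentiable[OF bounded_linear_fst]])
  moreover have "dd h fst p = fst h" by (rule dd_eqI[OF has_derivative_fst[OF has_derivative_ident]])
  ultimately show ?thesis using dd_comp_snd[OF d] dd_mus[OF assms] by (simp add: Vv_def)
qed

lemma dd_vs_Wv: "q \<in> \<Lambda> \<Longrightarrow> dd (snd i) vs q = Wv q i / W2s q"
  using dd_vs[of q "snd i"] W2s_neg[of q] by (simp add: Wv_def field_simps)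

text \<open>Origin of the W \<otimes> W and T \<otimes> T terms: the motion of the endstate
  contributes - 1 / \<open>W2s\<close> = a_s^2 / 2 times a product of W-components, and the explicit
  parameter dependence contributes \<open>TT\<close>.\<close>

lemma dd_dd_mm:
  assumes "snd p \<in> \<Lambda>"
  shows "dd i (dd j mm) p = (as (snd p))\<^sup>2 / 2 * (Wv (snd p) i * Wv (snd p) j) + TT (snd p) i j"
proof -
  have eq: "dd j mm y = dd (snd j) mus (snd y) - fst j" if "y \<in> UNIV \<times> \<Lambda>" for y
    using dd_mm[of y j] dd_mus[of "snd y" "snd j"] that by (auto simp: Vv_def)
  have d: "dd (snd j) mus differentiable (at (snd p))"
    by (rule smooth_on_differentiable[OF smooth_on_dd[OF smooth_mus] assms])
  have 1: "(\<lambda>p. dd (snd j) mus (snd p)) differentiable (at p)"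
    using has_derivative_compose_dd[OF d has_derivative_snd[OF has_derivative_ident]] by (auto simp: differentiable_def)
  have "dd i (dd j mm) p = dd i (\<lambda>y. dd (snd j) mus (snd y) - fst j) p"
    by (rule dd_cong[OF open_UL _ eq]) (use assms in \<open>auto simp: mem_Times_iff\<close>)
  also have "\<dots> = dd (snd i) (dd (snd j) mus) (snd p)"
    by (simp add: dd_diff[OF 1] dd_const dd_comp_snd[OF d])
  also have "\<dots> = (as (snd p))\<^sup>2 / 2 * (Wv (snd p) i * Wv (snd p) j) + TT (snd p) i j"
    using dd_dd_mus[OF assms, of "snd i" "snd j"] dd_vs_Wv[OF assms, of i]
    by (simp add: as_sq[OF assms] TT_def Wv_def)
  finally show ?thesis .
qed

text \<open>\<open>dd_Y\<close> solved for the logarithmic derivative of Y. It explains both the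
  coefficient \<beta>_s and the factor a_s^2 / 4 of the Z-terms.\<close>

lemma dd_Y_explicit:
  assumes q: "q \<in> \<Lambda>"
  shows "dd (snd i) Y q = - (Y q * (beta q * Wv q i + (as q)\<^sup>2 / 4 * Zv q i))"
proof -
  let ?y = "dd (snd i) Y q" and ?z = "Zv q i" and ?w = "Wv q i"
  define t where "t = deriv \<kappa> (vs q) / \<kappa> (vs q)"
  have k: "0 < \<kappa> (vs q)" and W: "W2s q < 0" and Y: "0 < Y q"
    using \<kappa>(2)[OF vs(2)[OF q]] W2s_neg[OF q] Y_pos[OF q] by auto
  have "- 4 * deriv \<kappa> (vs q) = t * (Y q)\<^sup>2 * W2s q"
    using Y_sq[OF q] k by (simp add: t_def field_simps)
  note * = this
  have "- 4 * (deriv \<kappa> (vs q) * (?w / W2s q)) = (- 4 * deriv \<kappa> (vs q)) * (?w / W2s q)" by simp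
  also have "\<dots> = t * (Y q)\<^sup>2 * W2s q * (?w / W2s q)" by (simp only: *)
  finally have "- 4 * (deriv \<kappa> (vs q) * (?w / W2s q)) = t * (Y q)\<^sup>2 * W2s q * (?w / W2s q)" .
  moreover have "dd (1, 0) (dd (1, 0) (dd (0, snd i) W)) (vs q, q) = - ?z" by (simp add: Zv_def)
  ultimately have "2 * Y q * ?y * W2s q + (Y q)\<^sup>2 * (?w / W2s q * W3s q + - ?z) = t * (Y q)\<^sup>2 * W2s q * (?w / W2s q)"
    using dd_Y[OF q, of "snd i"] unfolding dd_vs_Wv[OF q] by metis
  then have "Y q * (2 * ?y * W2s q) = Y q * (Y q * (t * ?w - ?w / W2s q * W3s q + ?z))"
    using W by (simp add: power2_eq_square algebra_simps)
  then have "2 * ?y * W2s q = Y q * (t * ?w - ?w / W2s q * W3s q + ?z)" using Y by simp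
  then have "?y = Y q * (t * ?w - ?w / W2s q * W3s q + ?z) / (2 * W2s q)" using W by (simp add: field_simps)
  also have "\<dots> = - (Y q * (beta q * ?w + (as q)\<^sup>2 / 4 * ?z))"
    unfolding beta_def as_sq[OF q] t_def using W k by (simp add: field_simps power2_eq_square)
  finally show ?thesis .
qed

text \<open>The left side is the coefficient of ln m in the Hessian at m = 0, with \<phi>2 / 16 the
  value of \<open>C\<close> there. Since ln m = 2 ln \<epsilon>, the factor Y / 2 becomes Y.\<close>

lemma log_coefficient:
  assumes q: "q \<in> \<Lambda>"
  shows "2 * (\<phi>2 q / 16) * (Vv q i * Vv q j) - (dd (snd j) Y q * Vv q i + dd (snd i) Y q * Vv q j) / 2
    + Y q / 2 * ((as q)\<^sup>2 / 2 * (Wv q i * Wv q j) + TT q i j) = Y q / 2 * Lc q i j"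
proof -
  have "\<phi>2 q = 4 * Y q * alpha q" using Y_pos[OF q] by (simp add: alpha_def)
  then show ?thesis unfolding dd_Y_explicit[OF q] Lc_def by (simp add: field_simps)
qed

text \<open>The estimate is uniform for q near \<open>q0\<close>, as needed for a limit in which the
  parameters move too. \<open>D\<close> comes from a local choice of coordinates here, so symmetry,
  linearity and the momentum identity are claimed at \<open>q0\<close> only;
  \<open>asymptotics\<close> removes the choice.\<close>

lemma local_asymptotics:
  assumes q0: "q0 \<in> \<Lambda>"
    and roots: "\<And>\<mu> q. q \<in> \<Lambda> \<Longrightarrow> W (v0 q, q) < \<mu> \<Longrightarrow> \<mu> < mus q \<Longrightarrow>
      v1 (\<mu>, q) \<in> I \<and> v1 (\<mu>, q) < vs q \<and> vs q < v2 (\<mu>, q) \<and> v2 (\<mu>, q) < v0 q \<and> v0 q < v3 (\<mu>, q) \<and> v3 (\<mu>, q) < vS q \<and>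
      W (v1 (\<mu>, q), q) = \<mu> \<and> W (v2 (\<mu>, q), q) = \<mu> \<and> W (v3 (\<mu>, q), q) = \<mu> \<and>
      (\<forall>v\<in>{v1 (\<mu>, q)..<vs q}. 0 < dd (1, 0) W (v, q))"
  obtains D where "\<And>i j. D q0 i j = D q0 j i" "\<And>j. linear (\<lambda>i. D q0 i j)"
    "\<And>i. Vv q0 i = 0 \<Longrightarrow> Wv q0 i = 0 \<Longrightarrow> TT q0 i i = 0 \<Longrightarrow>
      Y q0 * D q0 i i = (deriv ^^ 2) (\<lambda>t. mom (q0 + t *\<^sub>R snd i)) 0"
    "\<And>i j. \<exists>\<delta> \<Theta> K. 0 < \<delta> \<and> open \<Theta> \<and> q0 \<in> \<Theta> \<and> \<Theta> \<subseteq> \<Lambda> \<and> (\<forall>q\<in>\<Theta>. \<forall>\<epsilon>\<in>{0<..<\<delta>}.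
      let p = (mus q - \<epsilon>\<^sup>2, q); \<rho> = (v2 p - v1 p) / (v3 p - v2 p) in
        0 < \<rho> \<and> \<rho> \<le> K * \<epsilon> \<and> \<epsilon> \<le> K * \<bar>\<rho> * ln \<rho>\<bar> \<and>
        \<bar>hessian (act v2 v3) p i j / Y q - sing q \<rho> i j - D q i j\<bar> \<le> K * \<epsilon>)"
proof -
  obtain X X3 \<eta> \<Theta> C B where \<eta>: "0 < \<eta>" and \<Theta>: "open \<Theta>" "q0 \<in> \<Theta>" "\<Theta> \<subseteq> \<Lambda>"
    and sX: "smooth_on X ({-\<eta><..<\<eta>} \<times> \<Theta>)" and sX3: "smooth_on X3 ({-\<eta>\<^sup>2<..<\<eta>\<^sup>2} \<times> \<Theta>)"
    and X: "\<And>y q. y \<in> {-\<eta><..<\<eta>} \<Longrightarrow> q \<in> \<Theta> \<Longrightarrow> X (y, q) \<in> I \<and> X (y, q) < v0 q \<and>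
      W (X (y, q), q) = W (vs q, q) - y\<^sup>2 \<and> 0 < dd (1, 0) X (y, q)"
    and X0: "\<And>q. q \<in> \<Theta> \<Longrightarrow> X (0, q) = vs q \<and> X3 (0, q) = vS q"
    and X3: "\<And>m q. m \<in> {-\<eta>\<^sup>2<..<\<eta>\<^sup>2} \<Longrightarrow> q \<in> \<Theta> \<Longrightarrow> X3 (m, q) \<in> I \<and> v0 q < X3 (m, q) \<and>
      W (X3 (m, q), q) = W (vs q, q) - m \<and> dd (1, 0) X3 (m, q) < 0"
    and sC: "smooth_on C (UNIV \<times> \<Theta>)" and sB: "Ck_on 3 B ({-\<eta>\<^sup>2<..<\<eta>\<^sup>2} \<times> \<Theta>)"
    and exp: "\<And>m q. m \<in> {0..<\<eta>\<^sup>2} \<Longrightarrow> q \<in> \<Theta> \<Longrightarrow>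
      2 * integral {X (sqrt m, q)..X3 (m, q)} (\<lambda>v. sqrt (2 * \<kappa> v * (W (vs q, q) - m - W (v, q)))) =
      (sqrt (2 * \<kappa> (vs q)) * dd (1, 0) X (0, q) / 2 * m + m\<^sup>2 * C (m, q)) * ln m + B (m, q)"
    and C0: "\<And>q. q \<in> \<Theta> \<Longrightarrow>
      C (0, q) = dd (1, 0) (dd (1, 0) (\<lambda>p. sqrt (2 * \<kappa> (X p)) * dd (1, 0) X p)) (0, q) / 16"
    by (rule action_expansion[OF I \<Lambda> W \<kappa> vs v0 vS W1 W2 ord eqW neg pos q0], assumption+, rule that)
  have z: "0 \<in> {-\<eta><..<\<eta>}" and zz: "0 \<in> {-\<eta>\<^sup>2<..<\<eta>\<^sup>2}" using \<eta> by auto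
  have jets: "dd (1, 0) X (0, q) = as q" "C (0, q) = \<phi>2 q / 16" if q: "q \<in> \<Theta>" for q
  proof -
    have q\<Lambda>: "q \<in> \<Lambda>" using q \<Theta> by auto
    note J = straight_coordinate_jets[OF \<eta> \<Theta>(1,3) sX, of q]
    have XI: "X (y, q) \<in> I" "W (X (y, q), q) = mus q - y\<^sup>2" if "y \<in> {-\<eta><..<\<eta>}" "q \<in> \<Theta>" for y q
      using X[OF that] by (auto simp: mus_def)
    have X00: "X (0, q) = vs q" "0 < dd (1, 0) X (0, q)" if "q \<in> \<Theta>" for q using X0[OF that] X[OF z that] by auto
    note J = J[OF XI X00 q]
    show a: "dd (1, 0) X (0, q) = as q" by (rule J(1))
    have pos: "0 < as q" "W2s q < 0" using as_pos[OF q\<Lambda>] W2s_neg[OF q\<Lambda>] by auto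
    have 2: "dd (1, 0) (dd (1, 0) X) (0, q) = x2 q"
    proof -
      have "as q * (3 * W2s q * dd (1, 0) (dd (1, 0) X) (0, q) + W3s q * (as q)\<^sup>2) = 0"
        using J(2) by (simp add: power2_eq_square power3_eq_cube algebra_simps)
      then have "3 * W2s q * dd (1, 0) (dd (1, 0) X) (0, q) + W3s q * (as q)\<^sup>2 = 0" using pos by simp
      then have "dd (1, 0) (dd (1, 0) X) (0, q) * (3 * W2s q) = - W3s q * (as q)\<^sup>2" by (simp add: algebra_simps)
      then show ?thesis using pos unfolding x2_def by (subst eq_divide_eq) auto
    qed
    have 3: "dd (1, 0) (dd (1, 0) (dd (1, 0) X)) (0, q) = x3 q"
    proof -
      have "dd (1, 0) (dd (1, 0) (dd (1, 0) X)) (0, q) * (4 * W2s q * as q) =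
        - (W4s q * as q ^ 4 + 6 * W3s q * (as q)\<^sup>2 * x2 q + 3 * W2s q * (x2 q)\<^sup>2)"
        using J(3) unfolding 2 by (simp add: algebra_simps)
      then show ?thesis using pos unfolding x3_def by (subst eq_divide_eq) auto
    qed
    show "C (0, q) = \<phi>2 q / 16" using C0[OF q] J(4) 2 3 by (simp add: \<phi>2_def)
  qed

  \<comment> \<open>Both signs of \<open>mm\<close> are allowed, so that the points of the level m =
    0 are interior and the coefficients can be differentiated there.\<close>
  define N where "N = {p \<in> UNIV \<times> \<Theta>. mm p \<in> {-\<eta>\<^sup>2<..<\<eta>\<^sup>2}}"
  have op\<Theta>: "open ((UNIV::real set) \<times> \<Theta>)" using \<Theta> by (simp add: open_Times)
  have smm\<Theta>: "smooth_on mm (UNIV \<times> \<Theta>)" by (rule smooth_on_subset[OF smooth_mm]) (use \<Theta> in auto)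
  have N: "open N"
  proof -
    have "N = mm -` {-\<eta>\<^sup>2<..<\<eta>\<^sup>2} \<inter> (UNIV \<times> \<Theta>)" by (auto simp: N_def)
    then show ?thesis
      using continuous_on_open_vimage[OF op\<Theta>, of mm] smooth_on_continuous_on[OF smm\<Theta>] open_greaterThanLessThan by metis
  qed
  have N\<Theta>: "snd p \<in> \<Theta>" "snd p \<in> \<Lambda>" "p \<in> UNIV \<times> \<Lambda>" if "p \<in> N" for p using that \<Theta> by (auto simp: N_def mem_Times_iff)
  have smm: "smooth_on mm N" by (rule smooth_on_subset[OF smooth_mm]) (use N\<Theta> in auto)
  define \<Phi> where "\<Phi> p = (mm p, snd p)" for p
  have s\<Phi>: "smooth_on \<Phi> N" unfolding \<Phi>_def by (rule smooth_on_Pair[OF N smm smooth_on_snd])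
  have \<Phi>in: "\<Phi> p \<in> {-\<eta>\<^sup>2<..<\<eta>\<^sup>2} \<times> \<Theta>" if "p \<in> N" for p using that by (auto simp: \<Phi>_def N_def mem_Times_iff)
  have opB: "open ({-\<eta>\<^sup>2<..<\<eta>\<^sup>2} \<times> \<Theta>)" using \<Theta> by (intro open_Times_interval)
  define Yp where "Yp p = Y (snd p)" for p :: "real \<times> 'q"
  define Cp where "Cp p = C (\<Phi> p)" for p
  define Bp where "Bp p = B (\<Phi> p)" for p
  define Q where "Q p = Yp p / 2 + mm p * Cp p" for p
  have sYp: "smooth_on Yp N" unfolding Yp_def
    by (rule smooth_on_subset[OF smooth_on_snd_comp[OF smooth_Y]]) (use N\<Theta> in auto)
  have sCp: "smooth_on Cp N" unfolding Cp_def by (rule smooth_on_compose[OF N op\<Theta> sC s\<Phi>]) (use \<Phi>in in \<open>auto simp: mem_Times_iff\<close>)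
  have sBp: "Ck_on 3 Bp N" unfolding Bp_def by (rule Ck_on_compose[OF N opB sB smooth_onD[OF s\<Phi>] \<Phi>in])
  have sQ: "smooth_on Q N" unfolding Q_def
    by (intro smooth_on_add smooth_on_divide smooth_on_mult smooth_on_const sYp smm sCp N) auto
  have Yp_pos: "0 < Yp p" if "p \<in> N" for p using Y_pos N\<Theta>(2)[OF that] by (simp add: Yp_def)
  have sBp2: "Ck_on 1 (dd i (dd j Bp)) N" for i j
  proof -
    have "Ck_on (Suc (Suc 1)) Bp N" using sBp by (simp add: numeral_3_eq_3)
    then show ?thesis by (intro Ck_on_dd)
  qed

  \<comment> \<open>The point of the saddle level over q, where the limits of all coefficients are
    evaluated.\<close>
  define \<sigma> where "\<sigma> q = (mus q, q)" for q
  have \<sigma>N: "\<sigma> q \<in> N" and \<sigma>0: "mm (\<sigma> q) = 0" "snd (\<sigma> q) = q" if "q \<in> \<Theta>" for q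
    using that \<eta> by (auto simp: \<sigma>_def N_def mm_def)
  \<comment> \<open>\<open>L\<close> is the full coefficient of ln m and reduces to \<open>G\<close>
    at m = 0. \<open>G\<close> returns in \<open>Cc\<close> through the derivative 1 + ln m of m ln
    m, and the \<open>Cp\<close> term there is the part of Q dm dm / m that stays bounded.\<close>
  define G where "G i j p = dd j Q p * dd i mm p + dd i Q p * dd j mm p + Q p * dd i (dd j mm) p" for i j p
  define L where "L i j p = dd i (dd j Q) p * mm p + G i j p" for i j p
  define Cc where "Cc i j p = G i j p + Cp p * dd i mm p * dd j mm p + dd i (dd j Bp) p" for i j p
  have sG: "smooth_on (G i j) N" for i j
    unfolding G_def by (intro smooth_on_add smooth_on_mult smooth_on_dd sQ smm N)
  have sL: "smooth_on (L i j) N" for i j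
    unfolding L_def by (intro smooth_on_add[OF N smooth_on_mult[OF N smooth_on_dd[OF smooth_on_dd[OF sQ]] smm] sG])
  have sCc: "Ck_on 1 (Cc i j) N" for i j
    unfolding Cc_def
    by (rule Ck_on_add[OF N Ck_on_add[OF N smooth_onD[OF sG]
            Ck_on_mult[OF N Ck_on_mult[OF N smooth_onD[OF sCp] smooth_onD[OF smooth_on_dd[OF smm]]] smooth_onD[OF smooth_on_dd[OF smm]]]] sBp2])
  have G\<sigma>: "2 * G i j (\<sigma> q) = Y q * Lc q i j" if q: "q \<in> \<Theta>" for q i j
  proof -
    note p = \<sigma>N[OF q] and q\<Lambda> = N\<Theta>(2)[OF \<sigma>N[OF q], unfolded \<sigma>0(2)[OF q]]
    have d: "F differentiable (at (\<sigma> q))" if "smooth_on F N" for F :: "real \<times> 'q \<Rightarrow> real"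
      by (rule smooth_on_differentiable[OF that p])
    have dQ: "dd h Q (\<sigma> q) = dd (snd h) Y q / 2 - Vv q h * (\<phi>2 q / 16)" for h
    proof -
      have "dd h (\<lambda>p. Yp p / 2) (\<sigma> q) = dd h Yp (\<sigma> q) / 2"
        using dd_eqI[OF has_derivative_mult_right[OF has_derivative_dd[OF d[OF sYp]], of "1 / 2"], of h] by simp
      then have "dd h Q (\<sigma> q) = dd h Yp (\<sigma> q) / 2 + (mm (\<sigma> q) * dd h Cp (\<sigma> q) + dd h mm (\<sigma> q) * Cp (\<sigma> q))"
        unfolding Q_def
        by (simp add: dd_add[OF d[OF smooth_on_divide[OF N sYp smooth_on_const]] d[OF smooth_on_mult[OF N smm sCp]]]
            dd_mult[OF d[OF smm] d[OF sCp]])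
      also have "dd h Yp (\<sigma> q) = dd (snd h) Y q"
        unfolding Yp_def using dd_comp_snd[of Y "\<sigma> q" h] smooth_on_differentiable[OF smooth_Y q\<Lambda>] by (simp add: \<sigma>0(2)[OF q])
      also have "Cp (\<sigma> q) = \<phi>2 q / 16" using jets(2)[OF q] by (simp add: Cp_def \<Phi>_def \<sigma>0[OF q])
      finally show ?thesis using dd_mm[of "\<sigma> q" h] q\<Lambda> by (simp add: \<sigma>0[OF q])
    qed
    have Q\<sigma>: "Q (\<sigma> q) = Y q / 2" by (simp add: Q_def Yp_def \<sigma>0[OF q])
    have m2: "dd i (dd j mm) (\<sigma> q) = (as q)\<^sup>2 / 2 * (Wv q i * Wv q j) + TT q i j"
      using dd_dd_mm[of "\<sigma> q" i j] q\<Lambda> by (simp add: \<sigma>0[OF q])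
    have m1: "dd h mm (\<sigma> q) = - Vv q h" for h using dd_mm[of "\<sigma> q" h] q\<Lambda> by (simp add: \<sigma>0[OF q])
    show ?thesis
      using log_coefficient[OF q\<Lambda>, of i j] unfolding G_def dQ Q\<sigma> m1 m2 by (simp add: field_simps)
  qed

  have mono: "F (a, q) < F (b, q)" if "q \<in> \<Theta>" "a < b" "a \<in> S" "b \<in> S" "is_interval S" "smooth_on F (S \<times> \<Theta>)"
    "\<And>y. y \<in> S \<Longrightarrow> 0 < dd (1, 0) F (y, q)" for F :: "real \<times> 'q \<Rightarrow> real" and a b q S
  proof (rule DERIV_pos_imp_increasing[OF that(2)])
    fix y assume y: "a \<le> y" "y \<le> b"
    have "y \<in> S" by (rule mem_is_interval_1_I[OF that(5,3,4) y])
    then show "\<exists>d. ((\<lambda>y. F (y, q)) has_real_derivative d) (at y) \<and> 0 < d"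
      using dd_fst_line[OF that(6), of y q] that(7)[of y] that(1) by blast
  qed
  have Xmono: "X (a, q) < X (b, q)" if "q \<in> \<Theta>" "a < b" "a \<in> {-\<eta><..<\<eta>}" "b \<in> {-\<eta><..<\<eta>}" for a b q
    by (rule mono[OF that _ sX]) (use X that in \<open>auto simp: is_interval_1\<close>)
  have X3lt: "X3 (m, q) < vS q" if "q \<in> \<Theta>" "m \<in> {0<..<\<eta>\<^sup>2}" for m q
  proof -
    have m: "m \<in> {-\<eta>\<^sup>2<..<\<eta>\<^sup>2}" using that(2) \<eta> by (auto intro: less_le_trans[of _ 0])
    have "X3 (m, q) < X3 (0, q)"
    proof (rule DERIV_neg_imp_decreasing[where f = "\<lambda>y. X3 (y, q)" and a = 0 and b = m])
      show "0 < m" using that by simp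
      fix y assume "0 \<le> y" "y \<le> m"
      then have "y \<in> {-\<eta>\<^sup>2<..<\<eta>\<^sup>2}" using m \<eta> by (auto intro: less_le_trans[of _ 0])
      then show "\<exists>d. ((\<lambda>y. X3 (y, q)) has_real_derivative d) (at y) \<and> d < 0"
        using dd_fst_line[OF sX3, of y q] X3[of y q] that(1) by blast
    qed
    then show ?thesis using X0[OF that(1)] by simp
  qed
  \<comment> \<open>The given roots are identified with the coordinate roots by strict monotonicity
    on each branch: two points of one branch on the same level coincide.\<close>
  have root_id: "v1 (\<mu>, q) = X (- \<epsilon>, q)" "v2 (\<mu>, q) = X (\<epsilon>, q)" "v3 (\<mu>, q) = X3 (\<epsilon>\<^sup>2, q)"
    if q: "q \<in> \<Theta>" and \<epsilon>: "\<epsilon> \<in> {0<..<\<eta>}" and \<mu>: "\<mu> = mus q - \<epsilon>\<^sup>2" for q \<epsilon> \<mu>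
  proof -
    have q\<Lambda>: "q \<in> \<Lambda>" using q \<Theta> by auto
    have \<epsilon>2: "\<epsilon>\<^sup>2 \<in> {0<..<\<eta>\<^sup>2}" using \<epsilon> by (auto intro: power_strict_mono)
    then have \<epsilon>2': "\<epsilon>\<^sup>2 \<in> {-\<eta>\<^sup>2<..<\<eta>\<^sup>2}" unfolding greaterThanLessThan_iff by linarith
    have e: "\<epsilon> \<in> {-\<eta><..<\<eta>}" "- \<epsilon> \<in> {-\<eta><..<\<eta>}" using \<epsilon> by auto
    have a: "vs q < X (\<epsilon>, q)" using Xmono[OF q, of 0 \<epsilon>] X0[OF q] z e \<epsilon> by auto
    have b: "X (- \<epsilon>, q) < vs q" using Xmono[OF q, of "- \<epsilon>" 0] X0[OF q] z e \<epsilon> by auto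
    note Xe = X[OF e(1) q] and Xn = X[OF e(2) q] and X3e = X3[OF \<epsilon>2' q] and X3l = X3lt[OF q \<epsilon>2]
    have WX: "W (X (\<epsilon>, q), q) = \<mu>" "W (X (- \<epsilon>, q), q) = \<mu>" "W (X3 (\<epsilon>\<^sup>2, q), q) = \<mu>"
      using Xe Xn X3e \<mu> by (auto simp: mus_def)
    have lt: "W (v0 q, q) < \<mu>" "\<mu> < mus q"
      using W_decreasing[OF q\<Lambda>, of "X (\<epsilon>, q)" "v0 q"] a Xe WX \<epsilon> \<mu> by auto
    note r = roots[OF q\<Lambda> lt]
    show "v2 (\<mu>, q) = X (\<epsilon>, q)"
      using W_decreasing[OF q\<Lambda>, of "X (\<epsilon>, q)" "v2 (\<mu>, q)"] W_decreasing[OF q\<Lambda>, of "v2 (\<mu>, q)" "X (\<epsilon>, q)"] r a Xe WX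
      by (metis less_irrefl less_le_not_le linorder_neqE_linordered_idom)
    show "v3 (\<mu>, q) = X3 (\<epsilon>\<^sup>2, q)"
      using W_increasing[OF q\<Lambda>, of "X3 (\<epsilon>\<^sup>2, q)" "v3 (\<mu>, q)"] W_increasing[OF q\<Lambda>, of "v3 (\<mu>, q)" "X3 (\<epsilon>\<^sup>2, q)"] r X3e X3l WX
      by (metis less_irrefl less_le_not_le linorder_neqE_linordered_idom)
    show "v1 (\<mu>, q) = X (- \<epsilon>, q)"
    proof (rule linorder_cases)
      assume l: "v1 (\<mu>, q) < X (- \<epsilon>, q)"
      have "W (v1 (\<mu>, q), q) < W (X (- \<epsilon>, q), q)"
      proof (rule DERIV_pos_imp_increasing[where f = "\<lambda>v. W (v, q)", OF l])
        fix v assume v: "v1 (\<mu>, q) \<le> v" "v \<le> X (- \<epsilon>, q)"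
        have "v \<in> I" using segment_subset[of "v1 (\<mu>, q)" "X (- \<epsilon>, q)"] r Xn v by auto
        moreover have "0 < dd (1, 0) W (v, q)" using r v b by auto
        ultimately show "\<exists>d. ((\<lambda>v. W (v, q)) has_real_derivative d) (at v) \<and> 0 < d"
          using W_line[OF _ q\<Lambda>] by blast
      qed
      then show ?thesis using r WX by simp
    next
      \<comment> \<open>The sign of the slope is known only to the right of \<open>v1\<close>. So
        the intermediate value theorem writes \<open>v1\<close> as X (y) with - \<epsilon> < y <= 0,
        where the potential would exceed \<mu>.\<close>
      assume l: "X (- \<epsilon>, q) < v1 (\<mu>, q)"
      have "continuous_on {- \<epsilon>..0} (\<lambda>y. X (y, q))"
        by (rule continuous_on_compose2[OF smooth_on_continuous_on[OF sX]]) (use \<epsilon> q in \<open>auto intro: continuous_intros\<close>)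
      then obtain y where y: "- \<epsilon> \<le> y" "y \<le> 0" "X (y, q) = v1 (\<mu>, q)"
        using IVT'[of "\<lambda>y. X (y, q)" "- \<epsilon>" "v1 (\<mu>, q)" 0] l r X0[OF q] \<epsilon> by auto
      have "y \<noteq> - \<epsilon>" using y l by auto
      then have "y\<^sup>2 < \<epsilon>\<^sup>2" using y \<epsilon> by (intro abs_square_less_1[THEN iffD1] power2_strict_mono) auto
      moreover have "W (X (y, q), q) = mus q - y\<^sup>2" using X[of y q] y \<epsilon> q by (auto simp: mus_def)
      ultimately show ?thesis using y r \<mu> by simp
    qed
  qed

  define Np where "Np = {p \<in> N. 0 < mm p}"
  have Np: "open Np"
  proof -
    have "Np = mm -` {0<..} \<inter> N" by (auto simp: Np_def)
    then show ?thesis using continuous_on_open_vimage[OF N, of mm] smooth_on_continuous_on[OF smm] open_greaterThan by metis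
  qed
  have actN: "act v2 v3 p = Q p * (mm p * ln (mm p)) + Bp p" if "p \<in> Np" for p
  proof -
    obtain \<mu> q where p: "p = (\<mu>, q)" by (cases p)
    have q: "q \<in> \<Theta>" and m: "0 < mm p" "mm p < \<eta>\<^sup>2" using that by (auto simp: Np_def N_def p)
    define \<epsilon> where "\<epsilon> = sqrt (mm p)"
    have \<epsilon>: "\<epsilon> \<in> {0<..<\<eta>}" "\<epsilon>\<^sup>2 = mm p" using m \<eta> by (auto simp: \<epsilon>_def intro: real_less_lsqrt)
    have \<mu>: "\<mu> = mus q - \<epsilon>\<^sup>2" by (simp add: \<epsilon> p mm_def)
    have "act v2 v3 p = 2 * integral {X (sqrt (mm p), q)..X3 (mm p, q)} (\<lambda>v. sqrt (2 * \<kappa> v * (W (vs q, q) - mm p - W (v, q))))"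
      unfolding act_def p root_id[OF q \<epsilon>(1) \<mu>] fst_conv snd_conv \<epsilon>(2)[unfolded p] \<epsilon>_def[unfolded p, symmetric]
      using \<mu> \<epsilon>(2) by (simp add: mus_def p)
    also have "\<dots> = (sqrt (2 * \<kappa> (vs q)) * dd (1, 0) X (0, q) / 2 * mm p + (mm p)\<^sup>2 * C (mm p, q)) * ln (mm p) + B (mm p, q)"
      by (rule exp) (use m q in auto)
    also have "\<dots> = Q p * (mm p * ln (mm p)) + Bp p"
      by (simp add: Q_def Yp_def Cp_def Bp_def \<Phi>_def p jets(1)[OF q] Y_def power2_eq_square algebra_simps)
    finally show ?thesis .
  qed
  have hess: "hessian (act v2 v3) p i j = L i j p * ln (mm p) + Cc i j p + Yp p / 2 * (dd i mm p * dd j mm p) / mm p"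
    if p: "p \<in> Np" for p i j
  proof -
    have sub: "Np \<subseteq> N" and m: "0 < mm p" using p by (auto simp: Np_def)
    have Q2: "Ck_on 2 Q Np" and m2: "Ck_on 2 mm Np" and B2: "Ck_on 2 Bp Np"
      using smooth_onD[OF smooth_on_subset[OF sQ sub]] smooth_onD[OF smooth_on_subset[OF smm sub]]
        Ck_on_mono[OF Ck_on_subset[OF sBp sub], of 2] by auto
    have pos: "0 < mm y" if "y \<in> Np" for y using that by (simp add: Np_def)
    have "hessian (act v2 v3) p i j = hessian (\<lambda>p. Q p * (mm p * ln (mm p)) + Bp p) p i j"
      by (rule hessian_cong_open[OF Np p actN])
    also have "\<dots> = dd i (dd j (\<lambda>p. Q p * (mm p * ln (mm p)) + Bp p)) p"
      by (rule hessian_eq_dd[OF Np _ p])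
        (intro Ck_on_add[OF Np Ck_on_mult[OF Np Q2 Ck_on_mult[OF Np m2 Ck_on_ln[OF Np m2 pos]]] B2])
    also have "\<dots> = (dd i (dd j Q) p * mm p + dd j Q p * dd i mm p + dd i Q p * dd j mm p + Q p * dd i (dd j mm) p) * ln (mm p)
      + (dd j Q p * dd i mm p + dd i Q p * dd j mm p + Q p * dd i (dd j mm) p)
      + Q p * dd i mm p * dd j mm p / mm p + dd i (dd j Bp) p"
      by (rule dd_dd_log_expansion[OF Np Q2 m2 B2 pos p])
    also have "\<dots> = L i j p * ln (mm p) + Cc i j p + Yp p / 2 * (dd i mm p * dd j mm p) / mm p"
      using m by (simp add: L_def Cc_def G_def Q_def field_simps)
    finally show ?thesis .
  qed

  have XZ: "X (y, q) < X3 (m, q)" if "y \<in> {-\<eta><..<\<eta>}" "m \<in> {-\<eta>\<^sup>2<..<\<eta>\<^sup>2}" "q \<in> \<Theta>" for y m q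
    using X[OF that(1,3)] X3[OF that(2,3)] by auto
  have X1: "0 < dd (1, 0) X (0, q)" if "q \<in> \<Theta>" for q using X[OF z that] by simp
  obtain d \<delta> M \<Theta>' where \<delta>: "0 < \<delta>" "\<delta> \<le> \<eta>" "\<delta> \<le> 1" and \<Theta>': "open \<Theta>'" "q0 \<in> \<Theta>'" "\<Theta>' \<subseteq> \<Theta>"
    and gap: "\<And>\<epsilon> q \<rho> a h. \<epsilon> \<in> {0<..<\<delta>} \<Longrightarrow> q \<in> \<Theta>' \<Longrightarrow> \<rho> = (X (\<epsilon>, q) - X (- \<epsilon>, q)) / (X3 (\<epsilon>\<^sup>2, q) - X (\<epsilon>, q)) \<Longrightarrow>
      a = dd (1, 0) X (0, q) \<Longrightarrow> h = X3 (0, q) - X (0, q) \<Longrightarrow>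
      0 < \<rho> \<and> \<rho> \<le> M * \<epsilon> \<and> \<epsilon> \<le> M * \<bar>\<rho> * ln \<rho>\<bar> \<and>
      \<bar>1 / (2 * \<epsilon>\<^sup>2) - 2 * a\<^sup>2 / h\<^sup>2 * ((1 + \<rho>) / \<rho>\<^sup>2) - d q\<bar> \<le> M * \<epsilon> \<and>
      \<bar>ln \<epsilon> - ln \<rho> - ln (h / (2 * a))\<bar> \<le> M * \<epsilon>"
    by (rule gap_ratio_expansion[OF \<eta> \<Theta>(1,2) sX sX3 XZ X1], assumption+, rule that)
  \<comment> \<open>The constants left after 1 / (2 \<epsilon>^2) and 2 ln \<epsilon> are expressed
    by \<rho>: the offset \<open>d\<close> multiplies V \<otimes> V, and ln (h / (2 a)) multiplies
    the coefficient 2 G / Y of the logarithm.\<close>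
  define D where "D q i j = (Cc i j (\<sigma> q) + 2 * ln ((vS q - vs q) / (2 * as q)) * G i j (\<sigma> q)) / Y q
    + d q * (dd i mm (\<sigma> q) * dd j mm (\<sigma> q))" for q i j
  note q0N = \<sigma>N[OF \<Theta>(2)]
  have sym: "dd i (dd j mm) (\<sigma> q0) = dd j (dd i mm) (\<sigma> q0)" "dd i (dd j Bp) (\<sigma> q0) = dd j (dd i Bp) (\<sigma> q0)" for i j
    by (rule dd_commute[OF N smooth_onD[OF smm] q0N], rule dd_commute[OF N Ck_on_mono[OF sBp] q0N]) simp
  have lin: "linear (\<lambda>h. dd h F (\<sigma> q0))" if "Ck_on 1 F N" for F :: "real \<times> 'q \<Rightarrow> real"
    by (rule linear_dd[OF Ck_on_differentiable[OF that _ q0N]]) simp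
  have sBp1: "Ck_on 1 (dd j Bp) N" for j
  proof -
    have "Ck_on (Suc 1) Bp N" using Ck_on_mono[OF sBp, of 2] by (simp add: numeral_2_eq_2)
    then show ?thesis by (rule Ck_on_dd)
  qed
  show ?thesis
  proof (rule that[of D])
    show "D q0 i j = D q0 j i" for i j
      unfolding D_def Cc_def G_def sym[of i j] by (simp add: algebra_simps)
    show "linear (\<lambda>i. D q0 i j)" for j
    proof -
      note l = lin[OF smooth_onD[OF smm]] lin[OF smooth_onD[OF sQ]] lin[OF smooth_onD[OF smooth_on_dd[OF smm]], of j] lin[OF sBp1, of j]
      show ?thesis
        unfolding D_def Cc_def G_def
        by (rule linearI)
          (simp_all add: linear_add[OF l(1)] linear_add[OF l(2)] linear_add[OF l(3)] linear_add[OF l(4)]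
            linear_scale[OF l(1)] linear_scale[OF l(2)] linear_scale[OF l(3)] linear_scale[OF l(4)]
            algebra_simps add_divide_distrib)
    qed
  next
    \<comment> \<open>Along such a direction the first and second derivatives of m vanish at the
      saddle point. Hence \<open>G\<close> and the V \<otimes> V terms drop out, and the chain rule
      leaves only the second parameter derivative of B at m = 0.\<close>
    fix i assume i: "Vv q0 i = 0" "Wv q0 i = 0" "TT q0 i i = 0"
    have m1: "dd i mm (\<sigma> q0) = 0" using dd_mm[of "\<sigma> q0" i] q0 i \<sigma>0[OF \<Theta>(2)] by simp
    have m2: "dd i (dd i mm) (\<sigma> q0) = 0" using dd_dd_mm[of "\<sigma> q0" i i] q0 i \<sigma>0[OF \<Theta>(2)] by simp
    have "Y q0 * D q0 i i = dd i (dd i Bp) (\<sigma> q0)"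
      using Y_pos[OF q0] by (simp add: D_def Cc_def G_def m1 m2)
    also have "\<dots> = dd (0, snd i) (dd (0, snd i) B) (0, q0)"
    proof -
      have \<Phi>': "(\<Phi> has_derivative (\<lambda>h. (dd h mm p, snd h))) (at p)" if "p \<in> N" for p
        unfolding \<Phi>_def
        by (intro has_derivative_Pair smooth_on_has_derivative[OF smm that] has_derivative_snd has_derivative_ident)
      have comp: "((\<lambda>p. F (\<Phi> p)) has_derivative (\<lambda>h. dd h mm p * dd (1, 0) F (\<Phi> p) + dd (0, snd h) F (\<Phi> p))) (at p)"
        if "p \<in> N" "Ck_on 1 F ({-\<eta>\<^sup>2<..<\<eta>\<^sup>2} \<times> \<Theta>)" for F :: "real \<times> 'q \<Rightarrow> real" and p
      proof -
        have dF: "F differentiable (at (\<Phi> p))" using Ck_on_differentiable[OF that(2) _ \<Phi>in[OF that(1)]] by simp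
        note l = linear_dd[OF dF]
        have "dd (dd h mm p, snd h) F (\<Phi> p) = dd h mm p * dd (1, 0) F (\<Phi> p) + dd (0, snd h) F (\<Phi> p)" for h
          using linear_add[OF l, of "dd h mm p *\<^sub>R (1, 0)" "(0, snd h)"] linear_scale[OF l, of "dd h mm p" "(1, 0)"] by simp
        then show ?thesis using has_derivative_compose_dd[OF dF \<Phi>'[OF that(1)]] by simp
      qed
      have B1: "Ck_on 1 B ({-\<eta>\<^sup>2<..<\<eta>\<^sup>2} \<times> \<Theta>)" using Ck_on_mono[OF sB, of 1] by simp
      have B2: "Ck_on 1 (dd h B) ({-\<eta>\<^sup>2<..<\<eta>\<^sup>2} \<times> \<Theta>)" for h
        by (rule Ck_on_dd) (use Ck_on_mono[OF sB, of 2] in \<open>simp add: numeral_2_eq_2\<close>)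
      have "dd i (dd i Bp) (\<sigma> q0) = dd i (\<lambda>p. dd i mm p * dd (1, 0) B (\<Phi> p) + dd (0, snd i) B (\<Phi> p)) (\<sigma> q0)"
        by (rule dd_cong[OF N q0N]) (unfold Bp_def, rule dd_eqI[OF comp[OF _ B1]])
      also have "\<dots> = dd i mm (\<sigma> q0) * (dd i mm (\<sigma> q0) * dd (1, 0) (dd (1, 0) B) (\<Phi> (\<sigma> q0)) + dd (0, snd i) (dd (1, 0) B) (\<Phi> (\<sigma> q0)))
          + dd i (dd i mm) (\<sigma> q0) * dd (1, 0) B (\<Phi> (\<sigma> q0))
          + (dd i mm (\<sigma> q0) * dd (1, 0) (dd (0, snd i) B) (\<Phi> (\<sigma> q0)) + dd (0, snd i) (dd (0, snd i) B) (\<Phi> (\<sigma> q0)))"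
        by (rule dd_eqI, rule has_derivative_add[OF has_derivative_mult[OF
                smooth_on_has_derivative[OF smooth_on_dd[OF smm] q0N] comp[OF q0N B2]] comp[OF q0N B2]])
      also have "\<dots> = dd (0, snd i) (dd (0, snd i) B) (0, q0)"
        using \<sigma>0[OF \<Theta>(2)] by (simp add: m1 m2 \<Phi>_def)
      finally show ?thesis .
    qed
    also have "\<dots> = (deriv ^^ 2) (\<lambda>t. mom (q0 + t *\<^sub>R snd i)) 0"
    proof (rule deriv_deriv_line[symmetric, OF opB Ck_on_mono[OF sB]])
      show "(0, q0) \<in> {-\<eta>\<^sup>2<..<\<eta>\<^sup>2} \<times> \<Theta>" using zz \<Theta> by simp
      fix t assume "(0, q0) + t *\<^sub>R (0, snd i) \<in> {-\<eta>\<^sup>2<..<\<eta>\<^sup>2} \<times> \<Theta>"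
      then have q: "q0 + t *\<^sub>R snd i \<in> \<Theta>" by simp
      \<comment> \<open>At m = 0 the factor of the logarithm is zero, so the expansion says that the
        momentum is B (0, q).\<close>
      show "mom (q0 + t *\<^sub>R snd i) = B ((0, q0) + t *\<^sub>R (0, snd i))"
        using exp[OF _ q, of 0] X0[OF q] \<eta> by (simp add: mom_def mus_def)
    qed simp
    finally show "Y q0 * D q0 i i = (deriv ^^ 2) (\<lambda>t. mom (q0 + t *\<^sub>R snd i)) 0" .
  next
    fix i j
    show "\<exists>\<delta> \<Theta> K. 0 < \<delta> \<and> open \<Theta> \<and> q0 \<in> \<Theta> \<and> \<Theta> \<subseteq> \<Lambda> \<and> (\<forall>q\<in>\<Theta>. \<forall>\<epsilon>\<in>{0<..<\<delta>}.
      let p = (mus q - \<epsilon>\<^sup>2, q); \<rho> = (v2 p - v1 p) / (v3 p - v2 p) in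
        0 < \<rho> \<and> \<rho> \<le> K * \<epsilon> \<and> \<epsilon> \<le> K * \<bar>\<rho> * ln \<rho>\<bar> \<and>
        \<bar>hessian (act v2 v3) p i j / Y q - sing q \<rho> i j - D q i j\<bar> \<le> K * \<epsilon>)"
    proof -
      \<comment> \<open>\<open>H1\<close> and \<open>H2\<close> are compared at p and at \<sigma> q,
        which are \<epsilon>^2 apart. For \<open>H3\<close> and \<open>H4\<close> the Lipschitz
        property only provides the local bounds \<open>K3\<close> and \<open>K4\<close>.\<close>
      define H1 where "H1 p = L i j p / Yp p" for p
      define H2 where "H2 p = Cc i j p / Yp p" for p
      define H3 where "H3 p = dd i mm p * dd j mm p" for p
      define H4 where "H4 p = 2 * G i j p / Yp p" for p
      have nz: "Yp p \<noteq> 0" if "p \<in> N" for p using Yp_pos[OF that] by simp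
      have H: "Ck_on 1 H1 N" "Ck_on 1 H2 N" "Ck_on 1 H3 N" "Ck_on 1 H4 N"
        unfolding H1_def H2_def H3_def H4_def
        by (intro Ck_on_divide[OF N] Ck_on_mult[OF N] Ck_on_const smooth_onD[OF sL] smooth_onD[OF sG] sCc
            smooth_onD[OF smooth_on_dd[OF smm]] smooth_onD[OF sYp] nz; assumption)+
      obtain C1 s1 where L1: "0 < s1" "0 \<le> C1" "ball (\<sigma> q0) s1 \<subseteq> N"
        and L1': "\<And>x y. x \<in> ball (\<sigma> q0) s1 \<Longrightarrow> y \<in> ball (\<sigma> q0) s1 \<Longrightarrow> \<bar>H1 x - H1 y\<bar> \<le> C1 * norm (x - y)"
        by (rule Ck_on_locally_lipschitz[OF N H(1) q0N], rule that)
      obtain C2 s2 where L2: "0 < s2" "0 \<le> C2" "ball (\<sigma> q0) s2 \<subseteq> N"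
        and L2': "\<And>x y. x \<in> ball (\<sigma> q0) s2 \<Longrightarrow> y \<in> ball (\<sigma> q0) s2 \<Longrightarrow> \<bar>H2 x - H2 y\<bar> \<le> C2 * norm (x - y)"
        by (rule Ck_on_locally_lipschitz[OF N H(2) q0N], rule that)
      obtain C3 s3 where L3: "0 < s3" "0 \<le> C3" "ball (\<sigma> q0) s3 \<subseteq> N"
        and L3': "\<And>x y. x \<in> ball (\<sigma> q0) s3 \<Longrightarrow> y \<in> ball (\<sigma> q0) s3 \<Longrightarrow> \<bar>H3 x - H3 y\<bar> \<le> C3 * norm (x - y)"
        by (rule Ck_on_locally_lipschitz[OF N H(3) q0N], rule that)
      obtain C4 s4 where L4: "0 < s4" "0 \<le> C4" "ball (\<sigma> q0) s4 \<subseteq> N"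
        and L4': "\<And>x y. x \<in> ball (\<sigma> q0) s4 \<Longrightarrow> y \<in> ball (\<sigma> q0) s4 \<Longrightarrow> \<bar>H4 x - H4 y\<bar> \<le> C4 * norm (x - y)"
        by (rule Ck_on_locally_lipschitz[OF N H(4) q0N], rule that)
      define s where "s = min (min s1 s2) (min s3 s4)"
      have s: "0 < s" using L1 L2 L3 L4 by (simp add: s_def)
      define \<gamma> where "\<gamma> x = (mus (snd x) - (fst x)\<^sup>2, snd x)" for x :: "real \<times> 'q"
      have \<gamma>: "smooth_on \<gamma> (UNIV \<times> \<Lambda>)"
        unfolding \<gamma>_def
        by (rule smooth_on_Pair[OF open_UL smooth_on_diff[OF open_UL smooth_on_snd_comp[OF smooth_mus]
                smooth_on_power[OF open_UL smooth_on_fst]] smooth_on_snd])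
      have "eventually (\<lambda>p. p \<in> ball (\<sigma> q0) s) (nhds (\<gamma> (0, q0)))"
        by (rule eventually_nhds_in_open[OF open_ball]) (use s in \<open>simp add: \<gamma>_def \<sigma>_def\<close>)
      then have ev: "eventually (\<lambda>x. x \<in> UNIV \<times> \<Lambda> \<and> \<gamma> x \<in> ball (\<sigma> q0) s) (nhds (0, q0))"
        by (rule eventually_nhds_compose[OF open_UL smooth_on_continuous_on[OF \<gamma>], rotated]) (use q0 in simp)
      obtain \<delta>3 \<Theta>3 where b3: "0 < \<delta>3" "open \<Theta>3" "q0 \<in> \<Theta>3"
        and b3': "\<And>y q. y \<in> {-\<delta>3<..<\<delta>3} \<Longrightarrow> q \<in> \<Theta>3 \<Longrightarrow> (y, q) \<in> UNIV \<times> \<Lambda> \<and> \<gamma> (y, q) \<in> ball (\<sigma> q0) s"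
        by (rule eventually_nhds_prod_box[OF ev], rule that)
      define K3 where "K3 = \<bar>H3 (\<sigma> q0)\<bar> + C3 * s"
      define K4 where "K4 = \<bar>H4 (\<sigma> q0)\<bar> + C4 * s"
      \<comment> \<open>The sum of the constants of the four error terms below;
        \<open>max M 0\<close> stands in for \<open>M\<close> because the sign of \<open>M\<close>
        is not recorded.\<close>
      define K where "K = max M 0 + 2 * C1 + C2 + K4 * max M 0 + K3 * max M 0"
      have K3: "0 \<le> K3" and K4: "0 \<le> K4" using L3 L4 s by (auto simp: K3_def K4_def)
      have KM: "M \<le> K" "2 * C1 + C2 + K4 * max M 0 + K3 * max M 0 \<le> K"
        using K3 K4 L1 L2 unfolding K_def by (smt (verit) mult_nonneg_nonneg max.cobounded1 max.cobounded2)+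
      show ?thesis
      proof (rule exI[of _ "min \<delta> \<delta>3"], rule exI[of _ "\<Theta>' \<inter> \<Theta>3"], rule exI[of _ K], intro conjI ballI)
        show "0 < min \<delta> \<delta>3" "open (\<Theta>' \<inter> \<Theta>3)" "q0 \<in> \<Theta>' \<inter> \<Theta>3" "\<Theta>' \<inter> \<Theta>3 \<subseteq> \<Lambda>"
          using \<delta> b3 \<Theta>' \<Theta> by auto
        fix q \<epsilon> assume q: "q \<in> \<Theta>' \<inter> \<Theta>3" and \<epsilon>: "\<epsilon> \<in> {0<..<min \<delta> \<delta>3}"
        define p where "p = (mus q - \<epsilon>\<^sup>2, q)"
        define \<rho> where "\<rho> = (v2 p - v1 p) / (v3 p - v2 p)"
        have q\<Theta>: "q \<in> \<Theta>" "q \<in> \<Theta>'" "q \<in> \<Lambda>" using q \<Theta>' \<Theta> by auto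
        have \<epsilon>': "\<epsilon> \<in> {0<..<\<delta>}" "\<epsilon> \<in> {0<..<\<eta>}" "0 < \<epsilon>" "\<epsilon> \<le> 1" using \<epsilon> \<delta> by auto
        have pb: "p \<in> ball (\<sigma> q0) s" "\<sigma> q \<in> ball (\<sigma> q0) s"
          using b3'[of \<epsilon> q] b3'[of 0 q] \<epsilon> b3 q by (auto simp: \<gamma>_def p_def \<sigma>_def)
        then have balls: "x \<in> ball (\<sigma> q0) s1" "x \<in> ball (\<sigma> q0) s2" "x \<in> ball (\<sigma> q0) s3" "x \<in> ball (\<sigma> q0) s4"
          if "x = p \<or> x = \<sigma> q" for x using that by (auto simp: s_def)
        have mp: "mm p = \<epsilon>\<^sup>2" "snd p = q" by (simp_all add: p_def mm_def)
        have p: "p \<in> N" using balls(1)[of p] L1(3) by blast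
        then have pN: "p \<in> Np" using \<epsilon>' by (simp add: Np_def mp)
        have norm: "norm (p - \<sigma> q) = \<epsilon>\<^sup>2" by (simp add: p_def \<sigma>_def)
        have Yq: "Yp p = Y q" "Yp (\<sigma> q) = Y q" "0 < Y q" using Y_pos[OF q\<Theta>(3)] by (simp_all add: Yp_def mp \<sigma>0[OF q\<Theta>(1)])
        define a where "a = as q"
        define h where "h = vS q - vs q"
        have \<rho>X: "\<rho> = (X (\<epsilon>, q) - X (- \<epsilon>, q)) / (X3 (\<epsilon>\<^sup>2, q) - X (\<epsilon>, q))"
          unfolding \<rho>_def p_def root_id[OF q\<Theta>(1) \<epsilon>'(2) refl] ..
        have g: "0 < \<rho>" "\<rho> \<le> M * \<epsilon>" "\<epsilon> \<le> M * \<bar>\<rho> * ln \<rho>\<bar>"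
          "\<bar>1 / (2 * \<epsilon>\<^sup>2) - 2 * a\<^sup>2 / h\<^sup>2 * ((1 + \<rho>) / \<rho>\<^sup>2) - d q\<bar> \<le> M * \<epsilon>"
          "\<bar>ln \<epsilon> - ln \<rho> - ln (h / (2 * a))\<bar> \<le> M * \<epsilon>"
          using gap[OF \<epsilon>'(1) q\<Theta>(2) \<rho>X, of a h] jets(1)[OF q\<Theta>(1)] X0[OF q\<Theta>(1)] by (simp_all add: a_def h_def)
        have M0: "M * \<epsilon> \<le> max M 0 * \<epsilon>" using \<epsilon>' by (intro mult_right_mono) auto
        have H3p: "H3 p = Vv q i * Vv q j" "H3 (\<sigma> q) = Vv q i * Vv q j"
          using dd_mm[of p] dd_mm[of "\<sigma> q"] q\<Theta>(3) by (simp_all add: H3_def mp \<sigma>0[OF q\<Theta>(1)])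
        have H4\<sigma>: "H4 (\<sigma> q) = Lc q i j" using G\<sigma>[OF q\<Theta>(1), of i j] Yq by (simp add: H4_def)
        have H1\<sigma>: "H1 (\<sigma> q) = H4 (\<sigma> q) / 2" by (simp add: H1_def H4_def L_def \<sigma>0[OF q\<Theta>(1)])
        have "hessian (act v2 v3) p i j / Y q = H1 p * (2 * ln \<epsilon>) + H2 p + H3 p / (2 * \<epsilon>\<^sup>2)"
          unfolding hess[OF pN] H1_def H2_def H3_def using Yq \<epsilon>'
          by (simp add: mp ln_realpow add_divide_distrib)
        moreover have "sing q \<rho> i j = 2 * a\<^sup>2 / h\<^sup>2 * ((1 + \<rho>) / \<rho>\<^sup>2) * H3 (\<sigma> q) + H4 (\<sigma> q) * ln \<rho>"
          by (simp add: sing_def a_def h_def H3p H4\<sigma>)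
        moreover have "D q i j = H2 (\<sigma> q) + ln (h / (2 * a)) * H4 (\<sigma> q) + d q * H3 (\<sigma> q)"
          using Yq by (simp add: D_def H2_def H3_def H4_def a_def h_def add_divide_distrib)
        \<comment> \<open>\<open>H3\<close> depends on q alone, so the 1 / \<epsilon>^2 terms
          combine without error. \<open>H1\<close> is half of \<open>H4\<close> at \<sigma> q, so
          the logarithms leave only the variation of \<open>H1\<close> times 2 ln \<epsilon> and the
          defect ln \<epsilon> - ln \<rho> - ln (h / (2 a)).\<close>
        ultimately have E: "hessian (act v2 v3) p i j / Y q - sing q \<rho> i j - D q i j =
            (H1 p - H1 (\<sigma> q)) * (2 * ln \<epsilon>) + H4 (\<sigma> q) * (ln \<epsilon> - ln \<rho> - ln (h / (2 * a))) + (H2 p - H2 (\<sigma> q))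
            + H3 (\<sigma> q) * (1 / (2 * \<epsilon>\<^sup>2) - 2 * a\<^sup>2 / h\<^sup>2 * ((1 + \<rho>) / \<rho>\<^sup>2) - d q)"
          unfolding H1\<sigma> H3p by (simp add: algebra_simps)
        have b1: "\<bar>(H1 p - H1 (\<sigma> q)) * (2 * ln \<epsilon>)\<bar> \<le> 2 * C1 * \<epsilon>"
        proof -
          have "\<bar>(H1 p - H1 (\<sigma> q)) * (2 * ln \<epsilon>)\<bar> \<le> (C1 * \<epsilon>\<^sup>2) * (2 * \<bar>ln \<epsilon>\<bar>)"
            unfolding abs_mult using L1'[OF balls(1) balls(1), of p "\<sigma> q"] norm by (intro mult_mono) auto
          also have "\<dots> = 2 * C1 * \<epsilon> * (\<epsilon> * \<bar>ln \<epsilon>\<bar>)" by (simp add: power2_eq_square)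
          also have "\<dots> \<le> 2 * C1 * \<epsilon> * 1"
            using eps_abs_ln_le[OF \<epsilon>'(3,4)] L1 \<epsilon>' by (intro mult_left_mono) auto
          finally show ?thesis by simp
        qed
        have b2: "\<bar>H2 p - H2 (\<sigma> q)\<bar> \<le> C2 * \<epsilon>"
        proof -
          have "\<epsilon>\<^sup>2 \<le> 1 * \<epsilon>" unfolding power2_eq_square using \<epsilon>' by (intro mult_right_mono) auto
          then have "C2 * \<epsilon>\<^sup>2 \<le> C2 * \<epsilon>" using L2 by (intro mult_left_mono) auto
          then show ?thesis using L2'[OF balls(2) balls(2), of p "\<sigma> q"] norm by simp
        qed
        have dist: "norm (\<sigma> q - \<sigma> q0) \<le> s" using pb(2) by (simp add: dist_norm norm_minus_commute)
        have b4: "\<bar>H4 (\<sigma> q) * (ln \<epsilon> - ln \<rho> - ln (h / (2 * a)))\<bar> \<le> K4 * max M 0 * \<epsilon>"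
        proof -
          have "\<bar>H4 (\<sigma> q) - H4 (\<sigma> q0)\<bar> \<le> C4 * norm (\<sigma> q - \<sigma> q0)"
            by (rule L4'[OF balls(4)]) (use L4 in auto)
          also have "\<dots> \<le> C4 * s" using dist L4 by (intro mult_left_mono) auto
          finally have "\<bar>H4 (\<sigma> q)\<bar> \<le> K4" unfolding K4_def by linarith
          then have "\<bar>H4 (\<sigma> q) * (ln \<epsilon> - ln \<rho> - ln (h / (2 * a)))\<bar> \<le> K4 * (max M 0 * \<epsilon>)"
            unfolding abs_mult using g(5) M0 K4 by (intro mult_mono) auto
          then show ?thesis by simp
        qed
        have b3: "\<bar>H3 (\<sigma> q) * (1 / (2 * \<epsilon>\<^sup>2) - 2 * a\<^sup>2 / h\<^sup>2 * ((1 + \<rho>) / \<rho>\<^sup>2) - d q)\<bar> \<le> K3 * max M 0 * \<epsilon>"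
        proof -
          have "\<bar>H3 (\<sigma> q) - H3 (\<sigma> q0)\<bar> \<le> C3 * norm (\<sigma> q - \<sigma> q0)"
            by (rule L3'[OF balls(3)]) (use L3 in auto)
          also have "\<dots> \<le> C3 * s" using dist L3 by (intro mult_left_mono) auto
          finally have "\<bar>H3 (\<sigma> q)\<bar> \<le> K3" unfolding K3_def by linarith
          then have "\<bar>H3 (\<sigma> q) * (1 / (2 * \<epsilon>\<^sup>2) - 2 * a\<^sup>2 / h\<^sup>2 * ((1 + \<rho>) / \<rho>\<^sup>2) - d q)\<bar> \<le> K3 * (max M 0 * \<epsilon>)"
            unfolding abs_mult[of "H3 (\<sigma> q)"] using g(4) M0 K3 by (intro mult_mono) auto
          then show ?thesis by simp
        qed
        have "\<bar>hessian (act v2 v3) p i j / Y q - sing q \<rho> i j - D q i j\<bar> \<le>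
            2 * C1 * \<epsilon> + K4 * max M 0 * \<epsilon> + C2 * \<epsilon> + K3 * max M 0 * \<epsilon>"
          unfolding E by (intro abs_triangle_ineq[THEN order_trans] add_mono b1 b2 b3 b4)
        also have "\<dots> = (2 * C1 + C2 + K4 * max M 0 + K3 * max M 0) * \<epsilon>" by (simp add: algebra_simps)
        also have "\<dots> \<le> K * \<epsilon>" using KM(2) \<epsilon>' by (intro mult_right_mono) auto
        finally have fin: "\<bar>hessian (act v2 v3) p i j / Y q - sing q \<rho> i j - D q i j\<bar> \<le> K * \<epsilon>" .
        have "M * \<epsilon> \<le> K * \<epsilon>" "M * \<bar>\<rho> * ln \<rho>\<bar> \<le> K * \<bar>\<rho> * ln \<rho>\<bar>"
          using KM(1) \<epsilon>' by (auto intro: mult_right_mono)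
        then have "0 < \<rho> \<and> \<rho> \<le> K * \<epsilon> \<and> \<epsilon> \<le> K * \<bar>\<rho> * ln \<rho>\<bar> \<and>
            \<bar>hessian (act v2 v3) p i j / Y q - sing q \<rho> i j - D q i j\<bar> \<le> K * \<epsilon>"
          using g fin by linarith
        then show "let p = (mus q - \<epsilon>\<^sup>2, q); \<rho> = (v2 p - v1 p) / (v3 p - v2 p) in
            0 < \<rho> \<and> \<rho> \<le> K * \<epsilon> \<and> \<epsilon> \<le> K * \<bar>\<rho> * ln \<rho>\<bar> \<and>
            \<bar>hessian (act v2 v3) p i j / Y q - sing q \<rho> i j - D q i j\<bar> \<le> K * \<epsilon>"
          unfolding Let_def \<rho>_def p_def .
      qed
    qed
  qed
qed

end

section \<open>The coefficients\<close>

text \<open>The argument in the integrand of \<open>Rfun\<close> is affine in each of v, w, z, with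
  a coefficient depending on t and s; this shape covers all first and second derivatives needed. The
  Leibniz rule is applied first to the inner and then to the outer integral.\<close>

lemma double_integral_has_derivative:
  fixes f f' :: "real \<Rightarrow> real" and p0 k a :: "real \<Rightarrow> real \<Rightarrow> real"
  assumes S: "open S" "convex S" "\<sigma> \<in> S"
    and f: "\<And>v. v \<in> I \<Longrightarrow> (f has_real_derivative f' v) (at v)" "continuous_on I f'"
    and cont: "continuous_on ({0..1} \<times> {0..1}) (\<lambda>(t, s). p0 t s)" "continuous_on ({0..1} \<times> {0..1}) (\<lambda>(t, s). k t s)"
      "continuous_on ({0..1} \<times> {0..1}) (\<lambda>(t, s). a t s)"
    and P: "\<And>\<sigma> t s. \<sigma> \<in> S \<Longrightarrow> t \<in> {0..1} \<Longrightarrow> s \<in> {0..1} \<Longrightarrow> p0 t s + k t s * \<sigma> \<in> I"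
  shows "((\<lambda>\<sigma>. integral {0..1} (\<lambda>t. integral {0..1} (\<lambda>s. a t s * f (p0 t s + k t s * \<sigma>)))) has_real_derivative
    integral {0..1} (\<lambda>t. integral {0..1} (\<lambda>s. a t s * k t s * f' (p0 t s + k t s * \<sigma>)))) (at \<sigma>)"
proof -
  let ?J = "{0..1::real}"
  have contf: "continuous_on I f" by (rule DERIV_continuous_on) (use f(1) has_field_derivative_at_within in blast)
  have ts: "continuous_on ((S \<times> ?J) \<times> ?J) (\<lambda>x. h (snd (fst x)) (snd x))"
    if "continuous_on (?J \<times> ?J) (\<lambda>(t, s). h t s)" for h :: "real \<Rightarrow> real \<Rightarrow> real"
  proof -
    have "continuous_on ((S \<times> ?J) \<times> ?J) (\<lambda>x. (snd (fst x), snd x))" by (intro continuous_intros)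
    moreover have "(\<lambda>x. (snd (fst x), snd x)) ` ((S \<times> ?J) \<times> ?J) \<subseteq> ?J \<times> ?J" by auto
    ultimately show ?thesis using continuous_on_compose2[OF that, of "(S \<times> ?J) \<times> ?J" "\<lambda>x. (snd (fst x), snd x)"] by simp
  qed
  have arg: "continuous_on ((S \<times> ?J) \<times> ?J) (\<lambda>x. p0 (snd (fst x)) (snd x) + k (snd (fst x)) (snd x) * fst (fst x))"
    by (intro continuous_intros ts cont)
  have comp: "continuous_on ((S \<times> ?J) \<times> ?J) (\<lambda>x. g (p0 (snd (fst x)) (snd x) + k (snd (fst x)) (snd x) * fst (fst x)))"
    if "continuous_on I g" for g :: "real \<Rightarrow> real"
    by (rule continuous_on_compose2[OF that arg]) (use P in auto)
  have c2: "continuous_on ((S \<times> ?J) \<times> cbox 0 1) (\<lambda>(x, s). a (snd x) s * f (p0 (snd x) s + k (snd x) s * fst x))"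
    using continuous_on_mult[OF ts[OF cont(3)] comp[OF contf]] by (simp add: split_beta)
  have c3: "continuous_on ((S \<times> ?J) \<times> cbox 0 1) (\<lambda>(x, s). a (snd x) s * k (snd x) s * f' (p0 (snd x) s + k (snd x) s * fst x))"
    using continuous_on_mult[OF continuous_on_mult[OF ts[OF cont(3)] ts[OF cont(2)]] comp[OF f(2)]] by (simp add: split_beta)
  note int2 = integral_continuous_on_param[OF c2] and int3 = integral_continuous_on_param[OF c3]
  have slice: "continuous_on ?J (\<lambda>t. h (y, t))" if "continuous_on (S \<times> ?J) h" "y \<in> S" for h :: "real \<times> real \<Rightarrow> real" and y
    by (rule continuous_on_compose2[OF that(1)]) (use that(2) in \<open>auto intro!: continuous_intros\<close>)
  have slice2: "continuous_on (S \<times> cbox 0 1) (\<lambda>(y, s). h ((y, t), s))" if "continuous_on ((S \<times> ?J) \<times> cbox 0 1) h" "t \<in> ?J"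
    for h :: "(real \<times> real) \<times> real \<Rightarrow> real" and t
    unfolding split_beta by (rule continuous_on_compose2[OF that(1)]) (use that(2) in \<open>auto intro!: continuous_intros\<close>)
  have "((\<lambda>\<sigma>. integral (cbox 0 1) (\<lambda>t. integral (cbox 0 1) (\<lambda>s. a t s * f (p0 t s + k t s * \<sigma>)))) has_real_derivative
    integral (cbox 0 1) (\<lambda>t. integral (cbox 0 1) (\<lambda>s. a t s * k t s * f' (p0 t s + k t s * \<sigma>)))) (at \<sigma> within S)"
  proof (rule leibniz_rule_field_derivative[OF _ _ _ S(3,2)])
    fix y t assume y: "y \<in> S" and t: "t \<in> cbox (0::real) 1"
    show "((\<lambda>\<sigma>. integral (cbox 0 1) (\<lambda>s. a t s * f (p0 t s + k t s * \<sigma>))) has_real_derivative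
        integral (cbox 0 1) (\<lambda>s. a t s * k t s * f' (p0 t s + k t s * y))) (at y within S)"
    proof (rule leibniz_rule_field_derivative[OF _ _ _ y S(2)])
      fix z s assume z: "z \<in> S" and s: "s \<in> cbox (0::real) 1"
      have "((\<lambda>\<sigma>. f (p0 t s + k t s * \<sigma>)) has_real_derivative f' (p0 t s + k t s * z) * k t s) (at z)"
        by (rule DERIV_chain2[where g = "\<lambda>\<sigma>. p0 t s + k t s * \<sigma>", OF f(1)[OF P]]) (use z s t in \<open>auto intro!: derivative_eq_intros\<close>)
      from DERIV_cmult[OF this, of "a t s"]
      show "((\<lambda>\<sigma>. a t s * f (p0 t s + k t s * \<sigma>)) has_real_derivative a t s * k t s * f' (p0 t s + k t s * z)) (at z within S)"
        by (auto intro: has_field_derivative_at_within simp: mult_ac)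
    next
      show "(\<lambda>s. a t s * f (p0 t s + k t s * z)) integrable_on cbox 0 1" if "z \<in> S" for z
      proof (rule integrable_continuous)
        have "continuous_on (cbox 0 1) (\<lambda>s. (\<lambda>(y, s). a t s * f (p0 t s + k t s * y)) (z, s))"
          by (rule continuous_on_compose2[OF slice2[OF c2, of t, simplified]]) (use that t in \<open>auto intro!: continuous_intros\<close>)
        then show "continuous_on (cbox 0 1) (\<lambda>s. a t s * f (p0 t s + k t s * z))" by simp
      qed
      show "continuous_on (S \<times> cbox 0 1) (\<lambda>(z, s). a t s * k t s * f' (p0 t s + k t s * z))"
        using slice2[OF c3, of t] t by simp
    qed
  next
    show "(\<lambda>t. integral (cbox 0 1) (\<lambda>s. a t s * f (p0 t s + k t s * y))) integrable_on cbox 0 1" if "y \<in> S" for y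
      using integrable_continuous[of 0 1, OF slice[OF int2 that, unfolded cbox_interval[symmetric]]] by simp
    show "continuous_on (S \<times> cbox 0 1) (\<lambda>(y, t). integral (cbox 0 1) (\<lambda>s. a t s * k t s * f' (p0 t s + k t s * y)))"
      using int3 by (simp add: split_beta)
  qed
  then show ?thesis using at_within_open[OF S(3,1)] by simp
qed

text \<open>Logarithmic differentiation. Negativity of \<open>R\<close> on a neighbourhood lets the
  modulus be replaced by - R before differentiating.\<close>

lemma sqrt_quotient_has_derivative:
  fixes k R :: "real \<Rightarrow> real"
  assumes "(k has_real_derivative k') (at x)" "(R has_real_derivative R') (at x)" "0 < k x"
    and T: "open T" "x \<in> T" "\<And>y. y \<in> T \<Longrightarrow> R y < 0"
  shows "((\<lambda>y. sqrt (2 * k y / \<bar>R y\<bar>)) has_real_derivative sqrt (2 * k x / \<bar>R x\<bar>) * ((k' / k x - R' / R x) / 2)) (at x)"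
proof -
  let ?P = "2 * k x / - R x"
  have R: "R x < 0" using T by blast
  have P: "0 < ?P" using R assms(3) by (intro divide_pos_pos) auto
  have "((\<lambda>y. 2 * k y / - R y) has_real_derivative (2 * k' * - R x - 2 * k x * - R') / (- R x * - R x)) (at x)"
    by (rule DERIV_divide[OF DERIV_cmult[OF assms(1)] DERIV_minus[OF assms(2)]]) (use R in simp)
  from DERIV_chain2[OF DERIV_real_sqrt[OF P] this]
  have "((\<lambda>y. sqrt (2 * k y / - R y)) has_real_derivative inverse (sqrt ?P) / 2 * ((2 * k' * - R x - 2 * k x * - R') / (- R x * - R x))) (at x)" .
  moreover have "inverse (sqrt ?P) / 2 * ((2 * k' * - R x - 2 * k x * - R') / (- R x * - R x)) = sqrt ?P * ((k' / k x - R' / R x) / 2)"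
  proof -
    have "inverse (sqrt P) = sqrt P / P" if "0 < P" for P :: real
      using that by (metis inverse_divide real_div_sqrt less_imp_le)
    from this[OF P] have "inverse (sqrt ?P) = sqrt ?P / ?P" .
    then show ?thesis using R assms(3) unfolding \<open>inverse (sqrt ?P) = sqrt ?P / ?P\<close>
      by (simp add: divide_simps) (simp add: algebra_simps)?
  qed
  ultimately have "((\<lambda>y. sqrt (2 * k y / - R y)) has_real_derivative sqrt ?P * ((k' / k x - R' / R x) / 2)) (at x)" by (rule DERIV_cong)
  then have "((\<lambda>y. sqrt (2 * k y / \<bar>R y\<bar>)) has_real_derivative sqrt ?P * ((k' / k x - R' / R x) / 2)) (at x)"
    by (rule has_field_derivative_transform_within_open[OF _ T(1,2)]) (use T(3) in \<open>simp add: abs_of_neg\<close>)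
  then show ?thesis using R by (simp add: abs_of_neg)
qed

text \<open>The second formula is y'' / y = (ln y)'' + ((ln y)')^2.\<close>

lemma sqrt_quotient_deriv_deriv:
  fixes k k1 R R1 :: "real \<Rightarrow> real"
  assumes T: "open T" "x \<in> T" "\<And>y. y \<in> T \<Longrightarrow> R y < 0"
    and k: "\<And>y. y \<in> T \<Longrightarrow> 0 < k y" "\<And>y. y \<in> T \<Longrightarrow> (k has_real_derivative k1 y) (at y)" "(k1 has_real_derivative k2) (at x)"
    and R: "\<And>y. y \<in> T \<Longrightarrow> (R has_real_derivative R1 y) (at y)" "(R1 has_real_derivative R2) (at x)"
  shows "deriv (\<lambda>y. sqrt (2 * k y / \<bar>R y\<bar>)) x = sqrt (2 * k x / \<bar>R x\<bar>) * ((k1 x / k x - R1 x / R x) / 2)"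
    and "(deriv ^^ 2) (\<lambda>y. sqrt (2 * k y / \<bar>R y\<bar>)) x = sqrt (2 * k x / \<bar>R x\<bar>) *
      ((k2 / k x - (k1 x / k x)\<^sup>2 - R2 / R x + (R1 x / R x)\<^sup>2) / 2 + (k1 x / k x - R1 x / R x)\<^sup>2 / 4)"
proof -
  let ?Y = "\<lambda>y. sqrt (2 * k y / \<bar>R y\<bar>)"
  have Y1: "(?Y has_real_derivative ?Y y * ((k1 y / k y - R1 y / R y) / 2)) (at y)" if "y \<in> T" for y
    by (rule sqrt_quotient_has_derivative[OF k(2)[OF that] R(1)[OF that] k(1)[OF that] T(1) that T(3)])
  have d1: "deriv ?Y y = ?Y y * ((k1 y / k y - R1 y / R y) / 2)" if "y \<in> T" for y
    by (rule DERIV_imp_deriv[OF Y1[OF that]])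
  then show "deriv ?Y x = ?Y x * ((k1 x / k x - R1 x / R x) / 2)" using T by blast
  have nz: "k x \<noteq> 0" "R x \<noteq> 0" using k(1)[OF T(2)] T(3)[OF T(2)] by auto
  have "((\<lambda>y. ?Y y * ((k1 y / k y - R1 y / R y) / 2)) has_real_derivative
      ?Y x * ((k1 x / k x - R1 x / R x) / 2) * ((k1 x / k x - R1 x / R x) / 2) +
      ((k2 * k x - k1 x * k1 x) / (k x * k x) - (R2 * R x - R1 x * R1 x) / (R x * R x)) / 2 * ?Y x) (at x)"
    by (rule DERIV_mult[OF Y1[OF T(2)] DERIV_cdivide[OF DERIV_diff[OF DERIV_divide[OF k(3) k(2)[OF T(2)] nz(1)] DERIV_divide[OF R(2) R(1)[OF T(2)] nz(2)]]]])
  then have "(deriv ?Y has_real_derivative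
      ?Y x * ((k1 x / k x - R1 x / R x) / 2) * ((k1 x / k x - R1 x / R x) / 2) +
      ((k2 * k x - k1 x * k1 x) / (k x * k x) - (R2 * R x - R1 x * R1 x) / (R x * R x)) / 2 * ?Y x) (at x)"
    by (rule has_field_derivative_transform_within_open[OF _ T(1,2)]) (simp add: d1)
  then have "deriv (deriv ?Y) x = ?Y x * ((k1 x / k x - R1 x / R x) / 2) * ((k1 x / k x - R1 x / R x) / 2) +
      ((k2 * k x - k1 x * k1 x) / (k x * k x) - (R2 * R x - R1 x * R1 x) / (R x * R x)) / 2 * ?Y x"
    by (rule DERIV_imp_deriv)
  also have "\<dots> = ?Y x * ((k2 / k x - (k1 x / k x)\<^sup>2 - R2 / R x + (R1 x / R x)\<^sup>2) / 2 + (k1 x / k x - R1 x / R x)\<^sup>2 / 4)"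
  proof -
    have e: "(k2 * k x - k1 x * k1 x) / (k x * k x) = k2 / k x - (k1 x / k x)\<^sup>2"
      "(R2 * R x - R1 x * R1 x) / (R x * R x) = R2 / R x - (R1 x / R x)\<^sup>2"
      using nz by (simp_all add: diff_divide_distrib power2_eq_square)
    have "Y * ((A - C) / 2) * ((A - C) / 2) + ((E - A\<^sup>2) - (F - C\<^sup>2)) / 2 * Y
        = Y * ((E - A\<^sup>2 - F + C\<^sup>2) / 2 + (A - C)\<^sup>2 / 4)" for Y A C E F :: real
      by (simp add: power2_eq_square field_simps)
    then show ?thesis unfolding e .
  qed
  finally show "(deriv ^^ 2) ?Y x = ?Y x *
      ((k2 / k x - (k1 x / k x)\<^sup>2 - R2 / R x + (R1 x / R x)\<^sup>2) / 2 + (k1 x / k x - R1 x / R x)\<^sup>2 / 4)"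
    by (simp add: numeral_2_eq_2)
qed

lemma integral_power_01: "integral {0..1} (\<lambda>t::real. c * t ^ n) = c / (real n + 1)"
proof -
  have "((\<lambda>t::real. t ^ n) has_integral (1 ^ Suc n / real (Suc n) - 0 ^ Suc n / real (Suc n))) {0..1}"
    by (rule fundamental_theorem_of_calculus)
      (auto intro!: derivative_eq_intros simp: has_real_derivative_iff_has_vector_derivative[symmetric] simp del: power_Suc)
  from integral_unique[OF has_integral_mult_right[OF this, of c]] show ?thesis by (simp add: add.commute)
qed

text \<open>\<open>Rfun\<close> is the second divided difference of the potential in Hermite-Genocchi form.\<close>

lemma Yfun_jets:
  fixes W :: "real \<Rightarrow> real \<Rightarrow> 'l \<Rightarrow> real"
  assumes I: "open I" "is_interval I" "x \<in> I"
    and f: "\<And>v. v \<in> I \<Longrightarrow> dv 2 W v c lam = f2 v" "\<And>v. v \<in> I \<Longrightarrow> (f2 has_real_derivative f3 v) (at v)"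
      "\<And>v. v \<in> I \<Longrightarrow> (f3 has_real_derivative f4 v) (at v)" "continuous_on I f4"
    and neg: "f2 x < 0"
    and \<kappa>: "\<And>v. v \<in> I \<Longrightarrow> 0 < \<kappa> v" "\<And>v. v \<in> I \<Longrightarrow> (\<kappa> has_real_derivative \<kappa>1 v) (at v)" "(\<kappa>1 has_real_derivative \<kappa>2) (at x)"
  defines "r \<equiv> f3 x / (3 * f2 x)" and "r2 \<equiv> f4 x / (6 * f2 x)" and "u \<equiv> \<kappa>1 x / \<kappa> x"
  shows "Ys W \<kappa> x c lam = sqrt (2 * \<kappa> x) * sqrt (- 2 / f2 x)"
    and "Ys_v W \<kappa> x c lam = Ys W \<kappa> x c lam * ((u - r) / 2)"
    and "Ys_z W \<kappa> x c lam = Ys W \<kappa> x c lam * (- r / 2)"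
    and "Ys_vv W \<kappa> x c lam = Ys W \<kappa> x c lam * ((\<kappa>2 / \<kappa> x - u\<^sup>2 - r2 + r\<^sup>2) / 2 + (u - r)\<^sup>2 / 4)"
    and "Ys_zz W \<kappa> x c lam = Ys W \<kappa> x c lam * ((- r2 + r\<^sup>2) / 2 + r\<^sup>2 / 4)"
    and "Ys_wz W \<kappa> x c lam = Ys W \<kappa> x c lam * (3 / 4 * r\<^sup>2 - r2 / 4)"
proof -
  let ?J = "{0..1::real}"
  have conv: "convex I" using I(2) is_interval_convex by blast
  \<comment> \<open>The argument in \<open>Rfun\<close> is the convex combination of w, z, v with
    weights 1 - t, t (1 - s), t s, so it never leaves the interval.\<close>
  have cc: "\<alpha> * a + \<beta> * b + \<gamma> * d \<in> I" if "a \<in> I" "b \<in> I" "d \<in> I" "0 \<le> \<alpha>" "0 \<le> \<beta>" "0 \<le> \<gamma>" "\<alpha> + \<beta> + \<gamma> = 1"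
    for a b d \<alpha> \<beta> \<gamma> :: real
  proof (rule mem_is_interval_1_I[OF I(2)])
    let ?lo = "min a (min b d)" and ?hi = "max a (max b d)"
    show "?lo \<in> I" "?hi \<in> I" using that by (auto simp: min_def max_def)
    have "(\<alpha> + \<beta> + \<gamma>) * ?lo \<le> \<alpha> * a + \<beta> * b + \<gamma> * d"
      unfolding distrib_right using that by (intro add_mono mult_left_mono) auto
    then show "?lo \<le> \<alpha> * a + \<beta> * b + \<gamma> * d" using that(7) by simp
    have "\<alpha> * a + \<beta> * b + \<gamma> * d \<le> (\<alpha> + \<beta> + \<gamma>) * ?hi"
      unfolding distrib_right using that by (intro add_mono mult_left_mono) auto
    then show "\<alpha> * a + \<beta> * b + \<gamma> * d \<le> ?hi" using that(7) by simp
  qed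
  have contI: "continuous_on I f2" "continuous_on I f3"
    by (rule DERIV_continuous_on, erule has_field_derivative_at_within[OF f(2)])
      (rule DERIV_continuous_on, erule has_field_derivative_at_within[OF f(3)])
  have cts: "continuous_on (?J \<times> ?J) (\<lambda>(t, s). t)" "continuous_on (?J \<times> ?J) (\<lambda>(t, s). s)"
    unfolding split_beta by (intro continuous_intros)+
  have R_eq: "Rfun W c lam v w z = integral {0..1} (\<lambda>t. integral {0..1} (\<lambda>s. t * f2 (w + t * (z - w) + t * s * (v - z))))"
    if "v \<in> I" "w \<in> I" "z \<in> I" for v w z
    unfolding Rfun_def
  proof (intro integral_cong)
    fix t s assume ts: "t \<in> ?J" "s \<in> ?J"
    have "(1 - t) * w + t * (1 - s) * z + t * s * v \<in> I"
      by (rule cc[OF that(2,3,1)]) (use ts in \<open>auto simp: algebra_simps mult_left_le mult_left_le_one_le\<close>)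
    moreover have "(1 - t) * w + t * (1 - s) * z + t * s * v = w + t * (z - w) + t * s * (v - z)" by (simp add: algebra_simps)
    ultimately show "t * dv 2 W (w + t * (z - w) + t * s * (v - z)) c lam = t * f2 (w + t * (z - w) + t * s * (v - z))"
      using f(1) by simp
  qed
  \<comment> \<open>On the diagonal v = w = z = x the derivative of the potential is a constant
    factor, and each derivative of \<open>Rfun\<close> reduces to a moment of its weight over the
    unit square.\<close>
  have mon: "integral ?J (\<lambda>t. integral ?J (\<lambda>s. g t s * C)) = m * C"
    if "\<And>t. t \<in> ?J \<Longrightarrow> integral ?J (\<lambda>s. g t s) = h t" "integral ?J h = m" for g h m and C :: real
  proof -
    have "integral ?J (\<lambda>t. integral ?J (\<lambda>s. g t s * C)) = integral ?J (\<lambda>t. h t * C)"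
      by (rule integral_cong) (simp add: that(1))
    then show ?thesis using that(2) by simp
  qed
  note ip = integral_power_01
  have i0: "integral ?J (\<lambda>s::real. s) = 1 / 2" using ip[of 1 1] by simp
  have i1: "integral ?J (\<lambda>s::real. 1 - s) = 1 / 2"
    by (subst integral_diff) (auto simp: i0 intro!: integrable_continuous_real continuous_intros)
  have i2: "integral ?J (\<lambda>s::real. s\<^sup>2) = 1 / 3" using ip[of 1 2] by simp
  have i3: "integral ?J (\<lambda>s::real. (1 - s)\<^sup>2) = 1 / 3"
  proof -
    have "integral ?J (\<lambda>s::real. (1 - s)\<^sup>2) = integral ?J (\<lambda>s. (1 - 2 * s) + s\<^sup>2)"
      by (rule integral_cong) (simp add: power2_eq_square algebra_simps)
    also have "\<dots> = integral ?J (\<lambda>s. 1 - 2 * s) + integral ?J (\<lambda>s::real. s\<^sup>2)"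
      by (rule integral_add) (auto intro!: integrable_continuous_real continuous_intros)
    also have "integral ?J (\<lambda>s. 1 - 2 * s) = (0::real)"
      by (subst integral_diff) (auto simp: i0 intro!: integrable_continuous_real continuous_intros)
    finally show ?thesis by (simp add: i2)
  qed
  have t2: "integral ?J (\<lambda>t::real. t\<^sup>2 / 2) = 1 / 6" using ip[of "1 / 2" 2] by simp
  have t3: "integral ?J (\<lambda>t::real. t ^ 3 / 3) = 1 / 12" using ip[of "1 / 3" 3] by simp
  have t1: "integral ?J (\<lambda>t::real. t * (1 - t)) = 1 / 6"
  proof -
    have "integral ?J (\<lambda>t::real. t * (1 - t)) = integral ?J (\<lambda>t. t - t\<^sup>2)"
      by (rule integral_cong) (simp add: power2_eq_square algebra_simps)
    also have "\<dots> = 1 / 6" by (subst integral_diff) (auto simp: i0 i2 intro!: integrable_continuous_real continuous_intros)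
    finally show ?thesis .
  qed
  have t4: "integral ?J (\<lambda>t::real. t\<^sup>2 * (1 - t) / 2) = 1 / 24"
  proof -
    have "integral ?J (\<lambda>t::real. t\<^sup>2 * (1 - t) / 2) = integral ?J (\<lambda>t. t\<^sup>2 / 2 - t ^ 3 / 2)"
      by (rule integral_cong) (simp add: power2_eq_square power3_eq_cube field_simps)
    also have "\<dots> = 1 / 24"
      using ip[of "1 / 2" 3] by (subst integral_diff) (auto simp: t2 i2 intro!: integrable_continuous_real continuous_intros)
    finally show ?thesis .
  qed
  define R0 where "R0 = f2 x / 2"
  have R0: "Rfun W c lam x x x = R0"
    unfolding R_eq[OF I(3) I(3) I(3)] R0_def using mon[of "\<lambda>t s. t" "\<lambda>t. t" "1 / 2" "f2 x"] i0 by simp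
  have R0neg: "R0 < 0" using neg by (simp add: R0_def)
  have Ys: "Ys W \<kappa> x c lam = sqrt (2 * \<kappa> x / \<bar>R0\<bar>)" by (simp add: Ys_def Yfun_def R0)
  show "Ys W \<kappa> x c lam = sqrt (2 * \<kappa> x) * sqrt (- 2 / f2 x)"
    unfolding Ys using neg by (simp add: R0_def real_sqrt_mult[symmetric])
  have r: "r = f3 x / 6 / R0" "r2 = f4 x / 12 / R0" by (simp_all add: r_def r2_def R0_def)
  have pos\<kappa>: "0 < \<kappa> x" using \<kappa>(1) I(3) by simp

  define Rv where "Rv v = Rfun W c lam v x x" for v
  define Rv1 where "Rv1 v = integral ?J (\<lambda>t. integral ?J (\<lambda>s. t * (t * s) * f3 (x - t * s * x + t * s * v)))" for v
  have seg: "x - k * x + k * v \<in> I" if "v \<in> I" "0 \<le> k" "k \<le> 1" for k v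
    using cc[OF I(3) that(1) I(3), of "1 - k" k 0] that by (simp add: algebra_simps)
  have ts1: "0 \<le> t * s" "t * s \<le> 1" "0 \<le> t * (1 - s)" "t * (1 - s) \<le> 1" if "t \<in> ?J" "s \<in> ?J" for t s
    using that by (auto simp: mult_le_one)
  have RvD: "(Rv has_real_derivative Rv1 v) (at v)" if v: "v \<in> I" for v
  proof -
    have "((\<lambda>v. integral ?J (\<lambda>t. integral ?J (\<lambda>s. t * f2 (x - t * s * x + t * s * v)))) has_real_derivative Rv1 v) (at v)"
      unfolding Rv1_def
      by (rule double_integral_has_derivative[OF I(1) conv v f(2) contI(2)])
        (use cts seg ts1 in \<open>auto simp: split_beta intro!: continuous_intros\<close>)
    then show ?thesis
      by (rule has_field_derivative_transform_within_open[OF _ I(1) v])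
        (simp add: Rv_def R_eq I algebra_simps)
  qed
  have Rv1D: "(Rv1 has_real_derivative f4 x / 12) (at x)"
  proof -
    have "(Rv1 has_real_derivative integral ?J (\<lambda>t. integral ?J (\<lambda>s. t * (t * s) * (t * s) * f4 (x - t * s * x + t * s * x)))) (at x)"
      unfolding Rv1_def
      by (rule double_integral_has_derivative[OF I(1) conv I(3) f(3) f(4)])
        (use cts seg ts1 in \<open>auto simp: split_beta intro!: continuous_intros\<close>)
    moreover have "integral ?J (\<lambda>t. integral ?J (\<lambda>s. t * (t * s) * (t * s) * f4 (x - t * s * x + t * s * x))) = f4 x / 12"
    proof -
      have "integral ?J (\<lambda>s. t * (t * s) * (t * s)) = t ^ 3 / 3" for t :: real
      proof -
        have "integral ?J (\<lambda>s. t * (t * s) * (t * s)) = integral ?J (\<lambda>s. t ^ 3 * s\<^sup>2)"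
          by (rule integral_cong) (simp add: power2_eq_square power3_eq_cube)
        then show ?thesis using ip[of "t ^ 3" 2] by simp
      qed
      from mon[OF this t3, of "f4 x"] show ?thesis by simp
    qed
    ultimately show ?thesis by (rule DERIV_cong)
  qed
  have Rv1x: "Rv1 x = f3 x / 6"
  proof -
    have "integral ?J (\<lambda>s. t * (t * s)) = t\<^sup>2 / 2" for t :: real
    proof -
      have "integral ?J (\<lambda>s. t * (t * s)) = integral ?J (\<lambda>s. t\<^sup>2 * s ^ 1)"
        by (rule integral_cong) (simp add: power2_eq_square)
      then show ?thesis using ip[of "t\<^sup>2" 1] by simp
    qed
    from mon[OF this t2, of "f3 x"] show ?thesis by (simp add: Rv1_def)
  qed
  define Rz where "Rz z = Rfun W c lam x x z" for z
  define Rz1 where "Rz1 z = integral ?J (\<lambda>t. integral ?J (\<lambda>s. t * (t * (1 - s)) * f3 (x - t * (1 - s) * x + t * (1 - s) * z)))" for z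
  have RzD: "(Rz has_real_derivative Rz1 z) (at z)" if z: "z \<in> I" for z
  proof -
    have "((\<lambda>z. integral ?J (\<lambda>t. integral ?J (\<lambda>s. t * f2 (x - t * (1 - s) * x + t * (1 - s) * z)))) has_real_derivative Rz1 z) (at z)"
      unfolding Rz1_def
      by (rule double_integral_has_derivative[OF I(1) conv z f(2) contI(2)])
        (use cts seg ts1 in \<open>auto simp: split_beta intro!: continuous_intros\<close>)
    then show ?thesis
      by (rule has_field_derivative_transform_within_open[OF _ I(1) z])
        (simp add: Rz_def R_eq I algebra_simps)
  qed
  have k1: "integral ?J (\<lambda>s. t * (t * (1 - s))) = t\<^sup>2 / 2" for t :: real
    using i1 by (simp add: power2_eq_square)
  have Rz1D: "(Rz1 has_real_derivative f4 x / 12) (at x)"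
  proof -
    have "(Rz1 has_real_derivative integral ?J (\<lambda>t. integral ?J (\<lambda>s. t * (t * (1 - s)) * (t * (1 - s)) * f4 (x - t * (1 - s) * x + t * (1 - s) * x)))) (at x)"
      unfolding Rz1_def
      by (rule double_integral_has_derivative[OF I(1) conv I(3) f(3) f(4)])
        (use cts seg ts1 in \<open>auto simp: split_beta intro!: continuous_intros\<close>)
    moreover have "integral ?J (\<lambda>t. integral ?J (\<lambda>s. t * (t * (1 - s)) * (t * (1 - s)) * f4 (x - t * (1 - s) * x + t * (1 - s) * x))) = f4 x / 12"
    proof -
      have "integral ?J (\<lambda>s. t * (t * (1 - s)) * (t * (1 - s))) = t ^ 3 / 3" for t :: real
      proof -
        have "integral ?J (\<lambda>s. t * (t * (1 - s)) * (t * (1 - s))) = integral ?J (\<lambda>s. t ^ 3 * (1 - s)\<^sup>2)"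
          by (rule integral_cong) (simp add: power2_eq_square power3_eq_cube)
        then show ?thesis using i3 by simp
      qed
      from mon[OF this t3, of "f4 x"] show ?thesis by simp
    qed
    ultimately show ?thesis by (rule DERIV_cong)
  qed
  have Rz1x: "Rz1 x = f3 x / 6" using mon[OF k1 t2, of "f3 x"] by (simp add: Rz1_def)
  have contR: "isCont Rv x" "isCont Rz x" using DERIV_isCont[OF RvD[OF I(3)]] DERIV_isCont[OF RzD[OF I(3)]] .
  have negnbhd: "\<exists>T. open T \<and> x \<in> T \<and> T \<subseteq> I \<and> (\<forall>y\<in>T. F y < 0)"
    if "\<And>y. y \<in> I \<Longrightarrow> isCont F y" "F x < 0" for F :: "real \<Rightarrow> real"
  proof -
    have "continuous_on I F" using that(1) by (simp add: continuous_at_imp_continuous_on)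
    then have "open (F -` {..<0} \<inter> I)" using continuous_on_open_vimage[OF I(1)] open_lessThan by blast
    then show ?thesis using that(2) I(3) by (intro exI[of _ "F -` {..<0} \<inter> I"]) auto
  qed
  obtain Tv where Tv: "open Tv" "x \<in> Tv" "Tv \<subseteq> I" "\<And>y. y \<in> Tv \<Longrightarrow> Rv y < 0"
    using negnbhd[of Rv] DERIV_isCont[OF RvD] R0 R0neg by (auto simp: Rv_def)
  obtain Tz where Tz: "open Tz" "x \<in> Tz" "Tz \<subseteq> I" "\<And>y. y \<in> Tz \<Longrightarrow> Rz y < 0"
    using negnbhd[of Rz] DERIV_isCont[OF RzD] R0 R0neg by (auto simp: Rz_def)
  have Yv: "Yfun W \<kappa> c lam v x x = sqrt (2 * \<kappa> v / \<bar>Rv v\<bar>)" for v by (simp add: Yfun_def Rv_def)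
  have Yz: "Yfun W \<kappa> c lam x x z = sqrt (2 * \<kappa> x / \<bar>Rz z\<bar>)" for z by (simp add: Yfun_def Rz_def)
  have Rx: "Rv x = R0" "Rz x = R0" by (simp_all add: Rv_def Rz_def R0)
  have Tv': "0 < \<kappa> y" "(\<kappa> has_real_derivative \<kappa>1 y) (at y)" "(Rv has_real_derivative Rv1 y) (at y)" if "y \<in> Tv" for y
    using \<kappa> RvD Tv(3) that by blast+
  note dv = sqrt_quotient_deriv_deriv[where k = \<kappa> and R = Rv, OF Tv(1,2,4) Tv'(1,2) \<kappa>(3) Tv'(3) Rv1D,
    unfolded Rx Rv1x Ys[symmetric]]
  have e12: "f4 x / 12 / R0 = r2" "f3 x / 6 / R0 = r" using r by simp_all
  show "Ys_v W \<kappa> x c lam = Ys W \<kappa> x c lam * ((u - r) / 2)"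
    unfolding Ys_v_def Yv using dv(1) by (simp only: u_def e12)
  show "Ys_vv W \<kappa> x c lam = Ys W \<kappa> x c lam * ((\<kappa>2 / \<kappa> x - u\<^sup>2 - r2 + r\<^sup>2) / 2 + (u - r)\<^sup>2 / 4)"
    unfolding Ys_vv_def Yv using dv(2) by (simp only: u_def e12)
  have Tz': "(Rz has_real_derivative Rz1 y) (at y)" if "y \<in> Tz" for y
    using RzD Tz(3) that by blast
  note dz = sqrt_quotient_deriv_deriv[where k = "\<lambda>_. \<kappa> x" and R = Rz, OF Tz(1,2,4) pos\<kappa> DERIV_const DERIV_const Tz' Rz1D,
    unfolded Rx Rz1x Ys[symmetric]]
  show "Ys_z W \<kappa> x c lam = Ys W \<kappa> x c lam * (- r / 2)"
    unfolding Ys_z_def Yz using dz(1)[unfolded e12] by simp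
  show "Ys_zz W \<kappa> x c lam = Ys W \<kappa> x c lam * ((- r2 + r\<^sup>2) / 2 + r\<^sup>2 / 4)"
    unfolding Ys_zz_def Yz using dz(2)[unfolded e12] by simp

  \<comment> \<open>For the mixed derivative z is differentiated first, at z = x with w free;
    \<open>Rw\<close> and \<open>Rwz\<close> are the values of R and of its z-derivative along that
    line.\<close>
  define Rw where "Rw w = Rfun W c lam x w x" for w
  define Rwz where "Rwz w = integral ?J (\<lambda>t. integral ?J (\<lambda>s. t * (t * (1 - s)) * f3 (t * x + (1 - t) * w)))" for w
  have segw: "t * x + (1 - t) * w \<in> I" if "w \<in> I" "t \<in> ?J" for w t
    using cc[OF I(3) that(1) I(3), of t "1 - t" 0] that by simp
  have RwD: "(Rw has_real_derivative f3 x / 6) (at x)"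
  proof -
    have "((\<lambda>w. integral ?J (\<lambda>t. integral ?J (\<lambda>s. t * f2 (t * x + (1 - t) * w)))) has_real_derivative
        integral ?J (\<lambda>t. integral ?J (\<lambda>s. t * (1 - t) * f3 (t * x + (1 - t) * x)))) (at x)"
      by (rule double_integral_has_derivative[OF I(1) conv I(3) f(2) contI(2)])
        (use cts segw in \<open>auto simp: split_beta intro!: continuous_intros\<close>)
    moreover have "integral ?J (\<lambda>t. integral ?J (\<lambda>s. t * (1 - t) * f3 (t * x + (1 - t) * x))) = f3 x / 6"
      using mon[of "\<lambda>t s. t * (1 - t)", OF _ t1, of "f3 x"] by (simp add: algebra_simps)
    ultimately have "((\<lambda>w. integral ?J (\<lambda>t. integral ?J (\<lambda>s. t * f2 (t * x + (1 - t) * w)))) has_real_derivative f3 x / 6) (at x)" by (rule DERIV_cong)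
    then show ?thesis
      by (rule has_field_derivative_transform_within_open[OF _ I(1,3)]) (simp add: Rw_def R_eq I algebra_simps)
  qed
  have RwzD: "(Rwz has_real_derivative f4 x / 24) (at x)"
  proof -
    have "(Rwz has_real_derivative
        integral ?J (\<lambda>t. integral ?J (\<lambda>s. t * (t * (1 - s)) * (1 - t) * f4 (t * x + (1 - t) * x)))) (at x)"
      unfolding Rwz_def
      by (rule double_integral_has_derivative[OF I(1) conv I(3) f(3,4)])
        (use cts segw in \<open>auto simp: split_beta intro!: continuous_intros\<close>)
    moreover have "integral ?J (\<lambda>t. integral ?J (\<lambda>s. t * (t * (1 - s)) * (1 - t) * f4 (t * x + (1 - t) * x))) = f4 x / 24"
    proof -
      have "integral ?J (\<lambda>s. t * (t * (1 - s)) * (1 - t)) = t\<^sup>2 * (1 - t) / 2" for t :: real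
      proof -
        have e: "(\<lambda>s. t * (t * (1 - s)) * (1 - t)) = (\<lambda>s. (1 - s) * (t\<^sup>2 * (1 - t)))"
          by (simp add: fun_eq_iff power2_eq_square)
        show ?thesis unfolding e integral_mult_left i1 by simp
      qed
      from mon[OF this t4, of "f4 x"] show ?thesis by (simp add: algebra_simps)
    qed
    ultimately show ?thesis by (rule DERIV_cong)
  qed
  have Rwzx: "Rwz x = f3 x / 6"
    using mon[OF k1 t2, of "f3 x"] by (simp add: Rwz_def algebra_simps)
  have RzwD: "((\<lambda>z. Rfun W c lam x w z) has_real_derivative Rwz w) (at x)"
    and Rzw_cont: "\<And>z. z \<in> I \<Longrightarrow> isCont (\<lambda>z. Rfun W c lam x w z) z" if w: "w \<in> I" for w
  proof -
    have seg3: "(1 - t) * w + t * s * x + t * (1 - s) * z \<in> I" if "z \<in> I" "t \<in> ?J" "s \<in> ?J" for z t s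
      by (rule cc[OF w I(3) that(1)]) (use ts1[OF that(2,3)] that in \<open>auto simp: algebra_simps\<close>)
    have *: "((\<lambda>z. Rfun W c lam x w z) has_real_derivative
        integral ?J (\<lambda>t. integral ?J (\<lambda>s. t * (t * (1 - s)) * f3 (((1 - t) * w + t * s * x) + t * (1 - s) * z)))) (at z)" if z: "z \<in> I" for z
    proof -
      have "((\<lambda>z. integral ?J (\<lambda>t. integral ?J (\<lambda>s. t * f2 (((1 - t) * w + t * s * x) + t * (1 - s) * z)))) has_real_derivative
        integral ?J (\<lambda>t. integral ?J (\<lambda>s. t * (t * (1 - s)) * f3 (((1 - t) * w + t * s * x) + t * (1 - s) * z)))) (at z)"
        by (rule double_integral_has_derivative[OF I(1) conv z f(2) contI(2)])
          (use cts seg3 in \<open>auto simp: split_beta intro!: continuous_intros\<close>)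
      then show ?thesis
        by (rule has_field_derivative_transform_within_open[OF _ I(1) z]) (simp add: R_eq I w algebra_simps)
    qed
    have e: "((1 - t) * w + t * s * x) + t * (1 - s) * x = t * x + (1 - t) * w" for t s by (simp add: algebra_simps)
    show "((\<lambda>z. Rfun W c lam x w z) has_real_derivative Rwz w) (at x)"
      using *[OF I(3)] unfolding Rwz_def e .
    show "isCont (\<lambda>z. Rfun W c lam x w z) z" if "z \<in> I" for z by (rule DERIV_isCont[OF *[OF that]])
  qed
  have Rw_cont: "isCont Rw w" if w: "w \<in> I" for w
  proof -
    have "((\<lambda>w. integral ?J (\<lambda>t. integral ?J (\<lambda>s. t * f2 (t * x + (1 - t) * w)))) has_real_derivative
        integral ?J (\<lambda>t. integral ?J (\<lambda>s. t * (1 - t) * f3 (t * x + (1 - t) * w)))) (at w)"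
      by (rule double_integral_has_derivative[OF I(1) conv w f(2) contI(2)])
        (use cts segw in \<open>auto simp: split_beta intro!: continuous_intros\<close>)
    then have "(Rw has_real_derivative integral ?J (\<lambda>t. integral ?J (\<lambda>s. t * (1 - t) * f3 (t * x + (1 - t) * w)))) (at w)"
      by (rule has_field_derivative_transform_within_open[OF _ I(1) w]) (simp add: Rw_def R_eq I algebra_simps)
    then show ?thesis by (rule DERIV_isCont)
  qed
  have Rwx: "Rw x = R0" by (simp add: Rw_def R0)
  obtain Tw where Tw: "open Tw" "x \<in> Tw" "Tw \<subseteq> I" "\<And>y. y \<in> Tw \<Longrightarrow> Rw y < 0"
    using negnbhd[of Rw, OF Rw_cont] Rwx R0neg by auto
  have Yw: "((\<lambda>w. sqrt (2 * \<kappa> x / \<bar>Rw w\<bar>)) has_real_derivative Ys W \<kappa> x c lam * ((0 / \<kappa> x - f3 x / 6 / R0) / 2)) (at x)"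
    using sqrt_quotient_has_derivative[OF DERIV_const RwD pos\<kappa> Tw(1,2,4)] by (simp add: Rwx Ys)
  have inner: "deriv (\<lambda>z. Yfun W \<kappa> c lam x w z) x = sqrt (2 * \<kappa> x / \<bar>Rw w\<bar>) * ((0 / \<kappa> x - Rwz w / Rw w) / 2)" if w: "w \<in> Tw" for w
  proof -
    have wI: "w \<in> I" using w Tw by auto
    obtain T where T: "open T" "x \<in> T" "\<And>y. y \<in> T \<Longrightarrow> Rfun W c lam x w y < 0"
      using negnbhd[of "\<lambda>z. Rfun W c lam x w z", OF Rzw_cont[OF wI]] Tw(4)[OF w] by (auto simp: Rw_def)
    from sqrt_quotient_has_derivative[OF DERIV_const RzwD[OF wI] pos\<kappa> T]
    show ?thesis unfolding Yfun_def Rw_def by (rule DERIV_imp_deriv)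
  qed
  have nz: "Rw x \<noteq> 0" using Rwx R0neg by simp
  have "((\<lambda>w. sqrt (2 * \<kappa> x / \<bar>Rw w\<bar>) * ((0 / \<kappa> x - Rwz w / Rw w) / 2)) has_real_derivative
      Ys W \<kappa> x c lam * ((0 / \<kappa> x - f3 x / 6 / R0) / 2) * ((0 / \<kappa> x - Rwz x / Rw x) / 2)
      + (0 - (f4 x / 24 * Rw x - Rwz x * (f3 x / 6)) / (Rw x * Rw x)) / 2 * sqrt (2 * \<kappa> x / \<bar>Rw x\<bar>)) (at x)"
    by (rule DERIV_mult[OF Yw DERIV_cdivide[OF DERIV_diff[OF DERIV_const DERIV_divide[OF RwzD RwD nz]]]])
  then have "((\<lambda>w. deriv (\<lambda>z. Yfun W \<kappa> c lam x w z) x) has_real_derivative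
      Ys W \<kappa> x c lam * ((0 / \<kappa> x - f3 x / 6 / R0) / 2) * ((0 / \<kappa> x - Rwz x / Rw x) / 2)
      + (0 - (f4 x / 24 * Rw x - Rwz x * (f3 x / 6)) / (Rw x * Rw x)) / 2 * sqrt (2 * \<kappa> x / \<bar>Rw x\<bar>)) (at x)"
    by (rule has_field_derivative_transform_within_open[OF _ Tw(1,2)]) (simp add: inner)
  then have "Ys_wz W \<kappa> x c lam = Ys W \<kappa> x c lam * ((0 - r) / 2) * ((0 - r) / 2)
      + (0 - (f4 x / 24 * R0 - f3 x / 6 * (f3 x / 6)) / (R0 * R0)) / 2 * Ys W \<kappa> x c lam"
    unfolding Ys_wz_def Rwx Rwzx Ys[symmetric] e12 by (simp add: DERIV_imp_deriv)
  also have "(f4 x / 24 * R0 - f3 x / 6 * (f3 x / 6)) / (R0 * R0) = r2 / 2 - r\<^sup>2"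
    using R0neg by (simp add: r diff_divide_distrib power2_eq_square)
  finally show "Ys_wz W \<kappa> x c lam = Ys W \<kappa> x c lam * (3 / 4 * r\<^sup>2 - r2 / 4)"
    by (simp add: power2_eq_square field_simps)
qed

lemma smooth_on_real_deriv:
  fixes f :: "real \<Rightarrow> real"
  assumes "open S" "smooth_on f S"
  shows "v \<in> S \<Longrightarrow> (f has_real_derivative deriv f v) (at v)" and "smooth_on (deriv f) S"
proof -
  have d: "(f has_real_derivative deriv f v) (at v)" if "v \<in> S" for v
    using smooth_on_differentiable[OF assms(2) that] by (simp add: DERIV_deriv_iff_real_differentiable)
  then show "v \<in> S \<Longrightarrow> (f has_real_derivative deriv f v) (at v)" .
  have "deriv f v = dd 1 f v" if "v \<in> S" for v
    using dd_eqI[OF has_field_derivative_imp_has_derivative[OF d[OF that]], of 1] by simp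
  then show "smooth_on (deriv f) S" using smooth_on_cong[OF assms(1)] smooth_on_dd[OF assms(2), of 1] by blast
qed

text \<open>After cancelling K a everything is expressed by the logarithmic data u, u2 of \<kappa>
  and r, r2 of R. With a^2 = - 2 / A both sides become the same rational function of A, B, C, u, u2;
  only even powers of a occur once x3 is divided by a.\<close>

lemma alpha_arith:
  fixes A :: real
  assumes nz: "A \<noteq> 0" "K \<noteq> 0" "a \<noteq> 0" and a: "a\<^sup>2 = - 2 / A" and x2: "x2 = - B * a\<^sup>2 / (3 * A)"
    and x3: "x3 = - (C * a ^ 4 + 6 * B * a\<^sup>2 * x2 + 3 * A * x2\<^sup>2) / (4 * A * a)"
    and r: "r = B / (3 * A)" "r2 = C / (6 * A)"
  shows "(K * ((u2 - u\<^sup>2) / 2 + u\<^sup>2 / 4) * a ^ 3 + 3 * (K * (u / 2)) * a * x2 + K * x3) / (4 * (K * a)) =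
    1 / (K * a) * (1 / 3 * B / A\<^sup>2 * (K * a * ((u - r) / 2) + 2 * (K * a * (- r / 2)))
      + a\<^sup>2 * (1 / 4 * (K * a * ((u2 - u\<^sup>2 - r2 + r\<^sup>2) / 2 + (u - r)\<^sup>2 / 4))
        + K * a * ((- r2 + r\<^sup>2) / 2 + r\<^sup>2 / 4) - K * a * (3 / 4 * r\<^sup>2 - r2 / 4)))"
proof -
  have x2': "x2 = 2 * B / (3 * A\<^sup>2)" unfolding x2 a using nz by (simp add: field_simps power2_eq_square)
  have x3': "x3 / a = - (C * (a\<^sup>2)\<^sup>2 + 6 * B * a\<^sup>2 * x2 + 3 * A * x2\<^sup>2) / (4 * A * a\<^sup>2)"
    unfolding x3 using nz by (simp add: field_simps power2_eq_square eval_nat_numeral)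
  have "(K * ((u2 - u\<^sup>2) / 2 + u\<^sup>2 / 4) * a ^ 3 + 3 * (K * (u / 2)) * a * x2 + K * x3) / (4 * (K * a)) =
      (((u2 - u\<^sup>2) / 2 + u\<^sup>2 / 4) * a\<^sup>2 + 3 * (u / 2) * x2 + x3 / a) / 4"
    using nz by (simp add: field_simps power2_eq_square power3_eq_cube)
  also have "\<dots> = 1 / 3 * B / A\<^sup>2 * ((u - r) / 2 + 2 * (- r / 2))
      + a\<^sup>2 * (1 / 4 * ((u2 - u\<^sup>2 - r2 + r\<^sup>2) / 2 + (u - r)\<^sup>2 / 4) + ((- r2 + r\<^sup>2) / 2 + r\<^sup>2 / 4) - (3 / 4 * r\<^sup>2 - r2 / 4))"
    unfolding x3' unfolding x2' unfolding a r using nz(1) by (simp add: field_simps power2_eq_square)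
  also have "\<dots> = 1 / (K * a) * (1 / 3 * B / A\<^sup>2 * (K * a * ((u - r) / 2) + 2 * (K * a * (- r / 2)))
      + a\<^sup>2 * (1 / 4 * (K * a * ((u2 - u\<^sup>2 - r2 + r\<^sup>2) / 2 + (u - r)\<^sup>2 / 4))
        + K * a * ((- r2 + r\<^sup>2) / 2 + r\<^sup>2 / 4) - K * a * (3 / 4 * r\<^sup>2 - r2 / 4)))"
  proof -
    have "x1 * (x4 + 2 * x5) + s * (1 / 4 * x6 + x7 - x8) =
      1 / d * (x1 * (d * x4 + 2 * (d * x5)) + s * (1 / 4 * (d * x6) + d * x7 - d * x8))"
      if "d \<noteq> 0" for x1 x4 x5 s x6 x7 x8 d :: real using that by (simp add: field_simps)
    from this[of "K * a"] show ?thesis by this (use nz in simp)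
  qed
  finally show ?thesis .
qed

section \<open>Identification of the coefficients, and gluing of the local estimates\<close>

context soliton
begin

text \<open>Both descriptions of the coefficients, by derivatives of \<open>Yfun\<close> and by jets
  of the straightening coordinate, are reduced to derivatives of the potential and of \<kappa> at
  the endstate.\<close>

lemma coefficients:
  assumes q: "q \<in> \<Lambda>" and dvW: "\<And>v n. v \<in> I \<Longrightarrow> dv n W' v c lam = (dd (1, 0) ^^ n) W (v, q)"
  shows "a_s W' (vs q) c lam = as q" "Ys W' \<kappa> (vs q) c lam = Y q"
    "\<alpha>_s W' \<kappa> (vs q) c lam = alpha q" "\<beta>_s W' \<kappa> (vs q) c lam = beta q"
proof -
  note sk = smooth_on_real_deriv[OF I(1) \<kappa>(1)]
  note sk2 = smooth_on_real_deriv[OF I(1) sk(2)]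
  have vI: "vs q \<in> I" using vs(2) q .
  define F where "F n v = (dd (1, 0) ^^ n) W (v, q)" for n v
  have sF: "smooth_on ((dd (1, 0) ^^ n) W) (I \<times> \<Lambda>)" for n by (rule smooth_on_funpow_dd[OF W])
  have F: "(F n has_real_derivative F (Suc n) v) (at v)" if "v \<in> I" for n v
    using dd_fst_line[OF sF, of v q n] that q by (simp add: F_def[abs_def])
  have W234: "F 2 (vs q) = W2s q" "F 3 (vs q) = W3s q" "F 4 (vs q) = W4s q"
    by (simp_all add: F_def W2s_def W3s_def W4s_def eval_nat_numeral)
  have dF: "dv n W' v c lam = F n v" if "v \<in> I" for n v using dvW[OF that] by (simp add: F_def)
  have F4c: "continuous_on I (F 4)"
    by (rule DERIV_continuous_on) (rule has_field_derivative_at_within[OF F])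
  have neg: "F 2 (vs q) < 0" using W2s_neg[OF q] by (simp add: W234)
  have F': "(F 2 has_real_derivative F 3 v) (at v)" "(F 3 has_real_derivative F 4 v) (at v)" if "v \<in> I" for v
    using F[OF that, of 2] F[OF that, of 3] by (simp_all add: eval_nat_numeral)
  note J0 = Yfun_jets[where W = W' and c = c and lam = lam and \<kappa> = \<kappa> and ?f2.0 = "F 2" and ?f3.0 = "F 3" and ?f4.0 = "F 4",
      OF I vI dF F'(1,2) F4c neg \<kappa>(2) sk(1) sk2(1)[OF vI], unfolded W234]
  let ?Ys = "Ys W' \<kappa> (vs q) c lam" and ?u = "deriv \<kappa> (vs q) / \<kappa> (vs q)" and ?u2 = "deriv (deriv \<kappa>) (vs q) / \<kappa> (vs q)"
    and ?r = "W3s q / (3 * W2s q)" and ?r2 = "W4s q / (6 * W2s q)"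
  have J: "?Ys = sqrt (2 * \<kappa> (vs q)) * sqrt (- 2 / W2s q)" "Ys_v W' \<kappa> (vs q) c lam = ?Ys * ((?u - ?r) / 2)"
    "Ys_z W' \<kappa> (vs q) c lam = ?Ys * (- ?r / 2)"
    "Ys_vv W' \<kappa> (vs q) c lam = ?Ys * ((?u2 - ?u\<^sup>2 - ?r2 + ?r\<^sup>2) / 2 + (?u - ?r)\<^sup>2 / 4)"
    "Ys_zz W' \<kappa> (vs q) c lam = ?Ys * ((- ?r2 + ?r\<^sup>2) / 2 + ?r\<^sup>2 / 4)"
    "Ys_wz W' \<kappa> (vs q) c lam = ?Ys * (3 / 4 * ?r\<^sup>2 - ?r2 / 4)"
    by (rule J0; assumption)+
  show as: "a_s W' (vs q) c lam = as q" using dF[OF vI] by (simp add: a_s_def as_def W234)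
  show Ys: "Ys W' \<kappa> (vs q) c lam = Y q" using J(1) by (simp add: Y_def as_def)
  have bs: "b_s W' (vs q) c lam = 1 / 3 * W3s q / (W2s q)\<^sup>2" using dF[OF vI] by (simp add: b_s_def W234)
  have nz: "W2s q \<noteq> 0" "sqrt (2 * \<kappa> (vs q)) \<noteq> 0" "as q \<noteq> 0" "\<kappa> (vs q) \<noteq> 0"
    using W2s_neg[OF q] as_pos[OF q] \<kappa>(2)[OF vI] by auto
  \<comment> \<open>The quotient lemma with R constantly - 1 yields the derivatives of sqrt (2
    \<kappa>).\<close>
  note K = sqrt_quotient_deriv_deriv[where k = \<kappa> and R = "\<lambda>_. - 1" and ?R1.0 = "\<lambda>_. 0" and ?R2.0 = 0, OF I(1) vI _ \<kappa>(2) sk(1) sk2(1)[OF vI], simplified]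
  have K2: "deriv (deriv (\<lambda>v. sqrt (2 * \<kappa> v))) (vs q) = sqrt (2 * \<kappa> (vs q)) *
      ((deriv (deriv \<kappa>) (vs q) / \<kappa> (vs q) - (deriv \<kappa> (vs q) / \<kappa> (vs q))\<^sup>2) / 2 + (deriv \<kappa> (vs q) / \<kappa> (vs q))\<^sup>2 / 4)"
    using K(2) by (simp add: numeral_2_eq_2)
  have K1: "deriv (\<lambda>v. sqrt (2 * \<kappa> v)) (vs q) = sqrt (2 * \<kappa> (vs q)) * (deriv \<kappa> (vs q) / \<kappa> (vs q) / 2)"
    using K(1) by simp
  show "\<alpha>_s W' \<kappa> (vs q) c lam = alpha q"
    unfolding \<alpha>_s_def alpha_def \<phi>2_def unfolding bs as J(2-6) K1 K2 unfolding Ys unfolding Y_def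
    by (rule alpha_arith[OF nz(1-3) as_sq[OF q] x2_def x3_def refl refl, symmetric])
  show "\<beta>_s W' \<kappa> (vs q) c lam = beta q"
  proof -
    have e: "Ys_v W' \<kappa> (vs q) c lam / Y q = (deriv \<kappa> (vs q) / \<kappa> (vs q) - W3s q / (3 * W2s q)) / 2"
      using J(2) Y_pos[OF q] by (simp add: Ys)
    show ?thesis unfolding \<beta>_s_def bs as Ys beta_def as_sq[OF q] unfolding e
      using nz by (simp add: field_simps power2_eq_square)
  qed
qed

text \<open>The local matrices might depend on the choices made around each \<open>q0\<close>. But
  at fixed q each of them is the limit of the same expression as \<epsilon> tends to 0, so
  \<open>D\<close>, defined by that limit, agrees with all of them and inherits their
  properties.\<close>

lemma asymptotics:
  assumes roots: "\<And>\<mu> q. q \<in> \<Lambda> \<Longrightarrow> W (v0 q, q) < \<mu> \<Longrightarrow> \<mu> < mus q \<Longrightarrow>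
      v1 (\<mu>, q) \<in> I \<and> v1 (\<mu>, q) < vs q \<and> vs q < v2 (\<mu>, q) \<and> v2 (\<mu>, q) < v0 q \<and> v0 q < v3 (\<mu>, q) \<and> v3 (\<mu>, q) < vS q \<and>
      W (v1 (\<mu>, q), q) = \<mu> \<and> W (v2 (\<mu>, q), q) = \<mu> \<and> W (v3 (\<mu>, q), q) = \<mu> \<and>
      (\<forall>v\<in>{v1 (\<mu>, q)..<vs q}. 0 < dd (1, 0) W (v, q))"
  defines "\<rho> \<equiv> \<lambda>p. (v2 p - v1 p) / (v3 p - v2 p)"
  obtains D where "\<And>q i j. q \<in> \<Lambda> \<Longrightarrow> D q i j = D q j i" "\<And>q j. q \<in> \<Lambda> \<Longrightarrow> linear (\<lambda>i. D q i j)"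
    "\<And>q i. q \<in> \<Lambda> \<Longrightarrow> Vv q i = 0 \<Longrightarrow> Wv q i = 0 \<Longrightarrow> TT q i i = 0 \<Longrightarrow>
      Y q * D q i i = (deriv ^^ 2) (\<lambda>t. mom (q + t *\<^sub>R snd i)) 0"
    "\<And>q0 i j. q0 \<in> \<Lambda> \<Longrightarrow> \<exists>\<delta> \<Theta> K. 0 < \<delta> \<and> open \<Theta> \<and> q0 \<in> \<Theta> \<and> \<Theta> \<subseteq> \<Lambda> \<and> 0 \<le> K \<and>
      (\<forall>q\<in>\<Theta>. \<forall>\<mu>\<in>{mus q - \<delta><..<mus q}. 0 < \<rho> (\<mu>, q) \<and> \<rho> (\<mu>, q) \<le> K * sqrt (mus q - \<mu>) \<and>
        \<bar>hessian (act v2 v3) (\<mu>, q) i j / Y q - sing q (\<rho> (\<mu>, q)) i j - D q i j\<bar> \<le> K * \<bar>\<rho> (\<mu>, q) * ln (\<rho> (\<mu>, q))\<bar>)"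
proof -
  define E where "E q i j \<epsilon> = hessian (act v2 v3) (mus q - \<epsilon>\<^sup>2, q) i j / Y q - sing q (\<rho> (mus q - \<epsilon>\<^sup>2, q)) i j" for q i j \<epsilon>
  define D where "D q i j = Lim (at_right 0) (E q i j)" for q i j
  have main: "(\<forall>i j. D q0 i j = D q0 j i) \<and> (\<forall>j. linear (\<lambda>i. D q0 i j)) \<and>
    (\<forall>i. Vv q0 i = 0 \<longrightarrow> Wv q0 i = 0 \<longrightarrow> TT q0 i i = 0 \<longrightarrow>
      Y q0 * D q0 i i = (deriv ^^ 2) (\<lambda>t. mom (q0 + t *\<^sub>R snd i)) 0) \<and>
    (\<forall>i j. \<exists>\<delta> \<Theta> K. 0 < \<delta> \<and> open \<Theta> \<and> q0 \<in> \<Theta> \<and> \<Theta> \<subseteq> \<Lambda> \<and> 0 \<le> K \<and>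
      (\<forall>q\<in>\<Theta>. \<forall>\<mu>\<in>{mus q - \<delta><..<mus q}. 0 < \<rho> (\<mu>, q) \<and> \<rho> (\<mu>, q) \<le> K * sqrt (mus q - \<mu>) \<and>
        \<bar>hessian (act v2 v3) (\<mu>, q) i j / Y q - sing q (\<rho> (\<mu>, q)) i j - D q i j\<bar> \<le> K * \<bar>\<rho> (\<mu>, q) * ln (\<rho> (\<mu>, q))\<bar>))"
    if q0: "q0 \<in> \<Lambda>" for q0
  proof -
    obtain D' where D': "\<And>i j. D' q0 i j = D' q0 j i" "\<And>j. linear (\<lambda>i. D' q0 i j)"
      "\<And>i. Vv q0 i = 0 \<Longrightarrow> Wv q0 i = 0 \<Longrightarrow> TT q0 i i = 0 \<Longrightarrow>
        Y q0 * D' q0 i i = (deriv ^^ 2) (\<lambda>t. mom (q0 + t *\<^sub>R snd i)) 0"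
      and loc: "\<And>i j. \<exists>\<delta> \<Theta> K. 0 < \<delta> \<and> open \<Theta> \<and> q0 \<in> \<Theta> \<and> \<Theta> \<subseteq> \<Lambda> \<and> (\<forall>q\<in>\<Theta>. \<forall>\<epsilon>\<in>{0<..<\<delta>}.
        let p = (mus q - \<epsilon>\<^sup>2, q); \<rho> = (v2 p - v1 p) / (v3 p - v2 p) in
        0 < \<rho> \<and> \<rho> \<le> K * \<epsilon> \<and> \<epsilon> \<le> K * \<bar>\<rho> * ln \<rho>\<bar> \<and>
        \<bar>hessian (act v2 v3) p i j / Y q - sing q \<rho> i j - D' q i j\<bar> \<le> K * \<epsilon>)"
      by (rule local_asymptotics[OF q0 roots], assumption+, rule that)
    have loc': "\<exists>\<delta> \<Theta> K. 0 < \<delta> \<and> open \<Theta> \<and> q0 \<in> \<Theta> \<and> \<Theta> \<subseteq> \<Lambda> \<and> 0 \<le> K \<and> (\<forall>q\<in>\<Theta>. D q i j = D' q i j) \<and>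
      (\<forall>q\<in>\<Theta>. \<forall>\<mu>\<in>{mus q - \<delta><..<mus q}. 0 < \<rho> (\<mu>, q) \<and> \<rho> (\<mu>, q) \<le> K * sqrt (mus q - \<mu>) \<and>
        \<bar>hessian (act v2 v3) (\<mu>, q) i j / Y q - sing q (\<rho> (\<mu>, q)) i j - D q i j\<bar> \<le> K * \<bar>\<rho> (\<mu>, q) * ln (\<rho> (\<mu>, q))\<bar>)"
      for i j
    proof -
      obtain \<delta> \<Theta> K where \<delta>: "0 < \<delta>" and \<Theta>: "open \<Theta>" "q0 \<in> \<Theta>" "\<Theta> \<subseteq> \<Lambda>"
        and est0: "\<forall>q\<in>\<Theta>. \<forall>\<epsilon>\<in>{0<..<\<delta>}.
          let p = (mus q - \<epsilon>\<^sup>2, q); \<rho> = (v2 p - v1 p) / (v3 p - v2 p) in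
          0 < \<rho> \<and> \<rho> \<le> K * \<epsilon> \<and> \<epsilon> \<le> K * \<bar>\<rho> * ln \<rho>\<bar> \<and>
          \<bar>hessian (act v2 v3) p i j / Y q - sing q \<rho> i j - D' q i j\<bar> \<le> K * \<epsilon>"
        using loc[of i j] by (elim exE conjE) (rule that)
      have est: "0 < \<rho> (mus q - \<epsilon>\<^sup>2, q)" "\<rho> (mus q - \<epsilon>\<^sup>2, q) \<le> K * \<epsilon>" "\<epsilon> \<le> K * \<bar>\<rho> (mus q - \<epsilon>\<^sup>2, q) * ln (\<rho> (mus q - \<epsilon>\<^sup>2, q))\<bar>"
        "\<bar>E q i j \<epsilon> - D' q i j\<bar> \<le> K * \<epsilon>" if "q \<in> \<Theta>" "0 < \<epsilon>" "\<epsilon> < \<delta>" for q \<epsilon>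
        using est0[rule_format, OF that(1), of \<epsilon>] that(2,3) by (simp_all add: Let_def E_def \<rho>_def)
      \<comment> \<open>The sign of \<open>K\<close> is not part of the local statement; it follows
        from 0 < \<rho> <= K \<epsilon> at one admissible \<epsilon>.\<close>
      have "0 < K * (\<delta> / 2)" using est(1,2)[OF \<Theta>(2), of "\<delta> / 2"] \<delta> by linarith
      then have K: "0 \<le> K" using \<delta> by (simp add: zero_less_mult_iff)
      have DD: "D q i j = D' q i j" if q: "q \<in> \<Theta>" for q
      proof -
        have "((\<lambda>\<epsilon>. E q i j \<epsilon> - D' q i j) \<longlongrightarrow> 0) (at_right 0)"
        proof (rule Lim_null_comparison)
          show "\<forall>\<^sub>F \<epsilon> in at_right 0. norm (E q i j \<epsilon> - D' q i j) \<le> K * \<epsilon>"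
            unfolding eventually_at_right_field using est(4)[OF q] \<delta> by auto
          show "((\<lambda>\<epsilon>. K * \<epsilon>) \<longlongrightarrow> 0) (at_right 0)" by (auto intro!: tendsto_eq_intros)
        qed
        from tendsto_Lim[OF trivial_limit_at_right_real Lim_null[THEN iffD2, OF this]] show ?thesis by (simp add: D_def)
      qed
      \<comment> \<open>\<open>K\<close> bounds \<rho> by \<epsilon>; \<open>K * K\<close> arises
        when the error K \<epsilon> is bounded through \<epsilon> <= K |\<rho> ln \<rho>|. The range
        \<open>\<delta>\<^sup>2\<close> of \<mu> corresponds to \<epsilon> < \<delta>.\<close>
      have fin: "0 < \<rho> (\<mu>, q) \<and> \<rho> (\<mu>, q) \<le> (K + K * K) * sqrt (mus q - \<mu>) \<and>
        \<bar>hessian (act v2 v3) (\<mu>, q) i j / Y q - sing q (\<rho> (\<mu>, q)) i j - D q i j\<bar> \<le> (K + K * K) * \<bar>\<rho> (\<mu>, q) * ln (\<rho> (\<mu>, q))\<bar>"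
        if q: "q \<in> \<Theta>" and \<mu>: "\<mu> \<in> {mus q - \<delta>\<^sup>2<..<mus q}" for q \<mu>
      proof -
        define \<epsilon> where "\<epsilon> = sqrt (mus q - \<mu>)"
        have \<epsilon>: "0 < \<epsilon>" "\<epsilon> < \<delta>" "mus q - \<epsilon>\<^sup>2 = \<mu>" using \<mu> \<delta> by (auto simp: \<epsilon>_def intro!: real_less_lsqrt)
        note e = est[OF q \<epsilon>(1,2), unfolded E_def \<epsilon>(3)]
        let ?L = "\<bar>\<rho> (\<mu>, q) * ln (\<rho> (\<mu>, q))\<bar>"
        have "K * \<epsilon> \<le> K * (K * ?L)" using e(3) K by (rule mult_left_mono)
        moreover have "0 \<le> K * ?L" using K by simp
        moreover have "0 \<le> K * K * \<epsilon>" using \<epsilon> by simp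
        ultimately show ?thesis using e(1,2,4) unfolding DD[OF q] \<epsilon>_def[symmetric] distrib_right mult.assoc by linarith
      qed
      show ?thesis
        using \<delta> \<Theta> K DD fin by (intro exI[of _ "\<delta>\<^sup>2"] exI[of _ \<Theta>] exI[of _ "K + K * K"]) auto
    qed
    have eq: "D q0 i j = D' q0 i j" for i j using loc'[of i j] by blast
    show ?thesis
    proof (intro conjI allI impI)
      fix i j
      show "\<exists>\<delta> \<Theta> K. 0 < \<delta> \<and> open \<Theta> \<and> q0 \<in> \<Theta> \<and> \<Theta> \<subseteq> \<Lambda> \<and> 0 \<le> K \<and>
      (\<forall>q\<in>\<Theta>. \<forall>\<mu>\<in>{mus q - \<delta><..<mus q}. 0 < \<rho> (\<mu>, q) \<and> \<rho> (\<mu>, q) \<le> K * sqrt (mus q - \<mu>) \<and>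
        \<bar>hessian (act v2 v3) (\<mu>, q) i j / Y q - sing q (\<rho> (\<mu>, q)) i j - D q i j\<bar> \<le> K * \<bar>\<rho> (\<mu>, q) * ln (\<rho> (\<mu>, q))\<bar>)"
        using loc'[of i j] by (elim exE conjE, intro exI conjI) assumption+
    qed (use D' eq in simp_all)
  qed
  show ?thesis
  proof (rule that)
    show "\<And>q i j. q \<in> \<Lambda> \<Longrightarrow> D q i j = D q j i" by (rule main[THEN conjunct1, rule_format])
    show "\<And>q j. q \<in> \<Lambda> \<Longrightarrow> linear (\<lambda>i. D q i j)" by (rule main[THEN conjunct2, THEN conjunct1, rule_format])
    show "\<And>q i. q \<in> \<Lambda> \<Longrightarrow> Vv q i = 0 \<Longrightarrow> Wv q i = 0 \<Longrightarrow> TT q i i = 0 \<Longrightarrow>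
      Y q * D q i i = (deriv ^^ 2) (\<lambda>t. mom (q + t *\<^sub>R snd i)) 0"
      by (rule main[THEN conjunct2, THEN conjunct2, THEN conjunct1, rule_format])
    show "\<exists>\<delta> \<Theta> K. 0 < \<delta> \<and> open \<Theta> \<and> q0 \<in> \<Theta> \<and> \<Theta> \<subseteq> \<Lambda> \<and> 0 \<le> K \<and>
      (\<forall>q\<in>\<Theta>. \<forall>\<mu>\<in>{mus q - \<delta><..<mus q}. 0 < \<rho> (\<mu>, q) \<and> \<rho> (\<mu>, q) \<le> K * sqrt (mus q - \<mu>) \<and>
        \<bar>hessian (act v2 v3) (\<mu>, q) i j / Y q - sing q (\<rho> (\<mu>, q)) i j - D q i j\<bar> \<le> K * \<bar>\<rho> (\<mu>, q) * ln (\<rho> (\<mu>, q))\<bar>)"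
      if "q0 \<in> \<Lambda>" for q0 i j by (rule main[OF that, THEN conjunct2, THEN conjunct2, THEN conjunct2, THEN spec, THEN spec])
  qed
qed

end

section \<open>The Boussinesq potential\<close>

lemma dd_sndI:
  fixes F :: "real \<times> 'q::real_normed_vector \<Rightarrow> real"
  assumes "F differentiable (at (v, q))" "((\<lambda>t. F (v, q + t *\<^sub>R k)) has_real_derivative D) (at 0)"
  shows "dd (0, k) F (v, q) = D"
proof -
  have "F differentiable (at ((v, q) + 0 *\<^sub>R (0, k)))" using assms(1) by simp
  from dd_line_at[OF this] have "((\<lambda>t. F (v, q + t *\<^sub>R k)) has_real_derivative dd (0, k) F (v, q)) (at 0)" by simp
  from DERIV_unique[OF this assms(2)] show ?thesis .
qed

text \<open>The shape of the parameter gradient of the potential as a function of v, with the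
  components of the direction as constants A, B, C; it serves both dimensions.\<close>

lemma deriv_affine_combination:
  fixes g h :: "real \<Rightarrow> real"
  assumes S: "open S" "x \<in> S" and g: "smooth_on g S" and h: "smooth_on h S"
    and F: "\<And>v. v \<in> S \<Longrightarrow> F v = - (v * A + g v * B + h v * C)"
  shows "deriv F x = - (A + deriv g x * B + deriv h x * C)"
    and "deriv (deriv F) x = - (deriv (deriv g) x * B + deriv (deriv h) x * C)"
proof -
  note g' = smooth_on_real_deriv[OF S(1) g] and h' = smooth_on_real_deriv[OF S(1) h]
  note g'' = smooth_on_real_deriv(1)[OF S(1) g'(2)] and h'' = smooth_on_real_deriv(1)[OF S(1) h'(2)]
  have 1: "deriv F v = - (A + deriv g v * B + deriv h v * C)" if v: "v \<in> S" for v
  proof (rule DERIV_imp_deriv)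
    have "((\<lambda>v. - (v * A + g v * B + h v * C)) has_real_derivative - (A + deriv g v * B + deriv h v * C)) (at v)"
      using g'(1)[OF v] h'(1)[OF v] by (auto intro!: derivative_eq_intros)
    then show "(F has_real_derivative - (A + deriv g v * B + deriv h v * C)) (at v)"
      by (rule has_field_derivative_transform_within_open[OF _ S(1) v]) (simp add: F)
  qed
  then show "deriv F x = - (A + deriv g x * B + deriv h x * C)" using S by simp
  show "deriv (deriv F) x = - (deriv (deriv g) x * B + deriv (deriv h) x * C)"
  proof (rule DERIV_imp_deriv)
    have "((\<lambda>v. - (A + deriv g v * B + deriv h v * C)) has_real_derivative - (deriv (deriv g) x * B + deriv (deriv h) x * C)) (at x)"
      using g''[OF S(2)] h''[OF S(2)] by (auto intro!: derivative_eq_intros)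
    then show "(deriv F has_real_derivative - (deriv (deriv g) x * B + deriv (deriv h) x * C)) (at x)"
      by (rule has_field_derivative_transform_within_open[OF _ S]) (simp add: 1)
  qed
qed

lemma deriv_deriv_shift: "(deriv ^^ 2) (\<lambda>x. h (x - c)) c = (deriv ^^ 2) h (0::real)"
proof -
  have 1: "deriv (\<lambda>x. g (x - c)) = (\<lambda>x. deriv g (x - c))" for g :: "real \<Rightarrow> real"
    using DERIV_shift[of g _ _ "- c"] by (simp add: fun_eq_iff deriv_def)
  show ?thesis by (simp add: numeral_2_eq_2 1)
qed

text \<open>\<open>quad_form\<close> sees only entries on basis vectors; by bilinearity it becomes
  an evaluation at X, so that a general vector can be used as a direction of
  differentiation.\<close>

lemma quad_form_eq:
  assumes "\<And>i j. A i j = A j i" "\<And>j. linear (\<lambda>i. A i j)"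
  shows "quad_form A X = A X X"
proof -
  have e: "A X j = (\<Sum>i\<in>Basis. (X \<bullet> i) * A i j)" for j
  proof -
    have "A (\<Sum>i\<in>Basis. (X \<bullet> i) *\<^sub>R i) j = (\<Sum>i\<in>Basis. A ((X \<bullet> i) *\<^sub>R i) j)" by (rule linear_sum[OF assms(2)])
    then show ?thesis by (simp add: euclidean_representation linear_scale[OF assms(2)])
  qed
  have e2: "A i X = (\<Sum>j\<in>Basis. A i j * (X \<bullet> j))" for i
  proof -
    have "A i X = A X i" by (rule assms(1))
    also have "\<dots> = (\<Sum>j\<in>Basis. (X \<bullet> j) * A j i)" by (rule e)
    also have "\<dots> = (\<Sum>j\<in>Basis. A i j * (X \<bullet> j))"
      by (rule sum.cong[OF refl]) (subst assms(1), rule mult.commute)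
    finally show ?thesis .
  qed
  have "A X X = (\<Sum>i\<in>Basis. (X \<bullet> i) * A i X)" by (rule e)
  also have "\<dots> = (\<Sum>i\<in>Basis. \<Sum>j\<in>Basis. (X \<bullet> i) * A i j * (X \<bullet> j))"
    by (simp only: e2 sum_distrib_left mult.assoc)
  finally show ?thesis by (simp add: quad_form_def)
qed

text \<open>The parameter \<open>N\<close> only carries the index type whose cardinality is the
  dimension. That the numerals 1 and 2 name different indices is assumed in the two-dimensional
  case, since the class \<open>numeral\<close> alone does not ensure it.\<close>

locale boussinesq =
  fixes b :: real and I :: "real set" and f \<tau> :: "real \<Rightarrow> real" and N :: "'n::{finite,numeral} itself"
  assumes N: "CARD('n) = 1 \<or> (CARD('n) = 2 \<and> (1::'n) \<noteq> 2)" and b: "b \<noteq> 0" and I: "open I"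
    and f: "smooth_on f I" and \<tau>: "CARD('n) = 2 \<Longrightarrow> smooth_on \<tau> I \<and> (\<forall>v\<in>I. 0 < \<tau> v)"
begin

definition Wt :: "real \<times> real \<times> 'n rvec \<Rightarrow> real" where "Wt z = potential b f \<tau> (fst z) (fst (snd z)) (snd (snd z))"

lemma N_cases:
  obtains (one) "CARD('n) = 1" "(UNIV :: 'n set) = {1}"
  | (two) "CARD('n) = 2" "CARD('n) \<noteq> 1" "(1::'n) \<noteq> 2" "(UNIV :: 'n set) = {1, 2}"
proof (cases "CARD('n) = 1")
  case True
  then show ?thesis using one by (metis UNIV_I card_1_singletonE singletonD)
next
  case False
  with N have 2: "CARD('n) = 2" "(1::'n) \<noteq> 2" by auto
  then have "{1, 2} = (UNIV :: 'n set)" by (intro card_subset_eq) auto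
  then show ?thesis using two 2 False by blast
qed

lemma sum_UNIV: "(\<Sum>i\<in>(UNIV :: 'n set). h i) = h 1 + (if CARD('n) = 1 then 0 else h 2)" for h :: "'n \<Rightarrow> real"
proof (rule N_cases)
  assume u: "(UNIV :: 'n set) = {1}"
  show ?thesis unfolding u by simp
next
  assume u: "(UNIV :: 'n set) = {1, 2}" "(1::'n) \<noteq> 2"
  show ?thesis unfolding u(1) using u(2) by simp
qed

lemma comps_inner: "comps x y \<bullet> (k :: 'n rvec) = x * k $ 1 + (if CARD('n) = 1 then 0 else y * k $ 2)"
  using N by (auto simp: comps_def inner_vec_def sum_UNIV)

lemma open_IU: "open (I \<times> (UNIV :: (real \<times> 'n rvec) set))" using I by (simp add: open_Times)

lemma smooth_coordinates:
  "smooth_on (\<lambda>z::real \<times> real \<times> 'n rvec. fst (snd z)) S"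
  "smooth_on (\<lambda>z::real \<times> real \<times> 'n rvec. snd (snd z) $ i) S"
proof -
  have "bounded_linear (\<lambda>z::real \<times> real \<times> 'n rvec. fst (snd z))"
    by (rule bounded_linear_compose[OF bounded_linear_fst bounded_linear_snd])
  then show "smooth_on (\<lambda>z::real \<times> real \<times> 'n rvec. fst (snd z)) S" by (intro smooth_onI Ck_on_bounded_linear)
  have "bounded_linear (\<lambda>z::real \<times> real \<times> 'n rvec. snd (snd z) $ i)"
    by (rule bounded_linear_compose[OF bounded_linear_vec_nth bounded_linear_compose[OF bounded_linear_snd bounded_linear_snd]])
  then show "smooth_on (\<lambda>z::real \<times> real \<times> 'n rvec. snd (snd z) $ i) S" by (intro smooth_onI Ck_on_bounded_linear)
qed

lemma smooth_on_fst_comp: "smooth_on h I \<Longrightarrow> smooth_on (\<lambda>z::real \<times> real \<times> 'n rvec. h (fst z)) (I \<times> UNIV)"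
  by (rule smooth_on_compose[OF open_IU I _ smooth_on_fst]) auto

lemma smooth_gfun:
  assumes "CARD('n) = 2"
  shows "smooth_on (\<lambda>z::real \<times> real \<times> 'n rvec. gfun b \<tau> (fst z) (fst (snd z)) (snd (snd z))) (I \<times> UNIV)"
  unfolding gfun_def
  by (intro smooth_on_divide smooth_on_minus smooth_on_add smooth_on_mult open_IU smooth_coordinates smooth_on_fst
      smooth_on_const smooth_on_fst_comp) (use \<tau>[OF assms] b in auto)

lemma smooth_qfun:
  "smooth_on (\<lambda>z::real \<times> real \<times> 'n rvec. qfun b \<tau> (fst z) (fst (snd z)) (snd (snd z))) (I \<times> UNIV)"
proof (rule N_cases)
  assume "CARD('n) = 1"
  then show ?thesis unfolding qfun_def
    by simp (intro smooth_on_divide smooth_on_power open_IU smooth_on_fst smooth_on_const, use b in auto)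
next
  assume "CARD('n) = 2" "CARD('n) \<noteq> 1"
  then show ?thesis unfolding qfun_def
    by simp (intro smooth_on_divide smooth_on_mult open_IU smooth_on_fst smooth_on_const smooth_gfun, use b in auto)
qed

lemma smooth_Wt: "smooth_on Wt (I \<times> UNIV)"
proof (rule N_cases)
  assume "CARD('n) = 1"
  then show ?thesis unfolding Wt_def[abs_def] potential_def
    by simp (intro smooth_on_diff smooth_on_minus smooth_on_mult smooth_on_divide smooth_on_power open_IU smooth_on_fst
        smooth_on_const smooth_coordinates smooth_on_fst_comp f, use b in auto)
next
  assume "CARD('n) = 2" "CARD('n) \<noteq> 1"
  then show ?thesis unfolding Wt_def[abs_def] potential_def using \<tau>
    by simp (intro smooth_on_diff smooth_on_add smooth_on_minus smooth_on_mult smooth_on_divide smooth_on_power open_IU smooth_on_fst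
        smooth_on_const smooth_coordinates smooth_on_fst_comp f smooth_gfun, auto)
qed

text \<open>For N = 2 the quadratic term contributes \<tau> g times the derivative of g, and the
  factor \<tau> cancels the denominator of g. Thus the gradient in (c, lam) is minus (q, U), the
  parameter part of \<open>Vvec\<close>.\<close>

lemma dd_Wt:
  assumes v: "v \<in> I"
  shows "dd (0, (kc, kl)) Wt (v, (c, lam)) = - (comps v (gfun b \<tau> v c lam) \<bullet> kl + qfun b \<tau> v c lam * kc)"
proof (rule dd_sndI)
  show "Wt differentiable (at (v, (c, lam)))" using smooth_on_differentiable[OF smooth_Wt] v by simp
  show "((\<lambda>t. Wt (v, (c, lam) + t *\<^sub>R (kc, kl))) has_real_derivative
      - (comps v (gfun b \<tau> v c lam) \<bullet> kl + qfun b \<tau> v c lam * kc)) (at 0)"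
  proof (rule N_cases)
    assume 1: "CARD('n) = 1"
    have "((\<lambda>t. - f v - (c + t * kc) / (2 * b) * v\<^sup>2 - (lam $ 1 + t * kl $ 1) * v) has_real_derivative
        - (v * kl $ 1 + v\<^sup>2 / (2 * b) * kc)) (at 0)"
      using b by (auto intro!: derivative_eq_intros simp: field_simps)
    then show ?thesis using 1 by (simp add: Wt_def potential_def comps_inner qfun_def)
  next
    assume 2: "CARD('n) = 2" "CARD('n) \<noteq> 1"
    have nz: "\<tau> v \<noteq> 0" using \<tau>[OF 2(1)] v by force
    have g: "((\<lambda>t. - ((c + t * kc) / b * v + (lam $ 2 + t * kl $ 2)) / \<tau> v) has_real_derivative - (kc / b * v + kl $ 2) / \<tau> v) (at 0)"
      using b nz by (auto intro!: derivative_eq_intros simp: field_simps)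
    have "((\<lambda>t. - f v + 1 / 2 * \<tau> v * (- ((c + t * kc) / b * v + (lam $ 2 + t * kl $ 2)) / \<tau> v)\<^sup>2 - (lam $ 1 + t * kl $ 1) * v)
        has_real_derivative 0 + 1 / 2 * \<tau> v * (2 * (- ((c + 0 * kc) / b * v + (lam $ 2 + 0 * kl $ 2)) / \<tau> v) * (- (kc / b * v + kl $ 2) / \<tau> v)) - kl $ 1 * v) (at 0)"
      by (rule derivative_eq_intros g refl | simp)+
    moreover have "0 + 1 / 2 * \<tau> v * (2 * (- ((c + 0 * kc) / b * v + (lam $ 2 + 0 * kl $ 2)) / \<tau> v) * (- (kc / b * v + kl $ 2) / \<tau> v)) - kl $ 1 * v
      = - (v * kl $ 1 + gfun b \<tau> v c lam * kl $ 2 + v * gfun b \<tau> v c lam / b * kc)"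
      unfolding gfun_def using b nz by (simp add: field_simps)
    ultimately have d: "((\<lambda>t. - f v + 1 / 2 * \<tau> v * (- ((c + t * kc) / b * v + (lam $ 2 + t * kl $ 2)) / \<tau> v)\<^sup>2 - (lam $ 1 + t * kl $ 1) * v)
        has_real_derivative - (v * kl $ 1 + gfun b \<tau> v c lam * kl $ 2 + v * gfun b \<tau> v c lam / b * kc)) (at 0)"
      by (rule DERIV_cong)
    have "(\<lambda>t. Wt (v, (c, lam) + t *\<^sub>R (kc, kl))) =
      (\<lambda>t. - f v + 1 / 2 * \<tau> v * (- ((c + t * kc) / b * v + (lam $ 2 + t * kl $ 2)) / \<tau> v)\<^sup>2 - (lam $ 1 + t * kl $ 1) * v)"
      using 2(2) by (simp add: fun_eq_iff Wt_def potential_def gfun_def)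
    moreover have "comps v (gfun b \<tau> v c lam) \<bullet> kl + qfun b \<tau> v c lam * kc =
      v * kl $ 1 + gfun b \<tau> v c lam * kl $ 2 + v * gfun b \<tau> v c lam / b * kc"
      using 2(2) by (simp add: comps_inner qfun_def)
    ultimately show ?thesis using d by (simp only:)
  qed
qed

text \<open>Since g is affine in (c, lam), differentiating once more gives a rank-one form with
  factor 1 / \<tau>; for N = 1 the gradient is constant in the parameters. The numbers
  \<open>m\<close> and \<open>m'\<close> are arbitrary because the \<mu>-component of
  \<open>Tvec\<close> is zero.\<close>

lemma dd_dd_Wt:
  assumes v: "v \<in> I"
  shows "dd (0, (lc, ll)) (dd (0, (kc, kl)) Wt) (v, (c, lam)) =
    (Tvec b \<tau> v \<bullet> (m, ll, lc)) * (Tvec b \<tau> v \<bullet> (m', kl, kc))"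
proof (rule dd_sndI)
  show "dd (0, (kc, kl)) Wt differentiable (at (v, (c, lam)))"
    using smooth_on_differentiable[OF smooth_on_dd[OF smooth_Wt]] v by simp
  show "((\<lambda>t. dd (0, (kc, kl)) Wt (v, (c, lam) + t *\<^sub>R (lc, ll))) has_real_derivative
      (Tvec b \<tau> v \<bullet> (m, ll, lc)) * (Tvec b \<tau> v \<bullet> (m', kl, kc))) (at 0)"
  proof (rule N_cases)
    assume 1: "CARD('n) = 1"
    then show ?thesis using v by (simp add: dd_Wt comps_inner qfun_def Tvec_def)
  next
    assume 2: "CARD('n) = 2" "CARD('n) \<noteq> 1"
    have pos: "0 < \<tau> v" using \<tau>[OF 2(1)] v by force
    have g: "((\<lambda>t. gfun b \<tau> v (c + t * lc) (lam + t *\<^sub>R ll)) has_real_derivative - (lc / b * v + ll $ 2) / \<tau> v) (at 0)"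
      unfolding gfun_def using b pos by (auto intro!: derivative_eq_intros simp: field_simps)
    have "((\<lambda>t. - (v * kl $ 1 + gfun b \<tau> v (c + t * lc) (lam + t *\<^sub>R ll) * kl $ 2 + v * gfun b \<tau> v (c + t * lc) (lam + t *\<^sub>R ll) / b * kc))
      has_real_derivative - ((- (lc / b * v + ll $ 2) / \<tau> v) * kl $ 2 + v * (- (lc / b * v + ll $ 2) / \<tau> v) / b * kc)) (at 0)"
      by (rule derivative_eq_intros g refl | use b in simp)+
    moreover have "- ((- (lc / b * v + ll $ 2) / \<tau> v) * kl $ 2 + v * (- (lc / b * v + ll $ 2) / \<tau> v) / b * kc)
      = (Tvec b \<tau> v \<bullet> (m, ll, lc)) * (Tvec b \<tau> v \<bullet> (m', kl, kc))"
    proof -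
      have T: "Tvec b \<tau> v \<bullet> (m, ll, lc) = (ll $ 2 + v / b * lc) / sqrt (\<tau> v)" for m lc and ll :: "'n rvec"
        using 2(2) by (simp add: Tvec_def comps_inner add_divide_distrib mult.commute)
      show ?thesis unfolding T times_divide_times_eq real_sqrt_mult_self using b pos by (simp add: field_simps)
    qed
    ultimately show ?thesis using 2 v by (simp add: dd_Wt comps_inner qfun_def)
  qed
qed

lemma smooth_gq:
  shows "CARD('n) = 2 \<Longrightarrow> smooth_on (\<lambda>v. gfun b \<tau> v c (lam :: 'n rvec)) I"
    and "smooth_on (\<lambda>v. qfun b \<tau> v c (lam :: 'n rvec)) I"
proof -
  have p: "smooth_on (\<lambda>v. (v, (c, lam))) I"
    by (rule smooth_on_Pair[OF I smooth_on_id smooth_on_const])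
  show "CARD('n) = 2 \<Longrightarrow> smooth_on (\<lambda>v. gfun b \<tau> v c (lam :: 'n rvec)) I"
    using smooth_on_compose[OF I open_IU smooth_gfun p] by simp
  show "smooth_on (\<lambda>v. qfun b \<tau> v c (lam :: 'n rvec)) I"
    using smooth_on_compose[OF I open_IU smooth_qfun p] by simp
qed

text \<open>The parameter gradient is explicit as a function of v, so its v-derivatives are those of
  U and q, which make up \<open>Wvec\<close> and \<open>Zvec\<close>.\<close>

lemma dd_fst_dd_Wt:
  assumes v: "v \<in> I"
  shows "dd (1, 0) (dd (0, (kc, kl)) Wt) (v, (c, lam)) =
      - (comps 1 (dv 1 (gfun b \<tau>) v c lam) \<bullet> kl + dv 1 (qfun b \<tau>) v c lam * kc)"
    and "dd (1, 0) (dd (1, 0) (dd (0, (kc, kl)) Wt)) (v, (c, lam)) =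
      - (comps 0 (dv 2 (gfun b \<tau>) v c lam) \<bullet> kl + dv 2 (qfun b \<tau>) v c lam * kc)"
proof -
  \<comment> \<open>Replacing g by 0 when N = 1 lets one computation cover both dimensions, without
    regularity of \<tau> in the scalar case.\<close>
  define g where "g = (if CARD('n) = 1 then (\<lambda>_. 0) else (\<lambda>v. gfun b \<tau> v c lam))"
  have sg: "smooth_on g I"
    by (rule N_cases) (simp_all add: g_def smooth_on_const smooth_gq(1))
  let ?F = "\<lambda>v. dd (0, (kc, kl)) Wt (v, (c, lam))"
  have F: "?F w = - (w * kl $ 1 + g w * (if CARD('n) = 1 then 0 else kl $ 2) + qfun b \<tau> w c lam * kc)" if "w \<in> I" for w
    using dd_Wt[OF that] by (simp add: comps_inner g_def)
  note D = deriv_affine_combination[OF I v sg smooth_gq(2) F]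
  have e: "(deriv ^^ n) ?F v = (dd (1, 0) ^^ n) (dd (0, (kc, kl)) Wt) (v, (c, lam))" for n
    by (rule funpow_deriv_eq_dd[OF open_IU smooth_on_dd[OF smooth_Wt]]) (use v in simp)
  show "dd (1, 0) (dd (0, (kc, kl)) Wt) (v, (c, lam)) =
      - (comps 1 (dv 1 (gfun b \<tau>) v c lam) \<bullet> kl + dv 1 (qfun b \<tau>) v c lam * kc)"
    using e[of 1] D(1) by (cases "CARD('n) = 1") (simp_all add: dv_def comps_inner g_def)
  show "dd (1, 0) (dd (1, 0) (dd (0, (kc, kl)) Wt)) (v, (c, lam)) =
      - (comps 0 (dv 2 (gfun b \<tau>) v c lam) \<bullet> kl + dv 2 (qfun b \<tau>) v c lam * kc)"
    using e[of 2] D(2) by (cases "CARD('n) = 1") (simp_all add: dv_def comps_inner g_def numeral_2_eq_2)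
qed

text \<open>\<open>Bmat (1 / b)\<close> is a right inverse, which makes \<open>matrix_inv\<close> a
  genuine inverse; the components are then read off from B X = U.\<close>

lemma matrix_inv_Bmat:
  fixes U :: "'n rvec"
  shows "CARD('n) = 1 \<Longrightarrow> (matrix_inv (Bmat b) *v U) $ 1 = U $ 1 / b"
    and "CARD('n) = 2 \<Longrightarrow> (matrix_inv (Bmat b) *v U) $ 1 = U $ 2 / b"
    and "CARD('n) = 2 \<Longrightarrow> (matrix_inv (Bmat b) *v U) $ 2 = U $ 1 / b"
proof -
  have "Bmat b ** Bmat (1 / b) = (mat 1 :: ((real, 'n) vec, 'n) vec)"
  proof (rule N_cases)
    assume 1: "CARD('n) = 1" "(UNIV :: 'n set) = {1}"
    have "i = j" for i j :: 'n using 1(2) by (metis UNIV_I singletonD)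
    then show ?thesis using 1(1) b by (simp add: Bmat_def matrix_matrix_mult_def mat_def vec_eq_iff sum_UNIV)
  next
    assume 2: "CARD('n) = 2" "CARD('n) \<noteq> 1" "(1::'n) \<noteq> 2" "(UNIV :: 'n set) = {1, 2}"
    have "i = 1 \<or> i = 2" for i :: 'n using 2(4) by blast
    then have a: "(\<forall>i :: 'n. P i) \<longleftrightarrow> P 1 \<and> P 2" for P by metis
    show ?thesis using 2(1-3) b by (simp add: Bmat_def matrix_matrix_mult_def mat_def vec_eq_iff sum_UNIV a)
  qed
  then have "invertible (Bmat b :: ((real, 'n) vec, 'n) vec)" unfolding invertible_right_inverse by blast
  then have "Bmat b ** matrix_inv (Bmat b) = (mat 1 :: ((real, 'n) vec, 'n) vec)"
    unfolding invertible_def matrix_inv_def by (rule someI_ex[THEN conjunct1])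
  then have e: "Bmat b *v (matrix_inv (Bmat b) *v U) = U"
    by (simp add: matrix_vector_mul_assoc)
  let ?X = "matrix_inv (Bmat b) *v U"
  show "?X $ 1 = U $ 1 / b" if 1: "CARD('n) = 1"
  proof (rule N_cases)
    assume u: "(UNIV :: 'n set) = {1}"
    have "(Bmat b *v ?X) $ 1 = b * ?X $ 1" using 1 by (simp add: Bmat_def matrix_vector_mult_def sum_UNIV)
    then show ?thesis using b unfolding e by simp
  qed (use 1 in simp)
  have two: "U $ 1 = b * ?X $ 2 \<and> U $ 2 = b * ?X $ 1" if 2: "CARD('n) = 2"
  proof (rule N_cases)
    assume u: "(UNIV :: 'n set) = {1, 2}" "(1::'n) \<noteq> 2"
    have "(Bmat b *v ?X) $ 1 = b * ?X $ 2" "(Bmat b *v ?X) $ 2 = b * ?X $ 1"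
      using u(2) 2 by (simp_all add: Bmat_def matrix_vector_mult_def sum_UNIV)
    then show ?thesis unfolding e by simp
  qed (use 2 in simp)
  show "?X $ 1 = U $ 2 / b" "?X $ 2 = U $ 1 / b" if "CARD('n) = 2" using two[OF that] b by simp_all
qed

lemma comps_nth: "CARD('n) = 1 \<Longrightarrow> (comps x y :: 'n rvec) $ 1 = x"
  "CARD('n) = 2 \<Longrightarrow> (comps x y :: 'n rvec) $ 1 = x" "CARD('n) = 2 \<Longrightarrow> (comps x y :: 'n rvec) $ 2 = y"
  using N by (auto simp: comps_def)

text \<open>The identity U \<bullet> B^(-1) U = 2 q gives orthogonality to V, and its v-derivative
  gives that to W. For T the two contributions v / b cancel.\<close>

lemma Svec_orthogonal:
  assumes v: "v \<in> I"
  shows "Vvec b \<tau> v c (lam :: 'n rvec) \<bullet> Svec b \<tau> v c lam = 0"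
    and "Wvec b \<tau> v c (lam :: 'n rvec) \<bullet> Svec b \<tau> v c lam = 0"
    and "Tvec b \<tau> v \<bullet> Svec b \<tau> v c (lam :: 'n rvec) = 0"
proof -
  let ?U = "Uend b \<tau> v c lam" and ?g = "gfun b \<tau> v c lam"
  let ?X = "matrix_inv (Bmat b) *v ?U"
  have q: "?U \<bullet> ?X = 2 * qfun b \<tau> v c lam"
    by (rule N_cases)
      (use b in \<open>simp_all add: Uend_def comps_inner qfun_def matrix_inv_Bmat comps_nth field_simps power2_eq_square\<close>)
  then show "Vvec b \<tau> v c lam \<bullet> Svec b \<tau> v c lam = 0"
    by (simp add: Vvec_def Svec_def qend_def Uend_def)
  have "comps 1 (dv 1 (gfun b \<tau>) v c lam) \<bullet> ?X = dv 1 (qfun b \<tau>) v c lam"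
  proof (rule N_cases)
    assume 1: "CARD('n) = 1"
    have "((\<lambda>v. v\<^sup>2 / (2 * b)) has_real_derivative v / b) (at v)"
      using b by (auto intro!: derivative_eq_intros simp: field_simps)
    from DERIV_imp_deriv[OF this] show ?thesis
      using 1 by (simp add: dv_def qfun_def comps_inner matrix_inv_Bmat comps_nth Uend_def)
  next
    assume 2: "CARD('n) = 2" "CARD('n) \<noteq> 1"
    have g: "((\<lambda>v. gfun b \<tau> v c lam) has_real_derivative deriv (\<lambda>v. gfun b \<tau> v c lam) v) (at v)"
      by (rule smooth_on_real_deriv(1)[OF I smooth_gq(1)[OF 2(1)] v])
    have "((\<lambda>v. v * gfun b \<tau> v c lam / b) has_real_derivative (1 * ?g + deriv (\<lambda>v. gfun b \<tau> v c lam) v * v) / b) (at v)"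
      by (rule DERIV_cdivide[OF DERIV_mult[OF DERIV_ident g]])
    from DERIV_imp_deriv[OF this] show ?thesis
      using 2 by (simp add: dv_def qfun_def comps_inner matrix_inv_Bmat comps_nth Uend_def add_divide_distrib)
  qed
  then show "Wvec b \<tau> v c lam \<bullet> Svec b \<tau> v c lam = 0" by (simp add: Wvec_def Svec_def)
  show "Tvec b \<tau> v \<bullet> Svec b \<tau> v c lam = 0"
    by (rule N_cases) (simp_all add: Tvec_def Svec_def comps_inner matrix_inv_Bmat comps_nth Uend_def)
qed

lemma dv_potential:
  assumes "v \<in> I"
  shows "dv n (potential b f \<tau>) v c (lam :: 'n rvec) = (dd (1, 0) ^^ n) Wt (v, (c, lam))"
  using funpow_deriv_eq_dd[OF open_IU smooth_Wt, of v "(c, lam)" n] assms by (simp add: dv_def Wt_def)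

end

section \<open>Transfer of the abstract asymptotics to the parameters (\<mu>, lam, c)\<close>

theorem theorem5:
  fixes b :: real and I :: "real set" and f \<kappa> \<tau> :: "real \<Rightarrow> real"
    and W :: "real \<Rightarrow> real \<Rightarrow> 'n::{finite,numeral} rvec \<Rightarrow> real"
    and \<Lambda> :: "(real \<times> 'n rvec) set" and v0 vs vS :: "real \<times> 'n rvec \<Rightarrow> real"
    and \<Omega> :: "(real \<times> 'n rvec \<times> real) set"
    and v1 v2 v3 \<rho> :: "real \<times> 'n rvec \<times> real \<Rightarrow> real"
  assumes N: "CARD('n) = 1 \<or> (CARD('n) = 2 \<and> (1::'n) \<noteq> 2)"
    and b: "b \<noteq> 0"
    and I: "open I" "is_interval I"
    and f: "smooth_on f I"
    and \<kappa>: "smooth_on \<kappa> I" "\<forall>v\<in>I. 0 < \<kappa> v"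
    and \<tau>: "CARD('n) = 2 \<Longrightarrow> smooth_on \<tau> I \<and> (\<forall>v\<in>I. 0 < \<tau> v)"
    and W: "W = potential b f \<tau>"
    and standing: "solitary_branch W I \<Lambda> v0 vs vS"
    and \<Omega>: "\<Omega> = parameter_domain W \<Lambda> v0 vs"
    and roots: "root_branches W I \<Omega> v0 vs vS v1 v2 v3"
    and \<rho>: "\<rho> = (\<lambda>p. (v2 p - v1 p) / (v3 p - v2 p))"
  shows "\<exists>D :: real \<times> 'n rvec \<Rightarrow> real \<times> 'n rvec \<times> real \<Rightarrow> real \<times> 'n rvec \<times> real \<Rightarrow> real.
    (\<forall>(c, lam)\<in>\<Lambda>.
       symmetric_mat (D (c, lam)) \<and>
       Ys W \<kappa> (vs (c, lam)) c lam * quad_form (D (c, lam)) (Svec b \<tau> (vs (c, lam)) c lam) =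
         momentum_speed_deriv2 b (momentum W \<kappa> vs vS) (Uend b \<tau> (vs (c, lam)) c lam) c lam) \<and>
    (\<forall>(c0, lam0)\<in>\<Lambda>.
       let F = at (W (vs (c0, lam0)) c0 lam0, lam0, c0) within \<Omega> in
         (\<rho> \<longlongrightarrow> 0) F \<and>
         (\<forall>i\<in>Basis. \<forall>j\<in>Basis.
            (\<lambda>(\<mu>, lam, c).
               hessian (action W \<kappa> v2 v3) (\<mu>, lam, c) i j / Ys W \<kappa> (vs (c, lam)) c lam
               - singular_part b W \<kappa> \<tau> (vs (c, lam)) (vS (c, lam) - vs (c, lam)) c lam (\<rho> (\<mu>, lam, c)) i j
               - D (c, lam) i j)
            \<in> O[F](\<lambda>p. \<rho> p * ln (\<rho> p))))"
proof -
  have interval: "is_interval I" using I(2) .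
  interpret boussinesq b I f \<tau> "TYPE('n)"
    using N b I f \<tau> by unfold_locales auto
  have dvW: "dv n W v c lam = (dd (1, 0) ^^ n) Wt (v, (c, lam))" if "v \<in> I" for n v c and lam :: "'n rvec"
    unfolding W by (rule dv_potential[OF that])
  have Wt: "Wt (v, (c, lam)) = W v c lam" for v c lam by (simp add: Wt_def W)
  have dv1: "dv 1 W v c lam = dd (1, 0) Wt (v, (c, lam))" and dv2: "dv 2 W v c lam = dd (1, 0) (dd (1, 0) Wt) (v, (c, lam))"
    if "v \<in> I" for v c lam using dvW[OF that, of 1] dvW[OF that, of 2] by (simp_all add: numeral_2_eq_2)
  note st = standing[unfolded solitary_branch_def]
  have open\<Lambda>: "open \<Lambda>" and smooth: "smooth_on v0 \<Lambda>" "smooth_on vs \<Lambda>" "smooth_on vS \<Lambda>" using st by blast+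
  have mem: "v0 q \<in> I" "vs q \<in> I" "vS q \<in> I" and ord: "vs q < v0 q" "v0 q < vS q"
    and mu: "Wt (v0 q, q) < Wt (vs q, q)" "Wt (vs q, q) = Wt (vS q, q)"
    and W1s: "dd (1, 0) Wt (vs q, q) = 0" and W2s: "dd (1, 0) (dd (1, 0) Wt) (vs q, q) < 0"
    and sgn: "\<forall>v\<in>{vs q<..<v0 q}. dv 1 W v (fst q) (snd q) < 0" "\<forall>v\<in>{v0 q<..vS q}. 0 < dv 1 W v (fst q) (snd q)"
    if q: "q \<in> \<Lambda>" for q
  proof -
    obtain c lam where [simp]: "q = (c, lam)" by (cases q)
    note st' = bspec[OF st[THEN conjunct2, THEN conjunct2, THEN conjunct2, THEN conjunct2] q, simplified]
    show "v0 q \<in> I" "vs q \<in> I" "vS q \<in> I" "vs q < v0 q" "v0 q < vS q" using st' by simp_all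
    then show "Wt (v0 q, q) < Wt (vs q, q)" "Wt (vs q, q) = Wt (vS q, q)" "dd (1, 0) Wt (vs q, q) = 0"
      "dd (1, 0) (dd (1, 0) Wt) (vs q, q) < 0"
      using st' dv1[of "vs q" c lam] dv2[of "vs q" c lam] by (simp_all add: Wt)
    show "\<forall>v\<in>{vs q<..<v0 q}. dv 1 W v (fst q) (snd q) < 0" "\<forall>v\<in>{v0 q<..vS q}. 0 < dv 1 W v (fst q) (snd q)"
      using st' by simp_all
  qed
  have between: "v \<in> I" if "q \<in> \<Lambda>" "vs q < v" "v \<le> vS q" for q v
    by (rule mem_is_interval_1_I[OF interval mem(2)[OF that(1)] mem(3)[OF that(1)]]) (use that in auto)
  interpret soliton Wt \<kappa> I \<Lambda> v0 vs vS
  proof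
    show "smooth_on Wt (I \<times> \<Lambda>)" by (rule smooth_on_subset[OF smooth_Wt]) auto
    show "dd (1, 0) Wt (v, q) < 0" if q: "q \<in> \<Lambda>" and v: "v \<in> {vs q<..<v0 q}" for q v
    proof -
      have "v \<in> I" by (rule between[OF q]) (use v ord[OF q] in auto)
      then show ?thesis using bspec[OF sgn(1)[OF q] v] dv1[of v "fst q" "snd q"] by simp
    qed
    show "0 < dd (1, 0) Wt (v, q)" if q: "q \<in> \<Lambda>" and v: "v \<in> {v0 q<..vS q}" for q v
    proof -
      have "v \<in> I" by (rule between[OF q]) (use v ord[OF q] in auto)
      then show ?thesis using bspec[OF sgn(2)[OF q] v] dv1[of v "fst q" "snd q"] by simp
    qed
  qed (use I interval open\<Lambda> \<kappa> smooth mem ord mu W1s W2s in auto)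
  \<comment> \<open>Reorders (\<mu>, lam, c) into (\<mu>, (c, lam)), the form used in
    \<open>soliton\<close>. Being linear, it carries partial derivatives and Hessians over.\<close>
  define \<iota> :: "real \<times> 'n rvec \<times> real \<Rightarrow> real \<times> real \<times> 'n rvec" where "\<iota> p = (fst p, (snd (snd p), fst (snd p)))" for p
  define w1 where "w1 z = v1 (fst z, snd (snd z), fst (snd z))" for z
  define w2 where "w2 z = v2 (fst z, snd (snd z), fst (snd z))" for z
  define w3 where "w3 z = v3 (fst z, snd (snd z), fst (snd z))" for z
  have \<iota>: "\<iota> (p + t *\<^sub>R i) = \<iota> p + t *\<^sub>R \<iota> i" for p i t by (simp add: \<iota>_def)
  have lin\<iota>: "linear \<iota>" by (rule linearI) (simp_all add: \<iota>_def)
  have inI: "(v, q) \<in> I \<times> \<Lambda>" if "q \<in> \<Lambda>" "v \<in> I" for v q using that by simp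
  have rt: "w1 (\<mu>, q) \<in> I \<and> w1 (\<mu>, q) < vs q \<and> vs q < w2 (\<mu>, q) \<and> w2 (\<mu>, q) < v0 q \<and> v0 q < w3 (\<mu>, q) \<and> w3 (\<mu>, q) < vS q \<and>
      Wt (w1 (\<mu>, q), q) = \<mu> \<and> Wt (w2 (\<mu>, q), q) = \<mu> \<and> Wt (w3 (\<mu>, q), q) = \<mu> \<and>
      (\<forall>v\<in>{w1 (\<mu>, q)..<vs q}. 0 < dd (1, 0) Wt (v, q))"
    if q: "q \<in> \<Lambda>" and \<mu>: "Wt (v0 q, q) < \<mu>" "\<mu> < mus q" for \<mu> q
  proof -
    obtain c lam where [simp]: "q = (c, lam)" by (cases q)
    have "(\<mu>, lam, c) \<in> \<Omega>" using q \<mu> by (simp add: \<Omega> parameter_domain_def Wt mus_def)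
    from bspec[OF roots[unfolded root_branches_def, THEN conjunct2, THEN conjunct2, THEN conjunct2] this, simplified]
    have r: "w1 (\<mu>, q) \<in> I \<and> w1 (\<mu>, q) < vs q \<and> vs q < w2 (\<mu>, q) \<and> w2 (\<mu>, q) < v0 q \<and> v0 q < w3 (\<mu>, q) \<and> w3 (\<mu>, q) < vS q \<and>
      Wt (w1 (\<mu>, q), q) = \<mu> \<and> Wt (w2 (\<mu>, q), q) = \<mu> \<and> Wt (w3 (\<mu>, q), q) = \<mu> \<and>
      (\<forall>v\<in>{w1 (\<mu>, q)..<vs q}. 0 < dv 1 W v c lam)"
      by (simp add: w1_def w2_def w3_def Wt)
    have "0 < dd (1, 0) Wt (v, q)" if v: "v \<in> {w1 (\<mu>, q)..<vs q}" for v
    proof -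
      have "w1 (\<mu>, q) \<in> I" using r by blast
      then have "v \<in> I" by (rule mem_is_interval_1_I[OF interval _ mem(2)[OF q]]) (use v in auto)
      moreover have "0 < dv 1 W v c lam" using r v by blast
      ultimately show ?thesis using dv1[of v c lam] by simp
    qed
    then show ?thesis using r by blast
  qed
  define \<sigma> where "\<sigma> = (\<lambda>z. (w2 z - w1 z) / (w3 z - w2 z))"
  have \<rho>\<sigma>: "\<rho> p = \<sigma> (\<iota> p)" for p by (simp add: \<rho> \<sigma>_def w1_def w2_def w3_def \<iota>_def)
  obtain D where sym: "\<And>q i j. q \<in> \<Lambda> \<Longrightarrow> D q i j = D q j i" and lin: "\<And>q j. q \<in> \<Lambda> \<Longrightarrow> linear (\<lambda>i. D q i j)"
    and quad: "\<And>q i. q \<in> \<Lambda> \<Longrightarrow> Vv q i = 0 \<Longrightarrow> Wv q i = 0 \<Longrightarrow> TT q i i = 0 \<Longrightarrow>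
      Y q * D q i i = (deriv ^^ 2) (\<lambda>t. mom (q + t *\<^sub>R snd i)) 0"
    and asym: "\<And>q0 i j. q0 \<in> \<Lambda> \<Longrightarrow> \<exists>\<delta> \<Theta> K. 0 < \<delta> \<and> open \<Theta> \<and> q0 \<in> \<Theta> \<and> \<Theta> \<subseteq> \<Lambda> \<and> 0 \<le> K \<and>
      (\<forall>q\<in>\<Theta>. \<forall>\<mu>\<in>{mus q - \<delta><..<mus q}. 0 < \<sigma> (\<mu>, q) \<and> \<sigma> (\<mu>, q) \<le> K * sqrt (mus q - \<mu>) \<and>
        \<bar>hessian (act w2 w3) (\<mu>, q) i j / Y q - sing q (\<sigma> (\<mu>, q)) i j - D q i j\<bar> \<le> K * \<bar>\<sigma> (\<mu>, q) * ln (\<sigma> (\<mu>, q))\<bar>)"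
    by (rule asymptotics[OF rt], assumption+, rule that, unfold \<sigma>_def)
  have coeff: "a_s W (vs (c, lam)) c lam = as (c, lam)" "Ys W \<kappa> (vs (c, lam)) c lam = Y (c, lam)"
    "\<alpha>_s W \<kappa> (vs (c, lam)) c lam = alpha (c, lam)" "\<beta>_s W \<kappa> (vs (c, lam)) c lam = beta (c, lam)"
    if "(c, lam) \<in> \<Lambda>" for c lam
    by (rule coefficients[OF that dvW]; assumption)+
  have vecs: "Vv (c, lam) (\<iota> i) = Vvec b \<tau> (vs (c, lam)) c lam \<bullet> i" "Wv (c, lam) (\<iota> i) = Wvec b \<tau> (vs (c, lam)) c lam \<bullet> i"
    "Zv (c, lam) (\<iota> i) = Zvec b \<tau> (vs (c, lam)) c lam \<bullet> i"
    "TT (c, lam) (\<iota> i) (\<iota> j) = (Tvec b \<tau> (vs (c, lam)) \<bullet> i) * (Tvec b \<tau> (vs (c, lam)) \<bullet> j)"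
    if q: "(c, lam) \<in> \<Lambda>" for c lam i j
  proof -
    obtain m l k m' l' k' where [simp]: "i = (m, l, k)" "j = (m', l', k')" by (metis prod.exhaust)
    note v = mem(2)[OF q]
    show "Vv (c, lam) (\<iota> i) = Vvec b \<tau> (vs (c, lam)) c lam \<bullet> i" by (simp add: Vv_def Vvec_def \<iota>_def dd_Wt[OF v])
    show "Wv (c, lam) (\<iota> i) = Wvec b \<tau> (vs (c, lam)) c lam \<bullet> i"
      by (simp add: Wv_def Wvec_def \<iota>_def dd_fst_dd_Wt(1)[OF v] del: One_nat_def)
    show "Zv (c, lam) (\<iota> i) = Zvec b \<tau> (vs (c, lam)) c lam \<bullet> i" by (simp add: Zv_def Zvec_def \<iota>_def dd_fst_dd_Wt(2)[OF v])
    show "TT (c, lam) (\<iota> i) (\<iota> j) = (Tvec b \<tau> (vs (c, lam)) \<bullet> i) * (Tvec b \<tau> (vs (c, lam)) \<bullet> j)"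
      using dd_dd_Wt[OF v, of k l k' l' c lam m m'] by (simp add: TT_def \<iota>_def)
  qed
  have sing: "singular_part b W \<kappa> \<tau> (vs (c, lam)) (vS (c, lam) - vs (c, lam)) c lam r i j = sing (c, lam) r (\<iota> i) (\<iota> j)"
    if q: "(c, lam) \<in> \<Lambda>" for c lam r i j
    unfolding singular_part_def Let_def sing_def Lc_def coeff[OF q] vecs[OF q] outer_def
    by (simp add: algebra_simps)
  have action: "action W \<kappa> v2 v3 = (\<lambda>p. act w2 w3 (\<iota> p))"
    by (rule ext) (auto simp: act_def \<iota>_def w2_def w3_def Wt)
  have pd: "partial_deriv i (\<lambda>p. F (\<iota> p)) = (\<lambda>p. partial_deriv (\<iota> i) F (\<iota> p))" for i and F :: "real \<times> real \<times> 'n rvec \<Rightarrow> real"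
    by (simp add: fun_eq_iff partial_deriv_def \<iota>)
  have hess: "hessian (action W \<kappa> v2 v3) p i j = hessian (act w2 w3) (\<iota> p) (\<iota> i) (\<iota> j)" for p i j
    by (simp add: hessian_def action pd)
  have mom: "momentum W \<kappa> vs vS q = mom q" for q
    by (cases q) (simp add: mom_def mus_def Wt)
  define D' where "D' q i j = D q (\<iota> i) (\<iota> j)" for q i j
  show ?thesis
  proof (intro exI[of _ D'] conjI ballI)
    fix q assume q: "q \<in> \<Lambda>"
    obtain c lam where qq: "q = (c, lam)" by (cases q)
    note q' = q[unfolded qq]
    let ?S = "Svec b \<tau> (vs (c, lam)) c lam" and ?U = "Uend b \<tau> (vs (c, lam)) c lam"
    have 1: "symmetric_mat (D' (c, lam))" using sym[OF q'] by (simp add: symmetric_mat_def D'_def)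
    have linD: "linear (\<lambda>i. D' (c, lam) i j)" for j
      using linear_compose[OF lin\<iota> lin[OF q']] by (simp add: D'_def o_def)
    have symD: "D' (c, lam) i j = D' (c, lam) j i" for i j using sym[OF q'] by (simp add: D'_def)
    have "quad_form (D' (c, lam)) ?S = D' (c, lam) ?S ?S" by (rule quad_form_eq[OF symD linD])
    \<comment> \<open>A quadratic form is even. For the opposite vector the speed component is 1 and
      the lam-component is - B^(-1) U, exactly the line on which the endstate is held fixed in the
      momentum.\<close>
    also have "\<dots> = D' (c, lam) (- ?S) (- ?S)"
      using linear_neg[OF linD, of ?S "- ?S"] linear_neg[OF linD, of ?S ?S] symD[of ?S "- ?S"] by simp
    finally have qf: "quad_form (D' (c, lam)) ?S = D (c, lam) (\<iota> (- ?S)) (\<iota> (- ?S))" by (simp add: D'_def)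
    note orth = Svec_orthogonal[OF mem(2)[OF q'], of c lam]
    have "Y (c, lam) * D (c, lam) (\<iota> (- ?S)) (\<iota> (- ?S)) = (deriv ^^ 2) (\<lambda>t. mom ((c, lam) + t *\<^sub>R snd (\<iota> (- ?S)))) 0"
      by (rule quad[OF q']) (simp_all add: vecs[OF q'] orth)
    also have "\<dots> = (deriv ^^ 2) (\<lambda>c'. mom (c', lam - (c' - c) *\<^sub>R (matrix_inv (Bmat b) *v ?U))) c"
      unfolding deriv_deriv_shift[symmetric, of _ c] by (simp add: \<iota>_def Svec_def)
    finally have 2: "Ys W \<kappa> (vs (c, lam)) c lam * quad_form (D' (c, lam)) ?S =
        momentum_speed_deriv2 b (momentum W \<kappa> vs vS) ?U c lam"
      unfolding qf coeff[OF q'] momentum_speed_deriv2_def mom .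
    show "case q of (c, lam) \<Rightarrow> symmetric_mat (D' (c, lam)) \<and>
       Ys W \<kappa> (vs (c, lam)) c lam * quad_form (D' (c, lam)) (Svec b \<tau> (vs (c, lam)) c lam) =
         momentum_speed_deriv2 b (momentum W \<kappa> vs vS) (Uend b \<tau> (vs (c, lam)) c lam) c lam"
      using 1 2 by (simp add: qq)
  next
    fix q0 assume q0: "q0 \<in> \<Lambda>"
    obtain c0 lam0 where qq: "q0 = (c0, lam0)" by (cases q0)
    define F where "F = at (W (vs (c0, lam0)) c0 lam0, lam0, c0) within \<Omega>"
    define Q :: "real \<times> 'n rvec \<times> real \<Rightarrow> real \<times> 'n rvec" where "Q p = (snd (snd p), fst (snd p))" for p
    have id: "((\<lambda>p. p) \<longlongrightarrow> (W (vs (c0, lam0)) c0 lam0, lam0, c0)) F" unfolding F_def by (rule tendsto_ident_at)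
    have Q: "(Q \<longlongrightarrow> q0) F"
      using tendsto_Pair[OF tendsto_snd[OF tendsto_snd[OF id]] tendsto_fst[OF tendsto_snd[OF id]]]
      by (simp add: Q_def[abs_def] qq)
    \<comment> \<open>The parameters vary along the filter together with \<mu>; continuity of the
      saddle value shows that m still tends to 0.\<close>
    have "continuous_on \<Lambda> mus" by (rule smooth_on_continuous_on[OF smooth_mus])
    then have "isCont mus q0" using open\<Lambda> q0 by (simp add: continuous_on_eq_continuous_at)
    from tendsto_diff[OF isCont_tendsto_compose[OF this Q] tendsto_fst[OF id]]
    have gap: "((\<lambda>p. mus (Q p) - fst p) \<longlongrightarrow> 0) F" by (simp add: mus_def qq Wt)
    have in\<Omega>: "\<forall>\<^sub>F p in F. p \<in> \<Omega>" unfolding F_def eventually_at_filter by simp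
    have main: "\<exists>K. (\<forall>\<^sub>F p in F. norm (\<rho> p) \<le> K * sqrt (mus (Q p) - fst p)) \<and>
      (\<forall>\<^sub>F p in F. norm (hessian (action W \<kappa> v2 v3) p i j / Ys W \<kappa> (vs (Q p)) (fst (Q p)) (snd (Q p))
               - singular_part b W \<kappa> \<tau> (vs (Q p)) (vS (Q p) - vs (Q p)) (fst (Q p)) (snd (Q p)) (\<rho> p) i j
               - D' (Q p) i j) \<le> K * norm (\<rho> p * ln (\<rho> p)))" for i j
    proof -
      obtain \<delta> \<Theta> K where \<delta>: "0 < \<delta>" and \<Theta>: "open \<Theta>" "q0 \<in> \<Theta>" "\<Theta> \<subseteq> \<Lambda>"
        and est: "\<forall>q\<in>\<Theta>. \<forall>\<mu>\<in>{mus q - \<delta><..<mus q}. 0 < \<sigma> (\<mu>, q) \<and> \<sigma> (\<mu>, q) \<le> K * sqrt (mus q - \<mu>) \<and>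
          \<bar>hessian (act w2 w3) (\<mu>, q) (\<iota> i) (\<iota> j) / Y q - sing q (\<sigma> (\<mu>, q)) (\<iota> i) (\<iota> j) - D q (\<iota> i) (\<iota> j)\<bar>
            \<le> K * \<bar>\<sigma> (\<mu>, q) * ln (\<sigma> (\<mu>, q))\<bar>"
        using asym[OF q0, of "\<iota> i" "\<iota> j"] by (elim exE conjE) (rule that)
      have ev: "\<forall>\<^sub>F p in F. p \<in> \<Omega> \<and> Q p \<in> \<Theta> \<and> mus (Q p) - fst p < \<delta>"
        by (intro eventually_conj in\<Omega> topological_tendstoD[OF Q \<Theta>(1,2)] order_tendstoD(2)[OF gap \<delta>])
      have both: "norm (\<rho> p) \<le> K * sqrt (mus (Q p) - fst p) \<and>
        norm (hessian (action W \<kappa> v2 v3) p i j / Ys W \<kappa> (vs (Q p)) (fst (Q p)) (snd (Q p))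
               - singular_part b W \<kappa> \<tau> (vs (Q p)) (vS (Q p) - vs (Q p)) (fst (Q p)) (snd (Q p)) (\<rho> p) i j
               - D' (Q p) i j) \<le> K * norm (\<rho> p * ln (\<rho> p))"
        if p: "p \<in> \<Omega> \<and> Q p \<in> \<Theta> \<and> mus (Q p) - fst p < \<delta>" for p
      proof -
        obtain \<mu> lam c where pp: "p = (\<mu>, lam, c)" by (metis prod.exhaust)
        have q: "(c, lam) \<in> \<Theta>" "(c, lam) \<in> \<Lambda>" using p \<Theta>(3) by (auto simp: pp Q_def)
        have \<mu>: "\<mu> \<in> {mus (c, lam) - \<delta><..<mus (c, lam)}"
          using p by (simp add: pp Q_def \<Omega> parameter_domain_def mus_def Wt)
        have e: "\<iota> p = (\<mu>, (c, lam))" "Q p = (c, lam)" "fst p = \<mu>" by (simp_all add: pp \<iota>_def Q_def)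
        show ?thesis
          using est[rule_format, OF q(1) \<mu>]
          unfolding e fst_conv snd_conv \<rho>\<sigma> hess sing[OF q(2)] coeff[OF q(2)] D'_def by simp
      qed
      show ?thesis
        by (intro exI[of _ K] conjI; rule eventually_mono[OF ev]) (use both in blast)+
    qed
    have 1: "(\<rho> \<longlongrightarrow> 0) F"
    proof -
      \<comment> \<open>The bound on \<rho> is the same for all entries, so any pair of indices may
        be inserted.\<close>
      obtain K where K: "\<forall>\<^sub>F p in F. norm (\<rho> p) \<le> K * sqrt (mus (Q p) - fst p)" using main[of 0 0] by blast
      show ?thesis
        by (rule Lim_null_comparison[OF K]) (use tendsto_mult_right_zero[OF tendsto_real_sqrt[OF gap, unfolded real_sqrt_zero]] in simp)
    qed
    have 2: "(\<lambda>(\<mu>, lam, c).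
               hessian (action W \<kappa> v2 v3) (\<mu>, lam, c) i j / Ys W \<kappa> (vs (c, lam)) c lam
               - singular_part b W \<kappa> \<tau> (vs (c, lam)) (vS (c, lam) - vs (c, lam)) c lam (\<rho> (\<mu>, lam, c)) i j
               - D' (c, lam) i j)
            \<in> O[F](\<lambda>p. \<rho> p * ln (\<rho> p))" for i j
    proof -
      obtain K where K: "\<forall>\<^sub>F p in F. norm (hessian (action W \<kappa> v2 v3) p i j / Ys W \<kappa> (vs (Q p)) (fst (Q p)) (snd (Q p))
               - singular_part b W \<kappa> \<tau> (vs (Q p)) (vS (Q p) - vs (Q p)) (fst (Q p)) (snd (Q p)) (\<rho> p) i j
               - D' (Q p) i j) \<le> K * norm (\<rho> p * ln (\<rho> p))"
        using main[of i j] by blast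
      show ?thesis by (rule bigoI[where c = K]) (use K in \<open>simp add: split_beta Q_def\<close>)
    qed
    show "case q0 of (c0, lam0) \<Rightarrow>
       let F = at (W (vs (c0, lam0)) c0 lam0, lam0, c0) within \<Omega> in
         (\<rho> \<longlongrightarrow> 0) F \<and>
         (\<forall>i\<in>Basis. \<forall>j\<in>Basis.
            (\<lambda>(\<mu>, lam, c).
               hessian (action W \<kappa> v2 v3) (\<mu>, lam, c) i j / Ys W \<kappa> (vs (c, lam)) c lam
               - singular_part b W \<kappa> \<tau> (vs (c, lam)) (vS (c, lam) - vs (c, lam)) c lam (\<rho> (\<mu>, lam, c)) i j
               - D' (c, lam) i j)
            \<in> O[F](\<lambda>p. \<rho> p * ln (\<rho> p)))"
      unfolding qq prod.case Let_def F_def[symmetric] using 1 2 by blast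
  qed
qed

end
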